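(* Suppose $\hat\chi>0$ and $r_2=0$, let $\boldsymbol{H}\in\mathbb{R}^{n\times n}$ be an arbitrary symmetric positive definite matrix, and let $a>0$ satisfy $a<1/\lambda_{max}$, where $\lambda_{max}$ is the maximal eigenvalue of $\boldsymbol{Q}_{33}^{-1}\boldsymbol{A}_{33}$. Consider the moment system $$\boldsymbol{A}\frac{\mathrm{d}W}{\mathrm{d}y}=-\boldsymbol{Q}W+h,\quad y\in[0,+\infty),\qquad W(+\infty)=0,$$ with the boundary condition at $y=0$ $$\boldsymbol{H}\left(W_o(0)+\bar W_o-b_o\right)+\hat\chi\boldsymbol{M}^T\left(W_e(0)+\bar W_e-b_e\right)=0 .$$ For any $h$ with $\|h\|_a<+\infty$ and any given $g_1=\bar W_o-b_o\in\mathbb{R}^n$, $g_2=(\boldsymbol{I}_m-\boldsymbol{G}_e\boldsymbol{G}_e^T)(\bar W_e-b_e)\in\mathbb{R}^m$ with $\|g_1\|<+\infty$, $\|g_2\|<+\infty$, the system with this boundary condition has a unique solution for the pair of unknowns $W$ and $\boldsymbol{G}_e^T(\bar W_e-b_e)\in\mathbb{R}^{p_1}$, and there is a constant $c>0$ independent of $h,g_1,g_2$ such that $$\|W\|_a\le c\left(\|h\|_a+\|g_1\|+\|g_2\|\right),\qquad \|\boldsymbol{G}_e^T(\bar W_e-b_e)\|\le c\left(\|h\|_a+\|g_1\|+\|g_2\|\right).$$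
   Context: Grad matrices. Let $M\ge2$ be an integer and $N=\#\{\boldsymbol{\alpha}\in\mathbb{N}^3:|\boldsymbol{\alpha}|\le M\}$ ($0\in\mathbb{N}$). Let $\mathcal{M}(\boldsymbol{\xi})=(2\pi)^{-3/2}\exp(-|\boldsymbol{\xi}|^2/2)$ on $\mathbb{R}^3$, $\langle\cdot\rangle=\int_{\mathbb{R}^3}\cdot\,\mathrm{d}\boldsymbol{\xi}$, and $\phi_{\boldsymbol{\alpha}}$ the orthonormal (tensor-product) Hermite polynomials: $\langle\mathcal{M}\phi_{\boldsymbol{\alpha}}\phi_{\boldsymbol{\beta}}\rangle=\delta_{\boldsymbol{\alpha},\boldsymbol{\beta}}$, $\phi_{\boldsymbol{0}}=1$, $\phi_{\boldsymbol{e}_i}=\xi_i$. Let $\mathbb{I}_e$, $\mathbb{I}_o$ be the sets of $\boldsymbol{\alpha}\in\mathbb{N}^3$ with $|\boldsymbol{\alpha}|\le M$ and $\alpha_2$ even, respectively odd; $m=\#\mathbb{I}_e$, $n=\#\mathbb{I}_o$, $m+n=N$, $m\ge n$. Indices in $\mathbb{I}_e$ are ordered before those in $\mathbb{I}_o$, and $W=[W_e^T,W_o^T]^T$ with $W_e\in\mathbb{R}^m$, $W_o\in\mathbb{R}^n$. The matrix $\boldsymbol{M}\in\mathbb{R}^{m\times n}$ has entries $\langle\mathcal{M}\xi_2\phi_{\boldsymbol{\alpha}}\phi_{\boldsymbol{\beta}}\rangle$, $\boldsymbol{\alpha}\in\mathbb{I}_e$, $\boldsymbol{\beta}\in\mathbb{I}_o$;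 it has full column rank. $\boldsymbol{A}=\begin{bmatrix}\boldsymbol{0}&\boldsymbol{M}\\ \boldsymbol{M}^T&\boldsymbol{0}\end{bmatrix}$. $\boldsymbol{Q}=\begin{bmatrix}\boldsymbol{Q}_e&\boldsymbol{0}\\ \boldsymbol{0}&\boldsymbol{Q}_o\end{bmatrix}$, $\boldsymbol{Q}_e\in\mathbb{R}^{m\times m}$, $\boldsymbol{Q}_o\in\mathbb{R}^{n\times n}$, is the matrix with entries $-\langle\mathcal{L}[\mathcal{M}\phi_{\boldsymbol{\beta}}]\phi_{\boldsymbol{\alpha}}\rangle$ for the linearized Boltzmann collision operator $\mathcal{L}$; the standing assumptions on it are that $\boldsymbol{Q}$ has this block form, is symmetric positive semi-definite, and $\mathrm{Null}(\boldsymbol{A})\cap\mathrm{Null}(\boldsymbol{Q})=\{0\}$. Block bases. Let $p_1=\dim\mathrm{Null}(\boldsymbol{Q}_e)$, $p_2=\dim\mathrm{Null}(\boldsymbol{Q}_o)$, and let $\boldsymbol{G}_e\in\mathbb{R}^{m\times p_1}$, $\boldsymbol{G}_o\in\mathbb{R}^{n\times p_2}$ have orthonormal columns spanning these null spaces; $\boldsymbol{G}=\mathrm{diag}(\boldsymbol{G}_e,\boldsymbol{G}_o)$, $p=p_1+p_2$. Let $\boldsymbol{X}_e\in\mathbb{R}^{p_1\times r_1}$, $\boldsymbol{X}_o\in\mathbb{R}^{p_2\times r_2}$ have orthonormal columns spanning $\mathrm{Null}(\boldsymbol{G}_o^T\boldsymbol{M}^T\boldsymbol{G}_e)$ and $\mathrm{Null}(\boldsymbol{G}_e^T\boldsymbol{M}\boldsymbol{G}_o)$,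 of dimensions $r_1,r_2$; thus $\boldsymbol{X}=\mathrm{diag}(\boldsymbol{X}_e,\boldsymbol{X}_o)$ is an orthonormal basis matrix of $\mathrm{Null}(\boldsymbol{G}^T\boldsymbol{A}\boldsymbol{G})$, $r=r_1+r_2$. Put $\boldsymbol{V}_i=\mathrm{diag}(\boldsymbol{Y}_i,\boldsymbol{Z}_i)$, $i=1,2,3$, where $\boldsymbol{Y}_1=\boldsymbol{G}_e\boldsymbol{X}_e$, $\boldsymbol{Z}_1=\boldsymbol{G}_o\boldsymbol{X}_o$; $\boldsymbol{Y}_2\in\mathbb{R}^{m\times p_2}$, $\boldsymbol{Z}_2\in\mathbb{R}^{n\times p_1}$ have orthonormal columns spanning the column spaces of $\boldsymbol{M}\boldsymbol{G}_o$, $\boldsymbol{M}^T\boldsymbol{G}_e$; and $\boldsymbol{Y}_3\in\mathbb{R}^{m\times(m-r_1-p_2)}$, $\boldsymbol{Z}_3\in\mathbb{R}^{n\times(n-r_2-p_1)}$ make $[\boldsymbol{Y}_1,\boldsymbol{Y}_2,\boldsymbol{Y}_3]$ and $[\boldsymbol{Z}_1,\boldsymbol{Z}_2,\boldsymbol{Z}_3]$ orthogonal. Put $\boldsymbol{A}_{33}=\boldsymbol{V}_3^T\boldsymbol{A}\boldsymbol{V}_3$ and $\boldsymbol{Q}_{33}=\boldsymbol{V}_3^T\boldsymbol{Q}\boldsymbol{V}_3$ (the latter is positive definite). The condition $a<1/\lambda_{max}$ is read as no restriction if there is no positive eigenvalue. Boundary data. $\hat\chi=\frac{2\chi}{2-\chi}\frac{1}{\sqrt{2\pi}}$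 with $\chi\in[0,1]$ the accommodation coefficient. $\bar W_e\in\mathbb{R}^m,\bar W_o\in\mathbb{R}^n$ come from the flow outside the layer and $b_e\in\mathbb{R}^m,b_o\in\mathbb{R}^n$ from the wall; they enter only through $\bar W_o-b_o=g_1$ and $\bar W_e-b_e=\boldsymbol{G}_e\boldsymbol{G}_e^T(\bar W_e-b_e)+g_2$, where $g_1,g_2$ are given ($\boldsymbol{G}_e^Tg_2=0$) and $\boldsymbol{G}_e^T(\bar W_e-b_e)$ is unknown. Norms: $\|h\|_a=\left(\int_0^{+\infty}e^{2ay}h^T(y)h(y)\,\mathrm{d}y\right)^{1/2}$ for measurable $h:[0,+\infty)\to\mathbb{R}^N$; $\|g\|=\sqrt{g^Tg}$ for vectors. Solutions: $h$ is an everywhere defined measurable function. A solution is a function $W:[0,+\infty)\to\mathbb{R}^N$ with $\|W\|_a<+\infty$ (which is how $W(+\infty)=0$ is understood) such that $\boldsymbol{A}W$ is locally absolutely continuous, $(\boldsymbol{A}W)'=-\boldsymbol{Q}W+h$ almost everywhere, the algebraic part $v^T(-\boldsymbol{Q}W(y)+h(y))=0$ for all $v\in\mathrm{Null}(\boldsymbol{A})$ holds at every $y\ge0$ (so $W(0)$ is meaningful), and the boundary condition at $y=0$ holds. *)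

theory Defs
  imports
    "HOL-Analysis.Analysis"
    "Jordan_Normal_Form.Spectral_Radius"
    "Jordan_Normal_Form.Matrix_Kernel"
begin

text \<open>Matrices whose sizes vary (and may be zero) are those of Jordan_Normal_Form; the types
  \<open>real^3\<close> and \<open>nat^3\<close> from HOL-Analysis occur only as velocity space and as multi-indices.
  Below, \<open>$\<close> and \<open>\<bullet>\<close> always belong to Jordan_Normal_Form.\<close>

unbundle no vec_syntax
unbundle no inner_syntax


subsection \<open>Hermite polynomials and Grad matrices\<close>

text \<open>Probabilists' Hermite polynomials, orthogonal with respect to \<open>exp (- x\<^sup>2 / 2)\<close>,
  with squared norm \<open>k!\<close> for the normalised weight.\<close>

fun hermite :: "nat \<Rightarrow> real \<Rightarrow> real" where
  "hermite 0 x = 1"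
| "hermite (Suc 0) x = x"
| "hermite (Suc (Suc k)) x = x * hermite (Suc k) x - real (Suc k) * hermite k x"

definition hermite_phi :: "nat ^ 3 \<Rightarrow> real ^ 3 \<Rightarrow> real" where
  "hermite_phi \<alpha> \<xi> =
     (\<Prod>i\<in>UNIV. hermite (vec_nth \<alpha> i) (vec_nth \<xi> i) / sqrt (fact (vec_nth \<alpha> i)))"

definition maxwellian :: "real ^ 3 \<Rightarrow> real" where
  "maxwellian \<xi> = (2 * pi) powr (- 3 / 2) * exp (- (norm \<xi>)\<^sup>2 / 2)"

definition even_indices :: "nat \<Rightarrow> (nat ^ 3) set" where
  "even_indices K = {\<alpha>. (\<Sum>i\<in>UNIV. vec_nth \<alpha> i) \<le> K \<and> even (vec_nth \<alpha> 2)}"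

definition odd_indices :: "nat \<Rightarrow> (nat ^ 3) set" where
  "odd_indices K = {\<alpha>. (\<Sum>i\<in>UNIV. vec_nth \<alpha> i) \<le> K \<and> odd (vec_nth \<alpha> 2)}"

text \<open>An ordering of the multi-indices, even ones first: \<open>idx\<close> sends \<open>0, \<dots>, m - 1\<close> to
  the even and \<open>m, \<dots>, m + n - 1\<close> to the odd ones.\<close>

definition grad_ordering :: "nat \<Rightarrow> nat \<Rightarrow> nat \<Rightarrow> (nat \<Rightarrow> nat ^ 3) \<Rightarrow> bool" where
  "grad_ordering K m n idx \<longleftrightarrow>
     bij_betw idx {0..<m} (even_indices K) \<and> bij_betw idx {m..<m + n} (odd_indices K)"

definition grad_M :: "nat \<Rightarrow> nat \<Rightarrow> (nat \<Rightarrow> nat ^ 3) \<Rightarrow> real mat" where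
  "grad_M m n idx = mat m n (\<lambda>(i, j).
     LINT \<xi>|lborel. maxwellian \<xi> * vec_nth \<xi> 2 * hermite_phi (idx i) \<xi> * hermite_phi (idx (m + j)) \<xi>)"

definition grad_A :: "nat \<Rightarrow> nat \<Rightarrow> real mat \<Rightarrow> real mat" where
  "grad_A m n M = four_block_mat (0\<^sub>m m m) M M\<^sup>T (0\<^sub>m n n)"

definition grad_Q ::
  "((real ^ 3 \<Rightarrow> real) \<Rightarrow> real ^ 3 \<Rightarrow> real) \<Rightarrow> nat \<Rightarrow> nat \<Rightarrow> (nat \<Rightarrow> nat ^ 3) \<Rightarrow> real mat" where
  "grad_Q L m n idx = mat (m + n) (m + n) (\<lambda>(i, j).
     - (LINT \<xi>|lborel. L (\<lambda>\<zeta>. maxwellian \<zeta> * hermite_phi (idx j) \<zeta>) \<xi> * hermite_phi (idx i) \<xi>))"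


subsection \<open>Linear algebra\<close>

definition pos_semidef :: "real mat \<Rightarrow> bool" where
  "pos_semidef B \<longleftrightarrow> B\<^sup>T = B \<and> (\<forall>v\<in>carrier_vec (dim_row B). v \<bullet> (B *\<^sub>v v) \<ge> 0)"

definition pos_def :: "real mat \<Rightarrow> bool" where
  "pos_def B \<longleftrightarrow> B\<^sup>T = B \<and>
     (\<forall>v\<in>carrier_vec (dim_row B). v \<noteq> 0\<^sub>v (dim_row B) \<longrightarrow> v \<bullet> (B *\<^sub>v v) > 0)"

definition orthonormal_basis_mat :: "real mat \<Rightarrow> nat \<Rightarrow> nat \<Rightarrow> real vec set \<Rightarrow> bool" where
  "orthonormal_basis_mat B nr nc S \<longleftrightarrow>
     B \<in> carrier_mat nr nc \<and> B\<^sup>T * B = 1\<^sub>m nc \<and> vec_space.col_space nr B = S"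

definition real_orthogonal :: "nat \<Rightarrow> real mat \<Rightarrow> bool" where
  "real_orthogonal k U \<longleftrightarrow> U \<in> carrier_mat k k \<and> U\<^sup>T * U = 1\<^sub>m k"

definition vnorm :: "real vec \<Rightarrow> real" where
  "vnorm g = sqrt (g \<bullet> g)"


subsection \<open>Absolute continuity and the weighted norm\<close>

definition abs_continuous_on_ivl :: "real \<Rightarrow> real \<Rightarrow> (real \<Rightarrow> real) \<Rightarrow> bool" where
  "abs_continuous_on_ivl a b f \<longleftrightarrow>
     (\<forall>\<epsilon>>0. \<exists>\<delta>>0. \<forall>(k::nat) s t.
        (\<forall>i<k. a \<le> s i \<and> s i \<le> t i \<and> t i \<le> b) \<and>
        (\<forall>i<k. \<forall>j<k. i \<noteq> j \<longrightarrow> {s i<..<t i} \<inter> {s j<..<t j} = {}) \<and>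
        (\<Sum>i<k. t i - s i) < \<delta>
        \<longrightarrow> (\<Sum>i<k. \<bar>f (t i) - f (s i)\<bar>) < \<epsilon>)"

definition locally_abs_continuous :: "(real \<Rightarrow> real) \<Rightarrow> bool" where
  "locally_abs_continuous f \<longleftrightarrow> (\<forall>b\<ge>0. abs_continuous_on_ivl 0 b f)"

text \<open>Functions on the half line are represented by total functions; only their values on
  \<open>{0..}\<close> matter. \<open>weighted_L2 d a h\<close> says that \<open>h\<close> is a (Lebesgue) measurable function from
  \<open>{0..}\<close> to \<open>\<real>\<^sup>d\<close> with finite weighted norm; \<open>weighted_norm\<close> is meaningful only then.\<close>

definition weighted_L2 :: "nat \<Rightarrow> real \<Rightarrow> (real \<Rightarrow> real vec) \<Rightarrow> bool" where
  "weighted_L2 d a h \<longleftrightarrow>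
     (\<forall>y\<ge>0. h y \<in> carrier_vec d) \<and>
     (\<forall>i<d. (\<lambda>y. h y $ i) \<in> borel_measurable (lebesgue_on {0..})) \<and>
     integrable (lebesgue_on {0..}) (\<lambda>y. exp (2 * a * y) * (h y \<bullet> h y))"

definition weighted_norm :: "real \<Rightarrow> (real \<Rightarrow> real vec) \<Rightarrow> real" where
  "weighted_norm a h = sqrt (LINT y|lebesgue_on {0..}. exp (2 * a * y) * (h y \<bullet> h y))"


subsection \<open>Solutions of the half-space problem\<close>

text \<open>\<open>A W' = - Q W + h\<close> on the half line; the condition at infinity is the finiteness of the
  weighted norm of \<open>W\<close>. Since \<open>A\<close> may be singular, the part of the system without derivatives
  (tested against the null space of \<open>A\<close>) is required at every point.\<close>

definition half_line_solution ::
  "real \<Rightarrow> real mat \<Rightarrow> real mat \<Rightarrow> (real \<Rightarrow> real vec) \<Rightarrow> (real \<Rightarrow> real vec) \<Rightarrow> bool" where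
  "half_line_solution a A Q h W \<longleftrightarrow>
     weighted_L2 (dim_row A) a W \<and>
     (\<forall>i<dim_row A. locally_abs_continuous (\<lambda>y. (A *\<^sub>v W y) $ i)) \<and>
     (AE y in lebesgue_on {0..}. \<forall>i<dim_row A.
        ((\<lambda>t. (A *\<^sub>v W t) $ i) has_real_derivative (- (Q *\<^sub>v W y) + h y) $ i) (at y within {0..})) \<and>
     (\<forall>y\<ge>0. \<forall>v\<in>mat_kernel A. v \<bullet> (- (Q *\<^sub>v W y) + h y) = 0)"

text \<open>In the boundary condition, \<open>We\<close> and \<open>Wo\<close> stand for the even and odd parts of \<open>W 0\<close>,
  \<open>Wbe\<close>, \<open>Wbo\<close> for the outer flow and \<open>be\<close>, \<open>bo\<close> for the wall data.\<close>

definition boundary_condition ::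
  "real mat \<Rightarrow> real \<Rightarrow> real mat \<Rightarrow> real vec \<Rightarrow> real vec \<Rightarrow> real vec \<Rightarrow> real vec \<Rightarrow> real vec \<Rightarrow> real vec \<Rightarrow> bool"
  where
  "boundary_condition H \<chi>h M We Wo Wbe Wbo be bo \<longleftrightarrow>
     H *\<^sub>v (Wo + Wbo - bo) + \<chi>h \<cdot>\<^sub>v (M\<^sup>T *\<^sub>v (We + Wbe - be)) = 0\<^sub>v (dim_col M)"

text \<open>The pair of unknowns is \<open>W\<close> and \<open>u = Ge\<^sup>T (Wbe - be)\<close>. Given are only \<open>g1 = Wbo - bo\<close>
  and the component \<open>g2\<close> of \<open>Wbe - be\<close> orthogonal to the columns of \<open>Ge\<close>.\<close>

definition layer_solution ::
  "real \<Rightarrow> real mat \<Rightarrow> real mat \<Rightarrow> real mat \<Rightarrow> real mat \<Rightarrow> real mat \<Rightarrow> real \<Rightarrow>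
   (real \<Rightarrow> real vec) \<Rightarrow> real vec \<Rightarrow> real vec \<Rightarrow> (real \<Rightarrow> real vec) \<Rightarrow> real vec \<Rightarrow> bool" where
  "layer_solution a M A Q Ge H \<chi>h h g1 g2 W u \<longleftrightarrow>
     half_line_solution a A Q h W \<and>
     (\<exists>Wbe\<in>carrier_vec (dim_row M). \<exists>be\<in>carrier_vec (dim_row M).
      \<exists>Wbo\<in>carrier_vec (dim_col M). \<exists>bo\<in>carrier_vec (dim_col M).
        Wbo - bo = g1 \<and>
        (1\<^sub>m (dim_row M) - Ge * Ge\<^sup>T) *\<^sub>v (Wbe - be) = g2 \<and>
        Ge\<^sup>T *\<^sub>v (Wbe - be) = u \<and>
        boundary_condition H \<chi>h M
          (vec_first (W 0) (dim_row M)) (vec_last (W 0) (dim_col M)) Wbe Wbo be bo)"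

end

theory Submission
  imports Defs "HOL-Probability.Distributions"
begin

unbundle no vec_syntax
unbundle no inner_syntax

text \<open>In suitable trial and test bases \<open>A\<close> is diagonal and \<open>Q\<close> is lower triangular, so that the system splits into
  scalar equations \<open>e w' + f w = \<phi>\<close>. Those with \<open>e = 0\<close> are algebraic. For the others, \<open>a < 1 / \<lambda>\<^sub>m\<^sub>a\<^sub>x\<close> makes the
  initial value free when \<open>e, f > 0\<close>, while it is determined by the decay at infinity otherwise. The number of free
  initial values is the number of positive eigenvalues of \<open>A\<^sub>3\<^sub>3\<close> relative to \<open>Q\<^sub>3\<^sub>3\<close>; it is at least \<open>n - p\<^sub>1\<close>, because
  \<open>A\<^sub>3\<^sub>3\<close> is positive on the vectors \<open>(K z, z)\<close> with \<open>K = Y\<^sub>3\<^sup>T M Z\<^sub>3\<close>, which is injective since \<open>r\<^sub>2 = 0\<close>.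
  Combined with the \<open>p\<^sub>1\<close> unknown boundary parameters, \<open>n - p\<^sub>1\<close> free initial values give a square linear system for
  the boundary condition. It is injective by an energy argument: for a homogeneous solution \<open>W\<^sub>o(0) \<bullet> M\<^sup>T W\<^sub>e(0)\<close> is
  nonnegative by dissipation and nonpositive by the boundary condition.\<close>

section \<open>Absolutely continuous functions\<close>

text \<open>Diagonalizing outright is impossible: \<open>Q\<close> has a kernel, and kernel vectors
  that are also \<open>A\<close>-orthogonal to the kernel start Jordan chains of the pencil at 0.
  Hence \<open>Q\<close> becomes only triangular, and test vectors differ from trial vectors. Rows
  that belong to the kernel have rate \<open>f / e = 0 < a\<close>, so free initial values arise
  only in the \<open>V3\<close> part, with rates \<open>1 / \<mu>\<close>. A lower bound on their
  number is enough, since a surplus would contradict the injectivity of the boundary system. The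
  second obstacle is regularity. Only \<open>A W\<close> is absolutely continuous, and the algebraic
  components of \<open>W 0\<close> are not controlled by weighted norms. Boundary estimates are
  therefore made for \<open>A W 0\<close>, and the energy is written through \<open>A W\<close> as
  well. Absolute continuity is the epsilon-delta notion and derivatives exist only almost
  everywhere, so monotonicity and the differentiation of integrals rest on gauges, Henstock's lemma
  and Vitali coverings.\<close>

definition variation_small :: "real \<Rightarrow> real \<Rightarrow> (real \<Rightarrow> real) \<Rightarrow> real \<Rightarrow> real \<Rightarrow> bool" where
  "variation_small a b f \<epsilon> \<delta> \<longleftrightarrow> (\<forall>(k::nat) s t.
        (\<forall>i<k. a \<le> s i \<and> s i \<le> t i \<and> t i \<le> b) \<and>
        (\<forall>i<k. \<forall>j<k. i \<noteq> j \<longrightarrow> {s i<..<t i} \<inter> {s j<..<t j} = {}) \<and>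
        (\<Sum>i<k. t i - s i) < \<delta>
        \<longrightarrow> (\<Sum>i<k. \<bar>f (t i) - f (s i)\<bar>) < \<epsilon>)"

lemma abs_continuous_on_ivl_iff:
  "abs_continuous_on_ivl a b f \<longleftrightarrow> (\<forall>\<epsilon>>0. \<exists>\<delta>>0. variation_small a b f \<epsilon> \<delta>)"
  by (simp only: abs_continuous_on_ivl_def variation_small_def)

lemma variation_smallD:
  fixes k :: nat
  assumes "variation_small a b f \<epsilon> \<delta>"
    and "\<forall>i<k. a \<le> s i \<and> s i \<le> t i \<and> t i \<le> b"
    and "\<forall>i<k. \<forall>j<k. i \<noteq> j \<longrightarrow> {s i<..<t i} \<inter> {s j<..<t j} = {}"
    and "(\<Sum>i<k. t i - s i) < \<delta>"
  shows "(\<Sum>i<k. \<bar>f (t i) - f (s i)\<bar>) < \<epsilon>"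
  by (rule assms(1)[unfolded variation_small_def, THEN spec, THEN spec, THEN spec, THEN mp])
    (intro conjI assms)

lemma variation_smallI:
  assumes "\<And>(k::nat) s t. \<forall>i<k. a \<le> s i \<and> s i \<le> t i \<and> t i \<le> b \<Longrightarrow>
    \<forall>i<k. \<forall>j<k. i \<noteq> j \<longrightarrow> {s i<..<t i} \<inter> {s j<..<t j} = {} \<Longrightarrow>
    (\<Sum>i<k. t i - s i) < \<delta> \<Longrightarrow> (\<Sum>i<k. \<bar>f (t i) - f (s i)\<bar>) < \<epsilon>"
  shows "variation_small a b f \<epsilon> \<delta>"
  unfolding variation_small_def by (intro allI impI, elim conjE) (rule assms)

text \<open>Tagged divisions are finite sets of pairs, so the sums to be estimated run over sets
  that come without an enumeration.\<close>

lemma variation_small_finite: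
  fixes I :: "'i set"
  assumes vs: "variation_small a b f \<epsilon> \<delta>"
    and I: "finite I" and st: "\<And>i. i \<in> I \<Longrightarrow> a \<le> s i \<and> s i \<le> t i \<and> t i \<le> b"
    and disj: "\<And>i j. i \<in> I \<Longrightarrow> j \<in> I \<Longrightarrow> i \<noteq> j \<Longrightarrow> {s i<..<t i} \<inter> {s j<..<t j} = {}"
    and len: "(\<Sum>i\<in>I. t i - s i) < \<delta>"
  shows "(\<Sum>i\<in>I. \<bar>f (t i) - f (s i)\<bar>) < \<epsilon>"
proof -
    obtain \<pi> where \<pi>: "bij_betw \<pi> {..<card I} I"
      using ex_bij_betw_nat_finite[OF I] by (auto simp: atLeast0LessThan)
    have mem: "\<pi> i \<in> I" if "i < card I" for i
      using \<pi> that by (auto simp: bij_betw_def)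
    have inj: "\<pi> i \<noteq> \<pi> j" if "i < card I" "j < card I" "i \<noteq> j" for i j
      using \<pi> that by (auto simp: bij_betw_def inj_on_def)
    have sum: "(\<Sum>i<card I. g (\<pi> i)) = (\<Sum>i\<in>I. g i)" for g :: "'i \<Rightarrow> real"
      using sum.reindex_bij_betw[OF \<pi>] .
    have "(\<Sum>i<card I. \<bar>f ((t \<circ> \<pi>) i) - f ((s \<circ> \<pi>) i)\<bar>) < \<epsilon>"
    proof (rule variation_smallD[OF vs])
      show "\<forall>i<card I. a \<le> (s \<circ> \<pi>) i \<and> (s \<circ> \<pi>) i \<le> (t \<circ> \<pi>) i \<and> (t \<circ> \<pi>) i \<le> b"
        using st mem by auto
      show "\<forall>i<card I. \<forall>j<card I. i \<noteq> j \<longrightarrow> {(s \<circ> \<pi>) i<..<(t \<circ> \<pi>) i} \<inter> {(s \<circ> \<pi>) j<..<(t \<circ> \<pi>) j} = {}"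
        using disj mem inj by (metis comp_apply)
      show "(\<Sum>i<card I. (t \<circ> \<pi>) i - (s \<circ> \<pi>) i) < \<delta>"
        using len sum[of "\<lambda>i. t i - s i"] by simp
    qed
    then show ?thesis
            using sum[of "\<lambda>i. \<bar>f (t i) - f (s i)\<bar>"] by simp
qed

text \<open>A single domination criterion that covers sums, products on a compact interval, sign
  changes and functions that agree on the interval.\<close>

lemma abs_continuous_on_ivl_sum2:
  assumes f: "abs_continuous_on_ivl a b f" and g: "abs_continuous_on_ivl a b g"
    and B: "\<And>s t. a \<le> s \<Longrightarrow> s \<le> t \<Longrightarrow> t \<le> b \<Longrightarrow> \<bar>h t - h s\<bar> \<le> B * \<bar>f t - f s\<bar> + B * \<bar>g t - g s\<bar>"
  shows "abs_continuous_on_ivl a b h"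
proof (unfold abs_continuous_on_ivl_iff, intro allI impI)
  fix \<epsilon> :: real assume "\<epsilon> > 0"
  \<comment> \<open>\<open>B\<close> may have any sign; |B| + 1 dominates it and is positive, so the
    quotient makes sense also for \<open>B = 0\<close>.\<close>
  define \<eta> where "\<eta> = \<epsilon> / (2 * (\<bar>B\<bar> + 1))"
  have \<eta>: "\<eta> > 0" using \<open>\<epsilon> > 0\<close> unfolding \<eta>_def by (intro divide_pos_pos) auto
  have \<eta>\<epsilon>: "(\<bar>B\<bar> + 1) * \<eta> + (\<bar>B\<bar> + 1) * \<eta> = \<epsilon>"
    unfolding \<eta>_def by (simp add: field_simps add_nonneg_eq_0_iff)
  obtain d1 where d1: "d1 > 0" "variation_small a b f \<eta> d1"
    using f \<eta> unfolding abs_continuous_on_ivl_iff by blast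
  obtain d2 where d2: "d2 > 0" "variation_small a b g \<eta> d2"
    using g \<eta> unfolding abs_continuous_on_ivl_iff by blast
  show "\<exists>\<delta>>0. variation_small a b h \<epsilon> \<delta>"
  proof (intro exI[of _ "min d1 d2"] conjI variation_smallI)
    show "min d1 d2 > 0" using d1 d2 by simp
    fix k :: nat and s t :: "nat \<Rightarrow> real"
    assume st: "\<forall>i<k. a \<le> s i \<and> s i \<le> t i \<and> t i \<le> b"
      and disj: "\<forall>i<k. \<forall>j<k. i \<noteq> j \<longrightarrow> {s i<..<t i} \<inter> {s j<..<t j} = {}"
      and len: "(\<Sum>i<k. t i - s i) < min d1 d2"
    have F: "(\<Sum>i<k. \<bar>f (t i) - f (s i)\<bar>) < \<eta>" and G: "(\<Sum>i<k. \<bar>g (t i) - g (s i)\<bar>) < \<eta>"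
      using variation_smallD[OF d1(2) st disj] variation_smallD[OF d2(2) st disj] len by auto
    have "(\<Sum>i<k. \<bar>h (t i) - h (s i)\<bar>) \<le> (\<Sum>i<k. (\<bar>B\<bar> + 1) * \<bar>f (t i) - f (s i)\<bar> + (\<bar>B\<bar> + 1) * \<bar>g (t i) - g (s i)\<bar>)"
    proof (rule sum_mono)
      fix i assume "i \<in> {..<k}"
      then have "\<bar>h (t i) - h (s i)\<bar> \<le> B * \<bar>f (t i) - f (s i)\<bar> + B * \<bar>g (t i) - g (s i)\<bar>"
        using B st by auto
      also have "\<dots> \<le> (\<bar>B\<bar> + 1) * \<bar>f (t i) - f (s i)\<bar> + (\<bar>B\<bar> + 1) * \<bar>g (t i) - g (s i)\<bar>"
        by (intro add_mono mult_right_mono) auto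
      finally show "\<bar>h (t i) - h (s i)\<bar> \<le> \<dots>" .
    qed
    also have "\<dots> = (\<bar>B\<bar> + 1) * (\<Sum>i<k. \<bar>f (t i) - f (s i)\<bar>) + (\<bar>B\<bar> + 1) * (\<Sum>i<k. \<bar>g (t i) - g (s i)\<bar>)"
      by (simp add: sum.distrib sum_distrib_left)
    also have "\<dots> < (\<bar>B\<bar> + 1) * \<eta> + (\<bar>B\<bar> + 1) * \<eta>"
      using F G by (intro add_strict_mono mult_strict_left_mono) auto
    finally show "(\<Sum>i<k. \<bar>h (t i) - h (s i)\<bar>) < \<epsilon>" using \<eta>\<epsilon> by simp
  qed
qed

lemma abs_continuous_on_ivl_lipschitz:
  assumes "\<And>s t. a \<le> s \<Longrightarrow> s \<le> t \<Longrightarrow> t \<le> b \<Longrightarrow> \<bar>f t - f s\<bar> \<le> B * (t - s)"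
  shows "abs_continuous_on_ivl a b f"
proof (rule abs_continuous_on_ivl_sum2[where f = "\<lambda>x. x" and g = "\<lambda>x. x" and B = "\<bar>B\<bar>"])
  show "abs_continuous_on_ivl a b (\<lambda>x. x)"
  proof (unfold abs_continuous_on_ivl_iff, intro allI impI)
    fix \<epsilon> :: real assume "\<epsilon> > 0"
    show "\<exists>\<delta>>0. variation_small a b (\<lambda>x. x) \<epsilon> \<delta>"
      using \<open>\<epsilon> > 0\<close> by (intro exI[of _ \<epsilon>] conjI variation_smallI) auto
  qed
  then show "abs_continuous_on_ivl a b (\<lambda>x. x)" .
  fix s t assume st: "a \<le> s" "s \<le> t" "t \<le> b"
  have "B * (t - s) \<le> \<bar>B\<bar> * (t - s)" "0 \<le> \<bar>B\<bar> * (t - s)" using st by (auto intro!: mult_right_mono)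
  then show "\<bar>f t - f s\<bar> \<le> \<bar>B\<bar> * \<bar>t - s\<bar> + \<bar>B\<bar> * \<bar>t - s\<bar>"
    using assms[OF st] st by simp
qed

lemma abs_continuous_on_ivl_continuous:
  assumes f: "abs_continuous_on_ivl a b f"
  shows "continuous_on {a..b} f"
proof (rule continuous_onI)
  fix x \<epsilon> :: real assume x: "x \<in> {a..b}" and "\<epsilon> > 0"
  obtain d where "d > 0" and d: "variation_small a b f \<epsilon> d"
    using f \<open>\<epsilon> > 0\<close> unfolding abs_continuous_on_ivl_iff by blast
  have "dist (f x') (f x) \<le> \<epsilon>" if x': "x' \<in> {a..b}" "dist x' x < d" for x'
  proof (cases "x \<le> x'")
    case True
    then show ?thesis using variation_small_finite[OF d, of "{0::nat}" "\<lambda>_. x" "\<lambda>_. x'"] x x'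
      by (auto simp: dist_real_def)
  next
    case False
    then show ?thesis using variation_small_finite[OF d, of "{0::nat}" "\<lambda>_. x'" "\<lambda>_. x"] x x'
      by (auto simp: dist_real_def abs_minus_commute)
  qed
  then show "\<exists>d>0. \<forall>x'\<in>{a..b}. dist x' x < d \<longrightarrow> dist (f x') (f x) \<le> \<epsilon>"
    using \<open>d > 0\<close> by blast
qed

lemma abs_continuous_on_ivl_bounded:
  assumes f: "abs_continuous_on_ivl a b f"
  obtains B where "\<And>x. x \<in> {a..b} \<Longrightarrow> \<bar>f x\<bar> \<le> B"
proof -
  have "continuous_on {a..b} f" by (rule abs_continuous_on_ivl_continuous[OF f])
  then have "bounded (f ` {a..b})"
    using compact_continuous_image compact_imp_bounded compact_Icc by blast
  then obtain B where "\<forall>y\<in>f ` {a..b}. norm y \<le> B" unfolding bounded_iff by blast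
  then show ?thesis by (intro that[of B]) simp
qed

text \<open>Boundedness on the compact interval turns the product rule for increments into the
  domination criterion.\<close>

lemma abs_continuous_on_ivl_mult:
  assumes f: "abs_continuous_on_ivl a b f" and g: "abs_continuous_on_ivl a b g"
  shows "abs_continuous_on_ivl a b (\<lambda>x. f x * g x)"
proof -
  obtain B where B: "\<And>x. x \<in> {a..b} \<Longrightarrow> \<bar>f x\<bar> \<le> B" using abs_continuous_on_ivl_bounded[OF f] by blast
  obtain C where C: "\<And>x. x \<in> {a..b} \<Longrightarrow> \<bar>g x\<bar> \<le> C" using abs_continuous_on_ivl_bounded[OF g] by blast
  show ?thesis
  proof (rule abs_continuous_on_ivl_sum2[OF f g])
    fix s t assume st: "a \<le> s" "s \<le> t" "t \<le> b"
    have "f t * g t - f s * g s = (f t - f s) * g t + f s * (g t - g s)" by (simp add: algebra_simps)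
    then have "\<bar>f t * g t - f s * g s\<bar> \<le> \<bar>f t - f s\<bar> * \<bar>g t\<bar> + \<bar>f s\<bar> * \<bar>g t - g s\<bar>"
      by (metis abs_mult abs_triangle_ineq)
    also have "\<dots> \<le> \<bar>f t - f s\<bar> * max B C + max B C * \<bar>g t - g s\<bar>"
      using B[of s] C[of t] st by (intro add_mono mult_mono) auto
    finally show "\<bar>f t * g t - f s * g s\<bar> \<le> max B C * \<bar>f t - f s\<bar> + max B C * \<bar>g t - g s\<bar>"
      by (simp add: mult.commute)
  qed
qed

text \<open>A gauge argument. Intervals tagged in \<open>Z\<close> lie in an open set of measure
  below \<delta>, so absolute continuity makes their total increment small; on every other interval
  the nonnegative derivative at the tag allows \<open>f\<close> to drop by at most \<eta> times the
  length. Summing over a fine tagged division gives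
  \<open>f a \<le> f b + \<epsilon>\<close>.\<close>

lemma abs_continuous_nonneg_derivative_imp_le:
  assumes f: "abs_continuous_on_ivl a b f" and ab: "a \<le> b" and Z: "negligible Z"
    and der: "\<And>x. x \<in> {a..b} - Z \<Longrightarrow> \<exists>D\<ge>0. (f has_real_derivative D) (at x within {a..b})"
  shows "f a \<le> f b"
proof (rule field_le_epsilon)
  fix \<epsilon> :: real assume "\<epsilon> > 0"
  \<comment> \<open>A loss of \<eta> per unit length adds up to at most half of \<epsilon> over the
    whole interval; the 1 allows for \<open>a = b\<close>.\<close>
  define \<eta> where "\<eta> = \<epsilon> / (2 * (b - a + 1))"
  have \<eta>: "\<eta> > 0" and \<eta>\<epsilon>: "\<eta> * (b - a) \<le> \<epsilon> / 2"
    using \<open>\<epsilon> > 0\<close> ab unfolding \<eta>_def by (auto simp: field_simps add_nonneg_eq_0_iff)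
  obtain \<delta> where "\<delta> > 0" and \<delta>: "variation_small a b f (\<epsilon> / 2) \<delta>"
    using f \<open>\<epsilon> > 0\<close> unfolding abs_continuous_on_ivl_iff by (meson half_gt_zero)
  obtain U where U: "open U" "Z \<subseteq> U" "U \<in> lmeasurable" "measure lebesgue U < \<delta>"
  proof -
    obtain U where U: "open U" "Z \<subseteq> U" "U - Z \<in> lmeasurable" "emeasure lebesgue (U - Z) < ennreal \<delta>"
      using sets_lebesgue_outer_open[OF negligible_imp_sets[OF Z] \<open>\<delta> > 0\<close>] by metis
    have UZ: "U = (U - Z) \<union> Z" using U by blast
    have "measure lebesgue (U - Z) < \<delta>"
      using U \<open>0 < \<delta>\<close> by (metis emeasure_eq_measure2 ennreal_less_iff measure_nonneg)
    moreover have "U \<in> lmeasurable"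
      using fmeasurable.Un[OF U(3) negligible_imp_measurable[OF Z]] UZ by simp
    moreover have "measure lebesgue U \<le> measure lebesgue (U - Z) + measure lebesgue Z"
      using measure_Un_le[OF fmeasurableD[OF U(3)] negligible_imp_sets[OF Z]] UZ by simp
    moreover have "measure lebesgue Z = 0" using Z by (rule negligible_imp_measure0)
    ultimately show ?thesis using that[OF U(1,2)] by simp
  qed
  \<comment> \<open>Two kinds of radius, later joined in one gauge: at a tag in \<open>Z\<close> the
    ball stays inside \<open>U\<close>, at any other tag \<open>f\<close> is linear on the ball up
    to an error of slope \<eta>.\<close>
  have "\<exists>d>0. (x \<in> Z \<longrightarrow> ball x d \<subseteq> U) \<and>
      (x \<in> {a..b} - Z \<longrightarrow> (\<exists>D\<ge>0. \<forall>t\<in>{a..b} \<inter> ball x d. \<bar>f t - f x - D * (t - x)\<bar> \<le> \<eta> * \<bar>t - x\<bar>))" for x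
  proof (cases "x \<in> Z")
    case True
    then obtain d where "d > 0" "ball x d \<subseteq> U" using U openE by blast
    then show ?thesis using True by blast
  next
    case False
    show ?thesis
    proof (cases "x \<in> {a..b}")
      case True
      then obtain D where "D \<ge> 0" "(f has_real_derivative D) (at x within {a..b})" using der False by blast
      then obtain d where "d > 0" "\<And>t. t \<in> {a..b} \<Longrightarrow> norm (t - x) < d \<Longrightarrow> norm (f t - f x - D * (t - x)) \<le> \<eta> * norm (t - x)"
        unfolding has_field_derivative_def has_derivative_within_alt using \<eta> by blast
      then show ?thesis using False \<open>D \<ge> 0\<close>
        by (intro exI[of _ d]) (auto simp: dist_norm norm_minus_commute)
    qed (use False in \<open>auto intro: exI[of _ 1]\<close>)
  qed
  then obtain d where d: "\<And>x. d x > 0" "\<And>x. x \<in> Z \<Longrightarrow> ball x (d x) \<subseteq> U"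
    "\<And>x. x \<in> {a..b} - Z \<Longrightarrow> \<exists>D\<ge>0. \<forall>t\<in>{a..b} \<inter> ball x (d x). \<bar>f t - f x - D * (t - x)\<bar> \<le> \<eta> * \<bar>t - x\<bar>"
    by metis
  have "gauge (\<lambda>x. ball x (d x))" using d(1) by (simp add: gauge_def)
  then obtain p where p: "p tagged_division_of {a..b}" and fine: "(\<lambda>x. ball x (d x)) fine p"
    using fine_division_exists_real by blast
  note pD = tagged_division_ofD[OF p]
  have ivl: "K = {Inf K..Sup K} \<and> a \<le> Inf K \<and> Inf K \<le> x \<and> x \<le> Sup K \<and> Sup K \<le> b" if xK: "(x, K) \<in> p" for x K
  proof -
    obtain u v where K: "K = {u..v}" using pD(4)[OF xK] by auto
    have "x \<in> K" "K \<subseteq> {a..b}" using pD xK by auto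
    then show ?thesis using K by auto
  qed
  have fineD: "Inf K \<in> ball x (d x) \<and> Sup K \<in> ball x (d x)" if xK: "(x, K) \<in> p" for x K
    proof -
    have "Inf K \<in> K" "Sup K \<in> K" using ivl[OF xK] by (metis atLeastAtMost_iff order_refl order_trans)+
    then show ?thesis using Tagged_Division.fineD[OF fine xK] by blast
  qed
  define p1 where "p1 = {z \<in> p. fst z \<in> Z}"
  define p2 where "p2 = p - p1"
  have fin: "finite p" "finite p1" "finite p2" using pD(1) by (auto simp: p1_def p2_def)
  have disj: "{Inf (snd i)<..<Sup (snd i)} \<inter> {Inf (snd j)<..<Sup (snd j)} = {}"
    if "i \<in> p" "j \<in> p" "i \<noteq> j" for i j
  proof -
    obtain x K y L where "i = (x, K)" "j = (y, L)" by (metis surj_pair)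
    moreover have "interior K \<inter> interior L = {}" using calculation pD(5) that by metis
    moreover have "interior K = {Inf K<..<Sup K}" "interior L = {Inf L<..<Sup L}"
      using ivl calculation that interior_atLeastAtMost_real by metis+
    ultimately show ?thesis by simp
  qed
  \<comment> \<open>Division intervals have disjoint interiors, so the total length of those tagged
    in \<open>Z\<close> is the measure of a subset of \<open>U\<close>.\<close>
  have "(\<Sum>i\<in>p1. Sup (snd i) - Inf (snd i)) = (\<Sum>i\<in>p1. measure lebesgue {Inf (snd i)<..<Sup (snd i)})"
  proof (rule sum.cong)
    fix i assume "i \<in> p1"
    then have "Inf (snd i) \<le> Sup (snd i)" using ivl[of "fst i" "snd i"] by (auto simp: p1_def)
    then show "Sup (snd i) - Inf (snd i) = measure lebesgue {Inf (snd i)<..<Sup (snd i)}" by simp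
  qed simp
  also have "\<dots> = measure lebesgue (\<Union>i\<in>p1. {Inf (snd i)<..<Sup (snd i)})"
    using fin disj by (intro measure_UNION'[symmetric]) (auto simp: pairwise_def disjnt_def p1_def)
  also have "\<dots> \<le> measure lebesgue U"
  proof (rule measure_mono_fmeasurable)
    show "(\<Union>i\<in>p1. {Inf (snd i)<..<Sup (snd i)}) \<subseteq> U"
    proof (rule UN_least)
      fix i assume i: "i \<in> p1"
      then have "(fst i, snd i) \<in> p" "fst i \<in> Z" by (auto simp: p1_def)
      then have "snd i \<subseteq> U" using d(2) Tagged_Division.fineD[OF fine] by blast
      then show "{Inf (snd i)<..<Sup (snd i)} \<subseteq> U" using ivl[OF \<open>(fst i, snd i) \<in> p\<close>]
        by (metis greaterThanLessThan_subseteq_atLeastAtMost_iff order_refl subset_trans)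
    qed
    show "(\<Union>i\<in>p1. {Inf (snd i)<..<Sup (snd i)}) \<in> sets lebesgue"
      using fin by (intro sets.finite_UN) auto
  qed (rule U)
  finally have len: "(\<Sum>i\<in>p1. Sup (snd i) - Inf (snd i)) < \<delta>" using U by simp
  have "(\<Sum>i\<in>p1. \<bar>f (Sup (snd i)) - f (Inf (snd i))\<bar>) < \<epsilon> / 2"
  proof (rule variation_small_finite[OF \<delta> fin(2) _ _ len])
    fix i assume "i \<in> p1"
    then show "a \<le> Inf (snd i) \<and> Inf (snd i) \<le> Sup (snd i) \<and> Sup (snd i) \<le> b"
      using ivl[of "fst i" "snd i"] by (auto simp: p1_def)
  next
    fix i j assume "i \<in> p1" "j \<in> p1" "i \<noteq> j"
    then show "{Inf (snd i)<..<Sup (snd i)} \<inter> {Inf (snd j)<..<Sup (snd j)} = {}"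
      by (intro disj) (auto simp: p1_def)
  qed
  moreover have "- (\<Sum>i\<in>p1. \<bar>f (Sup (snd i)) - f (Inf (snd i))\<bar>) \<le> (\<Sum>i\<in>p1. f (Sup (snd i)) - f (Inf (snd i)))"
    unfolding sum_negf[symmetric] by (rule sum_mono) simp
  ultimately have S1: "(\<Sum>i\<in>p1. f (Sup (snd i)) - f (Inf (snd i))) \<ge> - \<epsilon> / 2" by simp
  have "(\<Sum>i\<in>p2. - \<eta> * (Sup (snd i) - Inf (snd i))) \<le> (\<Sum>i\<in>p2. f (Sup (snd i)) - f (Inf (snd i)))"
  proof (rule sum_mono)
    fix i assume i: "i \<in> p2"
    obtain x K where xK: "i = (x, K)" by fastforce
    have p: "(x, K) \<in> p" "x \<notin> Z" using i by (auto simp: p2_def p1_def xK)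
    have xab: "x \<in> {a..b} - Z" using ivl[OF p(1)] p by auto
    obtain D where "D \<ge> 0" and D: "\<And>t. t \<in> {a..b} \<Longrightarrow> t \<in> ball x (d x) \<Longrightarrow> \<bar>f t - f x - D * (t - x)\<bar> \<le> \<eta> * \<bar>t - x\<bar>"
      using d(3)[OF xab] by blast
    \<comment> \<open>The tag splits the interval, and the derivative estimate is used from the tag
      to each end point, where the linear terms have the right sign.\<close>
    have 1: "\<bar>f (Sup K) - f x - D * (Sup K - x)\<bar> \<le> \<eta> * \<bar>Sup K - x\<bar>"
      and 2: "\<bar>f (Inf K) - f x - D * (Inf K - x)\<bar> \<le> \<eta> * \<bar>Inf K - x\<bar>"
      using D[of "Sup K"] D[of "Inf K"] ivl[OF p(1), THEN conjunct2] fineD[OF p(1)] by simp_all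
    have 3: "0 \<le> D * (Sup K - x)" "0 \<le> D * (x - Inf K)" using \<open>D \<ge> 0\<close> ivl[OF p(1)] by auto
    have 4: "\<bar>Sup K - x\<bar> = Sup K - x" "\<bar>Inf K - x\<bar> = x - Inf K" using ivl[OF p(1)] by auto
    show "- \<eta> * (Sup (snd i) - Inf (snd i)) \<le> f (Sup (snd i)) - f (Inf (snd i))"
      using 1 2 3 unfolding 4 xK snd_conv by (simp add: algebra_simps abs_le_iff)
  qed
  moreover have "(\<Sum>i\<in>p2. \<eta> * (Sup (snd i) - Inf (snd i))) \<le> (\<Sum>i\<in>p. \<eta> * (Sup (snd i) - Inf (snd i)))"
  proof (rule sum_mono2[OF fin(1)])
    fix i assume "i \<in> p - p2"
    then show "0 \<le> \<eta> * (Sup (snd i) - Inf (snd i))" using ivl[of "fst i" "snd i"] \<eta> by simp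
  qed (simp add: p2_def)
  moreover have "(\<Sum>i\<in>p. \<eta> * (Sup (snd i) - Inf (snd i))) = \<eta> * (b - a)"
    using additive_tagged_division_1[OF ab p, of "\<lambda>x. x"] by (simp add: sum_distrib_left[symmetric] case_prod_beta)
  ultimately have S2: "(\<Sum>i\<in>p2. f (Sup (snd i)) - f (Inf (snd i))) \<ge> - \<epsilon> / 2"
    using \<eta>\<epsilon> by (simp add: sum_negf)
  have "f b - f a = (\<Sum>i\<in>p. f (Sup (snd i)) - f (Inf (snd i)))"
    using additive_tagged_division_1[OF ab p, of f] by (simp add: case_prod_beta)
  also have "\<dots> = (\<Sum>i\<in>p2. f (Sup (snd i)) - f (Inf (snd i))) + (\<Sum>i\<in>p1. f (Sup (snd i)) - f (Inf (snd i)))"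
    unfolding p2_def using fin by (intro sum.subset_diff) (auto simp: p1_def)
  finally show "f a \<le> f b + \<epsilon>" using S1 S2 by simp
qed

section \<open>Indefinite integrals\<close>

text \<open>Over every fine partial division, Henstock's lemma bounds the summed difference between
  \<open>f x\<close> times the length and the integral by \<open>\<eta> * \<epsilon>\<close>.
  Disjoint bad intervals, tagged at an end point, form such a division, and each contributes more
  than \<eta> times its length. So their total length is below \<epsilon>, and by Vitali's theorem
  such intervals cover the bad set up to a null set.\<close>

lemma negligible_large_difference_quotients:
  fixes f :: "real \<Rightarrow> real"
  assumes f: "f integrable_on {a..b}" and "\<eta> > 0"
  defines "F \<equiv> \<lambda>x. integral {a..x} f"
  shows "negligible {x \<in> {a<..<b}. \<forall>d>0. \<exists>s t. a \<le> s \<and> s < t \<and> t \<le> b \<and> (x = s \<or> x = t) \<and> t - s < d \<and>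
     \<bar>F t - F s - f x * (t - s)\<bar> > \<eta> * (t - s)}" (is "negligible ?E")
  unfolding negligible_outer_le
proof (intro allI impI)
  fix \<epsilon> :: real assume "\<epsilon> > 0"
  have "f integrable_on cbox a b" using f by simp
  moreover have "\<eta> * \<epsilon> > 0" using \<open>\<eta> > 0\<close> \<open>\<epsilon> > 0\<close> by simp
  ultimately obtain \<gamma> where \<gamma>: "gauge \<gamma>" and hen: "\<And>p. p tagged_partial_division_of cbox a b \<Longrightarrow> \<gamma> fine p \<Longrightarrow>
      (\<Sum>(x,k)\<in>p. norm (Sigma_Algebra.measure lborel k *\<^sub>R f x - integral k f)) < \<eta> * \<epsilon>"
    using Henstock_lemma[of f a b "\<eta> * \<epsilon>"] by blast
  define K where "K = {(x, s, t). x \<in> ?E \<and> a \<le> s \<and> s < t \<and> t \<le> b \<and> (x = s \<or> x = t) \<and> {s..t} \<subseteq> \<gamma> x \<and>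
     \<bar>F t - F s - f x * (t - s)\<bar> > \<eta> * (t - s)}"
  \<comment> \<open>Centre and radius: in dimension one the closed balls of the covering theorem are
    the intervals \<open>{s..t}\<close>.\<close>
  define c where "c = (\<lambda>(x::real, s::real, t::real). (s + t) / 2)"
  define r where "r = (\<lambda>(x::real, s::real, t::real). (t - s) / 2)"
  have cball: "cball (c (x, s, t)) (r (x, s, t)) = {s..t}" for x s t
    by (simp add: c_def r_def cball_eq_atLeastAtMost field_simps)
  obtain C where C: "countable C" "C \<subseteq> K"
    and pw: "pairwise (\<lambda>i j. disjnt (cball (c i) (r i)) (cball (c j) (r j))) C"
    and neg: "negligible (?E - (\<Union>i \<in> C. cball (c i) (r i)))"
  proof (rule Vitali_covering_theorem_cballs[of K r ?E c])
    show "0 < r i" if "i \<in> K" for i using that by (auto simp: K_def r_def)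
    fix x d :: real assume x: "x \<in> ?E" and "0 < d"
    obtain e where "e > 0" and e: "ball x e \<subseteq> \<gamma> x"
      using \<gamma> unfolding gauge_def by (meson openE)
    have "min d e > 0" using \<open>0 < d\<close> \<open>0 < e\<close> by simp
    then obtain s t where st: "a \<le> s" "s < t" "t \<le> b" "x = s \<or> x = t" "t - s < min d e"
      "\<bar>F t - F s - f x * (t - s)\<bar> > \<eta> * (t - s)" using x by blast
    have "{s..t} \<subseteq> ball x e" using st by (auto simp: dist_real_def)
    then have "(x, s, t) \<in> K" using st x e unfolding K_def by blast
    moreover have "x \<in> cball (c (x, s, t)) (r (x, s, t))" using st unfolding cball by auto
    moreover have "r (x, s, t) < d" using st by (simp add: r_def)
    ultimately show "\<exists>i. i \<in> K \<and> x \<in> cball (c i) (r i) \<and> r i < d" by blast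
  qed
  \<comment> \<open>Finite subfamilies suffice, because a countable union inherits a bound on the
    measures of its finite subunions.\<close>
  have bound: "measure lebesgue (\<Union>i\<in>C'. cball (c i) (r i)) \<le> \<epsilon>" if C': "C' \<subseteq> C" "finite C'" for C'
  proof -
    define ivl where "ivl = (\<lambda>(x::real, s::real, t::real). (x, {s..t}))"
    have ivl: "ivl i = (fst i, cball (c i) (r i))" for i
      by (cases i) (simp add: ivl_def cball)
    have inK: "i \<in> K" if "i \<in> C'" for i using that C' C by blast
    have ivlD: "\<exists>s t. (x, s, t) \<in> K \<and> k = {s..t}" if "(x, k) \<in> ivl ` C'" for x k
    proof -
      obtain i where i: "i \<in> C'" "(x, k) = ivl i" using \<open>(x, k) \<in> ivl ` C'\<close> by blast
      obtain x' s t where "i = (x', s, t)" by (metis prod_cases3)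
      then show ?thesis using i inK[OF i(1)] by (simp add: ivl_def) blast
    qed
    have inj: "inj_on ivl C'"
    proof (rule inj_onI)
      fix i j assume ij: "i \<in> C'" "j \<in> C'" "ivl i = ivl j"
      obtain x s t x' s' t' where "i = (x, s, t)" "j = (x', s', t')" by (metis prod_cases3)
      moreover have "s < t" using calculation inK[OF ij(1)] by (simp add: K_def)
      ultimately show "i = j" using ij(3) by (auto simp: ivl_def Icc_eq_Icc)
    qed
    have "(\<Sum>i\<in>C'. \<eta> * (2 * r i)) \<le> (\<Sum>i\<in>C'. norm (Sigma_Algebra.measure lborel (snd (ivl i)) *\<^sub>R f (fst (ivl i)) - integral (snd (ivl i)) f))"
    proof (rule sum_mono)
      fix i assume "i \<in> C'"
      then obtain x s t where i: "i = (x, s, t)" and "(x, s, t) \<in> K" using inK by (metis prod_cases3)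
      then have st: "a \<le> s" "s < t" "t \<le> b" "\<bar>F t - F s - f x * (t - s)\<bar> > \<eta> * (t - s)" by (auto simp: K_def)
      have "F s + integral {s..t} f = F t" unfolding F_def
        using st by (intro Henstock_Kurzweil_Integration.integral_combine integrable_subinterval_real[OF f]) auto
      then have "F t - F s = integral {s..t} f" by simp
      then show "\<eta> * (2 * r i) \<le> norm (Sigma_Algebra.measure lborel (snd (ivl i)) *\<^sub>R f (fst (ivl i)) - integral (snd (ivl i)) f)"
        using st by (simp add: i r_def ivl_def abs_minus_commute mult.commute right_diff_distrib)
    qed
    also have "\<dots> = (\<Sum>(x,k)\<in>ivl ` C'. norm (Sigma_Algebra.measure lborel k *\<^sub>R f x - integral k f))"
      by (simp add: sum.reindex[OF inj] case_prod_beta)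
    also have "\<dots> < \<eta> * \<epsilon>"
    proof (rule hen)
      show "ivl ` C' tagged_partial_division_of cbox a b"
        unfolding tagged_partial_division_of_def
      proof (intro conjI allI impI)
        show "finite (ivl ` C')" using C' by simp
        fix x k assume xk: "(x, k) \<in> ivl ` C'"
        then obtain s t where "(x, s, t) \<in> K" "k = {s..t}" using ivlD by blast
        then show "x \<in> k" "k \<subseteq> cbox a b" "\<exists>a b. k = cbox a b" by (auto simp: K_def)
      next
        fix x k y l assume "(x, k) \<in> ivl ` C' \<and> (y, l) \<in> ivl ` C' \<and> (x, k) \<noteq> (y, l)"
        then have xk: "(x, k) \<in> ivl ` C'" and yl: "(y, l) \<in> ivl ` C'" and ne: "(x, k) \<noteq> (y, l)" by auto
        obtain i j where ij: "i \<in> C'" "j \<in> C'" "(x, k) = ivl i" "(y, l) = ivl j" using xk yl by blast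
        then have "disjnt (cball (c i) (r i)) (cball (c j) (r j))" using pw ne C' unfolding pairwise_def by (metis subsetD)
        then have "k \<inter> l = {}" using ij by (simp add: ivl disjnt_def)
        then show "interior k \<inter> interior l = {}" using interior_subset by blast
      qed
      show "\<gamma> fine ivl ` C'"
      proof (rule fineI)
        fix x k assume "(x, k) \<in> ivl ` C'"
        then obtain s t where "(x, s, t) \<in> K" "k = {s..t}" using ivlD by blast
        then show "k \<subseteq> \<gamma> x" by (simp add: K_def)
      qed
    qed
    finally have "\<eta> * (\<Sum>i\<in>C'. 2 * r i) < \<eta> * \<epsilon>" by (simp add: sum_distrib_left)
    then have "(\<Sum>i\<in>C'. 2 * r i) < \<epsilon>" using \<open>\<eta> > 0\<close> by simp
    moreover have "measure lebesgue (\<Union>i\<in>C'. cball (c i) (r i)) \<le> (\<Sum>i\<in>C'. measure lebesgue (cball (c i) (r i)))"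
      using C' by (intro measure_UNION_le) auto
    moreover have "(\<Sum>i\<in>C'. measure lebesgue (cball (c i) (r i))) = (\<Sum>i\<in>C'. 2 * r i)"
    proof (rule sum.cong)
      fix i assume "i \<in> C'"
      then have "r i \<ge> 0" using inK[of i] by (cases i) (simp add: r_def K_def)
      then show "measure lebesgue (cball (c i) (r i)) = 2 * r i" by (simp add: cball_eq_atLeastAtMost)
    qed simp
    ultimately show ?thesis by simp
  qed
  have meas: "cball (c i) (r i) \<in> lmeasurable" for i by simp
  define T where "T = (\<Union>i\<in>C. cball (c i) (r i)) \<union> (?E - (\<Union>i \<in> C. cball (c i) (r i)))"
  have U: "(\<Union>i\<in>C. cball (c i) (r i)) \<in> lmeasurable" "measure lebesgue (\<Union>i\<in>C. cball (c i) (r i)) \<le> \<epsilon>"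
    using fmeasurable_UN_bound[OF C(1) meas bound] measure_UN_bound[OF C(1) meas bound] by auto
  show "\<exists>T. ?E \<subseteq> T \<and> T \<in> lmeasurable \<and> measure lebesgue T \<le> \<epsilon>"
  proof (intro exI[of _ T] conjI)
    show "?E \<subseteq> T" unfolding T_def by blast
    show "T \<in> lmeasurable" unfolding T_def by (intro fmeasurable.Un U negligible_imp_measurable neg)
    have "measure lebesgue T \<le> measure lebesgue (\<Union>i\<in>C. cball (c i) (r i)) + measure lebesgue (?E - (\<Union>i \<in> C. cball (c i) (r i)))"
      unfolding T_def by (intro measure_Un_le fmeasurableD U(1) negligible_imp_sets neg)
    then show "measure lebesgue T \<le> \<epsilon>" using U(2) negligible_imp_measure0[OF neg] by simp
  qed
qed

text \<open>The tolerances \<open>1 / (n + 1)\<close> get below every positive one, so the points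
  without the right derivative lie in a countable union of the null sets above.\<close>

theorem indefinite_integral_has_derivative_ae:
  fixes f :: "real \<Rightarrow> real"
  assumes f: "f integrable_on {a..b}"
  shows "\<exists>Z. negligible Z \<and> (\<forall>x\<in>{a<..<b} - Z. ((\<lambda>x. integral {a..x} f) has_real_derivative f x) (at x))"
proof -
  define F where "F = (\<lambda>x. integral {a..x} f)"
  define E where "E \<eta> = {x \<in> {a<..<b}. \<forall>d>0. \<exists>s t. a \<le> s \<and> s < t \<and> t \<le> b \<and> (x = s \<or> x = t) \<and> t - s < d \<and>
     \<bar>F t - F s - f x * (t - s)\<bar> > \<eta> * (t - s)}" for \<eta> :: real
  have "negligible (E \<eta>)" if "\<eta> > 0" for \<eta>
    using negligible_large_difference_quotients[OF f that] by (simp only: E_def F_def)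
  then have "negligible (\<Union>n::nat. E (inverse (real (Suc n))))"
    by (intro negligible_countable_Union) auto
  moreover have "(F has_real_derivative f x) (at x)"
    if x: "x \<in> {a<..<b}" "x \<notin> (\<Union>n::nat. E (inverse (real (Suc n))))" for x
    unfolding has_field_derivative_def has_derivative_within_alt
  proof (intro conjI allI impI)
    fix \<epsilon> :: real assume "\<epsilon> > 0"
    obtain n where n: "inverse (real (Suc n)) < \<epsilon>" using reals_Archimedean[OF \<open>\<epsilon> > 0\<close>] by auto
    have "x \<notin> E (inverse (real (Suc n)))" using x by blast
    then obtain d where "d > 0" and "\<not> (\<exists>s t. a \<le> s \<and> s < t \<and> t \<le> b \<and> (x = s \<or> x = t) \<and> t - s < d \<and>
      \<bar>F t - F s - f x * (t - s)\<bar> > inverse (real (Suc n)) * (t - s))"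
      using x(1) unfolding E_def by blast
    then have d: "\<bar>F t - F s - f x * (t - s)\<bar> \<le> inverse (real (Suc n)) * (t - s)"
      if "a \<le> s" "s < t" "t \<le> b" "x = s \<or> x = t" "t - s < d" for s t
      using that not_less by blast
    show "\<exists>d>0. \<forall>y\<in>UNIV. norm (y - x) < d \<longrightarrow> norm (F y - F x - f x * (y - x)) \<le> \<epsilon> * norm (y - x)"
    proof (intro exI[of _ "min d (min (x - a) (b - x))"] conjI ballI impI)
      show "0 < min d (min (x - a) (b - x))" using x \<open>d > 0\<close> by auto
      fix y assume y: "norm (y - x) < min d (min (x - a) (b - x))"
      have "norm (F y - F x - f x * (y - x)) \<le> inverse (real (Suc n)) * norm (y - x)"
      proof (cases x y rule: linorder_cases)
        case less
        then show ?thesis using d[of x y] x y by simp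
      next
        case greater
        then have "\<bar>F x - F y - f x * (x - y)\<bar> \<le> inverse (real (Suc n)) * (x - y)" using d[of y x] x y by simp
        moreover have "F x - F y - f x * (x - y) = - (F y - F x - f x * (y - x))" by (simp add: algebra_simps)
        ultimately show ?thesis using greater by simp
      qed simp
      also have "\<dots> \<le> \<epsilon> * norm (y - x)" using n by (intro mult_right_mono) auto
      finally show "norm (F y - F x - f x * (y - x)) \<le> \<epsilon> * norm (y - x)" .
    qed
  qed (rule bounded_linear_mult_right)
  ultimately show ?thesis unfolding F_def by blast
qed

text \<open>Cut the integrand at a height \<open>k\<close>. The excess \<open>g k\<close> has small
  integral by dominated convergence, and what remains is bounded and contributes at most a multiple
  of the total length.\<close>

lemma indefinite_integral_abs_continuous:
  fixes f :: "real \<Rightarrow> real"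
  assumes f: "f absolutely_integrable_on {a..b}"
  shows "abs_continuous_on_ivl a b (\<lambda>x. integral {a..x} f)"
  unfolding abs_continuous_on_ivl_iff
proof (intro allI impI)
  fix \<epsilon> :: real assume "\<epsilon> > 0"
  define g where "g k x = max (\<bar>f x\<bar> - real k) 0" for k :: nat and x
  have fi: "f integrable_on {a..b}" "(\<lambda>x. \<bar>f x\<bar>) integrable_on {a..b}"
    using f by (auto simp: absolutely_integrable_on_def)
  have meas: "f \<in> borel_measurable (lebesgue_on {a..b})"
    using f absolutely_integrable_measurable_real[of "{a..b}" f] by auto
  have gi: "g k absolutely_integrable_on {a..b}" for k
  proof (rule measurable_bounded_by_integrable_imp_absolutely_integrable[OF _ _ fi(2)])
    show "g k \<in> borel_measurable (lebesgue_on {a..b})" unfolding g_def using meas by measurable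
  qed (auto simp: g_def)
  have "(\<lambda>k. integral {a..b} (g k)) \<longlonglongrightarrow> integral {a..b} (\<lambda>x. 0)"
  proof (rule dominated_convergence(2)[OF _ fi(2)])
    show "g k integrable_on {a..b}" for k using gi by (rule set_lebesgue_integral_eq_integral(1))
    show "norm (g k x) \<le> \<bar>f x\<bar>" for k x by (auto simp: g_def)
    fix x
    obtain N where N: "\<bar>f x\<bar> \<le> real N" using real_arch_simple by blast
    have "g k x = 0" if "k \<ge> N" for k
      using N that by (simp add: g_def max_def)
    then show "(\<lambda>k. g k x) \<longlonglongrightarrow> 0" by (intro tendsto_eventually) (auto simp: eventually_sequentially)
  qed
  then have "eventually (\<lambda>k. integral {a..b} (g k) < \<epsilon> / 2) sequentially"
    using \<open>\<epsilon> > 0\<close> by (intro order_tendstoD(2)) auto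
  then obtain k where k: "integral {a..b} (g k) < \<epsilon> / 2"
    unfolding eventually_sequentially by blast
  show "\<exists>\<delta>>0. variation_small a b (\<lambda>x. integral {a..x} f) \<epsilon> \<delta>"
  \<comment> \<open>Half of \<epsilon> is reserved for the excess. Using \<open>real k + 1\<close>
    in place of \<open>k\<close> keeps the quotient meaningful when \<open>k = 0\<close>.\<close>
  proof (intro exI[of _ "\<epsilon> / (2 * (real k + 1))"] conjI variation_smallI)
    show "0 < \<epsilon> / (2 * (real k + 1))" using \<open>\<epsilon> > 0\<close> by simp
    fix K :: nat and s t
    assume st: "\<forall>i<K. a \<le> s i \<and> s i \<le> t i \<and> t i \<le> b"
      and disj: "\<forall>i<K. \<forall>j<K. i \<noteq> j \<longrightarrow> {s i<..<t i} \<inter> {s j<..<t j} = {}"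
      and len: "(\<Sum>i<K. t i - s i) < \<epsilon> / (2 * (real k + 1))"
    have sub: "{s i..t i} \<subseteq> {a..b}" if "i < K" for i using st that by auto
    have gsub: "g k absolutely_integrable_on {s i..t i}" if "i < K" for i
      using gi sub[OF that] by (rule absolutely_integrable_on_subinterval)
    have int: "((\<lambda>x. if x \<in> {s i<..<t i} then g k x else 0) has_integral integral {s i<..<t i} (g k)) {a..b}"
      if "i < K" for i
    proof -
      have "(g k has_integral integral {s i<..<t i} (g k)) {s i<..<t i}"
        using set_lebesgue_integral_eq_integral(1)[OF gsub[OF that]]
        by (intro integrable_integral) (simp add: integrable_on_open_interval_real)
      moreover have "{s i<..<t i} \<subseteq> {a..b}" using st that by auto
      ultimately show ?thesis by (subst has_integral_restrict) auto
    qed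
    have "(\<Sum>i<K. \<bar>integral {a..t i} f - integral {a..s i} f\<bar>) \<le> (\<Sum>i<K. integral {s i..t i} (g k) + (real k + 1) * (t i - s i))"
    proof (rule sum_mono)
      fix i assume "i \<in> {..<K}"
      then have i: "i < K" by simp
      have "integral {a..s i} f + integral {s i..t i} f = integral {a..t i} f"
        using st i by (intro Henstock_Kurzweil_Integration.integral_combine integrable_subinterval_real[OF fi(1)]) auto
      then have "\<bar>integral {a..t i} f - integral {a..s i} f\<bar> = norm (integral {s i..t i} f)" by simp
      also have "\<dots> \<le> integral {s i..t i} (\<lambda>x. g k x + (real k + 1))"
      proof (rule integral_norm_bound_integral)
        show "f integrable_on {s i..t i}" using fi(1) sub[OF i] by (rule integrable_subinterval_real)
        show "(\<lambda>x. g k x + (real k + 1)) integrable_on {s i..t i}"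
          using set_lebesgue_integral_eq_integral(1)[OF gsub[OF i]] by (intro integrable_add) auto
      qed (auto simp: g_def)
      also have "\<dots> = integral {s i..t i} (g k) + (real k + 1) * (t i - s i)"
        using set_lebesgue_integral_eq_integral(1)[OF gsub[OF i]] st i
        by (subst integral_add) auto
      finally show "\<bar>integral {a..t i} f - integral {a..s i} f\<bar> \<le> integral {s i..t i} (g k) + (real k + 1) * (t i - s i)" .
    qed
    also have "\<dots> = (\<Sum>i<K. integral {s i..t i} (g k)) + (real k + 1) * (\<Sum>i<K. t i - s i)"
      by (simp add: sum.distrib sum_distrib_left)
    also have "(\<Sum>i<K. integral {s i..t i} (g k)) = (\<Sum>i<K. integral {s i<..<t i} (g k))"
      by (simp add: integral_open_interval_real)
    also have "\<dots> = (\<Sum>i<K. integral {a..b} (\<lambda>x. if x \<in> {s i<..<t i} then g k x else 0))"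
      using int by (intro sum.cong integral_unique[symmetric]) auto
    also have "\<dots> = integral {a..b} (\<lambda>x. \<Sum>i<K. if x \<in> {s i<..<t i} then g k x else 0)"
      using int by (intro integral_sum[symmetric]) (auto intro: has_integral_integrable)
    \<comment> \<open>At each point at most one indicator is nonzero, since the open intervals are
      disjoint, and \<open>g k\<close> is nonnegative.\<close>
    also have "\<dots> \<le> integral {a..b} (g k)"
    proof (rule integral_le)
      show "(\<lambda>x. \<Sum>i<K. if x \<in> {s i<..<t i} then g k x else 0) integrable_on {a..b}"
        using int by (intro integrable_sum) (auto intro: has_integral_integrable)
      show "g k integrable_on {a..b}" using gi by (rule set_lebesgue_integral_eq_integral(1))
      fix x
      show "(\<Sum>i<K. if x \<in> {s i<..<t i} then g k x else 0) \<le> g k x"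
      proof (cases "\<exists>i<K. x \<in> {s i<..<t i}")
        case True
        then obtain i where i: "i < K" "x \<in> {s i<..<t i}" by blast
        have ne: "x \<notin> {s j<..<t j}" if "j < K" "j \<noteq> i" for j
          using disj[rule_format, OF i(1) that(1)] i(2) that(2) by blast
        have "(\<Sum>j<K. if x \<in> {s j<..<t j} then g k x else 0) = (\<Sum>j<K. if j = i then g k x else 0)"
          using i ne by (intro sum.cong refl if_cong) (auto simp del: greaterThanLessThan_iff)
        then show ?thesis using i by simp
      next
        case False
        then have "(\<Sum>i<K. if x \<in> {s i<..<t i} then g k x else 0) = 0" by (intro sum.neutral) auto
        then show ?thesis by (simp add: g_def)
      qed
    qed
    also have "\<dots> < \<epsilon> / 2" by (rule k)
    also have "(real k + 1) * (\<Sum>i<K. t i - s i) < \<epsilon> / 2"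
      using len by (simp add: field_simps add_nonneg_eq_0_iff)
    finally show "(\<Sum>i<K. \<bar>integral {a..t i} f - integral {a..s i} f\<bar>) < \<epsilon>" by simp
  qed
qed

section \<open>Locally absolutely continuous primitives on the half line\<close>

text \<open>\<open>g\<close> is only one representative of the derivative of \<open>f\<close>. The
  exceptional null set is quantified explicitly, so that several such facts are combined by a union
  of null sets; the derivative at 0 is one-sided, as in the notion of solution.\<close>

definition primitive_of :: "(real \<Rightarrow> real) \<Rightarrow> (real \<Rightarrow> real) \<Rightarrow> bool" where
  "primitive_of f g \<longleftrightarrow> locally_abs_continuous f \<and>
     (\<exists>Z. negligible Z \<and> (\<forall>y\<in>{0..} - Z. (f has_real_derivative g y) (at y within {0..})))"

lemma AE_lebesgue_on_iff_negligible:
  fixes S :: "real set"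
  assumes "S \<in> sets lebesgue"
  shows "(AE y in lebesgue_on S. P y) \<longleftrightarrow> (\<exists>Z. negligible Z \<and> (\<forall>y\<in>S - Z. P y))"
proof -
  have "(AE y in lebesgue_on S. P y) \<longleftrightarrow> (AE y in lebesgue. y \<in> S \<longrightarrow> P y)"
    using assms by (intro AE_restrict_space_iff) auto
  also have "\<dots> \<longleftrightarrow> (\<exists>Z. negligible Z \<and> (\<forall>y\<in>S - Z. P y))"
    unfolding eventually_ae_filter_negligible by blast
  finally show ?thesis .
qed

lemma primitive_of_iff:
  "primitive_of f g \<longleftrightarrow> locally_abs_continuous f \<and>
     (AE y in lebesgue_on {0..}. (f has_real_derivative g y) (at y within {0..}))"
  unfolding primitive_of_def by (subst AE_lebesgue_on_iff_negligible) auto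

lemma primitive_of_cong:
  assumes "primitive_of f g" "negligible Z" "\<And>y. y \<ge> 0 \<Longrightarrow> y \<notin> Z \<Longrightarrow> g y = g' y"
  shows "primitive_of f g'"
proof -
  obtain Z' where "negligible Z'" "\<forall>y\<in>{0..} - Z'. (f has_real_derivative g y) (at y within {0..})"
    and "locally_abs_continuous f" using assms(1) unfolding primitive_of_def by blast
  moreover have "negligible (Z \<union> Z')" using calculation assms(2) by (simp add: negligible_Un)
  ultimately show ?thesis using assms(3) unfolding primitive_of_def by (metis DiffD1 DiffD2 DiffI UnCI atLeast_iff)
qed

lemma primitive_of_eqI:
  assumes "primitive_of f g" "f = f'" "\<And>y. y \<ge> 0 \<Longrightarrow> g y = g' y"
  shows "primitive_of f' g'"
  using primitive_of_cong[OF assms(1), of "{}" g'] assms(2,3) by simp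

lemma primitive_of_const: "primitive_of (\<lambda>_. c) (\<lambda>_. 0)"
  unfolding primitive_of_def locally_abs_continuous_def
  by (intro conjI exI[of _ "{}"]) (auto intro!: abs_continuous_on_ivl_lipschitz[where B = 0] derivative_eq_intros)

lemma primitive_of_add:
  assumes "primitive_of f f'" "primitive_of g g'"
  shows "primitive_of (\<lambda>y. f y + g y) (\<lambda>y. f' y + g' y)"
proof -
  obtain Z where "negligible Z" and Z: "\<forall>y\<in>{0..} - Z. (f has_real_derivative f' y) (at y within {0..})"
    using assms unfolding primitive_of_def by blast
  obtain Z' where "negligible Z'" and Z': "\<forall>y\<in>{0..} - Z'. (g has_real_derivative g' y) (at y within {0..})"
    using assms unfolding primitive_of_def by blast
  have "locally_abs_continuous (\<lambda>y. f y + g y)"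
    unfolding locally_abs_continuous_def
  proof (intro allI impI)
    fix b :: real assume "b \<ge> 0"
    then have f: "abs_continuous_on_ivl 0 b f" and g: "abs_continuous_on_ivl 0 b g"
      using assms unfolding primitive_of_def locally_abs_continuous_def by blast+
    show "abs_continuous_on_ivl 0 b (\<lambda>y. f y + g y)"
    proof (rule abs_continuous_on_ivl_sum2[OF f g, where B = 1])
      fix s t
      have "\<bar>(f t - f s) + (g t - g s)\<bar> \<le> \<bar>f t - f s\<bar> + \<bar>g t - g s\<bar>" by (rule abs_triangle_ineq)
      then show "\<bar>f t + g t - (f s + g s)\<bar> \<le> 1 * \<bar>f t - f s\<bar> + 1 * \<bar>g t - g s\<bar>"
        by (simp add: algebra_simps)
    qed
  qed
  moreover have "negligible (Z \<union> Z')" using \<open>negligible Z\<close> \<open>negligible Z'\<close> by (rule negligible_Un)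
  moreover have "\<forall>y\<in>{0..} - (Z \<union> Z'). ((\<lambda>y. f y + g y) has_real_derivative f' y + g' y) (at y within {0..})"
    using Z Z' by (intro ballI DERIV_add) auto
  ultimately show ?thesis unfolding primitive_of_def by blast
qed

lemma primitive_of_mult:
  assumes "primitive_of f f'" "primitive_of g g'"
  shows "primitive_of (\<lambda>y. f y * g y) (\<lambda>y. f' y * g y + g' y * f y)"
proof -
  obtain Z where "negligible Z" and Z: "\<forall>y\<in>{0..} - Z. (f has_real_derivative f' y) (at y within {0..})"
    using assms unfolding primitive_of_def by blast
  obtain Z' where "negligible Z'" and Z': "\<forall>y\<in>{0..} - Z'. (g has_real_derivative g' y) (at y within {0..})"
    using assms unfolding primitive_of_def by blast
  have "locally_abs_continuous (\<lambda>y. f y * g y)"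
    using assms unfolding primitive_of_def locally_abs_continuous_def
    by (simp add: abs_continuous_on_ivl_mult)
  moreover have "negligible (Z \<union> Z')" using \<open>negligible Z\<close> \<open>negligible Z'\<close> by (rule negligible_Un)
  moreover have "\<forall>y\<in>{0..} - (Z \<union> Z'). ((\<lambda>y. f y * g y) has_real_derivative f' y * g y + g' y * f y) (at y within {0..})"
    using Z Z' by (intro ballI DERIV_mult) auto
  ultimately show ?thesis unfolding primitive_of_def by blast
qed

lemma primitive_of_cmult:
  assumes "primitive_of f f'"
  shows "primitive_of (\<lambda>y. c * f y) (\<lambda>y. c * f' y)"
  by (rule primitive_of_eqI[OF primitive_of_mult[OF primitive_of_const[of c] assms]]) auto

lemma primitive_of_sum:
  assumes "\<And>i. i \<in> I \<Longrightarrow> primitive_of (f i) (f' i)"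
  shows "primitive_of (\<lambda>y. \<Sum>i\<in>I. f i y) (\<lambda>y. \<Sum>i\<in>I. f' i y)"
  using assms
proof (induction I rule: infinite_finite_induct)
  case (insert i I)
  have "primitive_of (\<lambda>y. f i y + (\<Sum>i\<in>I. f i y)) (\<lambda>y. f' i y + (\<Sum>i\<in>I. f' i y))"
    using insert by (intro primitive_of_add) auto
  then show ?case using insert by (simp add: sum.insert)
qed (auto intro: primitive_of_const)

lemma primitive_of_exp: "primitive_of (\<lambda>y. exp (c * y)) (\<lambda>y. c * exp (c * y))"
proof -
  have der: "((\<lambda>y. exp (c * y)) has_real_derivative c * exp (c * y)) (at y within S)" for y S
    by (auto intro!: derivative_eq_intros)
  have "abs_continuous_on_ivl 0 b (\<lambda>y. exp (c * y))" for b
  proof (rule abs_continuous_on_ivl_lipschitz)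
    fix s t assume st: "0 \<le> s" "s \<le> t" "t \<le> b"
    have "norm (exp (c * t) - exp (c * s)) \<le> (\<bar>c\<bar> * exp (\<bar>c\<bar> * \<bar>b\<bar>)) * norm (t - s)"
    proof (rule field_differentiable_bound[where S = "{0..b}"])
      fix z assume z: "z \<in> {0..b}"
      show "((\<lambda>y. exp (c * y)) has_field_derivative c * exp (c * z)) (at z within {0..b})" by (rule der)
      have "c * z \<le> \<bar>c\<bar> * z" using z by (intro mult_right_mono) auto
      also have "\<dots> \<le> \<bar>c\<bar> * \<bar>b\<bar>" using z by (intro mult_left_mono) auto
      finally have "c * z \<le> \<bar>c\<bar> * \<bar>b\<bar>" .
      then show "norm (c * exp (c * z)) \<le> \<bar>c\<bar> * exp (\<bar>c\<bar> * \<bar>b\<bar>)" by (simp add: abs_mult mult_left_mono)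
    qed (use st in auto)
    then show "\<bar>exp (c * t) - exp (c * s)\<bar> \<le> \<bar>c\<bar> * exp (\<bar>c\<bar> * \<bar>b\<bar>) * (t - s)" using st by simp
  qed
  then show ?thesis unfolding primitive_of_def locally_abs_continuous_def using der by blast
qed

text \<open>The differentiation theorem concerns interior points of bounded intervals: the null sets
  for \<open>{0..n}\<close> are united over all \<open>n\<close>, and the end point 0 is
  added.\<close>

lemma primitive_of_integral:
  assumes g: "\<And>b. g absolutely_integrable_on {0..b}"
  shows "primitive_of (\<lambda>y. integral {0..y} g) g"
proof -
  have "\<forall>n::nat. \<exists>Z. negligible Z \<and> (\<forall>x\<in>{0<..<real n} - Z. ((\<lambda>x. integral {0..x} g) has_real_derivative g x) (at x))"
    by (intro allI indefinite_integral_has_derivative_ae set_lebesgue_integral_eq_integral(1)[OF g])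
  from choice[OF this] obtain Z where Z: "\<forall>n. negligible (Z n) \<and>
    (\<forall>x\<in>{0<..<real n} - Z n. ((\<lambda>x. integral {0..x} g) has_real_derivative g x) (at x))" ..
  have Z1: "negligible (Z n)" for n using Z[THEN spec, of n] by (rule conjunct1)
  have Z2: "((\<lambda>x. integral {0..x} g) has_real_derivative g x) (at x)" if "x \<in> {0<..<real n} - Z n" for n x
    using Z[THEN spec, of n, THEN conjunct2] that by (rule bspec)
  have "negligible (\<Union>(range Z))"
    by (rule negligible_countable_Union) (auto simp: Z1)
  then have neg: "negligible ({0} \<union> \<Union>(range Z))"
    by (intro negligible_Un negligible_sing)
  have der: "((\<lambda>x. integral {0..x} g) has_real_derivative g y) (at y within {0..})"
    if y: "y \<in> {0..} - ({0} \<union> \<Union>(range Z))" for y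
  proof -
    obtain n where "y < real n" using reals_Archimedean2[of y] ..
    then have "y \<in> {0<..<real n} - Z n" using y by auto
    then show ?thesis by (rule has_field_derivative_at_within[OF Z2])
  qed
  show ?thesis
    unfolding primitive_of_def locally_abs_continuous_def
    by (intro conjI allI impI exI[of _ "{0} \<union> \<Union>(range Z)"] ballI indefinite_integral_abs_continuous[OF g] neg der)
qed

lemma abs_continuous_on_ivl_subset:
  assumes f: "abs_continuous_on_ivl a b f" and ab: "a \<le> a'" "b' \<le> b"
  shows "abs_continuous_on_ivl a' b' f"
  unfolding abs_continuous_on_ivl_iff
proof (intro allI impI)
  fix \<epsilon> :: real assume "\<epsilon> > 0"
  then obtain \<delta> where "\<delta> > 0" and \<delta>: "variation_small a b f \<epsilon> \<delta>"
    using f unfolding abs_continuous_on_ivl_iff by blast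
  have "variation_small a' b' f \<epsilon> \<delta>"
  proof (rule variation_smallI)
    fix k :: nat and s t
    assume st: "\<forall>i<k. a' \<le> s i \<and> s i \<le> t i \<and> t i \<le> b'"
    have "\<forall>i<k. a \<le> s i \<and> s i \<le> t i \<and> t i \<le> b" using st ab by fastforce
    moreover assume "\<forall>i<k. \<forall>j<k. i \<noteq> j \<longrightarrow> {s i<..<t i} \<inter> {s j<..<t j} = {}"
      and "(\<Sum>i<k. t i - s i) < \<delta>"
    ultimately show "(\<Sum>i<k. \<bar>f (t i) - f (s i)\<bar>) < \<epsilon>" by (rule variation_smallD[OF \<delta>])
  qed
  then show "\<exists>\<delta>>0. variation_small a' b' f \<epsilon> \<delta>" using \<open>\<delta> > 0\<close> by blast
qed

lemma primitive_of_nonpos_imp_antimono: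
  assumes f: "primitive_of f g" and Z: "negligible Z" and g: "\<And>y. y \<ge> 0 \<Longrightarrow> y \<notin> Z \<Longrightarrow> g y \<le> 0"
    and xy: "0 \<le> x" "x \<le> y"
  shows "f y \<le> f x"
proof -
  obtain Z' where Z': "negligible Z'" "\<forall>y\<in>{0..} - Z'. (f has_real_derivative g y) (at y within {0..})"
    using f unfolding primitive_of_def by blast
  have "(\<lambda>y. - f y) x \<le> (\<lambda>y. - f y) y"
  proof (rule abs_continuous_nonneg_derivative_imp_le[OF _ xy(2)])
    have "abs_continuous_on_ivl 0 y f"
      using f xy unfolding primitive_of_def locally_abs_continuous_def by simp
    then have f': "abs_continuous_on_ivl x y f"
      by (rule abs_continuous_on_ivl_subset) (use xy in auto)
    show "abs_continuous_on_ivl x y (\<lambda>y. - f y)"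
      by (rule abs_continuous_on_ivl_sum2[OF f' f', where B = 1]) (simp add: abs_minus_commute)
    show "negligible (Z \<union> Z')" using Z Z'(1) by (rule negligible_Un)
    fix t assume t: "t \<in> {x..y} - (Z \<union> Z')"
    then have "(f has_real_derivative g t) (at t within {x..y})"
      using Z'(2) xy by (auto intro!: DERIV_subset[of f _ t "{0..}" "{x..y}"])
    then show "\<exists>D\<ge>0. ((\<lambda>y. - f y) has_real_derivative D) (at t within {x..y})"
      using g[of t] t xy by (intro exI[of _ "- g t"]) (auto intro!: DERIV_minus)
  qed
  then show ?thesis by simp
qed

lemma primitive_of_zero_imp_const:
  assumes f: "primitive_of f g" and Z: "negligible Z" and g: "\<And>y. y \<ge> 0 \<Longrightarrow> y \<notin> Z \<Longrightarrow> g y = 0"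
    and y: "0 \<le> y"
  shows "f y = f 0"
proof -
  have "f y \<le> f 0" using primitive_of_nonpos_imp_antimono[OF f Z _ order_refl y] g by simp
  moreover have "- 1 * f y \<le> - 1 * f 0"
    using primitive_of_nonpos_imp_antimono[OF primitive_of_cmult[OF f, of "-1"] Z _ order_refl y] g by simp
  ultimately show ?thesis by simp
qed

section \<open>Weighted square integrable functions\<close>

definition wL2 :: "real \<Rightarrow> (real \<Rightarrow> real) \<Rightarrow> bool" where
  "wL2 a g \<longleftrightarrow> g \<in> borel_measurable (lebesgue_on {0..}) \<and>
     integrable (lebesgue_on {0..}) (\<lambda>y. exp (2 * a * y) * (g y)\<^sup>2)"

text \<open>The square of the norm rather than the norm: squares add over the components of a
  vector, and two-term bounds with a factor 2 can replace the triangle inequality.\<close>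

definition wsq :: "real \<Rightarrow> (real \<Rightarrow> real) \<Rightarrow> real" where
  "wsq a g = (LINT y|lebesgue_on {0..}. exp (2 * a * y) * (g y)\<^sup>2)"

lemma continuous_measurable_half_line: "continuous_on UNIV k \<Longrightarrow> k \<in> borel_measurable (lebesgue_on {0::real..})"
  using continuous_on_subset[of UNIV k "{0..}"] continuous_imp_measurable_on_sets_lebesgue[of "{0..}" k] by simp

lemma measurable_exp_linear [measurable]: "(\<lambda>y. exp (c * y)) \<in> borel_measurable (lebesgue_on {0::real..})" for c :: real
  by (intro continuous_measurable_half_line continuous_intros)

lemma wsq_nonneg: "wsq a g \<ge> 0"
  unfolding wsq_def by (intro integral_nonneg_AE) simp

lemma wL2_dominated:
  assumes "g \<in> borel_measurable (lebesgue_on {0..})" and F: "integrable (lebesgue_on {0..}) F"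
    and le: "\<And>y. y \<ge> 0 \<Longrightarrow> exp (2 * a * y) * (g y)\<^sup>2 \<le> F y"
  shows "wL2 a g" "wsq a g \<le> (LINT y|lebesgue_on {0..}. F y)"
proof -
  have [measurable]: "g \<in> borel_measurable (lebesgue_on {0..})" by fact
  have int: "integrable (lebesgue_on {0..}) (\<lambda>y. exp (2 * a * y) * (g y)\<^sup>2)"
  proof (rule Bochner_Integration.integrable_bound[OF F])
    show "(\<lambda>y. exp (2 * a * y) * (g y)\<^sup>2) \<in> borel_measurable (lebesgue_on {0..})" by measurable
    show "AE y in lebesgue_on {0..}. norm (exp (2 * a * y) * (g y)\<^sup>2) \<le> norm (F y)"
    proof (rule AE_I2)
      fix y assume "y \<in> space (lebesgue_on {0::real..})"
      then have "y \<ge> 0" by simp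
      moreover have "norm (exp (2 * a * y) * (g y)\<^sup>2) = exp (2 * a * y) * (g y)\<^sup>2" by (simp add: abs_mult)
      ultimately show "norm (exp (2 * a * y) * (g y)\<^sup>2) \<le> norm (F y)" using le[of y] by simp
    qed
  qed
  then show "wL2 a g" using assms(1) unfolding wL2_def by simp
  show "wsq a g \<le> (LINT y|lebesgue_on {0..}. F y)"
    unfolding wsq_def using int F le by (intro integral_mono) auto
qed

lemma wL2_cmult:
  assumes "wL2 a g" shows "wL2 a (\<lambda>y. c * g y)" "wsq a (\<lambda>y. c * g y) = c\<^sup>2 * wsq a g"
proof -
  have eq: "exp (2 * a * y) * (c * g y)\<^sup>2 = c\<^sup>2 * (exp (2 * a * y) * (g y)\<^sup>2)" for y
    by (simp add: power_mult_distrib)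
  have [measurable]: "g \<in> borel_measurable (lebesgue_on {0..})" using assms by (simp add: wL2_def)
  have "(\<lambda>y. c * g y) \<in> borel_measurable (lebesgue_on {0..})" by measurable
  then show "wL2 a (\<lambda>y. c * g y)" using assms unfolding wL2_def eq by simp
  show "wsq a (\<lambda>y. c * g y) = c\<^sup>2 * wsq a g" unfolding wsq_def eq by simp
qed

lemma wL2_zero: "wL2 a (\<lambda>_. 0)" "wsq a (\<lambda>_. 0) = 0"
  by (simp_all add: wL2_def wsq_def)

lemma wL2_add:
  assumes "wL2 a f" "wL2 a g"
  shows "wL2 a (\<lambda>y. f y + g y)" "wsq a (\<lambda>y. f y + g y) \<le> 2 * wsq a f + 2 * wsq a g"
proof -
  have [measurable]: "f \<in> borel_measurable (lebesgue_on {0..})" "g \<in> borel_measurable (lebesgue_on {0..})"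
    and int: "integrable (lebesgue_on {0..}) (\<lambda>y. exp (2 * a * y) * (f y)\<^sup>2)"
    "integrable (lebesgue_on {0..}) (\<lambda>y. exp (2 * a * y) * (g y)\<^sup>2)"
    using assms by (simp_all add: wL2_def)
  let ?F = "\<lambda>y. 2 * (exp (2 * a * y) * (f y)\<^sup>2) + 2 * (exp (2 * a * y) * (g y)\<^sup>2)"
  have m: "(\<lambda>y. f y + g y) \<in> borel_measurable (lebesgue_on {0..})" by measurable
  have F: "integrable (lebesgue_on {0..}) ?F" using int by simp
  have le: "exp (2 * a * y) * (f y + g y)\<^sup>2 \<le> ?F y" for y
  proof -
    have "(f y + g y)\<^sup>2 \<le> 2 * (f y)\<^sup>2 + 2 * (g y)\<^sup>2" using sum_squares_bound[of "f y" "g y"] by (simp add: power2_sum)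
    then have "exp (2 * a * y) * (f y + g y)\<^sup>2 \<le> exp (2 * a * y) * (2 * (f y)\<^sup>2 + 2 * (g y)\<^sup>2)"
      by (intro mult_left_mono) simp_all
    then show ?thesis by (simp add: algebra_simps)
  qed
  show "wL2 a (\<lambda>y. f y + g y)" by (rule wL2_dominated(1)[OF m F le])
  have "wsq a (\<lambda>y. f y + g y) \<le> (LINT y|lebesgue_on {0..}. ?F y)" by (rule wL2_dominated(2)[OF m F le])
  also have "\<dots> = 2 * wsq a f + 2 * wsq a g" unfolding wsq_def using int by simp
  finally show "wsq a (\<lambda>y. f y + g y) \<le> 2 * wsq a f + 2 * wsq a g" .
qed

text \<open>The power of 2 comes from iterating the two-term bound; what matters is that it depends
  on the number of terms only.\<close>

lemma wL2_sum:
  assumes "finite I" "\<And>i. i \<in> I \<Longrightarrow> wL2 a (f i)"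
  shows "wL2 a (\<lambda>y. \<Sum>i\<in>I. f i y)" "wsq a (\<lambda>y. \<Sum>i\<in>I. f i y) \<le> 2 ^ card I * (\<Sum>i\<in>I. wsq a (f i))"
proof -
  have "wL2 a (\<lambda>y. \<Sum>i\<in>I. f i y) \<and> wsq a (\<lambda>y. \<Sum>i\<in>I. f i y) \<le> 2 ^ card I * (\<Sum>i\<in>I. wsq a (f i))"
    using assms
  proof (induction I rule: finite_induct)
    case empty
    then show ?case by (simp add: wL2_zero)
  next
    case (insert i I)
    then have IH: "wL2 a (\<lambda>y. \<Sum>i\<in>I. f i y)" "wsq a (\<lambda>y. \<Sum>i\<in>I. f i y) \<le> 2 ^ card I * (\<Sum>i\<in>I. wsq a (f i))"
      and i: "wL2 a (f i)" by auto
    have "wsq a (\<lambda>y. f i y + (\<Sum>i\<in>I. f i y)) \<le> 2 * wsq a (f i) + 2 * wsq a (\<lambda>y. \<Sum>i\<in>I. f i y)"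
      by (rule wL2_add(2)[OF i IH(1)])
    also have "\<dots> \<le> 2 * (2 ^ card I * wsq a (f i)) + 2 * (2 ^ card I * (\<Sum>i\<in>I. wsq a (f i)))"
    proof -
      have "1 * wsq a (f i) \<le> 2 ^ card I * wsq a (f i)" by (intro mult_right_mono wsq_nonneg) simp
      then show ?thesis using IH(2) by simp
    qed
    also have "\<dots> = 2 ^ card (insert i I) * (\<Sum>i\<in>insert i I. wsq a (f i))"
      using insert.hyps by (simp add: algebra_simps)
    finally show ?case using wL2_add(1)[OF i IH(1)] insert.hyps by simp
  qed
  then show "wL2 a (\<lambda>y. \<Sum>i\<in>I. f i y)" "wsq a (\<lambda>y. \<Sum>i\<in>I. f i y) \<le> 2 ^ card I * (\<Sum>i\<in>I. wsq a (f i))"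
    by simp_all
qed

lemma wL2_diff:
  assumes "wL2 a f" "wL2 a g"
  shows "wL2 a (\<lambda>y. f y - g y)"
proof -
  have "wL2 a (\<lambda>y. f y + (- 1) * g y)" by (rule wL2_add(1)[OF assms(1) wL2_cmult(1)[OF assms(2)]])
  then show ?thesis by simp
qed

text \<open>Passage from the Lebesgue integral of the definition to the gauge integral, in which the
  calculus on bounded intervals is done.\<close>

lemma wL2_integral:
  assumes "wL2 a g"
  shows "(\<lambda>y. exp (2 * a * y) * (g y)\<^sup>2) integrable_on {0..}"
    "wsq a g = integral {0..} (\<lambda>y. exp (2 * a * y) * (g y)\<^sup>2)"
    "(\<lambda>y. exp (2 * a * y) * (g y)\<^sup>2) integrable_on {0..b}"
    "integral {0..b} (\<lambda>y. exp (2 * a * y) * (g y)\<^sup>2) \<le> wsq a g"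
proof -
  have int: "integrable (lebesgue_on {0..}) (\<lambda>y. exp (2 * a * y) * (g y)\<^sup>2)" using assms by (simp add: wL2_def)
  show 1: "(\<lambda>y. exp (2 * a * y) * (g y)\<^sup>2) integrable_on {0..}"
    using integrable_on_lebesgue_on[OF int] by simp
  show 2: "wsq a g = integral {0..} (\<lambda>y. exp (2 * a * y) * (g y)\<^sup>2)"
    unfolding wsq_def using lebesgue_integral_eq_integral[OF int] by simp
  show 3: "(\<lambda>y. exp (2 * a * y) * (g y)\<^sup>2) integrable_on {0..b}"
  proof -
    have "(\<lambda>y. exp (2 * a * y) * (g y)\<^sup>2) absolutely_integrable_on {0..}"
      using 1 by (intro nonnegative_absolutely_integrable_1) simp_all
    then show ?thesis
      by (rule set_lebesgue_integral_eq_integral(1)[OF absolutely_integrable_on_subinterval]) auto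
  qed
  show "integral {0..b} (\<lambda>y. exp (2 * a * y) * (g y)\<^sup>2) \<le> wsq a g"
    unfolding 2 by (rule integral_subset_le[OF _ 3 1]) simp_all
qed

text \<open>Energy estimates bound the integrals over \<open>{0..b}\<close> uniformly in
  \<open>b\<close>; monotone convergence of the truncations carries the bound over to the half
  line.\<close>

lemma wL2_bounded_partial_integrals:
  assumes m: "w \<in> borel_measurable (lebesgue_on {0..})"
    and int: "\<And>b. (\<lambda>y. exp (2 * a * y) * (w y)\<^sup>2) integrable_on {0..b}"
    and B: "\<And>b. b \<ge> 0 \<Longrightarrow> integral {0..b} (\<lambda>y. exp (2 * a * y) * (w y)\<^sup>2) \<le> B"
  shows "wL2 a w" "wsq a w \<le> B"
proof -
  define F where "F = (\<lambda>y. exp (2 * a * y) * (w y)\<^sup>2)"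
  define f where "f = (\<lambda>(k::nat) y. if y \<in> {0..real k} then F y else 0)"
  have F0: "F y \<ge> 0" for y by (simp add: F_def)
  have hf: "(f k has_integral integral {0..real k} F) {0..}" for k
  proof -
    have "(F has_integral integral {0..real k} F) {0..real k}"
      using int[of "real k"] unfolding F_def by (rule integrable_integral)
    then show ?thesis unfolding f_def by (subst has_integral_restrict) auto
  qed
  have fB: "integral {0..} (f k) \<le> B" for k
    using integral_unique[OF hf[of k]] B[of "real k"] unfolding F_def by simp
  have lim: "(\<lambda>k. f k y) \<longlonglongrightarrow> F y" if "y \<in> {0..}" for y
  proof -
    obtain n :: nat where "y \<le> real n" using real_arch_simple[of y] ..
    then have "f k y = F y" if "k \<ge> n" for k using that \<open>y \<in> {0..}\<close> by (simp add: f_def)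
    then show ?thesis by (intro tendsto_eventually) (simp only: eventually_sequentially, blast)
  qed
  have mono: "f k y \<le> f (Suc k) y" for k y using F0[of y] by (simp add: f_def)
  have bdd: "bounded (range (\<lambda>k. integral {0..} (f k)))"
  proof (rule boundedI)
    fix x assume "x \<in> range (\<lambda>k. integral {0..} (f k))"
    then obtain k where "x = integral {0..} (f k)" by blast
    moreover have "0 \<le> integral {0..} (f k)"
      using hf[of k] F0 by (intro integral_nonneg has_integral_integrable[OF hf]) (simp add: f_def)
    ultimately show "norm x \<le> B" using fB[of k] by simp
  qed
  have MC: "F integrable_on {0..} \<and> (\<lambda>k. integral {0..} (f k)) \<longlonglongrightarrow> integral {0..} F"
    by (rule monotone_convergence_increasing[OF has_integral_integrable[OF hf] mono lim bdd])
  then have F: "F absolutely_integrable_on {0..}"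
    using F0 by (intro nonnegative_absolutely_integrable_1) simp_all
  have F': "integrable (lebesgue_on {0..}) F" using F by (simp add: absolutely_integrable_measurable set_integrable_def integrable_restrict_space)
  then show "wL2 a w" using m unfolding wL2_def F_def by simp
  have "wsq a w = integral {0..} F" using wL2_integral(2)[OF \<open>wL2 a w\<close>] unfolding F_def .
  moreover have "integral {0..} F \<le> B"
    using MC fB by (intro LIMSEQ_le_const2[of "\<lambda>k. integral {0..} (f k)"]) auto
  ultimately show "wsq a w \<le> B" by simp
qed

text \<open>Young's inequality with the weight split between the factors:
  \<open>|k g| \<le> k^2 exp (- 2 a y) + exp (2 a y) g^2\<close>, and on a bounded interval both
  terms are integrable.\<close>

lemma wL2_mult_continuous_integrable:
  assumes g: "wL2 a g" and k: "continuous_on UNIV k"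
  shows "(\<lambda>y. k y * g y) absolutely_integrable_on {0..b}"
proof -
  have k': "continuous_on S k" for S using k continuous_on_subset by blast
  have mg: "g \<in> borel_measurable (lebesgue_on {0..b})"
  proof -
    have "g \<in> borel_measurable (lebesgue_on {0..})" using g by (simp add: wL2_def)
    then show ?thesis by (rule measurable_restrict_mono) auto
  qed
  have mk: "k \<in> borel_measurable (lebesgue_on {0..b})"
    by (rule continuous_imp_measurable_on_sets_lebesgue[OF k']) simp
  show ?thesis
  proof (rule measurable_bounded_by_integrable_imp_absolutely_integrable)
    show "(\<lambda>y. k y * g y) \<in> borel_measurable (lebesgue_on {0..b})" using mk mg by (rule borel_measurable_times)
    show "{0..b} \<in> sets lebesgue" by simp
    show "(\<lambda>y. (k y)\<^sup>2 * exp (- 2 * a * y) + exp (2 * a * y) * (g y)\<^sup>2) integrable_on {0..b}"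
      by (intro integrable_add wL2_integral(3)[OF g] integrable_continuous_interval continuous_intros k')
    fix y
    have "2 * (\<bar>k y\<bar> * exp (- a * y)) * (exp (a * y) * \<bar>g y\<bar>) \<le> (\<bar>k y\<bar> * exp (- a * y))\<^sup>2 + (exp (a * y) * \<bar>g y\<bar>)\<^sup>2"
      by (rule sum_squares_bound)
    moreover have "(\<bar>k y\<bar> * exp (- a * y)) * (exp (a * y) * \<bar>g y\<bar>) = \<bar>k y\<bar> * \<bar>g y\<bar>"
      by (simp add: exp_minus field_simps)
    moreover have "(\<bar>k y\<bar> * exp (- a * y))\<^sup>2 = (k y)\<^sup>2 * exp (- 2 * a * y)" "(exp (a * y) * \<bar>g y\<bar>)\<^sup>2 = exp (2 * a * y) * (g y)\<^sup>2"
      by (simp_all add: power_mult_distrib exp_double[symmetric] mult.assoc)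
    moreover have "0 \<le> \<bar>k y\<bar> * \<bar>g y\<bar>" by simp
    ultimately have "\<bar>k y\<bar> * \<bar>g y\<bar> \<le> (k y)\<^sup>2 * exp (- 2 * a * y) + exp (2 * a * y) * (g y)\<^sup>2" by linarith
    then show "norm (k y * g y) \<le> (k y)\<^sup>2 * exp (- 2 * a * y) + exp (2 * a * y) * (g y)\<^sup>2" by (simp add: abs_mult)
  qed
qed

section \<open>Scalar equations on the half line\<close>

lemma primitive_of_continuous:
  assumes "primitive_of f g"
  shows "continuous_on {0..} f"
  unfolding continuous_on_iff
proof (intro ballI allI impI)
  fix x e :: real assume x: "x \<in> {0..}" and e: "0 < e"
  have "abs_continuous_on_ivl 0 (x + 1) f"
    using assms x unfolding primitive_of_def locally_abs_continuous_def by simp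
  then have "continuous_on {0..x + 1} f" by (rule abs_continuous_on_ivl_continuous)
  moreover have "x \<in> {0..x + 1}" using x by simp
  ultimately obtain d where d: "d > 0" "\<forall>x'\<in>{0..x + 1}. dist x' x < d \<longrightarrow> dist (f x') (f x) < e"
    using e unfolding continuous_on_iff by blast
  show "\<exists>d>0. \<forall>x'\<in>{0..}. dist x' x < d \<longrightarrow> dist (f x') (f x) < e"
  proof (intro exI[of _ "min d 1"] conjI ballI impI)
    show "0 < min d 1" using d by simp
    fix x' assume "x' \<in> {0..}" "dist x' x < min d 1"
    then have "x' \<in> {0..x + 1}" "dist x' x < d" by (auto simp: dist_real_def)
    then show "dist (f x') (f x) < e" using d(2) by blast
  qed
qed

lemma primitive_of_measurable:
  "primitive_of f g \<Longrightarrow> f \<in> borel_measurable (lebesgue_on {0..})"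
  by (rule continuous_imp_measurable_on_sets_lebesgue[OF primitive_of_continuous]) simp_all

text \<open>Variation of constants.\<close>

lemma primitive_of_exponential_solution:
  fixes \<kappa> \<theta> :: real
  assumes \<phi>: "wL2 a \<phi>"
  defines "w \<equiv> (\<lambda>y. exp (- \<kappa> * y) * (\<theta> + integral {0..y} (\<lambda>s. exp (\<kappa> * s) * \<phi> s)))"
  shows "primitive_of w (\<lambda>y. \<phi> y - \<kappa> * w y)" "w 0 = \<theta>"
proof -
  have "primitive_of (\<lambda>y. integral {0..y} (\<lambda>s. exp (\<kappa> * s) * \<phi> s)) (\<lambda>s. exp (\<kappa> * s) * \<phi> s)"
    by (intro primitive_of_integral wL2_mult_continuous_integrable[OF \<phi>] continuous_intros)
  from primitive_of_mult[OF primitive_of_exp[of "- \<kappa>"] primitive_of_add[OF primitive_of_const[of \<theta>] this]]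
  show "primitive_of w (\<lambda>y. \<phi> y - \<kappa> * w y)"
  proof (rule primitive_of_eqI)
    show "(\<lambda>y. exp (- \<kappa> * y) * (\<theta> + integral {0..y} (\<lambda>s. exp (\<kappa> * s) * \<phi> s))) = w" by (simp add: w_def)
    fix y :: real
    have "exp (\<kappa> * y) * \<phi> y * exp (- \<kappa> * y) = \<phi> y" by (simp add: exp_minus field_simps)
    then show "- \<kappa> * exp (- \<kappa> * y) * (\<theta> + integral {0..y} (\<lambda>s. exp (\<kappa> * s) * \<phi> s)) +
        (0 + exp (\<kappa> * y) * \<phi> y) * exp (- \<kappa> * y) = \<phi> y - \<kappa> * w y"
      by (simp add: w_def mult.assoc)
  qed
  show "w 0 = \<theta>" by (simp add: w_def)
qed

text \<open>With \<open>v = e\<^sup>a\<^sup>y w\<close> and \<open>c = \<kappa> - a\<close> one has \<open>v' = e\<^sup>a\<^sup>y \<phi> - c v\<close>, and completing the square shows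
  that \<open>sgn c v\<^sup>2 + \<bar>c\<bar> \<integral> v\<^sup>2 - \<integral> (e\<^sup>a\<^sup>y \<phi>)\<^sup>2 / \<bar>c\<bar>\<close> decreases.\<close>

lemma weighted_energy_inequality:
  assumes w: "primitive_of w (\<lambda>y. \<phi> y - \<kappa> * w y)" and \<phi>: "wL2 a \<phi>" and c: "\<kappa> \<noteq> a" and b: "b \<ge> 0"
  shows "(\<lambda>y. exp (2 * a * y) * (w y)\<^sup>2) integrable_on {0..b}"
    and "\<bar>\<kappa> - a\<bar> * integral {0..b} (\<lambda>y. exp (2 * a * y) * (w y)\<^sup>2)
      \<le> sgn (\<kappa> - a) * ((w 0)\<^sup>2 - exp (2 * a * b) * (w b)\<^sup>2) + wsq a \<phi> / \<bar>\<kappa> - a\<bar>"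
proof -
  define c where "c = \<kappa> - a"
  define W where "W = (\<lambda>y. exp (2 * a * y) * (w y)\<^sup>2)"
  define G where "G = (\<lambda>y. exp (2 * a * y) * (\<phi> y)\<^sup>2)"
  have c0: "\<bar>c\<bar> > 0" using c by (simp add: c_def)
  have "continuous_on {0..b'} w" for b'
    using primitive_of_continuous[OF w] by (rule continuous_on_subset) auto
  then have Wc: "continuous_on {0..b'} W" for b'
    unfolding W_def by (intro continuous_intros) simp_all
  then show "(\<lambda>y. exp (2 * a * y) * (w y)\<^sup>2) integrable_on {0..b}"
    unfolding W_def[symmetric] by (rule integrable_continuous_interval)
  have pW: "primitive_of (\<lambda>y. integral {0..y} W) W"
    by (intro primitive_of_integral absolutely_integrable_continuous_real Wc)
  have pG: "primitive_of (\<lambda>y. integral {0..y} G) G"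
    unfolding G_def by (intro primitive_of_integral nonnegative_absolutely_integrable_1 wL2_integral(3)[OF \<phi>]) simp_all
  have "primitive_of W (\<lambda>y. 2 * a * exp (2 * a * y) * (w y * w y) +
      ((\<phi> y - \<kappa> * w y) * w y + (\<phi> y - \<kappa> * w y) * w y) * exp (2 * a * y))"
    using primitive_of_mult[OF primitive_of_exp[of "2 * a"] primitive_of_mult[OF w w]]
    unfolding W_def power2_eq_square .
  note p = primitive_of_add[OF primitive_of_add[OF primitive_of_cmult[OF this, of "sgn c"] primitive_of_cmult[OF pW, of "\<bar>c\<bar>"]]
      primitive_of_cmult[OF pG, of "- 1 / \<bar>c\<bar>"]]
  have "sgn c * W b + \<bar>c\<bar> * integral {0..b} W + - 1 / \<bar>c\<bar> * integral {0..b} G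
     \<le> sgn c * W 0 + \<bar>c\<bar> * integral {0..0} W + - 1 / \<bar>c\<bar> * integral {0..0} G"
  proof (rule primitive_of_nonpos_imp_antimono[OF p negligible_empty _ order_refl b])
    fix y
    have s: "sgn c * c = \<bar>c\<bar>" "sgn c * sgn c = 1" using c0 by (simp_all add: sgn_if)
    have "sgn c * (2 * a * exp (2 * a * y) * (w y * w y) +
        ((\<phi> y - \<kappa> * w y) * w y + (\<phi> y - \<kappa> * w y) * w y) * exp (2 * a * y)) + \<bar>c\<bar> * W y + - 1 / \<bar>c\<bar> * G y
      = exp (2 * a * y) * (2 * sgn c * w y * \<phi> y - 2 * (sgn c * c) * (w y)\<^sup>2 + \<bar>c\<bar> * (w y)\<^sup>2 - (\<phi> y)\<^sup>2 / \<bar>c\<bar>)"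
      unfolding W_def G_def c_def[of] by (simp add: algebra_simps power2_eq_square)
    also have "2 * sgn c * w y * \<phi> y - 2 * (sgn c * c) * (w y)\<^sup>2 + \<bar>c\<bar> * (w y)\<^sup>2 - (\<phi> y)\<^sup>2 / \<bar>c\<bar>
      = - ((\<bar>c\<bar> * w y - sgn c * \<phi> y)\<^sup>2 / \<bar>c\<bar>)"
    proof -
      have "(\<bar>c\<bar> * w y - sgn c * \<phi> y)\<^sup>2 = \<bar>c\<bar> * (\<bar>c\<bar> * (w y)\<^sup>2) - \<bar>c\<bar> * (2 * sgn c * w y * \<phi> y) + (sgn c * sgn c) * (\<phi> y)\<^sup>2"
        by (simp add: power2_eq_square algebra_simps)
      then have "(\<bar>c\<bar> * w y - sgn c * \<phi> y)\<^sup>2 / \<bar>c\<bar> = \<bar>c\<bar> * (w y)\<^sup>2 - 2 * sgn c * w y * \<phi> y + (\<phi> y)\<^sup>2 / \<bar>c\<bar>"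
        using c0 unfolding s by (simp add: add_divide_distrib diff_divide_distrib)
      then show ?thesis unfolding s by simp
    qed
    also have "exp (2 * a * y) * - ((\<bar>c\<bar> * w y - sgn c * \<phi> y)\<^sup>2 / \<bar>c\<bar>) \<le> 0"
      by (intro mult_nonneg_nonpos) simp_all
    finally show "sgn c * (2 * a * exp (2 * a * y) * (w y * w y) +
        ((\<phi> y - \<kappa> * w y) * w y + (\<phi> y - \<kappa> * w y) * w y) * exp (2 * a * y)) + \<bar>c\<bar> * W y + - 1 / \<bar>c\<bar> * G y \<le> 0" .
  qed
  moreover have "integral {0..b} G / \<bar>c\<bar> \<le> wsq a \<phi> / \<bar>c\<bar>"
    unfolding G_def using wL2_integral(4)[OF \<phi>, of b] c0 by (intro divide_right_mono) simp_all
  moreover have "W 0 = (w 0)\<^sup>2" by (simp add: W_def)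
  ultimately have "\<bar>c\<bar> * integral {0..b} W \<le> sgn c * (w 0)\<^sup>2 - sgn c * W b + wsq a \<phi> / \<bar>c\<bar>" by simp
  also have "sgn c * (w 0)\<^sup>2 - sgn c * W b = sgn c * ((w 0)\<^sup>2 - W b)" by (rule right_diff_distrib[symmetric])
  finally show "\<bar>\<kappa> - a\<bar> * integral {0..b} (\<lambda>y. exp (2 * a * y) * (w y)\<^sup>2)
      \<le> sgn (\<kappa> - a) * ((w 0)\<^sup>2 - exp (2 * a * b) * (w b)\<^sup>2) + wsq a \<phi> / \<bar>\<kappa> - a\<bar>"
    unfolding W_def c_def .
qed

lemma decaying_scalar_solution:
  assumes \<phi>: "wL2 a \<phi>" and \<kappa>: "\<kappa> > a"
  shows "\<exists>w. wL2 a w \<and> primitive_of w (\<lambda>y. \<phi> y - \<kappa> * w y) \<and> w 0 = \<theta> \<and>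
    wsq a w \<le> \<theta>\<^sup>2 / (\<kappa> - a) + wsq a \<phi> / (\<kappa> - a)\<^sup>2"
proof -
  define w where "w = (\<lambda>y. exp (- \<kappa> * y) * (\<theta> + integral {0..y} (\<lambda>s. exp (\<kappa> * s) * \<phi> s)))"
  have w: "primitive_of w (\<lambda>y. \<phi> y - \<kappa> * w y)" "w 0 = \<theta>"
    unfolding w_def by (rule primitive_of_exponential_solution[OF \<phi>])+
  have c: "\<kappa> - a > 0" "\<kappa> \<noteq> a" using \<kappa> by simp_all
  have cont: "continuous_on {0..b} w" for b
    using primitive_of_continuous[OF w(1)] by (rule continuous_on_subset) auto
  have int: "(\<lambda>y. exp (2 * a * y) * (w y)\<^sup>2) integrable_on {0..b}" for b
    by (intro integrable_continuous_interval continuous_intros cont)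
  have B: "integral {0..b} (\<lambda>y. exp (2 * a * y) * (w y)\<^sup>2) \<le> \<theta>\<^sup>2 / (\<kappa> - a) + wsq a \<phi> / (\<kappa> - a)\<^sup>2"
    if "b \<ge> 0" for b
  proof -
    have "(\<kappa> - a) * integral {0..b} (\<lambda>y. exp (2 * a * y) * (w y)\<^sup>2) \<le> (\<theta>\<^sup>2 - exp (2 * a * b) * (w b)\<^sup>2) + wsq a \<phi> / (\<kappa> - a)"
      using weighted_energy_inequality(2)[OF w(1) \<phi> c(2) that] c w(2) by simp
    also have "\<dots> \<le> \<theta>\<^sup>2 + wsq a \<phi> / (\<kappa> - a)" by simp
    also have "\<dots> = (\<kappa> - a) * (\<theta>\<^sup>2 / (\<kappa> - a) + wsq a \<phi> / (\<kappa> - a)\<^sup>2)"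
      using c by (simp add: distrib_left power2_eq_square)
    finally show ?thesis using c by simp
  qed
  show ?thesis
    using wL2_bounded_partial_integrals[OF primitive_of_measurable[OF w(1)] int B] w by blast
qed

text \<open>The family of bounds over all weights \<mu> is optimal at
  \<open>\<mu> = sqrt (W / \<alpha>)\<close>, where it becomes the Cauchy-Schwarz bound. For
  \<open>W = 0\<close> there is no minimizer, and small \<mu> are used instead.\<close>

lemma power2_le_of_weighted_means:
  fixes x \<alpha> W :: real
  assumes "\<alpha> > 0" "W \<ge> 0" and le: "\<And>\<mu>. \<mu> > 0 \<Longrightarrow> \<bar>x\<bar> \<le> (\<mu> * \<alpha> + W / \<mu>) / 2"
  shows "x\<^sup>2 \<le> \<alpha> * W"
proof (cases "W = 0")
  case True
  have "\<bar>x\<bar> \<le> 0"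
  proof (rule field_le_epsilon)
    fix \<epsilon> :: real assume "\<epsilon> > 0"
    then show "\<bar>x\<bar> \<le> 0 + \<epsilon>" using le[of "\<epsilon> / \<alpha>"] \<open>\<alpha> > 0\<close> True by simp
  qed
  then show ?thesis using True by simp
next
  case False
  then have W: "W > 0" using assms by simp
  define \<mu> where "\<mu> = sqrt (W / \<alpha>)"
  have \<mu>: "\<mu> > 0" "\<mu>\<^sup>2 = W / \<alpha>" using W \<open>\<alpha> > 0\<close> by (simp_all add: \<mu>_def)
  have "W / \<mu> = \<mu> * \<alpha>" using \<mu> \<open>\<alpha> > 0\<close> by (simp add: field_simps power2_eq_square)
  then have "\<bar>x\<bar> \<le> \<mu> * \<alpha>" using le[OF \<mu>(1)] by (simp add: mult.commute)
  then have "x\<^sup>2 \<le> (\<mu> * \<alpha>)\<^sup>2" using \<mu> \<open>\<alpha> > 0\<close> by (intro abs_le_square_iff[THEN iffD1]) simp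
  also have "\<dots> = \<alpha> * W" using \<mu>(2) \<open>\<alpha> > 0\<close> by (simp add: power_mult_distrib field_simps power2_eq_square)
  finally show ?thesis .
qed

text \<open>For \<open>\<kappa> < a\<close> the solution is minus a tail integral of the forcing.
  The end term of the energy inequality now has the unfavourable sign, so it is first bounded
  pointwise by a Cauchy-Schwarz estimate of the tail; this second contribution causes the factor 2
  in the norm bound.\<close>

lemma growing_scalar_solution:
  assumes \<phi>: "wL2 a \<phi>" and \<kappa>: "\<kappa> < a"
  shows "\<exists>w. wL2 a w \<and> primitive_of w (\<lambda>y. \<phi> y - \<kappa> * w y) \<and>
    (w 0)\<^sup>2 \<le> wsq a \<phi> / (a - \<kappa>) \<and> wsq a w \<le> 2 * wsq a \<phi> / (a - \<kappa>)\<^sup>2"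
proof -
  define d where "d = a - \<kappa>"
  define f where "f = (\<lambda>s. exp (\<kappa> * s) * \<phi> s)"
  define G where "G = (\<lambda>s. exp (2 * a * s) * (\<phi> s)\<^sup>2)"
  \<comment> \<open>The initial value is minus the total integral, so that the bracket becomes minus
    the integral over the tail from \<open>y\<close> on.\<close>
  define w where "w = (\<lambda>y. exp (- \<kappa> * y) * (- integral {0..} f + integral {0..y} f))"
  have d: "d > 0" "\<kappa> \<noteq> a" using \<kappa> by (simp_all add: d_def)
  have w: "primitive_of w (\<lambda>y. \<phi> y - \<kappa> * w y)" "w 0 = - integral {0..} f"
    unfolding w_def f_def by (rule primitive_of_exponential_solution[OF \<phi>])+
  \<comment> \<open>Young's inequality with a free parameter \<open>l\<close>, after splitting
    \<open>exp (\<kappa> * s)\<close> into \<open>exp (- d * s)\<close> and the weight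
    \<open>exp (a * s)\<close>.\<close>
  have f_le: "\<bar>f s\<bar> \<le> (l / 2) * exp (- (2 * d) * s) + G s / (2 * l)" if "l > 0" for l s
  proof -
    define p where "p = sqrt l * exp (- d * s)"
    define q where "q = exp (a * s) * \<bar>\<phi> s\<bar> / sqrt l"
    have "2 * p * q \<le> p\<^sup>2 + q\<^sup>2" by (rule sum_squares_bound)
    moreover have "p * q = exp (- d * s) * exp (a * s) * \<bar>\<phi> s\<bar>" using that by (simp add: p_def q_def)
    moreover have "exp (- d * s) * exp (a * s) = exp (\<kappa> * s)" unfolding exp_add[symmetric] d_def by (simp add: algebra_simps)
    moreover have "p\<^sup>2 = l * exp (- (2 * d) * s)" using that
      by (simp add: p_def power_mult_distrib exp_double[symmetric] mult.assoc)
    moreover have "q\<^sup>2 = G s / l" using that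
      by (simp add: q_def G_def power_mult_distrib power_divide exp_double[symmetric] mult.assoc)
    ultimately show ?thesis by (simp add: f_def abs_mult)
  qed
  have expint: "((\<lambda>s. exp (- (2 * d) * s)) has_integral exp (- (2 * d) * y) / (2 * d)) {y..}" for y
    using has_integral_exp_minus_to_infinity[of "2 * d" y] d by simp
  have G: "G integrable_on {0..}" "wsq a \<phi> = integral {0..} G"
    unfolding G_def by (rule wL2_integral[OF \<phi>])+
  have Gabs: "G absolutely_integrable_on {0..}"
    by (intro nonnegative_absolutely_integrable_1 G) (simp add: G_def)
  have sub: "{y..} \<subseteq> {0..}" if "y \<ge> 0" for y :: real using that by auto
  have Gy: "G integrable_on {y..}" if "y \<ge> 0" for y
    by (rule set_lebesgue_integral_eq_integral(1)[OF set_integrable_subset[OF Gabs _ sub[OF that]]]) simp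
  have fint: "f absolutely_integrable_on {0..}"
  proof (rule measurable_bounded_by_integrable_imp_absolutely_integrable)
    have [measurable]: "\<phi> \<in> borel_measurable (lebesgue_on {0..})" using \<phi> by (simp add: wL2_def)
    show "f \<in> borel_measurable (lebesgue_on {0..})" unfolding f_def by measurable
    show "(\<lambda>s. (1 / 2) * exp (- (2 * d) * s) + (1 / (2 * 1)) * G s) integrable_on {0..}"
      by (intro integrable_add integrable_on_mult_right has_integral_integrable[OF expint] G)
    show "norm (f s) \<le> (1 / 2) * exp (- (2 * d) * s) + (1 / (2 * 1)) * G s" for s
      using f_le[of 1 s] by simp
  qed simp
  have tail: "w y = - exp (- \<kappa> * y) * integral {y..} f" if "y \<ge> 0" for y
  proof -
    have "f integrable_on {0..y}" "f integrable_on {y..}"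
      using fint that by (auto intro!: set_lebesgue_integral_eq_integral(1)[OF set_integrable_subset[OF fint]])
    then have "integral ({0..y} \<union> {y..}) f = integral {0..y} f + integral {y..} f"
    proof (rule integral_Un)
      have "{0..y} \<inter> {y..} = {y}" using that by auto
      then show "negligible ({0..y} \<inter> {y..})" by simp
    qed
    moreover have "{0..y} \<union> {y..} = {0..}" using that by auto
    ultimately show ?thesis by (simp add: w_def)
  qed
  have bound: "exp (2 * a * y) * (w y)\<^sup>2 \<le> wsq a \<phi> / d" if y: "y \<ge> 0" for y
  proof -
    have "\<bar>exp (a * y) * w y\<bar> \<le> (\<mu> * (1 / d) + wsq a \<phi> / \<mu>) / 2" if \<mu>: "\<mu> > 0" for \<mu>
    proof -
      \<comment> \<open>This choice of the parameter cancels the factor \<open>exp (d * y)\<close>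
        in both terms and leaves a bound that does not depend on \<open>y\<close>.\<close>
      define l where "l = \<mu> * exp (d * y)"
      have l: "l > 0" using \<mu> by (simp add: l_def)
      have "norm (integral {y..} f) \<le> integral {y..} (\<lambda>s. (l / 2) * exp (- (2 * d) * s) + (1 / (2 * l)) * G s)"
      proof (rule integral_norm_bound_integral)
        show "f integrable_on {y..}"
          by (rule set_lebesgue_integral_eq_integral(1)[OF set_integrable_subset[OF fint _ sub[OF y]]]) simp
        show "(\<lambda>s. (l / 2) * exp (- (2 * d) * s) + (1 / (2 * l)) * G s) integrable_on {y..}"
          by (intro integrable_add integrable_on_mult_right has_integral_integrable[OF expint] Gy y)
        show "norm (f s) \<le> (l / 2) * exp (- (2 * d) * s) + (1 / (2 * l)) * G s" for s
          using f_le[OF l, of s] by simp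
      qed
      also have "\<dots> = (l / 2) * (exp (- (2 * d) * y) / (2 * d)) + (1 / (2 * l)) * integral {y..} G"
        by (intro integral_unique has_integral_add has_integral_mult_right expint integrable_integral Gy y)
      also have "\<dots> \<le> (l / 2) * (exp (- (2 * d) * y) / (2 * d)) + (1 / (2 * l)) * wsq a \<phi>"
        unfolding G(2) using l by (intro add_left_mono mult_left_mono integral_subset_le sub y Gy G) (simp_all add: G_def)
      finally have "\<bar>integral {y..} f\<bar> \<le> (l / 2) * (exp (- (2 * d) * y) / (2 * d)) + (1 / (2 * l)) * wsq a \<phi>" by simp
      then have "exp (d * y) * \<bar>integral {y..} f\<bar> \<le> exp (d * y) * ((l / 2) * (exp (- (2 * d) * y) / (2 * d)) + (1 / (2 * l)) * wsq a \<phi>)"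
        by (rule mult_left_mono) simp
      also have "\<dots> = (\<mu> / (4 * d)) * (exp (d * y) * exp (d * y) * exp (- (2 * d) * y)) + wsq a \<phi> / (2 * \<mu>)"
        using \<mu> d by (simp add: l_def field_simps)
      also have "exp (d * y) * exp (d * y) * exp (- (2 * d) * y) = 1"
        unfolding exp_add[symmetric] by simp
      also have "exp (d * y) * \<bar>integral {y..} f\<bar> = \<bar>exp (a * y) * w y\<bar>"
      proof -
        have "exp (a * y) * exp (- \<kappa> * y) = exp (d * y)" unfolding exp_add[symmetric] d_def by (simp add: algebra_simps)
        then show ?thesis unfolding tail[OF y] by (simp add: abs_mult mult.assoc[symmetric])
      qed
      finally have "\<bar>exp (a * y) * w y\<bar> \<le> \<mu> / (4 * d) + wsq a \<phi> / (2 * \<mu>)" by simp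
      also have "\<dots> \<le> (\<mu> * (1 / d) + wsq a \<phi> / \<mu>) / 2" using \<mu> d by (simp add: field_simps)
      finally show ?thesis .
    qed
    then have "(exp (a * y) * w y)\<^sup>2 \<le> (1 / d) * wsq a \<phi>"
      by (rule power2_le_of_weighted_means[rotated 2]) (use d wsq_nonneg in simp_all)
    then show ?thesis by (simp add: power_mult_distrib exp_double[symmetric] mult.assoc)
  qed
  have cont: "continuous_on {0..b} w" for b
    using primitive_of_continuous[OF w(1)] by (rule continuous_on_subset) auto
  have int: "(\<lambda>y. exp (2 * a * y) * (w y)\<^sup>2) integrable_on {0..b}" for b
    by (intro integrable_continuous_interval continuous_intros cont)
  have B: "integral {0..b} (\<lambda>y. exp (2 * a * y) * (w y)\<^sup>2) \<le> 2 * wsq a \<phi> / d\<^sup>2" if "b \<ge> 0" for b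
  proof -
    have neg: "sgn (\<kappa> - a) = - 1" "\<bar>\<kappa> - a\<bar> = d" using d by (simp_all add: d_def)
    have "d * integral {0..b} (\<lambda>y. exp (2 * a * y) * (w y)\<^sup>2) \<le> - 1 * ((w 0)\<^sup>2 - exp (2 * a * b) * (w b)\<^sup>2) + wsq a \<phi> / d"
      using weighted_energy_inequality(2)[OF w(1) \<phi> d(2) that] unfolding neg .
    also have "\<dots> \<le> wsq a \<phi> / d + wsq a \<phi> / d"
    proof -
      have "- 1 * ((w 0)\<^sup>2 - exp (2 * a * b) * (w b)\<^sup>2) \<le> exp (2 * a * b) * (w b)\<^sup>2" by simp
      also have "\<dots> \<le> wsq a \<phi> / d" by (rule bound[OF that])
      finally show ?thesis by (rule add_right_mono)
    qed
    also have "\<dots> = d * (2 * wsq a \<phi> / d\<^sup>2)" using d by (simp add: power2_eq_square)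
    finally show ?thesis by (rule mult_left_le_imp_le) (rule d(1))
  qed
  have "(w 0)\<^sup>2 \<le> wsq a \<phi> / d" using bound[of 0] by simp
  then show ?thesis
    using wL2_bounded_partial_integrals[OF primitive_of_measurable[OF w(1)] int B] w unfolding d_def by blast
qed

text \<open>A triangular system \<open>e\<^sub>i w\<^sub>i' + f\<^sub>i w\<^sub>i + (\<Sum>j<i. q\<^sub>i\<^sub>j w\<^sub>j) = \<phi>\<^sub>i\<close> is solved equation by equation. An equation with
  \<open>e\<^sub>i = 0\<close> is algebraic; one with \<open>f\<^sub>i / e\<^sub>i > a\<close> leaves the initial value \<open>\<theta>\<^sub>i\<close> free, while \<open>f\<^sub>i / e\<^sub>i < a\<close>
  determines it.\<close>

definition solves_scalar :: "real \<Rightarrow> real \<Rightarrow> real \<Rightarrow> real \<Rightarrow> (real \<Rightarrow> real) \<Rightarrow> (real \<Rightarrow> real) \<Rightarrow> bool" where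
  "solves_scalar a e f \<theta> \<phi> w \<longleftrightarrow> wL2 a w \<and> primitive_of (\<lambda>y. e * w y) (\<lambda>y. \<phi> y - f * w y) \<and>
     (e = 0 \<longrightarrow> (\<forall>y. f * w y = \<phi> y)) \<and> (e \<noteq> 0 \<and> f / e > a \<longrightarrow> w 0 = \<theta>)"

text \<open>At 0 only \<open>e * w 0\<close> is estimated: for \<open>e = 0\<close> the solution is
  \<open>\<phi> / f\<close>, whose value at a single point is not controlled by a weighted norm. For
  \<open>e \<noteq> 0\<close> the equation is divided by \<open>e\<close>, and the sign of
  \<open>f / e - a\<close> selects the construction.\<close>

lemma scalar_solution_exists:
  fixes a e f :: real
  assumes "e = 0 \<and> f \<noteq> 0 \<or> e \<noteq> 0 \<and> f / e \<noteq> a"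
  shows "\<exists>C\<ge>0. \<forall>\<phi> \<theta>. wL2 a \<phi> \<longrightarrow> (\<exists>w. solves_scalar a e f \<theta> \<phi> w \<and>
    wsq a w \<le> C * (wsq a \<phi> + \<theta>\<^sup>2) \<and> (e * w 0)\<^sup>2 \<le> C * (wsq a \<phi> + \<theta>\<^sup>2))"
proof (cases "e = 0")
  case True
  then have f: "f \<noteq> 0" using assms by simp
  show ?thesis
  proof (intro exI[of _ "(1 / f)\<^sup>2"] conjI allI impI)
    fix \<phi> :: "real \<Rightarrow> real" and \<theta> :: real assume \<phi>: "wL2 a \<phi>"
    note w = wL2_cmult[OF \<phi>, of "1 / f"]
    have "(\<lambda>y. \<phi> y - f * (1 / f * \<phi> y)) = (\<lambda>y. 0)" using f by simp
    then have "primitive_of (\<lambda>y. e * (1 / f * \<phi> y)) (\<lambda>y. \<phi> y - f * (1 / f * \<phi> y))"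
      using primitive_of_const[of 0] True by simp
    then have "solves_scalar a e f \<theta> \<phi> (\<lambda>y. 1 / f * \<phi> y)"
      unfolding solves_scalar_def using w(1) True f by simp
    moreover have "wsq a (\<lambda>y. 1 / f * \<phi> y) \<le> (1 / f)\<^sup>2 * (wsq a \<phi> + \<theta>\<^sup>2)"
      unfolding w(2) by (intro mult_left_mono) simp_all
    moreover have "(e * (1 / f * \<phi> 0))\<^sup>2 \<le> (1 / f)\<^sup>2 * (wsq a \<phi> + \<theta>\<^sup>2)"
      using True wsq_nonneg[of a \<phi>] by simp
    ultimately show "\<exists>w. solves_scalar a e f \<theta> \<phi> w \<and>
        wsq a w \<le> (1 / f)\<^sup>2 * (wsq a \<phi> + \<theta>\<^sup>2) \<and> (e * w 0)\<^sup>2 \<le> (1 / f)\<^sup>2 * (wsq a \<phi> + \<theta>\<^sup>2)" by blast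
  qed simp
next
  case False
  define \<kappa> where "\<kappa> = f / e"
  define D where "D = \<bar>\<kappa> - a\<bar>"
  have D: "D > 0" using assms False by (simp add: \<kappa>_def D_def)
  \<comment> \<open>A common bound for the constants of the decaying and of the growing solution,
    both for the norm and for the initial value; the summand 1 is for the prescribed value
    \<theta>.\<close>
  define B where "B = 1 / D + 2 / D\<^sup>2 + 1"
  have B: "B \<ge> 1 / D" "B \<ge> 2 / D\<^sup>2" "B \<ge> 1 / D\<^sup>2" "B \<ge> 1" "B \<ge> 0" using D by (simp_all add: B_def field_simps)
  \<comment> \<open>The powers of \<open>e\<close> account for the division of \<phi> by
    \<open>e\<close> and for the passage from \<open>w 0\<close> to \<open>e * w 0\<close>.\<close>
  define C where "C = B * (1 / e)\<^sup>2 + B + e\<^sup>2 * B * (1 / e)\<^sup>2 + e\<^sup>2 * B"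
  show ?thesis
  proof (intro exI[of _ C] conjI allI impI)
    show "0 \<le> C" unfolding C_def using B by simp
    fix \<phi> :: "real \<Rightarrow> real" and \<theta> :: real assume \<phi>: "wL2 a \<phi>"
    define \<psi> where "\<psi> = (\<lambda>y. 1 / e * \<phi> y)"
    have \<psi>: "wL2 a \<psi>" "wsq a \<psi> = (1 / e)\<^sup>2 * wsq a \<phi>" unfolding \<psi>_def by (rule wL2_cmult[OF \<phi>])+
    have "\<exists>w. wL2 a w \<and> primitive_of w (\<lambda>y. \<psi> y - \<kappa> * w y) \<and> (\<kappa> > a \<longrightarrow> w 0 = \<theta>) \<and>
      wsq a w \<le> B * (wsq a \<psi> + \<theta>\<^sup>2) \<and> (w 0)\<^sup>2 \<le> B * (wsq a \<psi> + \<theta>\<^sup>2)"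
    proof (cases "\<kappa> > a")
      case True
      then have DD: "D = \<kappa> - a" by (simp add: D_def)
      obtain w where w: "wL2 a w" "primitive_of w (\<lambda>y. \<psi> y - \<kappa> * w y)" "w 0 = \<theta>"
        "wsq a w \<le> \<theta>\<^sup>2 / D + wsq a \<psi> / D\<^sup>2"
        using decaying_scalar_solution[OF \<psi>(1) True, of \<theta>] unfolding DD by blast
      have "\<theta>\<^sup>2 / D + wsq a \<psi> / D\<^sup>2 = (1 / D) * \<theta>\<^sup>2 + (1 / D\<^sup>2) * wsq a \<psi>" by simp
      also have "\<dots> \<le> B * \<theta>\<^sup>2 + B * wsq a \<psi>" by (intro add_mono mult_right_mono B wsq_nonneg) simp
      finally have "wsq a w \<le> B * (wsq a \<psi> + \<theta>\<^sup>2)" using w(4) by (simp add: distrib_left)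
      moreover have "(w 0)\<^sup>2 \<le> B * (wsq a \<psi> + \<theta>\<^sup>2)"
      proof -
        have "1 * \<theta>\<^sup>2 \<le> B * (wsq a \<psi> + \<theta>\<^sup>2)" using B wsq_nonneg[of a \<psi>] by (intro mult_mono) simp_all
        then show ?thesis using w(3) by simp
      qed
      ultimately show ?thesis using w by blast
    next
      case False
      then have \<kappa>: "\<kappa> < a" "D = a - \<kappa>" using D by (simp_all add: D_def)
      obtain w where w: "wL2 a w" "primitive_of w (\<lambda>y. \<psi> y - \<kappa> * w y)"
        "(w 0)\<^sup>2 \<le> wsq a \<psi> / D" "wsq a w \<le> 2 * wsq a \<psi> / D\<^sup>2"
        using growing_scalar_solution[OF \<psi>(1) \<kappa>(1)] unfolding \<kappa>(2) by blast
      have "wsq a \<psi> / D = (1 / D) * wsq a \<psi>" "2 * wsq a \<psi> / D\<^sup>2 = (2 / D\<^sup>2) * wsq a \<psi>" by simp_all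
      moreover have "(1 / D) * wsq a \<psi> \<le> B * (wsq a \<psi> + \<theta>\<^sup>2)" "(2 / D\<^sup>2) * wsq a \<psi> \<le> B * (wsq a \<psi> + \<theta>\<^sup>2)"
        using wsq_nonneg[of a \<psi>] D by (intro mult_mono B; simp)+
      ultimately show ?thesis using w False by (metis order_trans)
    qed
    then obtain w where w: "wL2 a w" "primitive_of w (\<lambda>y. \<psi> y - \<kappa> * w y)" "\<kappa> > a \<longrightarrow> w 0 = \<theta>"
      "wsq a w \<le> B * (wsq a \<psi> + \<theta>\<^sup>2)" "(w 0)\<^sup>2 \<le> B * (wsq a \<psi> + \<theta>\<^sup>2)" by blast
    have "e * (\<psi> y - \<kappa> * w y) = \<phi> y - f * w y" for y
      using False by (simp add: \<psi>_def \<kappa>_def right_diff_distrib)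
    then have "primitive_of (\<lambda>y. e * w y) (\<lambda>y. \<phi> y - f * w y)"
      using primitive_of_cmult[OF w(2), of e] by simp
    then have sol: "solves_scalar a e f \<theta> \<phi> w"
      unfolding solves_scalar_def using w(1,3) False by (simp add: \<kappa>_def)
    have nn: "wsq a \<phi> \<ge> 0" "\<theta>\<^sup>2 \<ge> 0" by (simp_all add: wsq_nonneg)
    have "B * (wsq a \<psi> + \<theta>\<^sup>2) = (B * (1 / e)\<^sup>2) * wsq a \<phi> + B * \<theta>\<^sup>2" by (simp add: \<psi>(2) distrib_left)
    also have "\<dots> \<le> C * wsq a \<phi> + C * \<theta>\<^sup>2"
      using B(5) by (intro add_mono mult_right_mono nn) (simp_all add: C_def)
    finally have 1: "wsq a w \<le> C * (wsq a \<phi> + \<theta>\<^sup>2)" using w(4) by (simp add: distrib_left)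
    have "(e * w 0)\<^sup>2 = e\<^sup>2 * (w 0)\<^sup>2" by (rule power_mult_distrib)
    also have "\<dots> \<le> e\<^sup>2 * (B * (wsq a \<psi> + \<theta>\<^sup>2))" by (intro mult_left_mono w(5)) simp
    also have "\<dots> = (e\<^sup>2 * B * (1 / e)\<^sup>2) * wsq a \<phi> + (e\<^sup>2 * B) * \<theta>\<^sup>2" by (simp add: \<psi>(2) distrib_left)
    also have "\<dots> \<le> C * wsq a \<phi> + C * \<theta>\<^sup>2"
      using B(5) by (intro add_mono mult_right_mono nn) (simp_all add: C_def)
    finally have 2: "(e * w 0)\<^sup>2 \<le> C * (wsq a \<phi> + \<theta>\<^sup>2)" by (simp add: distrib_left)
    show "\<exists>w. solves_scalar a e f \<theta> \<phi> w \<and> wsq a w \<le> C * (wsq a \<phi> + \<theta>\<^sup>2) \<and> (e * w 0)\<^sup>2 \<le> C * (wsq a \<phi> + \<theta>\<^sup>2)"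
      using sol 1 2 by blast
  qed
qed

text \<open>Forward substitution: the solutions found so far enter the next equation as forcing,
  which stays in the weighted space. The constant is fixed by the coefficients before \<phi> and
  \<theta> are given.\<close>

lemma triangular_system_solution_exists:
  fixes a :: real and e f :: "nat \<Rightarrow> real" and q :: "nat \<Rightarrow> nat \<Rightarrow> real"
  assumes "\<And>i. i < N \<Longrightarrow> e i = 0 \<and> f i \<noteq> 0 \<or> e i \<noteq> 0 \<and> f i / e i \<noteq> a"
  shows "\<exists>C\<ge>0. \<forall>\<phi> \<theta>. (\<forall>i<N. wL2 a (\<phi> i)) \<longrightarrow> (\<exists>w. \<forall>i<N.
    solves_scalar a (e i) (f i) (\<theta> i) (\<lambda>y. \<phi> i y - (\<Sum>j<i. q i j * w j y)) (w i) \<and>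
    wsq a (w i) \<le> C * (\<Sum>j<N. wsq a (\<phi> j) + (\<theta> j)\<^sup>2) \<and> (e i * w i 0)\<^sup>2 \<le> C * (\<Sum>j<N. wsq a (\<phi> j) + (\<theta> j)\<^sup>2))"
  using assms
proof (induction N)
  case 0
  show ?case by (intro exI[of _ 0]) simp
next
  case (Suc N)
  obtain C where C: "C \<ge> 0" and sol: "\<And>\<phi> \<theta>. \<forall>i<N. wL2 a (\<phi> i) \<Longrightarrow> \<exists>w. \<forall>i<N.
    solves_scalar a (e i) (f i) (\<theta> i) (\<lambda>y. \<phi> i y - (\<Sum>j<i. q i j * w j y)) (w i) \<and>
    wsq a (w i) \<le> C * (\<Sum>j<N. wsq a (\<phi> j) + (\<theta> j)\<^sup>2) \<and> (e i * w i 0)\<^sup>2 \<le> C * (\<Sum>j<N. wsq a (\<phi> j) + (\<theta> j)\<^sup>2)"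
    using Suc.IH[OF Suc.prems[OF less_SucI]] by blast
  obtain D where D: "D \<ge> 0" and sol': "\<And>\<phi> \<theta>. wL2 a \<phi> \<Longrightarrow> \<exists>w. solves_scalar a (e N) (f N) \<theta> \<phi> w \<and>
    wsq a w \<le> D * (wsq a \<phi> + \<theta>\<^sup>2) \<and> (e N * w 0)\<^sup>2 \<le> D * (wsq a \<phi> + \<theta>\<^sup>2)"
    using scalar_solution_exists[of "e N" "f N" a] Suc.prems[of N] by (metis lessI)
  \<comment> \<open>Bounds the squared norm of the coupling term of equation \<open>N\<close> by the
    data of the earlier equations.\<close>
  define E where "E = 2 ^ N * ((\<Sum>j<N. (q N j)\<^sup>2 * C))"
  have E: "E \<ge> 0" unfolding E_def using C by (intro mult_nonneg_nonneg sum_nonneg) simp_all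
  \<comment> \<open>The factor \<open>2 + 2 * E\<close> comes from splitting the forcing
    \<open>\<phi> N - g\<close> by the two-term bound.\<close>
  define C' where "C' = C + D * (2 + 2 * E)"
  have C': "C' \<ge> C" "C' \<ge> 0" "C' \<ge> D * (2 + 2 * E)" unfolding C'_def using C D E by simp_all
  show ?case
  proof (intro exI[of _ C'] conjI allI impI)
    fix \<phi> :: "nat \<Rightarrow> real \<Rightarrow> real" and \<theta> :: "nat \<Rightarrow> real"
    assume \<phi>: "\<forall>i<Suc N. wL2 a (\<phi> i)"
    define S where "S = (\<Sum>j<N. wsq a (\<phi> j) + (\<theta> j)\<^sup>2)"
    define S' where "S' = (\<Sum>j<Suc N. wsq a (\<phi> j) + (\<theta> j)\<^sup>2)"
    have SS': "S' = S + (wsq a (\<phi> N) + (\<theta> N)\<^sup>2)" by (simp add: S_def S'_def)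
    have S0: "S \<ge> 0" unfolding S_def by (intro sum_nonneg add_nonneg_nonneg wsq_nonneg) simp
    have t0: "wsq a (\<phi> N) + (\<theta> N)\<^sup>2 \<ge> 0" by (simp add: wsq_nonneg)
    have "\<forall>i<N. wL2 a (\<phi> i)" using \<phi> by simp
    from sol[OF this, of \<theta>] obtain w where w: "\<And>i. i < N \<Longrightarrow>
      solves_scalar a (e i) (f i) (\<theta> i) (\<lambda>y. \<phi> i y - (\<Sum>j<i. q i j * w j y)) (w i) \<and>
      wsq a (w i) \<le> C * S \<and> (e i * w i 0)\<^sup>2 \<le> C * S" unfolding S_def by blast
    have wi: "wL2 a (w i)" "wsq a (w i) \<le> C * S" if "i < N" for i
      using w[OF that] by (simp_all add: solves_scalar_def)
    define g where "g = (\<lambda>y. \<Sum>j<N. q N j * w j y)"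
    have gi: "wL2 a g" "wsq a g \<le> 2 ^ card {..<N} * (\<Sum>j<N. wsq a (\<lambda>y. q N j * w j y))"
      unfolding g_def by (intro wL2_sum wL2_cmult(1) wi(1); simp)+
    have gb: "wsq a g \<le> E * S"
    proof -
      have "(\<Sum>j<N. wsq a (\<lambda>y. q N j * w j y)) \<le> (\<Sum>j<N. (q N j)\<^sup>2 * C * S)"
      proof (rule sum_mono)
        fix j assume "j \<in> {..<N}"
        then have "wL2 a (w j)" "wsq a (w j) \<le> C * S" using wi by simp_all
        then show "wsq a (\<lambda>y. q N j * w j y) \<le> (q N j)\<^sup>2 * C * S"
          by (simp only: wL2_cmult(2) mult.assoc) (intro mult_left_mono, simp_all)
      qed
      then have "2 ^ card {..<N} * (\<Sum>j<N. wsq a (\<lambda>y. q N j * w j y)) \<le> 2 ^ N * (\<Sum>j<N. (q N j)\<^sup>2 * C * S)"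
        by simp
      also have "\<dots> = E * S" unfolding E_def sum_distrib_right[symmetric] by simp
      finally show ?thesis using gi(2) by linarith
    qed
    have \<psi>: "wL2 a (\<lambda>y. \<phi> N y - g y)" using \<phi> gi(1) by (intro wL2_diff) simp_all
    have \<psi>b: "wsq a (\<lambda>y. \<phi> N y - g y) \<le> 2 * wsq a (\<phi> N) + 2 * (E * S)"
    proof -
      have "wsq a (\<lambda>y. \<phi> N y + (- 1) * g y) \<le> 2 * wsq a (\<phi> N) + 2 * wsq a (\<lambda>y. (- 1) * g y)"
        using \<phi> by (intro wL2_add(2) wL2_cmult(1) gi(1)) simp
      also have "wsq a (\<lambda>y. (- 1) * g y) = wsq a g" using wL2_cmult(2)[OF gi(1), of "- 1"] by simp
      finally show ?thesis using gb by simp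
    qed
    obtain u where u: "solves_scalar a (e N) (f N) (\<theta> N) (\<lambda>y. \<phi> N y - g y) u"
      "wsq a u \<le> D * (wsq a (\<lambda>y. \<phi> N y - g y) + (\<theta> N)\<^sup>2)" "(e N * u 0)\<^sup>2 \<le> D * (wsq a (\<lambda>y. \<phi> N y - g y) + (\<theta> N)\<^sup>2)"
      using sol'[OF \<psi>, of "\<theta> N"] by blast
    have "D * (wsq a (\<lambda>y. \<phi> N y - g y) + (\<theta> N)\<^sup>2) \<le> C' * S'"
    proof -
      have "wsq a (\<lambda>y. \<phi> N y - g y) + (\<theta> N)\<^sup>2 \<le> 2 * (wsq a (\<phi> N) + (\<theta> N)\<^sup>2) + 2 * (E * S)"
        using add_mono[OF \<psi>b, of "(\<theta> N)\<^sup>2" "2 * (\<theta> N)\<^sup>2"] by (simp add: algebra_simps)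
      also have "\<dots> \<le> (2 + 2 * E) * S'"
      proof -
        have "0 \<le> E * (wsq a (\<phi> N) + (\<theta> N)\<^sup>2)" using E t0 by (rule mult_nonneg_nonneg)
        then show ?thesis unfolding SS' using S0 by (simp add: distrib_left distrib_right)
      qed
      finally have "D * (wsq a (\<lambda>y. \<phi> N y - g y) + (\<theta> N)\<^sup>2) \<le> D * ((2 + 2 * E) * S')"
        by (rule mult_left_mono) (rule D)
      also have "\<dots> \<le> C' * S'" unfolding mult.assoc[symmetric]
        by (rule mult_right_mono[OF C'(3)]) (use SS' S0 t0 in simp)
      finally show ?thesis .
    qed
    then have ub: "wsq a u \<le> C' * S'" "(e N * u 0)\<^sup>2 \<le> C' * S'" using u(2,3) by linarith+
    have CS: "C * S \<le> C' * S'" using C' C S0 t0 SS' by (intro mult_mono) simp_all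
    \<comment> \<open>Earlier equations contain only indices below \<open>N\<close>, so the new
      component does not affect them.\<close>
    define w' where "w' = w(N := u)"
    show "\<exists>w. \<forall>i<Suc N. solves_scalar a (e i) (f i) (\<theta> i) (\<lambda>y. \<phi> i y - (\<Sum>j<i. q i j * w j y)) (w i) \<and>
        wsq a (w i) \<le> C' * (\<Sum>j<Suc N. wsq a (\<phi> j) + (\<theta> j)\<^sup>2) \<and> (e i * w i 0)\<^sup>2 \<le> C' * (\<Sum>j<Suc N. wsq a (\<phi> j) + (\<theta> j)\<^sup>2)"
      unfolding S'_def[symmetric]
    proof (intro exI[of _ w'] allI impI)
      fix i assume i: "i < Suc N"
      have eq: "(\<Sum>j<i. q i j * w' j y) = (\<Sum>j<i. q i j * w j y)" for y
        using i by (intro sum.cong) (simp_all add: w'_def)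
      show "solves_scalar a (e i) (f i) (\<theta> i) (\<lambda>y. \<phi> i y - (\<Sum>j<i. q i j * w' j y)) (w' i) \<and>
        wsq a (w' i) \<le> C' * S' \<and> (e i * w' i 0)\<^sup>2 \<le> C' * S'"
      proof (cases "i = N")
        case True
        then show ?thesis unfolding eq using u(1) ub by (simp add: w'_def g_def)
      next
        case False
        then have iN: "i < N" using i by simp
        have "w' i = w i" using False by (simp add: w'_def)
        then show ?thesis unfolding eq using w[OF iN] CS by fastforce
      qed
    qed
  qed (rule C'(2))
qed

section \<open>Symmetric pencils\<close>

lemma scalar_prod_self_nonneg: "(v :: real vec) \<bullet> v \<ge> 0"
  unfolding scalar_prod_def by (intro sum_nonneg) simp

lemma scalar_prod_self_eq_0:
  assumes "(v :: real vec) \<in> carrier_vec n" "v \<bullet> v = 0"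
  shows "v = 0\<^sub>v n"
proof -
  have "v $ i = 0" if "i < n" for i
    using assms that sum_nonneg_eq_0_iff[of "{0..<n}" "\<lambda>i. v $ i * v $ i"]
    by (auto simp: scalar_prod_def)
  then show ?thesis using assms by (intro eq_vecI) auto
qed

lemma mult_mat_zero_vec: "(A :: real mat) \<in> carrier_mat nr nc \<Longrightarrow> A *\<^sub>v 0\<^sub>v nc = 0\<^sub>v nr"
  by (intro eq_vecI) (auto simp: scalar_prod_def)

lemma scalar_prod_mult_mat_vec:
  assumes "(A :: real mat) \<in> carrier_mat nr nc" "x \<in> carrier_vec nc" "y \<in> carrier_vec nr"
  shows "y \<bullet> (A *\<^sub>v x) = (A\<^sup>T *\<^sub>v y) \<bullet> x"
  by (rule transpose_vec_mult_scalar[OF assms, symmetric])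

lemma symmetric_scalar_prod:
  assumes "(A :: real mat) \<in> carrier_mat n n" "A\<^sup>T = A" "x \<in> carrier_vec n" "y \<in> carrier_vec n"
  shows "y \<bullet> (A *\<^sub>v x) = x \<bullet> (A *\<^sub>v y)"
  using scalar_prod_mult_mat_vec[OF assms(1,3,4)] assms comm_scalar_prod[of "A *\<^sub>v y" n x] by simp

text \<open>The inverse is also identified with \<open>mat_inverse\<close>, because the matrix whose
  eigenvalues restrict \<open>a\<close> is formed with it.\<close>

lemma injective_imp_inverse:
  fixes A :: "real mat"
  assumes A: "A \<in> carrier_mat n n" and inj: "\<And>v. v \<in> carrier_vec n \<Longrightarrow> A *\<^sub>v v = 0\<^sub>v n \<Longrightarrow> v = 0\<^sub>v n"
  shows "\<exists>B. B \<in> carrier_mat n n \<and> A * B = 1\<^sub>m n \<and> B * A = 1\<^sub>m n \<and> mat_inverse A = Some B"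
proof -
  have "det A \<noteq> 0"
  proof
    assume "det A = 0"
    then obtain v where "v \<in> carrier_vec n" "v \<noteq> 0\<^sub>v n" "A *\<^sub>v v = 0\<^sub>v n"
      using det_0_iff_vec_prod_zero_field[OF A] by auto
    then show False using inj[of v] by simp
  qed
  then have U: "A \<in> Units (ring_mat TYPE(real) n ())" by (rule det_non_zero_imp_unit[OF A])
  show ?thesis
  proof (cases "mat_inverse A")
    case None
    then show ?thesis using mat_inverse(1)[OF A None, where b = "()"] U by simp
  next
    case (Some B)
    then show ?thesis using mat_inverse(2)[OF A Some] by (intro exI[of _ B]) simp
  qed
qed

text \<open>Padding with zero rows gives a square matrix whose products all have a zero row, so it
  has no right inverse and cannot be injective.\<close>

lemma wide_matrix_has_kernel:
  fixes A :: "real mat"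
  assumes A: "A \<in> carrier_mat nr nc" and lt: "nr < nc"
  shows "\<exists>v\<in>carrier_vec nc. v \<noteq> 0\<^sub>v nc \<and> A *\<^sub>v v = 0\<^sub>v nr"
proof -
  define B where "B = mat nc nc (\<lambda>(i, j). if i < nr then A $$ (i, j) else 0)"
  have B: "B \<in> carrier_mat nc nc" by (simp add: B_def)
  have "\<not> (\<exists>C. C \<in> carrier_mat nc nc \<and> B * C = 1\<^sub>m nc)"
  proof
    assume "\<exists>C. C \<in> carrier_mat nc nc \<and> B * C = 1\<^sub>m nc"
    then obtain C where C: "C \<in> carrier_mat nc nc" "B * C = 1\<^sub>m nc" by blast
    have "(B * C) $$ (nr, nr) = 0" using lt B C(1) by (simp add: B_def scalar_prod_def)
    then show False unfolding C(2) using lt by simp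
  qed
  then obtain v where v: "v \<in> carrier_vec nc" "B *\<^sub>v v = 0\<^sub>v nc" "v \<noteq> 0\<^sub>v nc"
    using injective_imp_inverse[OF B] by blast
  have "A *\<^sub>v v = 0\<^sub>v nr"
  proof (rule eq_vecI)
    fix i assume "i < dim_vec (0\<^sub>v nr :: real vec)"
    then have i: "i < nr" by simp
    have "(A *\<^sub>v v) $ i = (B *\<^sub>v v) $ i" using i lt A v(1) by (simp add: B_def scalar_prod_def)
    then show "(A *\<^sub>v v) $ i = 0\<^sub>v nr $ i" using v(2) i lt by simp
  qed (use A in simp)
  then show ?thesis using v by blast
qed

text \<open>A complex eigenvector \<open>x + i y\<close> of \<open>Q^{-1} A\<close> exists. Symmetry
  of both forms, applied to the real and imaginary parts of the eigenvalue equation, yields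
  \<open>Im ev * (x \<bullet> Q x + y \<bullet> Q y) = 0\<close>, so the eigenvalue is real and
  \<open>x\<close> or \<open>y\<close> is a real eigenvector.\<close>

lemma real_eigenvector_of_symmetric_pencil:
  fixes A Q :: "real mat"
  assumes A: "A \<in> carrier_mat k k" "A\<^sup>T = A" and Q: "Q \<in> carrier_mat k k" "pos_def Q" and k: "k > 0"
  shows "\<exists>v \<mu>. v \<in> carrier_vec k \<and> v \<bullet> (Q *\<^sub>v v) = 1 \<and> A *\<^sub>v v = \<mu> \<cdot>\<^sub>v (Q *\<^sub>v v)"
proof -
  have Qs: "Q\<^sup>T = Q" and Qp: "\<And>v. v \<in> carrier_vec k \<Longrightarrow> v \<noteq> 0\<^sub>v k \<Longrightarrow> v \<bullet> (Q *\<^sub>v v) > 0"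
    using Q unfolding pos_def_def by auto
  have "v = 0\<^sub>v k" if "v \<in> carrier_vec k" "Q *\<^sub>v v = 0\<^sub>v k" for v
    using Qp[OF that(1)] that by (cases "v = 0\<^sub>v k") simp_all
  then obtain R where R: "R \<in> carrier_mat k k" "Q * R = 1\<^sub>m k"
    using injective_imp_inverse[OF Q(1)] by blast
  define B where "B = R * A"
  have B: "B \<in> carrier_mat k k" using R A by (simp add: B_def)
  have "Q * B = Q * R * A" unfolding B_def by (rule assoc_mult_mat[OF Q(1) R(1) A(1), symmetric])
  then have "Q * B = A" using R(2) A(1) by simp
  then have QB: "Q *\<^sub>v (B *\<^sub>v v) = A *\<^sub>v v" if "v \<in> carrier_vec k" for v
    using assoc_mult_mat_vec[OF Q(1) B that] by simp
  define cB where "cB = map_mat complex_of_real B"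
  have cB: "cB \<in> carrier_mat k k" using B by (simp add: cB_def)
  obtain ev where "ev \<in> spectrum cB" using spectrum_non_empty[OF cB k] by blast
  then obtain z where z: "z \<in> carrier_vec k" "z \<noteq> 0\<^sub>v k" "cB *\<^sub>v z = ev \<cdot>\<^sub>v z"
    unfolding spectrum_def eigenvalue_def eigenvector_def using cB by auto
  define x where "x = map_vec Re z"
  define y where "y = map_vec Im z"
  have xy: "x \<in> carrier_vec k" "y \<in> carrier_vec k" using z(1) by (simp_all add: x_def y_def)
  have ReIm: "(B *\<^sub>v x) $ i = Re ((cB *\<^sub>v z) $ i) \<and> (B *\<^sub>v y) $ i = Im ((cB *\<^sub>v z) $ i)" if i: "i < k" for i
    using B z(1) i by (simp add: cB_def x_def y_def scalar_prod_def)
  have Bx: "B *\<^sub>v x = Re ev \<cdot>\<^sub>v x - Im ev \<cdot>\<^sub>v y"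
  proof (rule eq_vecI)
    fix i assume "i < dim_vec (Re ev \<cdot>\<^sub>v x - Im ev \<cdot>\<^sub>v y)"
    then have i: "i < k" using xy by simp
    have "(B *\<^sub>v x) $ i = Re ((ev \<cdot>\<^sub>v z) $ i)" using ReIm[OF i] unfolding z(3) by (rule conjunct1)
    then show "(B *\<^sub>v x) $ i = (Re ev \<cdot>\<^sub>v x - Im ev \<cdot>\<^sub>v y) $ i"
      using i z(1) by (simp add: x_def y_def del: index_mult_mat_vec)
  qed (use B xy in simp)
  have By: "B *\<^sub>v y = Re ev \<cdot>\<^sub>v y + Im ev \<cdot>\<^sub>v x"
  proof (rule eq_vecI)
    fix i assume "i < dim_vec (Re ev \<cdot>\<^sub>v y + Im ev \<cdot>\<^sub>v x)"
    then have i: "i < k" using xy by simp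
    have "(B *\<^sub>v y) $ i = Im ((ev \<cdot>\<^sub>v z) $ i)" using ReIm[OF i] unfolding z(3) by (rule conjunct2)
    then show "(B *\<^sub>v y) $ i = (Re ev \<cdot>\<^sub>v y + Im ev \<cdot>\<^sub>v x) $ i"
      using i z(1) by (simp add: x_def y_def del: index_mult_mat_vec)
  qed (use B xy in simp)
  have Qxy: "Q *\<^sub>v x \<in> carrier_vec k" "Q *\<^sub>v y \<in> carrier_vec k" using Q xy by auto
  have Ax: "A *\<^sub>v x = Re ev \<cdot>\<^sub>v (Q *\<^sub>v x) - Im ev \<cdot>\<^sub>v (Q *\<^sub>v y)"
    using QB[OF xy(1)] Q(1) xy by (simp add: Bx mult_minus_distrib_mat_vec[of _ k k] mult_mat_vec[of _ k k])
  have Ay: "A *\<^sub>v y = Re ev \<cdot>\<^sub>v (Q *\<^sub>v y) + Im ev \<cdot>\<^sub>v (Q *\<^sub>v x)"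
    using QB[OF xy(2)] Q(1) xy by (simp add: By mult_add_distrib_mat_vec[of _ k k] mult_mat_vec[of _ k k])
  have nz: "x \<noteq> 0\<^sub>v k \<or> y \<noteq> 0\<^sub>v k"
  proof (rule ccontr)
    assume "\<not> (x \<noteq> 0\<^sub>v k \<or> y \<noteq> 0\<^sub>v k)"
    then have "x $ i = 0 \<and> y $ i = 0" if "i < k" for i using that by simp
    then have "z $ i = 0" if "i < k" for i using that z(1) by (simp add: x_def y_def complex_eq_iff)
    then show False using z(1,2) by (metis carrier_vecD eq_vecI index_zero_vec)
  qed
  have "y \<bullet> (A *\<^sub>v x) = x \<bullet> (A *\<^sub>v y)" by (rule symmetric_scalar_prod[OF A xy])
  moreover have "y \<bullet> (Q *\<^sub>v x) = x \<bullet> (Q *\<^sub>v y)" by (rule symmetric_scalar_prod[OF Q(1) Qs xy])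
  ultimately have "Im ev * (x \<bullet> (Q *\<^sub>v x) + y \<bullet> (Q *\<^sub>v y)) = 0"
    unfolding Ax Ay using xy Qxy
    by (simp add: scalar_prod_add_distrib[of _ k] scalar_prod_minus_distrib[of _ k] algebra_simps)
  moreover have "x \<bullet> (Q *\<^sub>v x) + y \<bullet> (Q *\<^sub>v y) > 0"
  proof -
    have nn: "v \<bullet> (Q *\<^sub>v v) \<ge> 0" if "v \<in> carrier_vec k" for v
      using Qp[OF that] mult_mat_zero_vec[OF Q(1)] by (cases "v = 0\<^sub>v k") (simp_all add: less_imp_le)
    show ?thesis
    proof (cases "x = 0\<^sub>v k")
      case True
      then have "y \<bullet> (Q *\<^sub>v y) > 0" using nz Qp xy by blast
      then show ?thesis using nn[OF xy(1)] by simp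
    next
      case False
      then have "x \<bullet> (Q *\<^sub>v x) > 0" using Qp xy by blast
      then show ?thesis using nn[OF xy(2)] by simp
    qed
  qed
  ultimately have Im0: "Im ev = 0" by simp
  have "A *\<^sub>v x = Re ev \<cdot>\<^sub>v (Q *\<^sub>v x)" "A *\<^sub>v y = Re ev \<cdot>\<^sub>v (Q *\<^sub>v y)"
    unfolding Ax Ay Im0 using Qxy by (auto intro!: eq_vecI)
  then obtain u where u: "u \<in> carrier_vec k" "u \<noteq> 0\<^sub>v k" "A *\<^sub>v u = Re ev \<cdot>\<^sub>v (Q *\<^sub>v u)" using nz xy by blast
  define s where "s = u \<bullet> (Q *\<^sub>v u)"
  have s: "s > 0" using Qp u by (simp add: s_def)
  define v where "v = (1 / sqrt s) \<cdot>\<^sub>v u"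
  have Qu: "Q *\<^sub>v u \<in> carrier_vec k" using Q u by auto
  have v: "v \<in> carrier_vec k" using u by (simp add: v_def)
  have Qv: "Q *\<^sub>v v = (1 / sqrt s) \<cdot>\<^sub>v (Q *\<^sub>v u)" unfolding v_def by (rule mult_mat_vec[OF Q(1) u(1)])
  have "v \<bullet> (Q *\<^sub>v v) = (1 / sqrt s) * ((1 / sqrt s) * s)"
    unfolding Qv unfolding v_def s_def using u Qu by simp
  then have "v \<bullet> (Q *\<^sub>v v) = 1" using s by simp
  moreover have "A *\<^sub>v v = Re ev \<cdot>\<^sub>v (Q *\<^sub>v v)"
    unfolding Qv unfolding v_def mult_mat_vec[OF A(1) u(1)] u(3) by (simp add: smult_smult_assoc mult.commute)
  ultimately show ?thesis using v by blast
qed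

section \<open>Congruence and simultaneous diagonalization\<close>

lemma congruence_scalar_prod:
  fixes P B :: "real mat"
  assumes "P \<in> carrier_mat n k" "B \<in> carrier_mat n n" "x \<in> carrier_vec k" "y \<in> carrier_vec k"
  shows "x \<bullet> ((P\<^sup>T * (B * P)) *\<^sub>v y) = (P *\<^sub>v x) \<bullet> (B *\<^sub>v (P *\<^sub>v y))"
proof -
  have BP: "B * P \<in> carrier_mat n k" and PT: "P\<^sup>T \<in> carrier_mat k n"
    and Py: "P *\<^sub>v y \<in> carrier_vec n" using assms by auto
  have "(P\<^sup>T * (B * P)) *\<^sub>v y = P\<^sup>T *\<^sub>v ((B * P) *\<^sub>v y)" by (rule assoc_mult_mat_vec[OF PT BP assms(4)])
  also have "(B * P) *\<^sub>v y = B *\<^sub>v (P *\<^sub>v y)" by (rule assoc_mult_mat_vec[OF assms(2,1,4)])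
  also have "x \<bullet> (P\<^sup>T *\<^sub>v (B *\<^sub>v (P *\<^sub>v y))) = (P\<^sup>T\<^sup>T *\<^sub>v x) \<bullet> (B *\<^sub>v (P *\<^sub>v y))"
    by (rule scalar_prod_mult_mat_vec[OF PT _ assms(3)]) (use assms(2) Py in simp)
  finally show ?thesis by simp
qed

lemma congruence_symmetric:
  fixes P B :: "real mat"
  assumes "P \<in> carrier_mat n k" "B \<in> carrier_mat n n" "B\<^sup>T = B"
  shows "P\<^sup>T * (B * P) \<in> carrier_mat k k" "(P\<^sup>T * (B * P))\<^sup>T = P\<^sup>T * (B * P)"
proof -
  have BP: "B * P \<in> carrier_mat n k" and PT: "P\<^sup>T \<in> carrier_mat k n" using assms by auto
  then show "P\<^sup>T * (B * P) \<in> carrier_mat k k" by simp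
  have "(P\<^sup>T * (B * P))\<^sup>T = (B * P)\<^sup>T * P" using transpose_mult[OF PT BP] by simp
  also have "(B * P)\<^sup>T = P\<^sup>T * B" using transpose_mult[OF assms(2,1)] assms(3) by simp
  also have "P\<^sup>T * B * P = P\<^sup>T * (B * P)" by (rule assoc_mult_mat[OF PT assms(2,1)])
  finally show "(P\<^sup>T * (B * P))\<^sup>T = P\<^sup>T * (B * P)" .
qed

text \<open>Deflation: since \<open>A v\<close> is a multiple of \<open>Q v\<close> for an
  eigenvector \<open>v\<close>, vectors that are \<open>Q\<close>-orthogonal to \<open>v\<close> are
  also \<open>A\<close>-orthogonal to it, and the pencil restricts to them with one dimension
  less.\<close>

lemma symmetric_pencil_diagonalizable:
  fixes A Q :: "real mat"
  assumes "A \<in> carrier_mat k k" "A\<^sup>T = A" "Q \<in> carrier_mat k k" "pos_def Q"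
  shows "\<exists>c \<mu>. (\<forall>i<k. c i \<in> carrier_vec k) \<and> (\<forall>i<k. \<forall>j<k.
    c i \<bullet> (Q *\<^sub>v c j) = (if i = j then 1 else 0) \<and> c i \<bullet> (A *\<^sub>v c j) = (if i = j then \<mu> i else (0::real)))"
  using assms
proof (induction k arbitrary: A Q)
  case 0
  show ?case by simp
next
  case (Suc k)
  note A = Suc.prems(1,2) and Q = Suc.prems(3,4)
  have Qs: "Q\<^sup>T = Q" and Qp: "\<And>v. v \<in> carrier_vec (Suc k) \<Longrightarrow> v \<noteq> 0\<^sub>v (Suc k) \<Longrightarrow> v \<bullet> (Q *\<^sub>v v) > 0"
    using Q unfolding pos_def_def by auto
  obtain v \<mu>0 where v: "v \<in> carrier_vec (Suc k)" "v \<bullet> (Q *\<^sub>v v) = 1" "A *\<^sub>v v = \<mu>0 \<cdot>\<^sub>v (Q *\<^sub>v v)"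
    using real_eigenvector_of_symmetric_pencil[OF A Q] by blast
  define w where "w = Q *\<^sub>v v"
  have w: "w \<in> carrier_vec (Suc k)" using Q v by (simp add: w_def)
  have "\<exists>j<Suc k. w $ j \<noteq> 0"
  proof (rule ccontr)
    assume "\<not> (\<exists>j<Suc k. w $ j \<noteq> 0)"
    then have "v \<bullet> w = 0" using w by (simp add: scalar_prod_def)
    then show False using v(2) by (simp add: w_def)
  qed
  then obtain j where j: "j < Suc k" "w $ j \<noteq> 0" by blast
  \<comment> \<open>The hyperplane orthogonal to \<open>w\<close> is parametrized by all coordinates
    but \<open>j\<close>. The map \<sigma> enumerates these, and column \<open>c\<close> of
    \<open>P\<close> is the unit vector at \<open>\<sigma> c\<close> with its entry at
    \<open>j\<close> chosen to make it orthogonal to \<open>w\<close>.\<close>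
  define \<sigma> where "\<sigma> = (\<lambda>c. if c < j then c else Suc c)"
  have \<sigma>: "\<sigma> c \<noteq> j" "c < k \<Longrightarrow> \<sigma> c < Suc k" for c using j by (auto simp: \<sigma>_def)
  have \<sigma>_inj: "\<sigma> c = \<sigma> d \<longleftrightarrow> c = d" for c d by (auto simp: \<sigma>_def)
  define P where "P = mat (Suc k) k (\<lambda>(i, c). if i = \<sigma> c then 1 else if i = j then - w $ \<sigma> c / w $ j else 0)"
  have P: "P \<in> carrier_mat (Suc k) k" by (simp add: P_def)
  have PT: "P\<^sup>T *\<^sub>v w = 0\<^sub>v k"
  proof (rule eq_vecI)
    fix c assume "c < dim_vec (0\<^sub>v k :: real vec)"
    then have c: "c < k" by simp
    have "(P\<^sup>T *\<^sub>v w) $ c = (\<Sum>i<Suc k. P $$ (i, c) * w $ i)"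
      using P w c by (simp add: scalar_prod_def atLeast0LessThan)
    also have "\<dots> = (\<Sum>i<Suc k. (if i = \<sigma> c then w $ \<sigma> c else 0) + (if i = j then - w $ \<sigma> c else 0))"
      using c j(2) \<sigma>(1)[of c] by (intro sum.cong) (simp_all add: P_def)
    also have "\<dots> = 0" using \<sigma>(2)[OF c] j(1) by (simp add: sum.distrib)
    finally show "(P\<^sup>T *\<^sub>v w) $ c = 0\<^sub>v k $ c" using c by simp
  qed (use P in simp)
  have Pinj: "x = 0\<^sub>v k" if x: "x \<in> carrier_vec k" "P *\<^sub>v x = 0\<^sub>v (Suc k)" for x
  proof (rule eq_vecI)
    fix c assume "c < dim_vec (0\<^sub>v k :: real vec)"
    then have c: "c < k" by simp
    have "(P *\<^sub>v x) $ \<sigma> c = (\<Sum>d<k. P $$ (\<sigma> c, d) * x $ d)"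
      using P x(1) \<sigma>(2)[OF c] by (simp add: scalar_prod_def atLeast0LessThan)
    also have "\<dots> = (\<Sum>d<k. if d = c then x $ c else 0)"
      using \<sigma> c by (intro sum.cong) (simp_all add: P_def \<sigma>_inj)
    also have "\<dots> = x $ c" using c by simp
    finally show "x $ c = 0\<^sub>v k $ c" using x(2) \<sigma>(2)[OF c] c by simp
  qed (use x in simp)
  define A' where "A' = P\<^sup>T * (A * P)"
  define Q' where "Q' = P\<^sup>T * (Q * P)"
  note A' = congruence_symmetric[OF P A, folded A'_def] and Q' = congruence_symmetric[OF P Q(1) Qs, folded Q'_def]
  note form = congruence_scalar_prod[OF P]
  have "pos_def Q'"
    unfolding pos_def_def
  proof (intro conjI ballI impI)
    fix x :: "real vec" assume "x \<in> carrier_vec (dim_row Q')" "x \<noteq> 0\<^sub>v (dim_row Q')"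
    then have x: "x \<in> carrier_vec k" "x \<noteq> 0\<^sub>v k" using Q' by simp_all
    have "P *\<^sub>v x \<in> carrier_vec (Suc k)" "P *\<^sub>v x \<noteq> 0\<^sub>v (Suc k)" using P x Pinj by auto
    then show "0 < x \<bullet> (Q' *\<^sub>v x)" using Qp unfolding Q'_def form[OF Q(1) x(1) x(1)] by blast
  qed (rule Q'(2))
  from Suc.IH[OF A' Q'(1) this] obtain c \<mu> where c: "\<And>i. i < k \<Longrightarrow> c i \<in> carrier_vec k"
    and cQ: "\<And>i j. i < k \<Longrightarrow> j < k \<Longrightarrow> c i \<bullet> (Q' *\<^sub>v c j) = (if i = j then 1 else 0)"
    and cA: "\<And>i j. i < k \<Longrightarrow> j < k \<Longrightarrow> c i \<bullet> (A' *\<^sub>v c j) = (if i = j then \<mu> i else 0)" by blast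
  define c' where "c' = case_nat v (\<lambda>i. P *\<^sub>v c i)"
  define \<mu>' where "\<mu>' = case_nat \<mu>0 \<mu>"
  have Pc: "P *\<^sub>v c i \<in> carrier_vec (Suc k)" if "i < k" for i using P c[OF that] by simp
  have perp: "(P *\<^sub>v c i) \<bullet> w = 0" if "i < k" for i
  proof -
    have "w \<bullet> (P *\<^sub>v c i) = (P\<^sup>T *\<^sub>v w) \<bullet> c i" by (rule scalar_prod_mult_mat_vec[OF P c[OF that] w])
    then show ?thesis using PT c[OF that] comm_scalar_prod[OF Pc[OF that] w] by simp
  qed
  have perpQ: "v \<bullet> (Q *\<^sub>v (P *\<^sub>v c i)) = 0" "(P *\<^sub>v c i) \<bullet> (Q *\<^sub>v v) = 0" if "i < k" for i
    using perp[OF that] symmetric_scalar_prod[OF Q(1) Qs v(1) Pc[OF that]] by (simp_all add: w_def)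
  have perpA: "v \<bullet> (A *\<^sub>v (P *\<^sub>v c i)) = 0" "(P *\<^sub>v c i) \<bullet> (A *\<^sub>v v) = 0" if "i < k" for i
  proof -
    show "(P *\<^sub>v c i) \<bullet> (A *\<^sub>v v) = 0"
      unfolding v(3) using perp[OF that] Pc[OF that] w by (simp add: w_def)
    then show "v \<bullet> (A *\<^sub>v (P *\<^sub>v c i)) = 0"
      using symmetric_scalar_prod[OF A v(1) Pc[OF that]] by simp
  qed
  show ?case
  proof (intro exI[of _ c'] exI[of _ \<mu>'] conjI allI impI)
    fix i assume "i < Suc k"
    then show "c' i \<in> carrier_vec (Suc k)" using v Pc by (cases i) (simp_all add: c'_def)
  next
    fix i j assume ij: "i < Suc k" "j < Suc k"
    show "c' i \<bullet> (Q *\<^sub>v c' j) = (if i = j then 1 else 0)"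
    proof (cases i; cases j)
      fix i' j' assume "i = Suc i'" "j = Suc j'"
      then show ?thesis using ij cQ[of i' j'] form[OF Q(1) c c, of i' j'] by (simp add: c'_def Q'_def)
    qed (use ij v perpQ in \<open>simp_all add: c'_def\<close>)
    show "c' i \<bullet> (A *\<^sub>v c' j) = (if i = j then \<mu>' i else 0)"
    proof (cases i; cases j)
      fix i' j' assume "i = Suc i'" "j = Suc j'"
      then show ?thesis using ij cA[of i' j'] form[OF A(1) c c, of i' j'] by (simp add: c'_def \<mu>'_def A'_def)
    qed (use ij v perpA w in \<open>simp_all add: c'_def \<mu>'_def w_def\<close>)
  qed
qed

text \<open>These are the rows of the left inverse \<open>(B^T B)^{-1} B^T\<close>; injectivity of
  \<open>B\<close> makes the Gram matrix invertible.\<close>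

lemma dual_family_exists:
  fixes B :: "real mat"
  assumes B: "B \<in> carrier_mat n k" and inj: "\<And>v. v \<in> carrier_vec k \<Longrightarrow> B *\<^sub>v v = 0\<^sub>v n \<Longrightarrow> v = 0\<^sub>v k"
  shows "\<exists>b. \<forall>j<k. b j \<in> carrier_vec n \<and> (\<forall>v\<in>carrier_vec k. (B *\<^sub>v v) \<bullet> b j = v $ j)"
proof -
  have BB: "B\<^sup>T * (1\<^sub>m n * B) \<in> carrier_mat k k" using B by simp
  have BBv: "x \<bullet> ((B\<^sup>T * (1\<^sub>m n * B)) *\<^sub>v y) = (B *\<^sub>v x) \<bullet> (B *\<^sub>v y)"
    if "x \<in> carrier_vec k" "y \<in> carrier_vec k" for x y
  proof -
    have "B *\<^sub>v y \<in> carrier_vec n" using B that by simp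
    then show ?thesis using congruence_scalar_prod[OF B _ that, of "1\<^sub>m n"] by simp
  qed
  have "v = 0\<^sub>v k" if v: "v \<in> carrier_vec k" "(B\<^sup>T * (1\<^sub>m n * B)) *\<^sub>v v = 0\<^sub>v k" for v
  proof -
    have "(B *\<^sub>v v) \<bullet> (B *\<^sub>v v) = 0" using BBv[OF v(1,1)] v by simp
    moreover have "B *\<^sub>v v \<in> carrier_vec n" using B v(1) by simp
    ultimately show ?thesis using inj[OF v(1)] scalar_prod_self_eq_0 by blast
  qed
  then obtain E where E: "E \<in> carrier_mat k k" "(B\<^sup>T * (1\<^sub>m n * B)) * E = 1\<^sub>m k"
    using injective_imp_inverse[OF BB] by blast
  show ?thesis
  proof (intro exI[of _ "\<lambda>j. B *\<^sub>v (E *\<^sub>v unit_vec k j)"] allI impI conjI ballI)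
    fix j assume j: "j < k"
    have Ej: "E *\<^sub>v unit_vec k j \<in> carrier_vec k" using E(1) by simp
    show "B *\<^sub>v (E *\<^sub>v unit_vec k j) \<in> carrier_vec n" using B Ej by simp
    fix v :: "real vec" assume v: "v \<in> carrier_vec k"
    have "(B *\<^sub>v v) \<bullet> (B *\<^sub>v (E *\<^sub>v unit_vec k j)) = v \<bullet> ((B\<^sup>T * (1\<^sub>m n * B)) *\<^sub>v (E *\<^sub>v unit_vec k j))"
      using BBv[OF v Ej] by simp
    also have "(B\<^sup>T * (1\<^sub>m n * B)) *\<^sub>v (E *\<^sub>v unit_vec k j) = unit_vec k j"
      using assoc_mult_mat_vec[OF BB E(1) unit_vec_carrier, of j] E(2) by simp
    also have "v \<bullet> unit_vec k j = v $ j" using v j by simp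
    finally show "(B *\<^sub>v v) \<bullet> (B *\<^sub>v (E *\<^sub>v unit_vec k j)) = v $ j" .
  qed
qed

text \<open>The nonnegative form at \<open>v - t z\<close> with \<open>z = Q v\<close> equals
  \<open>- 2 t |z|^2 + t^2 (z \<bullet> Q z)\<close>, which would be negative for small
  \<open>t > 0\<close> if \<open>z\<close> were not zero.\<close>

lemma psd_null_vector:
  fixes Q :: "real mat"
  assumes Q: "Q \<in> carrier_mat n n" "Q\<^sup>T = Q" and psd: "\<And>v. v \<in> carrier_vec n \<Longrightarrow> v \<bullet> (Q *\<^sub>v v) \<ge> 0"
    and v: "v \<in> carrier_vec n" "v \<bullet> (Q *\<^sub>v v) = 0"
  shows "Q *\<^sub>v v = 0\<^sub>v n"
proof -
  define z where "z = Q *\<^sub>v v"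
  have z: "z \<in> carrier_vec n" and Qz: "Q *\<^sub>v z \<in> carrier_vec n" using Q v by (simp_all add: z_def)
  have le: "2 * t * (z \<bullet> z) \<le> t\<^sup>2 * (z \<bullet> (Q *\<^sub>v z))" for t
  proof -
    have tz: "t \<cdot>\<^sub>v z \<in> carrier_vec n" using z by simp
    have "0 \<le> (v - t \<cdot>\<^sub>v z) \<bullet> (Q *\<^sub>v (v - t \<cdot>\<^sub>v z))" using v(1) tz by (intro psd) simp
    also have "Q *\<^sub>v (v - t \<cdot>\<^sub>v z) = z - t \<cdot>\<^sub>v (Q *\<^sub>v z)"
      by (simp add: mult_minus_distrib_mat_vec[OF Q(1) v(1) tz] mult_mat_vec[OF Q(1) z] z_def[symmetric])
    also have "(v - t \<cdot>\<^sub>v z) \<bullet> (z - t \<cdot>\<^sub>v (Q *\<^sub>v z)) = v \<bullet> z - t * (v \<bullet> (Q *\<^sub>v z)) - (t * (z \<bullet> z) - t * (t * (z \<bullet> (Q *\<^sub>v z))))"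
      using v(1) z Qz by (simp add: minus_scalar_prod_distrib[of _ n] scalar_prod_minus_distrib[of _ n])
    also have "v \<bullet> (Q *\<^sub>v z) = z \<bullet> z" using symmetric_scalar_prod[OF Q z v(1)] by (simp add: z_def)
    also have "v \<bullet> z = 0" using v(2) by (simp add: z_def)
    finally show ?thesis by (simp add: power2_eq_square algebra_simps)
  qed
  have "z \<bullet> z = 0"
  proof (rule ccontr)
    assume "z \<bullet> z \<noteq> 0"
    then have zz: "z \<bullet> z > 0" using scalar_prod_self_nonneg[of z] by simp
    define q where "q = z \<bullet> (Q *\<^sub>v z)"
    have q: "q \<ge> 0" unfolding q_def by (rule psd[OF z])
    \<comment> \<open>Small enough for the linear term to prevail over the quadratic one; the 1
      allows for \<open>q = 0\<close>.\<close>
    define t where "t = (z \<bullet> z) / (q + 1)"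
    have t: "t > 0" "t * q \<le> z \<bullet> z" using zz q by (simp_all add: t_def field_simps)
    have "t * (2 * (z \<bullet> z)) \<le> t * (t * q)" using le[of t] by (simp add: q_def power2_eq_square algebra_simps)
    then have "2 * (z \<bullet> z) \<le> t * q" using t(1) by simp
    then show False using t(2) zz by simp
  qed
  then show ?thesis using scalar_prod_self_eq_0[OF z] by (simp add: z_def)
qed

text \<open>The vector form of the hypotheses on the bases: the columns of \<open>G\<close> span the kernel of \<open>Q\<close>, those of
  \<open>V1\<close> its intersection with the \<open>A\<close>-orthogonal complement of that kernel, and the columns of \<open>V3\<close> span the
  orthogonal complement of \<open>V1\<close> and \<open>A G\<close>.\<close>

locale kinetic_pencil =
  fixes N p k r :: nat and A Q G V1 V3 :: "real mat"
  assumes A: "A \<in> carrier_mat N N" "A\<^sup>T = A"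
    and Q: "Q \<in> carrier_mat N N" "Q\<^sup>T = Q"
    and Q_nonneg: "\<And>v. v \<in> carrier_vec N \<Longrightarrow> v \<bullet> (Q *\<^sub>v v) \<ge> 0"
    and null_AQ: "\<And>v. v \<in> carrier_vec N \<Longrightarrow> A *\<^sub>v v = 0\<^sub>v N \<Longrightarrow> Q *\<^sub>v v = 0\<^sub>v N \<Longrightarrow> v = 0\<^sub>v N"
    and G: "G \<in> carrier_mat N p"
    and G_inj: "\<And>c. c \<in> carrier_vec p \<Longrightarrow> G *\<^sub>v c = 0\<^sub>v N \<Longrightarrow> c = 0\<^sub>v p"
    and QG: "\<And>c. c \<in> carrier_vec p \<Longrightarrow> Q *\<^sub>v (G *\<^sub>v c) = 0\<^sub>v N"
    and Q_null: "\<And>v. v \<in> carrier_vec N \<Longrightarrow> Q *\<^sub>v v = 0\<^sub>v N \<Longrightarrow> \<exists>c\<in>carrier_vec p. v = G *\<^sub>v c"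
    and V1: "V1 \<in> carrier_mat N r"
    and V1_inj: "\<And>d. d \<in> carrier_vec r \<Longrightarrow> V1 *\<^sub>v d = 0\<^sub>v N \<Longrightarrow> d = 0\<^sub>v r"
    and V1_G: "\<And>d. d \<in> carrier_vec r \<Longrightarrow> \<exists>c\<in>carrier_vec p. V1 *\<^sub>v d = G *\<^sub>v c"
    and G_A_V1: "\<And>c d. c \<in> carrier_vec p \<Longrightarrow> d \<in> carrier_vec r \<Longrightarrow> (G *\<^sub>v c) \<bullet> (A *\<^sub>v (V1 *\<^sub>v d)) = 0"
    and G_null: "\<And>c. c \<in> carrier_vec p \<Longrightarrow> (\<And>c'. c' \<in> carrier_vec p \<Longrightarrow> (G *\<^sub>v c') \<bullet> (A *\<^sub>v (G *\<^sub>v c)) = 0) \<Longrightarrow>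
      \<exists>d\<in>carrier_vec r. G *\<^sub>v c = V1 *\<^sub>v d"
    and V3: "V3 \<in> carrier_mat N k"
    and V3_inj: "\<And>u. u \<in> carrier_vec k \<Longrightarrow> V3 *\<^sub>v u = 0\<^sub>v N \<Longrightarrow> u = 0\<^sub>v k"
    and V3_A_G: "\<And>u c. u \<in> carrier_vec k \<Longrightarrow> c \<in> carrier_vec p \<Longrightarrow> (V3 *\<^sub>v u) \<bullet> (A *\<^sub>v (G *\<^sub>v c)) = 0"
    and V3_V1: "\<And>u d. u \<in> carrier_vec k \<Longrightarrow> d \<in> carrier_vec r \<Longrightarrow> (V3 *\<^sub>v u) \<bullet> (V1 *\<^sub>v d) = 0"
    and complement: "\<And>v. v \<in> carrier_vec N \<Longrightarrow> (\<And>u. u \<in> carrier_vec k \<Longrightarrow> (V3 *\<^sub>v u) \<bullet> v = 0) \<Longrightarrow>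
      (\<And>d. d \<in> carrier_vec r \<Longrightarrow> (V1 *\<^sub>v d) \<bullet> v = 0) \<Longrightarrow> \<exists>c\<in>carrier_vec p. v = A *\<^sub>v (G *\<^sub>v c)"
begin

lemma Av [simp]: "v \<in> carrier_vec N \<Longrightarrow> A *\<^sub>v v \<in> carrier_vec N" using A by simp
lemma Qv [simp]: "v \<in> carrier_vec N \<Longrightarrow> Q *\<^sub>v v \<in> carrier_vec N" using Q by simp
lemma Gv [simp]: "v \<in> carrier_vec p \<Longrightarrow> G *\<^sub>v v \<in> carrier_vec N" using G by simp
lemma V1v [simp]: "v \<in> carrier_vec r \<Longrightarrow> V1 *\<^sub>v v \<in> carrier_vec N" using V1 by simp
lemma V3v [simp]: "v \<in> carrier_vec k \<Longrightarrow> V3 *\<^sub>v v \<in> carrier_vec N" using V3 by simp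

lemma A_sym: "x \<in> carrier_vec N \<Longrightarrow> y \<in> carrier_vec N \<Longrightarrow> y \<bullet> (A *\<^sub>v x) = x \<bullet> (A *\<^sub>v y)"
  by (rule symmetric_scalar_prod[OF A])

lemma Q_sym: "x \<in> carrier_vec N \<Longrightarrow> y \<in> carrier_vec N \<Longrightarrow> y \<bullet> (Q *\<^sub>v x) = x \<bullet> (Q *\<^sub>v y)"
  by (rule symmetric_scalar_prod[OF Q])

lemma QV1: "d \<in> carrier_vec r \<Longrightarrow> Q *\<^sub>v (V1 *\<^sub>v d) = 0\<^sub>v N"
  using V1_G QG by fastforce

text \<open>A null vector of the form in the range of \<open>V3\<close> would be some
  \<open>G c\<close>. Orthogonality of \<open>V3\<close> to \<open>A G\<close> puts it into the
  range of \<open>V1\<close>, and orthogonality of \<open>V3\<close> to \<open>V1\<close> then makes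
  it orthogonal to itself.\<close>

lemma V3_Q_pos:
  assumes u: "u \<in> carrier_vec k" "u \<noteq> 0\<^sub>v k"
  shows "(V3 *\<^sub>v u) \<bullet> (Q *\<^sub>v (V3 *\<^sub>v u)) > 0"
proof (rule ccontr)
  assume "\<not> (V3 *\<^sub>v u) \<bullet> (Q *\<^sub>v (V3 *\<^sub>v u)) > 0"
  then have "(V3 *\<^sub>v u) \<bullet> (Q *\<^sub>v (V3 *\<^sub>v u)) = 0" using Q_nonneg[of "V3 *\<^sub>v u"] u by simp
  then have "Q *\<^sub>v (V3 *\<^sub>v u) = 0\<^sub>v N" using u by (intro psd_null_vector[OF Q Q_nonneg]) simp_all
  then obtain c where c: "c \<in> carrier_vec p" "V3 *\<^sub>v u = G *\<^sub>v c" using Q_null u by (metis V3v)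
  have "(G *\<^sub>v c') \<bullet> (A *\<^sub>v (G *\<^sub>v c)) = 0" if "c' \<in> carrier_vec p" for c'
    using V3_A_G[OF u(1) that] A_sym[of "G *\<^sub>v c" "G *\<^sub>v c'"] c that by simp
  then obtain d where d: "d \<in> carrier_vec r" "G *\<^sub>v c = V1 *\<^sub>v d" using G_null[OF c(1)] by blast
  have "(V3 *\<^sub>v u) \<bullet> (V3 *\<^sub>v u) = 0" using V3_V1[OF u(1) d(1)] c d by simp
  then have "V3 *\<^sub>v u = 0\<^sub>v N" using u by (intro scalar_prod_self_eq_0) simp_all
  then show False using V3_inj u by blast
qed

lemma AG_inj:
  assumes "c \<in> carrier_vec p" "A *\<^sub>v (G *\<^sub>v c) = 0\<^sub>v N" shows "c = 0\<^sub>v p"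
  using null_AQ[of "G *\<^sub>v c"] QG G_inj assms by simp

lemma AV1_inj:
  assumes "d \<in> carrier_vec r" "A *\<^sub>v (V1 *\<^sub>v d) = 0\<^sub>v N" shows "d = 0\<^sub>v r"
  using null_AQ[of "V1 *\<^sub>v d"] QV1 V1_inj assms by simp

text \<open>Row \<open>i\<close> of the transformed system is its product with the test vector
  \<open>s i\<close>, and the trial vector \<open>t j\<close> carries the unknown
  \<open>w j\<close>. The last clause makes the test vectors complete, so that vectors of the
  original space can be compared row by row.\<close>

definition triangularizing ::
  "nat \<Rightarrow> (nat \<Rightarrow> real vec) \<Rightarrow> (nat \<Rightarrow> real vec) \<Rightarrow> (nat \<Rightarrow> real) \<Rightarrow> (nat \<Rightarrow> real) \<Rightarrow> bool" where
  "triangularizing d s t e f \<longleftrightarrow>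
     (\<forall>i<d. s i \<in> carrier_vec N \<and> t i \<in> carrier_vec N) \<and>
     (\<forall>i<d. \<forall>j<d. s i \<bullet> (A *\<^sub>v t j) = (if i = j then e i else 0)) \<and>
     (\<forall>i<d. \<forall>j<d. i \<le> j \<longrightarrow> s i \<bullet> (Q *\<^sub>v t j) = (if i = j then f i else 0)) \<and>
     (\<forall>v\<in>carrier_vec N. (\<forall>i<d. s i \<bullet> v = 0) \<longrightarrow> v = 0\<^sub>v N)"

text \<open>Test vectors are \<open>G\<close>, corrected eigenvectors in the range of
  \<open>V3\<close> and a dual family of \<open>A V1\<close>; trial vectors are a dual family of
  \<open>A G\<close>, the eigenvectors and \<open>V1\<close>. Since \<open>Q\<close> vanishes on
  \<open>G\<close> and \<open>V1\<close>, its first rows and last columns are zero, which is the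
  lower triangular form. Corrections by multiples of \<open>G\<close> in the rows and of
  \<open>V1\<close> in the columns clear the remaining entries of \<open>A\<close> and do not change
  those of \<open>Q\<close>.\<close>

lemma triangularizing_exists:
  "\<exists>s t c \<mu>.
     triangularizing (p + k + r) s t
       (\<lambda>i. if i < p then 1 else if i < p + k then \<mu> (i - p) else 1) (\<lambda>i. if p \<le> i \<and> i < p + k then 1 else 0) \<and>
     (\<forall>i<k. c i \<in> carrier_vec k) \<and>
     (\<forall>i<k. \<forall>j<k. (V3 *\<^sub>v c i) \<bullet> (Q *\<^sub>v (V3 *\<^sub>v c j)) = (if i = j then 1 else 0)) \<and>
     (\<forall>i<k. \<forall>j<k. (V3 *\<^sub>v c i) \<bullet> (A *\<^sub>v (V3 *\<^sub>v c j)) = (if i = j then \<mu> i else 0)) \<and>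
     (\<forall>u\<in>carrier_vec k. (\<forall>i<k. c i \<bullet> u = 0) \<longrightarrow> u = 0\<^sub>v k)"
proof -
  define A' where "A' = V3\<^sup>T * (A * V3)"
  define Q' where "Q' = V3\<^sup>T * (Q * V3)"
  note A' = congruence_symmetric[OF V3 A, folded A'_def]
  note Q' = congruence_symmetric[OF V3 Q, folded Q'_def]
  have A'v: "x \<bullet> (A' *\<^sub>v y) = (V3 *\<^sub>v x) \<bullet> (A *\<^sub>v (V3 *\<^sub>v y))" if "x \<in> carrier_vec k" "y \<in> carrier_vec k" for x y
    unfolding A'_def by (rule congruence_scalar_prod[OF V3 A(1) that])
  have Q'v: "x \<bullet> (Q' *\<^sub>v y) = (V3 *\<^sub>v x) \<bullet> (Q *\<^sub>v (V3 *\<^sub>v y))" if "x \<in> carrier_vec k" "y \<in> carrier_vec k" for x y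
    unfolding Q'_def by (rule congruence_scalar_prod[OF V3 Q(1) that])
  have "pos_def Q'"
    unfolding pos_def_def
  proof (intro conjI ballI impI)
    fix u :: "real vec" assume "u \<in> carrier_vec (dim_row Q')" "u \<noteq> 0\<^sub>v (dim_row Q')"
    then have "u \<in> carrier_vec k" "u \<noteq> 0\<^sub>v k" using Q'(1) by simp_all
    then show "0 < u \<bullet> (Q' *\<^sub>v u)" using V3_Q_pos Q'v by simp
  qed (rule Q'(2))
  from symmetric_pencil_diagonalizable[OF A' Q'(1) this] obtain c \<mu> where
    c: "\<And>i. i < k \<Longrightarrow> c i \<in> carrier_vec k"
    and cQ: "\<And>i j. i < k \<Longrightarrow> j < k \<Longrightarrow> c i \<bullet> (Q' *\<^sub>v c j) = (if i = j then 1 else 0)"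
    and cA: "\<And>i j. i < k \<Longrightarrow> j < k \<Longrightarrow> c i \<bullet> (A' *\<^sub>v c j) = (if i = j then \<mu> i else 0)" by blast
  define x where "x i = V3 *\<^sub>v c i" for i
  have x: "x i \<in> carrier_vec N" if "i < k" for i using c[OF that] by (simp add: x_def)
  have xQ: "x i \<bullet> (Q *\<^sub>v x j) = (if i = j then 1 else 0)" if "i < k" "j < k" for i j
    using cQ[OF that] Q'v c that by (simp add: x_def)
  have xA: "x i \<bullet> (A *\<^sub>v x j) = (if i = j then \<mu> i else 0)" if "i < k" "j < k" for i j
    using cA[OF that] A'v c that by (simp add: x_def)
  \<comment> \<open>\<open>Q'\<close>-orthonormality says that the matrix with rows
    \<open>c i\<close> has the matrix with columns \<open>Q' c j\<close> as right inverse; for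
    square matrices it is then also a left inverse.\<close>
  have c_span: "u = 0\<^sub>v k" if u: "u \<in> carrier_vec k" "\<forall>i<k. c i \<bullet> u = 0" for u
  proof -
    define R where "R = mat_of_rows k (map c [0..<k])"
    define S where "S = mat_of_cols k (map (\<lambda>j. Q' *\<^sub>v c j) [0..<k])"
    have R: "R \<in> carrier_mat k k" and S: "S \<in> carrier_mat k k" unfolding R_def S_def carrier_mat_def by simp_all
    have rR: "row R i = c i" if "i < k" for i using c[OF that] that by (simp add: R_def)
    have cS: "col S j = Q' *\<^sub>v c j" if "j < k" for j using c[OF that] that Q'(1) by (simp add: S_def)
    have RS: "R * S = 1\<^sub>m k"
      using R S by (intro eq_matI) (simp_all add: rR cS cQ)
    have SR: "S * R = 1\<^sub>m k" by (rule mat_mult_left_right_inverse[OF R S RS])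
    have "R *\<^sub>v u = 0\<^sub>v k" using R u by (intro eq_vecI) (simp_all add: rR)
    then have "S *\<^sub>v (R *\<^sub>v u) = 0\<^sub>v k" using mult_mat_zero_vec[OF S] by simp
    then show "u = 0\<^sub>v k" using assoc_mult_mat_vec[OF S R u(1)] SR u(1) by simp
  qed
  have AG: "A * G \<in> carrier_mat N p" and AV1: "A * V1 \<in> carrier_mat N r" using A G V1 by auto
  have AGv: "(A * G) *\<^sub>v v = A *\<^sub>v (G *\<^sub>v v)" if "v \<in> carrier_vec p" for v using assoc_mult_mat_vec[OF A(1) G that] .
  have AV1v: "(A * V1) *\<^sub>v v = A *\<^sub>v (V1 *\<^sub>v v)" if "v \<in> carrier_vec r" for v using assoc_mult_mat_vec[OF A(1) V1 that] .
  obtain \<tau> where \<tau>: "\<And>j. j < p \<Longrightarrow> \<tau> j \<in> carrier_vec N"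
    and \<tau>G: "\<And>j v. j < p \<Longrightarrow> v \<in> carrier_vec p \<Longrightarrow> (A *\<^sub>v (G *\<^sub>v v)) \<bullet> \<tau> j = v $ j"
    using dual_family_exists[OF AG] AG_inj AGv by (metis (no_types, lifting))
  obtain \<sigma> where \<sigma>: "\<And>j. j < r \<Longrightarrow> \<sigma> j \<in> carrier_vec N"
    and \<sigma>V: "\<And>j v. j < r \<Longrightarrow> v \<in> carrier_vec r \<Longrightarrow> (A *\<^sub>v (V1 *\<^sub>v v)) \<bullet> \<sigma> j = v $ j"
    using dual_family_exists[OF AV1] AV1_inj AV1v by (metis (no_types, lifting))
  have GA\<tau>: "(G *\<^sub>v v) \<bullet> (A *\<^sub>v \<tau> j) = v $ j" if "j < p" "v \<in> carrier_vec p" for j v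
    using \<tau>G[OF that] A_sym[OF \<tau>[OF that(1)] Gv[OF that(2)]] comm_scalar_prod[of "A *\<^sub>v (G *\<^sub>v v)" N "\<tau> j"] \<tau>[OF that(1)] that(2)
    by simp
  have \<sigma>AV: "\<sigma> j \<bullet> (A *\<^sub>v (V1 *\<^sub>v v)) = v $ j" if "j < r" "v \<in> carrier_vec r" for j v
    using \<sigma>V[OF that] comm_scalar_prod[of "A *\<^sub>v (V1 *\<^sub>v v)" N "\<sigma> j"] \<sigma>[OF that(1)] that(2) by simp
  have G0: "(G *\<^sub>v v) \<bullet> (Q *\<^sub>v y) = 0" if "v \<in> carrier_vec p" "y \<in> carrier_vec N" for v y
    using Q_sym[OF Gv[OF that(1)] that(2)] QG[OF that(1)] that(2) by simp
  have xAG: "x i \<bullet> (A *\<^sub>v (G *\<^sub>v v)) = 0" "(G *\<^sub>v v) \<bullet> (A *\<^sub>v x i) = 0" if "i < k" "v \<in> carrier_vec p" for i v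
    using V3_A_G[OF c[OF that(1)] that(2)] A_sym[OF x[OF that(1)] Gv[OF that(2)]] by (simp_all add: x_def)
  have xAV: "x i \<bullet> (A *\<^sub>v (V1 *\<^sub>v v)) = 0" if i: "i < k" "v \<in> carrier_vec r" for i v
  proof -
    obtain w where "w \<in> carrier_vec p" "V1 *\<^sub>v v = G *\<^sub>v w" using V1_G[OF i(2)] by blast
    then show ?thesis using xAG(1)[OF i(1)] by simp
  qed
  \<comment> \<open>These coefficients make \<open>s3 i\<close> orthogonal to \<open>A\<close>
    applied to each \<open>\<tau> l\<close>, and each \<open>\<sigma> l\<close> orthogonal to
    \<open>A\<close> applied to \<open>t' y\<close>.\<close>
  define \<alpha> where "\<alpha> i = vec p (\<lambda>l. x i \<bullet> (A *\<^sub>v \<tau> l))" for i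
  define \<beta> where "\<beta> y = vec r (\<lambda>l. \<sigma> l \<bullet> (A *\<^sub>v y))" for y
  have \<alpha>\<beta>: "\<alpha> i \<in> carrier_vec p" "\<beta> y \<in> carrier_vec r" for i y by (simp_all add: \<alpha>_def \<beta>_def)
  define s3 where "s3 i = x i - G *\<^sub>v \<alpha> i" for i
  define t' where "t' y = y - V1 *\<^sub>v \<beta> y" for y
  have s3: "s3 i \<in> carrier_vec N" if "i < k" for i using x[OF that] \<alpha>\<beta> by (simp add: s3_def)
  have t': "t' y \<in> carrier_vec N" if "y \<in> carrier_vec N" for y using that \<alpha>\<beta> by (simp add: t'_def)
  have At': "A *\<^sub>v t' y = A *\<^sub>v y - A *\<^sub>v (V1 *\<^sub>v \<beta> y)" if "y \<in> carrier_vec N" for y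
    unfolding t'_def by (rule mult_minus_distrib_mat_vec[OF A(1) that V1v[OF \<alpha>\<beta>(2)]])
  have Qt': "Q *\<^sub>v t' y = Q *\<^sub>v y" if "y \<in> carrier_vec N" for y
    unfolding t'_def mult_minus_distrib_mat_vec[OF Q(1) that V1v[OF \<alpha>\<beta>(2)]] using that by (simp add: QV1[OF \<alpha>\<beta>(2)])
  have s3p: "s3 i \<bullet> y = x i \<bullet> y - (G *\<^sub>v \<alpha> i) \<bullet> y" if "i < k" "y \<in> carrier_vec N" for i y
    unfolding s3_def by (rule minus_scalar_prod_distrib[OF x[OF that(1)] Gv[OF \<alpha>\<beta>(1)] that(2)])
  have pt': "z \<bullet> (A *\<^sub>v t' y) = z \<bullet> (A *\<^sub>v y) - z \<bullet> (A *\<^sub>v (V1 *\<^sub>v \<beta> y))"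
    if "z \<in> carrier_vec N" "y \<in> carrier_vec N" for z y
    unfolding At'[OF that(2)] by (rule scalar_prod_minus_distrib[OF that(1) Av[OF that(2)] Av[OF V1v[OF \<alpha>\<beta>(2)]]])
  have GAt': "(G *\<^sub>v v) \<bullet> (A *\<^sub>v t' y) = (G *\<^sub>v v) \<bullet> (A *\<^sub>v y)" if "v \<in> carrier_vec p" "y \<in> carrier_vec N" for v y
    using pt'[OF Gv[OF that(1)] that(2)] G_A_V1[OF that(1) \<alpha>\<beta>(2)] by simp
  have xAt': "x i \<bullet> (A *\<^sub>v t' y) = x i \<bullet> (A *\<^sub>v y)" if "i < k" "y \<in> carrier_vec N" for i y
    using pt'[OF x[OF that(1)] that(2)] xAV[OF that(1) \<alpha>\<beta>(2)] by simp
  have \<sigma>At': "\<sigma> i \<bullet> (A *\<^sub>v t' y) = 0" if "i < r" "y \<in> carrier_vec N" for i y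
    using pt'[OF \<sigma>[OF that(1)] that(2)] \<sigma>AV[OF that(1) \<alpha>\<beta>(2)] that(1) by (simp add: \<beta>_def)
  \<comment> \<open>The block order is the kernel of \<open>Q\<close>, then \<open>V3\<close>, then
    \<open>V1\<close>; it makes \<open>Q\<close> lower triangular, as forward substitution
    requires.\<close>
  define s where "s i = (if i < p then G *\<^sub>v unit_vec p i else if i < p + k then s3 (i - p) else \<sigma> (i - p - k))" for i
  define t where "t i = (if i < p then t' (\<tau> i) else if i < p + k then t' (x (i - p)) else V1 *\<^sub>v unit_vec r (i - p - k))" for i
  define e where "e = (\<lambda>i. if i < p then 1 else if i < p + k then \<mu> (i - p) else (1 :: real))"
  define f where "f = (\<lambda>i. if p \<le> i \<and> i < p + k then 1 else (0 :: real))"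
  have "triangularizing (p + k + r) s t e f"
    unfolding triangularizing_def
  proof (intro conjI allI impI ballI)
    fix i assume i: "i < p + k + r"
    show "s i \<in> carrier_vec N" using i s3 \<sigma> by (simp add: s_def)
    show "t i \<in> carrier_vec N" using i t' \<tau> x by (simp add: t_def)
  next
    fix i j assume i: "i < p + k + r" and j: "j < p + k + r"
    have r': "i - p - k < r" "j - p - k < r" if "\<not> i < p + k" "\<not> j < p + k" using i j that by auto
    consider "i < p" | "p \<le> i" "i < p + k" | "p + k \<le> i" by linarith
    then show "s i \<bullet> (A *\<^sub>v t j) = (if i = j then e i else 0)"
    proof cases
      case 1
      then show ?thesis
        using j \<tau> x GA\<tau>[of j "unit_vec p i"] xAG(2)[of "j - p" "unit_vec p i"] GAt'[of "unit_vec p i"]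
          G_A_V1[of "unit_vec p i" "unit_vec r (j - p - k)"]
        by (auto simp: s_def t_def e_def)
    next
      case 2
      then have ip: "i - p < k" by linarith
      consider "j < p" | "p \<le> j" "j < p + k" | "p + k \<le> j" by linarith
      then show ?thesis
      proof cases
        case 1
        then show ?thesis using 2 ip \<tau> s3p[OF ip, of "A *\<^sub>v t' (\<tau> j)"] t' GAt'[OF \<alpha>\<beta>(1)] xAt'[OF ip] GA\<tau>[OF _ \<alpha>\<beta>(1)]
          by (auto simp: s_def t_def e_def \<alpha>_def)
      next
        case j2: 2
        then have jp: "j - p < k" by linarith
        have "s3 (i - p) \<bullet> (A *\<^sub>v t' (x (j - p))) = (if i - p = j - p then \<mu> (i - p) else 0)"
          using s3p[OF ip] t' x[OF jp] GAt'[OF \<alpha>\<beta>(1)] xAt'[OF ip] xAG(2)[OF jp \<alpha>\<beta>(1)] xA[OF ip jp] by simp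
        then show ?thesis using 2 j2 by (auto simp: s_def t_def e_def)
      next
        case 3
        then have "s3 (i - p) \<bullet> (A *\<^sub>v (V1 *\<^sub>v unit_vec r (j - p - k))) = 0"
          using s3p[OF ip] xAV[OF ip] G_A_V1[OF \<alpha>\<beta>(1)] by simp
        then show ?thesis using 2 3 by (auto simp: s_def t_def e_def)
      qed
    next
      case 3
      then have ir: "i - p - k < r" using i by linarith
      show ?thesis
      proof (cases "j < p + k")
        case True
        then have "\<sigma> (i - p - k) \<bullet> (A *\<^sub>v t j) = 0"
          using \<sigma>At'[OF ir] \<tau> x by (auto simp: t_def)
        then show ?thesis using 3 True by (auto simp: s_def)
      next
        case False
        then have "\<sigma> (i - p - k) \<bullet> (A *\<^sub>v (V1 *\<^sub>v unit_vec r (j - p - k))) = (if i - p - k = j - p - k then 1 else 0)"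
          using \<sigma>AV[OF ir, of "unit_vec r (j - p - k)"] ir j by auto
        then show ?thesis using 3 False by (auto simp: s_def t_def e_def)
      qed
    qed
  next
    fix i j assume i: "i < p + k + r" and j: "j < p + k + r" and ij: "i \<le> j"
    have tj: "t j \<in> carrier_vec N" using j t' \<tau> x by (simp add: t_def)
    consider "i < p" | "p \<le> i" "i < p + k" | "p + k \<le> i" by linarith
    then show "s i \<bullet> (Q *\<^sub>v t j) = (if i = j then f i else 0)"
    proof cases
      case 1
      then show ?thesis using G0[OF _ tj, of "unit_vec p i"] by (simp add: s_def f_def)
    next
      case 2
      then have ip: "i - p < k" by linarith
      show ?thesis
      proof (cases "j < p + k")
        case True
        then have jp: "j - p < k" "\<not> j < p" using ij 2 by linarith+
        have "s3 (i - p) \<bullet> (Q *\<^sub>v t' (x (j - p))) = (if i - p = j - p then 1 else 0)"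
          using s3p[OF ip] Qt'[OF x[OF jp(1)]] G0[OF \<alpha>\<beta>(1) x[OF jp(1)]] xQ[OF ip jp(1)] x[OF jp(1)] by simp
        then show ?thesis using 2 True jp ij by (auto simp: s_def t_def f_def)
      next
        case False
        then have "Q *\<^sub>v t j = 0\<^sub>v N" using QV1 by (simp add: t_def)
        then show ?thesis using 2 False s3[OF ip] by (auto simp: s_def)
      qed
    next
      case 3
      then have "Q *\<^sub>v t j = 0\<^sub>v N" using QV1 ij by (simp add: t_def)
      moreover have "i - p - k < r" using i 3 by linarith
      ultimately show ?thesis using 3 \<sigma>[of "i - p - k"] by (simp add: s_def f_def)
    qed
  next
    fix v assume v: "v \<in> carrier_vec N" and s0: "\<forall>i<p + k + r. s i \<bullet> v = 0"
    have Gv0: "(G *\<^sub>v w) \<bullet> v = 0" if w: "w \<in> carrier_vec p" for w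
    proof -
      have GT: "G\<^sup>T *\<^sub>v v = 0\<^sub>v p"
      proof (rule eq_vecI)
        fix i assume "i < dim_vec (0\<^sub>v p :: real vec)"
        then have i: "i < p" by simp
        have "(G\<^sup>T *\<^sub>v v) \<bullet> unit_vec p i = v \<bullet> (G *\<^sub>v unit_vec p i)"
          by (rule transpose_vec_mult_scalar[OF G unit_vec_carrier v])
        also have "\<dots> = (G *\<^sub>v unit_vec p i) \<bullet> v" by (rule comm_scalar_prod[OF v]) simp
        also have "\<dots> = 0" using s0[rule_format, of i] i by (simp add: s_def)
        finally have "(G\<^sup>T *\<^sub>v v) \<bullet> unit_vec p i = 0" .
        moreover have "G\<^sup>T *\<^sub>v v \<in> carrier_vec p" using G v by simp
        ultimately show "(G\<^sup>T *\<^sub>v v) $ i = 0\<^sub>v p $ i" using i by (simp only: scalar_prod_right_unit index_zero_vec)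
      qed (use G in simp)
      have "(G *\<^sub>v w) \<bullet> v = v \<bullet> (G *\<^sub>v w)" by (rule comm_scalar_prod[OF _ v]) (simp add: w)
      also have "\<dots> = (G\<^sup>T *\<^sub>v v) \<bullet> w" by (rule scalar_prod_mult_mat_vec[OF G w v])
      finally show ?thesis using GT w by simp
    qed
    have xv: "x i \<bullet> v = 0" if "i < k" for i
      using s0[rule_format, of "p + i"] s3p[OF that v] Gv0[OF \<alpha>\<beta>(1)] that by (simp add: s_def)
    have V3T: "V3\<^sup>T *\<^sub>v v \<in> carrier_vec k" using V3 v by simp
    have V3v0: "(V3 *\<^sub>v u) \<bullet> v = u \<bullet> (V3\<^sup>T *\<^sub>v v)" if "u \<in> carrier_vec k" for u
    proof -
      have "(V3 *\<^sub>v u) \<bullet> v = v \<bullet> (V3 *\<^sub>v u)" by (rule comm_scalar_prod[OF _ v]) (simp add: that)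
      also have "\<dots> = (V3\<^sup>T *\<^sub>v v) \<bullet> u" by (rule scalar_prod_mult_mat_vec[OF V3 that v])
      finally show ?thesis using comm_scalar_prod[OF V3T that] by simp
    qed
    have "V3\<^sup>T *\<^sub>v v = 0\<^sub>v k"
    proof (rule c_span[OF V3T], intro allI impI)
      fix i assume "i < k"
      then show "c i \<bullet> (V3\<^sup>T *\<^sub>v v) = 0" using xv[of i] V3v0[OF c[of i]] by (simp add: x_def)
    qed
    then have "(V3 *\<^sub>v u) \<bullet> v = 0" if "u \<in> carrier_vec k" for u using V3v0[OF that] that by simp
    moreover have "(V1 *\<^sub>v d) \<bullet> v = 0" if "d \<in> carrier_vec r" for d using V1_G[OF that] Gv0 by fastforce
    \<comment> \<open>The complement clause leaves \<open>v\<close> in the range of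
      \<open>A G\<close>. Orthogonality to \<open>G\<close> turns \<open>G w\<close> into some
      \<open>V1 d\<close>, and the dual family \<sigma> then reads off \<open>d = 0\<close>.\<close>
    ultimately obtain w where w: "w \<in> carrier_vec p" "v = A *\<^sub>v (G *\<^sub>v w)" using complement[OF v] by blast
    obtain d where d: "d \<in> carrier_vec r" "G *\<^sub>v w = V1 *\<^sub>v d" using G_null[OF w(1)] Gv0 w(2) by blast
    have "d = 0\<^sub>v r"
    proof (rule eq_vecI)
      fix i assume "i < dim_vec (0\<^sub>v r :: real vec)"
      then have i: "i < r" by simp
      have "\<sigma> i \<bullet> v = 0" using s0[rule_format, of "p + k + i"] i by (simp add: s_def)
      then show "d $ i = 0\<^sub>v r $ i" using \<sigma>AV[OF i d(1)] w(2) d(2) i by simp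
    qed (use d in simp)
    then show "v = 0\<^sub>v N" using w(2) d(2) mult_mat_zero_vec[OF V1] mult_mat_zero_vec[OF A(1)] by simp
  qed
  then show ?thesis
    unfolding e_def f_def using c xQ xA c_span by (intro exI[of _ s] exI[of _ t] exI[of _ c] exI[of _ \<mu>]) (simp add: x_def)
qed

end

section \<open>Solutions of the half-space problem\<close>

text \<open>Each component is dominated by the vector, and the squared length is a finite sum of
  squared components, so questions on vector norms reduce to scalar ones.\<close>

lemma weighted_L2_iff:
  "weighted_L2 d a h \<longleftrightarrow> (\<forall>y\<ge>0. h y \<in> carrier_vec d) \<and> (\<forall>i<d. wL2 a (\<lambda>y. h y $ i))"
proof (cases "\<forall>y\<ge>0. h y \<in> carrier_vec d")
  case True
  have eq: "exp (2 * a * y) * (h y \<bullet> h y) = (\<Sum>i<d. exp (2 * a * y) * (h y $ i)\<^sup>2)" if "y \<ge> 0" for y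
    using True[rule_format, OF that, THEN carrier_vecD]
    by (simp add: scalar_prod_def sum_distrib_left atLeast0LessThan power2_eq_square)
  have int_eq: "integrable (lebesgue_on {0..}) (\<lambda>y. exp (2 * a * y) * (h y \<bullet> h y)) \<longleftrightarrow>
      integrable (lebesgue_on {0..}) (\<lambda>y. \<Sum>i<d. exp (2 * a * y) * (h y $ i)\<^sup>2)"
    by (intro Bochner_Integration.integrable_cong refl) (simp add: eq)
  show ?thesis
  proof
    assume L: "weighted_L2 d a h"
    have "wL2 a (\<lambda>y. h y $ i)" if i: "i < d" for i
    proof (rule wL2_dominated(1))
      show "(\<lambda>y. h y $ i) \<in> borel_measurable (lebesgue_on {0..})" using L i unfolding weighted_L2_def by blast
      show "integrable (lebesgue_on {0..}) (\<lambda>y. \<Sum>i<d. exp (2 * a * y) * (h y $ i)\<^sup>2)"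
        using L int_eq unfolding weighted_L2_def by blast
      show "exp (2 * a * y) * (h y $ i)\<^sup>2 \<le> (\<Sum>i<d. exp (2 * a * y) * (h y $ i)\<^sup>2)" for y
        using i by (intro member_le_sum) simp_all
    qed
    then show "(\<forall>y\<ge>0. h y \<in> carrier_vec d) \<and> (\<forall>i<d. wL2 a (\<lambda>y. h y $ i))" using True by simp
  next
    assume R: "(\<forall>y\<ge>0. h y \<in> carrier_vec d) \<and> (\<forall>i<d. wL2 a (\<lambda>y. h y $ i))"
    then have "integrable (lebesgue_on {0..}) (\<lambda>y. \<Sum>i<d. exp (2 * a * y) * (h y $ i)\<^sup>2)"
      by (intro Bochner_Integration.integrable_sum) (simp add: wL2_def)
    then show "weighted_L2 d a h" using R int_eq unfolding weighted_L2_def wL2_def by blast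
  qed
qed (auto simp: weighted_L2_def)

lemma weighted_norm_power2:
  assumes "weighted_L2 d a h"
  shows "(weighted_norm a h)\<^sup>2 = (\<Sum>i<d. wsq a (\<lambda>y. h y $ i))"
proof -
  have car: "\<forall>y\<ge>0. h y \<in> carrier_vec d" and L: "\<And>i. i < d \<Longrightarrow> wL2 a (\<lambda>y. h y $ i)"
    using assms unfolding weighted_L2_iff by blast+
  have "(LINT y|lebesgue_on {0..}. exp (2 * a * y) * (h y \<bullet> h y)) = (LINT y|lebesgue_on {0..}. (\<Sum>i<d. exp (2 * a * y) * (h y $ i)\<^sup>2))"
    using car[rule_format, THEN carrier_vecD] by (intro Bochner_Integration.integral_cong refl)
      (simp add: scalar_prod_def sum_distrib_left atLeast0LessThan power2_eq_square)
  also have "\<dots> = (\<Sum>i<d. wsq a (\<lambda>y. h y $ i))"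
    unfolding wsq_def using L by (intro Bochner_Integration.integral_sum) (simp add: wL2_def)
  finally show ?thesis
    unfolding weighted_norm_def by (simp add: sum_nonneg wsq_nonneg)
qed

lemma weighted_norm_nonneg: "weighted_norm a h \<ge> 0"
  unfolding weighted_norm_def by (simp add: integral_nonneg_AE scalar_prod_self_nonneg)

text \<open>Indexed by numbers with an explicit dimension, so that repeated vectors and the empty
  family are allowed.\<close>

definition lincomb :: "nat \<Rightarrow> nat \<Rightarrow> (nat \<Rightarrow> real vec) \<Rightarrow> (nat \<Rightarrow> real) \<Rightarrow> real vec" where
  "lincomb n d t c = vec n (\<lambda>l. \<Sum>i<d. c i * t i $ l)"

lemma lincomb_carrier [simp]: "lincomb n d t c \<in> carrier_vec n"
  by (simp add: lincomb_def)

lemma index_lincomb [simp]: "l < n \<Longrightarrow> lincomb n d t c $ l = (\<Sum>i<d. c i * t i $ l)"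
  by (simp add: lincomb_def)

lemma scalar_prod_lincomb:
  assumes "v \<in> carrier_vec n" "\<And>i. i < d \<Longrightarrow> t i \<in> carrier_vec n"
  shows "v \<bullet> lincomb n d t c = (\<Sum>i<d. c i * (v \<bullet> t i))"
proof -
  have "v \<bullet> lincomb n d t c = (\<Sum>l<n. \<Sum>i<d. v $ l * (c i * t i $ l))"
    by (simp add: scalar_prod_def lincomb_def atLeast0LessThan sum_distrib_left)
  also have "\<dots> = (\<Sum>i<d. \<Sum>l<n. v $ l * (c i * t i $ l))" by (rule sum.swap)
  also have "\<dots> = (\<Sum>i<d. c i * (v \<bullet> t i))"
  proof (intro sum.cong refl)
    fix i assume "i \<in> {..<d}"
    then have "dim_vec (t i) = n" using assms(2) by auto
    then show "(\<Sum>l<n. v $ l * (c i * t i $ l)) = c i * (v \<bullet> t i)"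
      by (simp add: scalar_prod_def atLeast0LessThan sum_distrib_left algebra_simps)
  qed
  finally show ?thesis .
qed

lemma mult_mat_lincomb:
  assumes B: "B \<in> carrier_mat n' n" and t: "\<And>i. i < d \<Longrightarrow> t i \<in> carrier_vec n"
  shows "B *\<^sub>v lincomb n d t c = lincomb n' d (\<lambda>i. B *\<^sub>v t i) c"
proof (rule eq_vecI)
  fix l assume "l < dim_vec (lincomb n' d (\<lambda>i. B *\<^sub>v t i) c)"
  then have l: "l < n'" by (simp add: lincomb_def)
  have "row B l \<in> carrier_vec n" using B l by simp
  then show "(B *\<^sub>v lincomb n d t c) $ l = lincomb n' d (\<lambda>i. B *\<^sub>v t i) c $ l"
    using l B by (simp add: scalar_prod_lincomb t)
qed (use B in \<open>simp add: lincomb_def\<close>)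

lemma wL2_lincomb:
  assumes "\<And>i. i < d \<Longrightarrow> wL2 a (w i)"
  shows "wL2 a (\<lambda>y. \<Sum>i<d. w i y * c i)"
    "wsq a (\<lambda>y. \<Sum>i<d. w i y * c i) \<le> 2 ^ d * (\<Sum>i<d. (c i)\<^sup>2) * (\<Sum>i<d. wsq a (w i))"
proof -
  have L: "wL2 a (\<lambda>y. w i y * c i)" "wsq a (\<lambda>y. w i y * c i) = (c i)\<^sup>2 * wsq a (w i)" if "i < d" for i
    using wL2_cmult[OF assms[OF that], of "c i"] by (simp_all add: mult.commute)
  show "wL2 a (\<lambda>y. \<Sum>i<d. w i y * c i)" using L by (intro wL2_sum) simp_all
  have "wsq a (\<lambda>y. \<Sum>i<d. w i y * c i) \<le> 2 ^ card {..<d} * (\<Sum>i<d. wsq a (\<lambda>y. w i y * c i))"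
    using L by (intro wL2_sum) simp_all
  also have "(\<Sum>i<d. wsq a (\<lambda>y. w i y * c i)) \<le> (\<Sum>i<d. (\<Sum>i<d. (c i)\<^sup>2) * wsq a (w i))"
  proof (rule sum_mono)
    fix i assume i: "i \<in> {..<d}"
    have "(c i)\<^sup>2 \<le> (\<Sum>i<d. (c i)\<^sup>2)" using i by (intro member_le_sum) simp_all
    then show "wsq a (\<lambda>y. w i y * c i) \<le> (\<Sum>i<d. (c i)\<^sup>2) * wsq a (w i)"
      using L(2)[of i] i by (simp add: mult_right_mono wsq_nonneg)
  qed
  finally show "wsq a (\<lambda>y. \<Sum>i<d. w i y * c i) \<le> 2 ^ d * (\<Sum>i<d. (c i)\<^sup>2) * (\<Sum>i<d. wsq a (w i))"
    by (simp only: card_lessThan sum_distrib_left[symmetric] mult.assoc) simp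
qed

lemma scalar_prod_uminus_right: "(v :: real vec) \<bullet> (- w) = - (v \<bullet> w)"
  by (simp add: scalar_prod_def sum_negf[symmetric])

context kinetic_pencil
begin

text \<open>Rows with \<open>e i = 0\<close> carry the algebraic constraints. A vector that meets
  them lies in the range of \<open>A\<close>, and by symmetry of \<open>A\<close> it is then
  orthogonal to the kernel of \<open>A\<close>, as the notion of solution demands at every
  point.\<close>

lemma triangularizing_range:
  assumes T: "triangularizing d s t e f" and R: "R \<in> carrier_vec N"
    and R0: "\<And>i. i < d \<Longrightarrow> e i = 0 \<Longrightarrow> s i \<bullet> R = 0"
  shows "R = A *\<^sub>v lincomb N d t (\<lambda>i. (s i \<bullet> R) / e i)"
proof -
  have st: "\<And>i. i < d \<Longrightarrow> s i \<in> carrier_vec N" "\<And>i. i < d \<Longrightarrow> t i \<in> carrier_vec N"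
    and TA: "\<And>i j. i < d \<Longrightarrow> j < d \<Longrightarrow> s i \<bullet> (A *\<^sub>v t j) = (if i = j then e i else 0)"
    and span: "\<And>v. v \<in> carrier_vec N \<Longrightarrow> (\<And>i. i < d \<Longrightarrow> s i \<bullet> v = 0) \<Longrightarrow> v = 0\<^sub>v N"
    using T unfolding triangularizing_def by blast+
  have lA: "A *\<^sub>v lincomb N d t c = lincomb N d (\<lambda>i. A *\<^sub>v t i) c" for c
    by (rule mult_mat_lincomb[OF A(1)]) (rule st(2))
  define z where "z = A *\<^sub>v lincomb N d t (\<lambda>i. (s i \<bullet> R) / e i)"
  have z: "z \<in> carrier_vec N" by (simp add: z_def)
  have "R - z = 0\<^sub>v N"
  proof (rule span)
    fix i assume i: "i < d"
    have "s i \<bullet> z = (\<Sum>j<d. (s j \<bullet> R) / e j * (s i \<bullet> (A *\<^sub>v t j)))"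
      unfolding z_def lA
      by (rule scalar_prod_lincomb[OF st(1)[OF i]]) (simp add: st)
    \<comment> \<open>If \<open>e i = 0\<close>, the quotient is 0 by the convention on division, in
      agreement with \<open>s i \<bullet> R = 0\<close>.\<close>
    also have "\<dots> = (\<Sum>j<d. if j = i then (s i \<bullet> R) / e i * e i else 0)"
      using i by (intro sum.cong) (simp_all add: TA)
    also have "\<dots> = s i \<bullet> R" using i R0[OF i] by simp
    finally show "s i \<bullet> (R - z) = 0" using scalar_prod_minus_distrib[OF st(1)[OF i] R z] by simp
  qed (use R z in simp)
  then have "R = z" using R z by (auto simp: vec_eq_iff)
  then show ?thesis by (simp add: z_def)
qed

text \<open>Writing \<open>W\<close> as the sum of the \<open>w i * t i\<close>, with forcing
  \<open>s i \<bullet> h\<close> in row \<open>i\<close>, reduces the system to the triangular one.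
  What is estimated at 0 is \<open>A W 0\<close>, since the algebraic components of
  \<open>W 0\<close> are not bounded by norms.\<close>

theorem half_line_solution_exists:
  assumes T: "triangularizing d s t e f"
    and adm: "\<And>i. i < d \<Longrightarrow> e i = 0 \<and> f i \<noteq> 0 \<or> e i \<noteq> 0 \<and> f i / e i \<noteq> a"
  shows "\<exists>C\<ge>0. \<forall>h \<theta>. weighted_L2 N a h \<longrightarrow> (\<exists>W. half_line_solution a A Q h W \<and>
     (weighted_norm a W)\<^sup>2 \<le> C * ((weighted_norm a h)\<^sup>2 + (\<Sum>i<d. (\<theta> i)\<^sup>2)) \<and>
     (\<forall>l<N. ((A *\<^sub>v W 0) $ l)\<^sup>2 \<le> C * ((weighted_norm a h)\<^sup>2 + (\<Sum>i<d. (\<theta> i)\<^sup>2))) \<and>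
     (\<forall>i<d. e i \<noteq> 0 \<and> f i / e i > a \<longrightarrow> s i \<bullet> (A *\<^sub>v W 0) = e i * \<theta> i))"
proof -
  have st: "\<And>i. i < d \<Longrightarrow> s i \<in> carrier_vec N" "\<And>i. i < d \<Longrightarrow> t i \<in> carrier_vec N"
    and TA: "\<And>i j. i < d \<Longrightarrow> j < d \<Longrightarrow> s i \<bullet> (A *\<^sub>v t j) = (if i = j then e i else 0)"
    and TQ: "\<And>i j. i < d \<Longrightarrow> j < d \<Longrightarrow> i \<le> j \<Longrightarrow> s i \<bullet> (Q *\<^sub>v t j) = (if i = j then f i else 0)"
    and span: "\<And>v. v \<in> carrier_vec N \<Longrightarrow> (\<And>i. i < d \<Longrightarrow> s i \<bullet> v = 0) \<Longrightarrow> v = 0\<^sub>v N"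
    using T unfolding triangularizing_def by blast+
  have lA: "A *\<^sub>v lincomb N d t c = lincomb N d (\<lambda>i. A *\<^sub>v t i) c" for c
    by (rule mult_mat_lincomb[OF A(1)]) (rule st(2))
  have lQ: "Q *\<^sub>v lincomb N d t c = lincomb N d (\<lambda>i. Q *\<^sub>v t i) c" for c
    by (rule mult_mat_lincomb[OF Q(1)]) (rule st(2))
  \<comment> \<open>A trial vector of an algebraic row lies in the kernel of \<open>A\<close>; hence
    \<open>A W\<close> involves the products \<open>e i * w i\<close> only.\<close>
  have At0: "A *\<^sub>v t i = 0\<^sub>v N" if i: "i < d" "e i = 0" for i
    by (rule span) (use i st TA in auto)
  define q where "q i j = s i \<bullet> (Q *\<^sub>v t j)" for i j
  have "\<exists>C\<ge>0. \<forall>\<phi> \<theta>. (\<forall>i<d. wL2 a (\<phi> i)) \<longrightarrow> (\<exists>w. \<forall>i<d.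
    solves_scalar a (e i) (f i) (\<theta> i) (\<lambda>y. \<phi> i y - (\<Sum>j<i. q i j * w j y)) (w i) \<and>
    wsq a (w i) \<le> C * (\<Sum>j<d. wsq a (\<phi> j) + (\<theta> j)\<^sup>2) \<and> (e i * w i 0)\<^sup>2 \<le> C * (\<Sum>j<d. wsq a (\<phi> j) + (\<theta> j)\<^sup>2))"
    by (rule triangular_system_solution_exists) (rule adm)
  then obtain C0 where C0: "C0 \<ge> 0" and tri: "\<forall>\<phi> \<theta>. (\<forall>i<d. wL2 a (\<phi> i)) \<longrightarrow> (\<exists>w. \<forall>i<d.
    solves_scalar a (e i) (f i) (\<theta> i) (\<lambda>y. \<phi> i y - (\<Sum>j<i. q i j * w j y)) (w i) \<and>
    wsq a (w i) \<le> C0 * (\<Sum>j<d. wsq a (\<phi> j) + (\<theta> j)\<^sup>2) \<and> (e i * w i 0)\<^sup>2 \<le> C0 * (\<Sum>j<d. wsq a (\<phi> j) + (\<theta> j)\<^sup>2))"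
    by (elim exE conjE) (rule that)
  define D where "D = (\<Sum>i<d. 2 ^ N * (\<Sum>l<N. (s i $ l)\<^sup>2))"
  have D: "D \<ge> 0" unfolding D_def by (intro sum_nonneg mult_nonneg_nonneg) simp_all
  define C1 where "C1 = C0 * (D + 1)"
  have C1: "C1 \<ge> 0" using C0 D by (simp add: C1_def)
  define K1 where "K1 = (\<Sum>l<N. 2 ^ d * (\<Sum>i<d. (t i $ l)\<^sup>2) * real d)"
  have K1: "K1 \<ge> 0" unfolding K1_def by (intro sum_nonneg mult_nonneg_nonneg) simp_all
  define K2 where "K2 = (\<Sum>l<N. \<Sum>i<d. ((A *\<^sub>v t i) $ l / e i)\<^sup>2) * real d"
  have K2: "K2 \<ge> 0" unfolding K2_def by (intro mult_nonneg_nonneg sum_nonneg) simp_all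
  define C where "C = (K1 + K2) * C1"
  show ?thesis
  proof (intro exI[of _ C] conjI allI impI)
    show "C \<ge> 0" using C1 K1 K2 by (simp add: C_def)
    fix h :: "real \<Rightarrow> real vec" and \<theta> :: "nat \<Rightarrow> real"
    assume h: "weighted_L2 N a h"
    have hc: "h y \<in> carrier_vec N" if "y \<ge> 0" for y using h that unfolding weighted_L2_iff by blast
    have hL: "wL2 a (\<lambda>y. h y $ l)" if "l < N" for l using h that unfolding weighted_L2_iff by blast
    \<comment> \<open>Written as a sum over components, so that the bound for linear combinations
      applies; it agrees with \<open>s i \<bullet> h y\<close> for \<open>y \<ge> 0\<close>, where
      \<open>h y\<close> is known to have the right dimension.\<close>
    define \<phi> where "\<phi> i y = (\<Sum>l<N. h y $ l * s i $ l)" for i y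
    have \<phi>_eq: "\<phi> i y = s i \<bullet> h y" if "i < d" "y \<ge> 0" for i y
      using hc[OF that(2)] by (simp add: \<phi>_def scalar_prod_def atLeast0LessThan mult.commute)
    have \<phi>L: "wL2 a (\<phi> i)" "wsq a (\<phi> i) \<le> 2 ^ N * (\<Sum>l<N. (s i $ l)\<^sup>2) * (weighted_norm a h)\<^sup>2" for i
      unfolding \<phi>_def weighted_norm_power2[OF h] by (rule wL2_lincomb; simp add: hL)+
    define E where "E = (weighted_norm a h)\<^sup>2 + (\<Sum>i<d. (\<theta> i)\<^sup>2)"
    have E: "E \<ge> 0" unfolding E_def by (simp add: sum_nonneg)
    have "(\<Sum>j<d. wsq a (\<phi> j) + (\<theta> j)\<^sup>2) \<le> (D + 1) * E"
    proof -
      have "(\<Sum>j<d. wsq a (\<phi> j)) \<le> D * (weighted_norm a h)\<^sup>2"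
        unfolding D_def sum_distrib_right by (intro sum_mono \<phi>L)
      then have "(\<Sum>j<d. wsq a (\<phi> j) + (\<theta> j)\<^sup>2) \<le> D * (weighted_norm a h)\<^sup>2 + (\<Sum>i<d. (\<theta> i)\<^sup>2)"
        by (simp add: sum.distrib)
      also have "\<dots> \<le> D * E + 1 * E"
        unfolding E_def using D by (intro add_mono mult_left_mono) (simp_all add: sum_nonneg)
      finally show ?thesis by (simp only: distrib_right)
    qed
    then have le: "C0 * (\<Sum>j<d. wsq a (\<phi> j) + (\<theta> j)\<^sup>2) \<le> C1 * E"
      unfolding C1_def mult.assoc by (rule mult_left_mono[OF _ C0])
    have "\<forall>i<d. wL2 a (\<phi> i)" using \<phi>L(1) by simp
    from tri[THEN spec, THEN spec, THEN mp, OF this, of \<theta>] obtain w where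
      ws: "\<forall>i<d. solves_scalar a (e i) (f i) (\<theta> i) (\<lambda>y. \<phi> i y - (\<Sum>j<i. q i j * w j y)) (w i) \<and>
        wsq a (w i) \<le> C0 * (\<Sum>j<d. wsq a (\<phi> j) + (\<theta> j)\<^sup>2) \<and> (e i * w i 0)\<^sup>2 \<le> C0 * (\<Sum>j<d. wsq a (\<phi> j) + (\<theta> j)\<^sup>2)" ..
    have w: "\<And>i. i < d \<Longrightarrow> solves_scalar a (e i) (f i) (\<theta> i) (\<lambda>y. \<phi> i y - (\<Sum>j<i. q i j * w j y)) (w i)"
      and w1: "\<And>i. i < d \<Longrightarrow> wsq a (w i) \<le> C1 * E" and w2: "\<And>i. i < d \<Longrightarrow> (e i * w i 0)\<^sup>2 \<le> C1 * E"
      using ws le by fastforce+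
    define W where "W y = lincomb N d t (\<lambda>i. w i y)" for y
    have Wc: "W y \<in> carrier_vec N" for y by (simp add: W_def)
    have wL: "wL2 a (w i)" if "i < d" for i using w[OF that] by (simp add: solves_scalar_def)
    define R where "R y = - (Q *\<^sub>v W y) + h y" for y
    have Rc: "R y \<in> carrier_vec N" if "y \<ge> 0" for y using hc[OF that] Wc by (simp add: R_def)
    \<comment> \<open>The right-hand side of row \<open>i\<close>; it equals the product of
      \<open>s i\<close> with the right-hand side of the original system.\<close>
    define \<rho> where "\<rho> i y = \<phi> i y - (\<Sum>j<i. q i j * w j y) - f i * w i y" for i y
    have \<rho>_eq: "\<rho> i y = s i \<bullet> R y" if i: "i < d" and y: "y \<ge> 0" for i y
    proof -
      have "s i \<bullet> (Q *\<^sub>v W y) = (\<Sum>j<d. w j y * q i j)"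
        unfolding W_def lQ q_def
        by (rule scalar_prod_lincomb[OF st(1)[OF i]]) (simp add: st)
      also have "\<dots> = (\<Sum>j<Suc i. w j y * q i j)"
        using i TQ[OF i] by (intro sum.mono_neutral_right) (auto simp: q_def)
      also have "\<dots> = (\<Sum>j<i. q i j * w j y) + f i * w i y"
        using TQ[OF i i] by (simp add: q_def mult.commute)
      finally have "s i \<bullet> (Q *\<^sub>v W y) = (\<Sum>j<i. q i j * w j y) + f i * w i y" .
      moreover have "s i \<bullet> R y = - (s i \<bullet> (Q *\<^sub>v W y)) + s i \<bullet> h y"
        unfolding R_def using st(1)[OF i] Wc[of y] hc[OF y]
        by (simp add: scalar_prod_add_distrib[of _ N] scalar_prod_uminus_right)
      ultimately show ?thesis by (simp add: \<rho>_def \<phi>_eq[OF i y])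
    qed
    have \<rho>p: "primitive_of (\<lambda>y. e i * w i y) (\<rho> i)" if "i < d" for i
      using w[OF that] unfolding solves_scalar_def \<rho>_def by simp
    have R0: "s i \<bullet> R y = 0" if "i < d" "e i = 0" "y \<ge> 0" for i y
      using \<rho>_eq[OF that(1,3)] w[OF that(1)] that(2) by (simp add: solves_scalar_def \<rho>_def)
    have Rrange: "R y = A *\<^sub>v lincomb N d t (\<lambda>i. (s i \<bullet> R y) / e i)" if "y \<ge> 0" for y
      by (rule triangularizing_range[OF T Rc[OF that] R0[OF _ _ that]])
    \<comment> \<open>Each coefficient is divided by \<open>e i\<close> and multiplied back, because
      the derivative is known for \<open>e i * w i\<close>; in algebraic rows both sides
      vanish.\<close>
    have AWl: "(A *\<^sub>v W y) $ l = (\<Sum>i<d. (A *\<^sub>v t i) $ l / e i * (e i * w i y))" if l: "l < N" for l y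
    proof -
      have "(A *\<^sub>v W y) $ l = (\<Sum>i<d. w i y * (A *\<^sub>v t i) $ l)"
        unfolding W_def lA by (rule index_lincomb[OF l])
      also have "\<dots> = (\<Sum>i<d. (A *\<^sub>v t i) $ l / e i * (e i * w i y))"
      proof (rule sum.cong)
        fix i assume "i \<in> {..<d}"
        then show "w i y * (A *\<^sub>v t i) $ l = (A *\<^sub>v t i) $ l / e i * (e i * w i y)"
          using At0[of i] l by (cases "e i = 0") (simp_all del: index_mult_mat_vec)
      qed simp
      finally show ?thesis .
    qed
    have prim: "primitive_of (\<lambda>y. (A *\<^sub>v W y) $ l) (\<lambda>y. R y $ l)" if l: "l < N" for l
    proof (rule primitive_of_eqI)
      show "primitive_of (\<lambda>y. \<Sum>i<d. (A *\<^sub>v t i) $ l / e i * (e i * w i y)) (\<lambda>y. \<Sum>i<d. (A *\<^sub>v t i) $ l / e i * \<rho> i y)"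
        by (intro primitive_of_sum primitive_of_cmult \<rho>p) simp
      show "(\<lambda>y. \<Sum>i<d. (A *\<^sub>v t i) $ l / e i * (e i * w i y)) = (\<lambda>y. (A *\<^sub>v W y) $ l)"
        by (rule ext, rule AWl[OF l, symmetric])
      fix y :: real assume y: "y \<ge> 0"
      have "R y = lincomb N d (\<lambda>i. A *\<^sub>v t i) (\<lambda>i. (s i \<bullet> R y) / e i)"
        using Rrange[OF y] unfolding lA .
      then have "R y $ l = lincomb N d (\<lambda>i. A *\<^sub>v t i) (\<lambda>i. (s i \<bullet> R y) / e i) $ l" by (rule arg_cong)
      also have "\<dots> = (\<Sum>i<d. (A *\<^sub>v t i) $ l / e i * \<rho> i y)"
        unfolding index_lincomb[OF l] by (intro sum.cong refl) (simp add: \<rho>_eq[OF _ y] del: index_mult_mat_vec)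
      finally show "(\<Sum>i<d. (A *\<^sub>v t i) $ l / e i * \<rho> i y) = R y $ l" by simp
    qed
    have WL: "wL2 a (\<lambda>y. W y $ l)" "wsq a (\<lambda>y. W y $ l) \<le> 2 ^ d * (\<Sum>i<d. (t i $ l)\<^sup>2) * (\<Sum>i<d. wsq a (w i))"
      if l: "l < N" for l
      unfolding W_def index_lincomb[OF l] by (rule wL2_lincomb; simp add: wL)+
    have W2: "weighted_L2 N a W" unfolding weighted_L2_iff using Wc WL(1) by blast
    have dA: "dim_row A = N" using A(1) by simp
    have sol: "half_line_solution a A Q h W"
      unfolding half_line_solution_def dA
    proof (intro conjI allI impI ballI)
      show "weighted_L2 N a W" by (rule W2)
      show "locally_abs_continuous (\<lambda>y. (A *\<^sub>v W y) $ i)" if "i < N" for i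
        using prim[OF that] by (simp add: primitive_of_def)
      have "\<forall>i\<in>{..<N}. AE y in lebesgue_on {0..}. ((\<lambda>t. (A *\<^sub>v W t) $ i) has_real_derivative R y $ i) (at y within {0..})"
        using prim unfolding primitive_of_iff by blast
      then have "AE y in lebesgue_on {0..}. \<forall>i\<in>{..<N}. ((\<lambda>t. (A *\<^sub>v W t) $ i) has_real_derivative R y $ i) (at y within {0..})"
        by (subst AE_finite_all) simp_all
      then show "AE y in lebesgue_on {0..}. \<forall>i<N. ((\<lambda>t. (A *\<^sub>v W t) $ i) has_real_derivative (- (Q *\<^sub>v W y) + h y) $ i) (at y within {0..})"
        unfolding R_def by (simp only: Ball_def lessThan_iff)
      fix y :: real and v assume y: "y \<ge> 0" and "v \<in> mat_kernel A"
      then have v: "v \<in> carrier_vec N" "A *\<^sub>v v = 0\<^sub>v N" using mat_kernelD[OF A(1)] by blast+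
      define z where "z = lincomb N d t (\<lambda>i. (s i \<bullet> R y) / e i)"
      have z: "z \<in> carrier_vec N" "R y = A *\<^sub>v z" using Rrange[OF y] by (simp_all add: z_def)
      have "v \<bullet> R y = z \<bullet> (A *\<^sub>v v)" unfolding z(2) by (rule A_sym[OF z(1) v(1)])
      then show "v \<bullet> (- (Q *\<^sub>v W y) + h y) = 0" using v(2) z(1) by (simp add: R_def)
    qed
    have CE: "K1 * (C1 * E) \<le> C * E" "K2 * (C1 * E) \<le> C * E"
      using K1 K2 mult_nonneg_nonneg[OF K1 mult_nonneg_nonneg[OF C1 E]] mult_nonneg_nonneg[OF K2 mult_nonneg_nonneg[OF C1 E]]
      by (simp_all add: C_def algebra_simps)
    have "(weighted_norm a W)\<^sup>2 \<le> K1 * (C1 * E)"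
      unfolding weighted_norm_power2[OF W2] K1_def sum_distrib_right
    proof (rule sum_mono)
      fix l assume "l \<in> {..<N}"
      then have "wsq a (\<lambda>y. W y $ l) \<le> 2 ^ d * (\<Sum>i<d. (t i $ l)\<^sup>2) * (\<Sum>i<d. wsq a (w i))" using WL(2) by simp
      also have "\<dots> \<le> 2 ^ d * (\<Sum>i<d. (t i $ l)\<^sup>2) * (real d * (C1 * E))"
      proof (rule mult_left_mono)
        have "(\<Sum>i<d. wsq a (w i)) \<le> (\<Sum>i<d. C1 * E)" using w1 by (intro sum_mono) simp
        then show "(\<Sum>i<d. wsq a (w i)) \<le> real d * (C1 * E)" by simp
      qed (intro mult_nonneg_nonneg sum_nonneg; simp)
      finally show "wsq a (\<lambda>y. W y $ l) \<le> 2 ^ d * (\<Sum>i<d. (t i $ l)\<^sup>2) * real d * (C1 * E)" by (simp only: mult.assoc)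
    qed
    then have nW: "(weighted_norm a W)\<^sup>2 \<le> C * E" using CE(1) by (rule order_trans)
    have AW0: "((A *\<^sub>v W 0) $ l)\<^sup>2 \<le> C * E" if l: "l < N" for l
    proof -
      have "((A *\<^sub>v W 0) $ l)\<^sup>2 \<le> (\<Sum>i<d. ((A *\<^sub>v t i) $ l / e i)\<^sup>2) * (\<Sum>i<d. (e i * w i 0)\<^sup>2)"
        unfolding AWl[OF l] by (rule Cauchy_Schwarz_ineq_sum)
      also have "\<dots> \<le> (\<Sum>l<N. \<Sum>i<d. ((A *\<^sub>v t i) $ l / e i)\<^sup>2) * (real d * (C1 * E))"
      proof (rule mult_mono)
        show "(\<Sum>i<d. ((A *\<^sub>v t i) $ l / e i)\<^sup>2) \<le> (\<Sum>l<N. \<Sum>i<d. ((A *\<^sub>v t i) $ l / e i)\<^sup>2)"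
          using l by (intro member_le_sum[of l "{..<N}" "\<lambda>l. \<Sum>i<d. ((A *\<^sub>v t i) $ l / e i)\<^sup>2"] sum_nonneg) simp_all
        have "(\<Sum>i<d. (e i * w i 0)\<^sup>2) \<le> (\<Sum>i<d. C1 * E)" using w2 by (intro sum_mono) simp
        then show "(\<Sum>i<d. (e i * w i 0)\<^sup>2) \<le> real d * (C1 * E)" by simp
      qed (intro sum_nonneg; simp)+
      also have "\<dots> = K2 * (C1 * E)" by (simp only: K2_def mult.assoc)
      also have "\<dots> \<le> C * E" by (rule CE(2))
      finally show ?thesis .
    qed
    have free: "s i \<bullet> (A *\<^sub>v W 0) = e i * \<theta> i" if i: "i < d" "e i \<noteq> 0 \<and> f i / e i > a" for i
    proof -
      have "s i \<bullet> (A *\<^sub>v W 0) = (\<Sum>j<d. w j 0 * (s i \<bullet> (A *\<^sub>v t j)))"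
        unfolding W_def lA
        by (rule scalar_prod_lincomb[OF st(1)[OF i(1)]]) (simp add: st)
      also have "\<dots> = (\<Sum>j<d. if j = i then e i * w i 0 else 0)" using i by (intro sum.cong) (simp_all add: TA)
      also have "\<dots> = e i * w i 0" using i by simp
      also have "w i 0 = \<theta> i" using w[OF i(1)] i(2) by (simp add: solves_scalar_def)
      finally show ?thesis .
    qed
    show "\<exists>W. half_line_solution a A Q h W \<and>
       (weighted_norm a W)\<^sup>2 \<le> C * ((weighted_norm a h)\<^sup>2 + (\<Sum>i<d. (\<theta> i)\<^sup>2)) \<and>
       (\<forall>l<N. ((A *\<^sub>v W 0) $ l)\<^sup>2 \<le> C * ((weighted_norm a h)\<^sup>2 + (\<Sum>i<d. (\<theta> i)\<^sup>2))) \<and>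
       (\<forall>i<d. e i \<noteq> 0 \<and> f i / e i > a \<longrightarrow> s i \<bullet> (A *\<^sub>v W 0) = e i * \<theta> i)"
      unfolding E_def[symmetric] using sol nW AW0 free by blast
  qed
qed

end

section \<open>The Grad matrix has full column rank\<close>

definition gauss_mean :: "real poly \<Rightarrow> real" where
  "gauss_mean p = (LINT x|lborel. std_normal_density x * poly p x)"

lemma integrable_gauss_poly: "integrable lborel (\<lambda>x. std_normal_density x * poly p x)"
proof -
  have "(\<lambda>x. std_normal_density x * poly p x) = (\<lambda>x. \<Sum>i\<le>degree p. coeff p i * (std_normal_density x * x ^ i))"
    by (simp add: poly_altdef sum_distrib_left mult.left_commute)
  moreover have "integrable lborel (\<lambda>x. \<Sum>i\<le>degree p. coeff p i * (std_normal_density x * x ^ i))"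
    by (intro Bochner_Integration.integrable_sum integrable_mult_right integrable_std_normal_moment)
  ultimately show ?thesis by simp
qed

lemma gauss_mean_add: "gauss_mean (p + q) = gauss_mean p + gauss_mean q"
  unfolding gauss_mean_def poly_add distrib_left
  by (rule Bochner_Integration.integral_add[OF integrable_gauss_poly integrable_gauss_poly])

lemma gauss_mean_smult: "gauss_mean (Polynomial.smult c p) = c * gauss_mean p"
proof -
  have "(\<lambda>x. std_normal_density x * poly (Polynomial.smult c p) x) = (\<lambda>x. c * (std_normal_density x * poly p x))"
    by (simp add: mult.left_commute)
  then show ?thesis unfolding gauss_mean_def by simp
qed

lemma gauss_mean_0: "gauss_mean 0 = 0"
  by (simp add: gauss_mean_def)

lemma gauss_mean_sum: "gauss_mean (\<Sum>i\<in>I. p i) = (\<Sum>i\<in>I. gauss_mean (p i))"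
  by (induction I rule: infinite_finite_induct) (simp_all add: gauss_mean_add gauss_mean_0)

lemma gauss_mean_monom:
  "gauss_mean (monom c (2 * k)) = c * (fact (2 * k) / (2 ^ k * fact k))"
  "gauss_mean (monom c (2 * k + 1)) = 0"
proof -
  have eq: "gauss_mean (monom c n) = c * (LINT x|lborel. std_normal_density x * x ^ n)" for n
    unfolding gauss_mean_def poly_monom by (simp add: mult.left_commute)
  show "gauss_mean (monom c (2 * k)) = c * (fact (2 * k) / (2 ^ k * fact k))"
    unfolding eq integral_std_normal_moment_even ..
  show "gauss_mean (monom c (2 * k + 1)) = 0"
    unfolding eq integral_std_normal_moment_odd by simp
qed

text \<open>Gaussian integration by parts, verified on monomials by the moment formulas and extended
  by linearity.\<close>

lemma gauss_mean_pderiv: "gauss_mean (pderiv p) = gauss_mean ([:0, 1:] * p)"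
proof -
  have mon: "gauss_mean (pderiv (monom c n)) = gauss_mean (monom c (Suc n))" for c n
  proof (cases n)
    case 0
    then show ?thesis using gauss_mean_monom(2)[of c 0] by (simp add: pderiv_monom gauss_mean_0)
  next
    case (Suc l)
    show ?thesis
    proof (cases "even l")
      case True
      then obtain j where l: "l = 2 * j" by blast
      have "fact (2 * Suc j) / (2 ^ Suc j * fact (Suc j)) = real (2 * j + 1) * (fact (2 * j) / (2 ^ j * fact j))"
      proof -
        have 1: "fact (2 * Suc j) = (2 * real j + 2) * (real (2 * j + 1) * fact (2 * j))" by (simp add: algebra_simps)
        have 2: "2 ^ Suc j * fact (Suc j) = (2 * real j + 2) * (2 ^ j * fact j)" by (simp add: algebra_simps)
        have "2 * real j + 2 \<noteq> 0" by simp
        then show ?thesis unfolding 1 2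
          using mult_divide_mult_cancel_left[of "2 * real j + 2" "real (2 * j + 1) * fact (2 * j)" "2 ^ j * fact j"]
          by (simp only: times_divide_eq_right not_False_eq_True)
      qed
      then show ?thesis
        using gauss_mean_monom(1)[of c "Suc j"] gauss_mean_monom(1)[of "real (2 * j + 1) * c" j]
        unfolding Suc l pderiv_monom by (simp add: mult.commute mult.left_commute)
    next
      case False
      then obtain j where l: "l = 2 * j + 1" by (rule oddE)
      then show ?thesis
        using gauss_mean_monom(2)[of c "Suc j"] gauss_mean_monom(2)[of "real (2 * j + 2) * c" j]
        unfolding Suc l pderiv_monom by simp
    qed
  qed
  have shift: "[:0, 1:] * monom c n = monom c (Suc n)" for c :: real and n by (simp add: monom_Suc)
  have p: "p = (\<Sum>i\<le>degree p. monom (coeff p i) i)" by (rule poly_as_sum_of_monoms[symmetric])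
  have "gauss_mean (pderiv p) = (\<Sum>i\<le>degree p. gauss_mean (pderiv (monom (coeff p i) i)))"
    by (subst p) (simp only: pderiv_sum gauss_mean_sum)
  also have "\<dots> = (\<Sum>i\<le>degree p. gauss_mean ([:0, 1:] * monom (coeff p i) i))" by (simp only: mon shift)
  also have "\<dots> = gauss_mean ([:0, 1:] * (\<Sum>i\<le>degree p. monom (coeff p i) i))"
    by (simp only: sum_distrib_left gauss_mean_sum)
  finally show ?thesis by (simp only: p[symmetric])
qed

text \<open>The recursion of \<open>hermite\<close> in the type of polynomials, where derivatives
  are available algebraically.\<close>

fun hermite_poly :: "nat \<Rightarrow> real poly" where
  "hermite_poly 0 = 1"
| "hermite_poly (Suc 0) = [:0, 1:]"
| "hermite_poly (Suc (Suc k)) = [:0, 1:] * hermite_poly (Suc k) - Polynomial.smult (real (Suc k)) (hermite_poly k)"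

lemma poly_hermite_poly: "poly (hermite_poly k) x = hermite k x"
  by (induction k rule: hermite_poly.induct) simp_all

lemma pderiv_hermite_poly: "pderiv (hermite_poly (Suc k)) = Polynomial.smult (real (Suc k)) (hermite_poly k)"
proof (induction k rule: hermite_poly.induct)
  case (3 k)
  have "pderiv (hermite_poly (Suc (Suc (Suc k)))) =
      [:0, 1:] * pderiv (hermite_poly (Suc (Suc k))) + hermite_poly (Suc (Suc k)) - Polynomial.smult (real (Suc (Suc k))) (pderiv (hermite_poly (Suc k)))"
    by (simp only: hermite_poly.simps pderiv_diff pderiv_mult pderiv_smult) (simp add: pderiv_pCons)
  also have "\<dots> = Polynomial.smult (real (Suc (Suc k))) ([:0, 1:] * hermite_poly (Suc k) - Polynomial.smult (real (Suc k)) (hermite_poly k))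
      + hermite_poly (Suc (Suc k))"
    by (simp only: 3) (simp add: smult_diff_right algebra_simps)
  also have "\<dots> = Polynomial.smult (real (Suc (Suc k))) (hermite_poly (Suc (Suc k))) + hermite_poly (Suc (Suc k))" by simp
  also have "\<dots> = Polynomial.smult (real (Suc (Suc (Suc k)))) (hermite_poly (Suc (Suc k)))"
  proof -
    have "real (Suc (Suc (Suc k))) = real (Suc (Suc k)) + 1" by simp
    then show ?thesis by (simp only: smult_add_left smult_1_left)
  qed
  finally show ?case .
qed (simp_all add: pderiv_pCons pderiv_diff)

text \<open>Since \<open>H_{k+1} = x H_k - H_k'\<close>, integration by parts moves one derivative
  onto the other factor.\<close>

lemma gauss_mean_hermite_Suc:
  "gauss_mean (hermite_poly (Suc k) * p) = gauss_mean (hermite_poly k * pderiv p)"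
proof -
  have rec: "hermite_poly (Suc k) + pderiv (hermite_poly k) = [:0, 1:] * hermite_poly k"
  proof (cases k)
    case (Suc l)
    then show ?thesis by (simp only: pderiv_hermite_poly hermite_poly.simps diff_add_cancel)
  qed simp
  have "gauss_mean (hermite_poly k * pderiv p) + gauss_mean (p * pderiv (hermite_poly k)) = gauss_mean ([:0, 1:] * (hermite_poly k * p))"
    unfolding gauss_mean_add[symmetric] pderiv_mult[symmetric] by (rule gauss_mean_pderiv)
  also have "[:0, 1:] * (hermite_poly k * p) = hermite_poly (Suc k) * p + p * pderiv (hermite_poly k)"
    unfolding mult.assoc[symmetric] rec[symmetric] by (simp add: algebra_simps)
  finally show ?thesis by (simp add: gauss_mean_add)
qed

text \<open>Both indices drop by one with each integration by parts, which collects the factors of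
  \<open>fact i\<close>; when one index reaches 0 before the other, the derivative of a constant
  remains.\<close>

lemma gauss_mean_hermite:
  "gauss_mean (hermite_poly i * hermite_poly j) = (if i = j then fact i else 0)"
proof (induction i arbitrary: j)
  case 0
  show ?case
  proof (cases j)
    case 0
    then show ?thesis using gauss_mean_monom(1)[of 1 0] by (simp add: monom_0 one_pCons)
  next
    case (Suc l)
    then show ?thesis using gauss_mean_hermite_Suc[of l 1] by (simp add: gauss_mean_0 del: hermite_poly.simps(2,3))
  qed
next
  case (Suc i)
  show ?case
  proof (cases j)
    case 0
    then show ?thesis using gauss_mean_hermite_Suc[of i 1] by (simp add: gauss_mean_0 del: hermite_poly.simps(2,3))
  next
    case (Suc l)
    have "gauss_mean (hermite_poly (Suc i) * hermite_poly (Suc l)) = real (Suc l) * gauss_mean (hermite_poly i * hermite_poly l)"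
      unfolding gauss_mean_hermite_Suc pderiv_hermite_poly by (simp only: mult_smult_right gauss_mean_smult)
    then show ?thesis using Suc.IH[of l] Suc by simp
  qed
qed

text \<open>Expand \<open>x H_i = H_{i+1} + i H_{i-1}\<close> and use orthogonality.\<close>

lemma gauss_mean_x_hermite:
  "gauss_mean ([:0, 1:] * hermite_poly i * hermite_poly j) = (if j = Suc i then fact j else if i = Suc j then fact i else 0)"
proof (cases i)
  case 0
  then have "[:0, 1:] * hermite_poly i = hermite_poly (Suc 0)" by simp
  then show ?thesis using gauss_mean_hermite[of "Suc 0" j] 0 by auto
next
  case (Suc k)
  have "[:0, 1:] * hermite_poly i = hermite_poly (Suc i) + Polynomial.smult (real i) (hermite_poly k)" by (simp add: Suc)
  then have "[:0, 1:] * hermite_poly i * hermite_poly j = hermite_poly (Suc i) * hermite_poly j + Polynomial.smult (real i) (hermite_poly k * hermite_poly j)"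
    by (simp only: distrib_right mult_smult_left)
  then have "gauss_mean ([:0, 1:] * hermite_poly i * hermite_poly j) =
      gauss_mean (hermite_poly (Suc i) * hermite_poly j) + real i * gauss_mean (hermite_poly k * hermite_poly j)"
    by (simp only: gauss_mean_add gauss_mean_smult)
  then show ?thesis unfolding gauss_mean_hermite using Suc by auto
qed

text \<open>Fubini for product integrands. Lebesgue measure on vectors is the image of a product
  measure indexed by the standard basis, so coordinates have to be renamed through
  \<open>axis\<close>.\<close>

lemma lebesgue_integral_prod_components:
  fixes f :: "'n::finite \<Rightarrow> real \<Rightarrow> real"
  assumes f: "\<And>i. integrable lborel (f i)"
  shows "(LINT \<xi>|lborel. (\<Prod>i\<in>UNIV. f i (vec_nth \<xi> i))) = (\<Prod>i\<in>UNIV. LINT x|lborel. f i x)"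
proof -
  have [measurable]: "f i \<in> borel_measurable borel" for i using borel_measurable_integrable[OF f, of i] by simp
  interpret product_sigma_finite "\<lambda>b::real ^ 'n. lborel :: real measure" ..
  define idx where "idx b = (THE i. b = axis i (1::real))" for b :: "real ^ 'n"
  have idx: "idx (axis i 1) = i" for i :: 'n unfolding idx_def by (auto simp: axis_eq_axis)
  have Basis: "(Basis :: (real ^ 'n) set) = (\<lambda>i. axis i 1) ` UNIV" by (auto simp: Basis_vec_def)
  have inj: "inj (\<lambda>i::'n. axis i (1::real))" by (auto simp: inj_on_def axis_eq_axis)
  have prod_eq: "(\<Prod>i\<in>UNIV. g i (axis i 1)) = (\<Prod>b\<in>Basis. g (idx b) b)" for g :: "'n \<Rightarrow> real ^ 'n \<Rightarrow> real"
    unfolding Basis by (simp add: prod.reindex[OF inj] idx)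
  have comp: "vec_nth (\<Sum>b\<in>Basis. x b *\<^sub>R b) i = x (axis i 1)" for x :: "real ^ 'n \<Rightarrow> real" and i
  proof -
    have "vec_nth (\<Sum>b\<in>Basis. x b *\<^sub>R b) i = inner (\<Sum>b\<in>Basis. x b *\<^sub>R b) (axis i 1)" by (simp add: inner_axis)
    also have "\<dots> = x (axis i 1)" by (rule inner_sum_left_Basis) simp
    finally show ?thesis .
  qed
  have "(LINT \<xi>|lborel. (\<Prod>i\<in>UNIV. f i (vec_nth \<xi> i))) =
      (LINT x|(\<Pi>\<^sub>M b\<in>Basis. lborel). (\<Prod>i\<in>UNIV. f i (vec_nth (\<Sum>b\<in>Basis. x b *\<^sub>R b) i)))"
    by (subst lborel_eq, subst integral_distr) simp_all
  also have "\<dots> = (LINT x|(\<Pi>\<^sub>M b\<in>Basis. lborel). (\<Prod>b\<in>Basis. f (idx b) (x b)))"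
    unfolding comp by (simp add: prod_eq[of "\<lambda>i b. f i (x b)" for x])
  also have "\<dots> = (\<Prod>b\<in>Basis. LINT y|lborel. f (idx b) y)"
    by (rule product_integral_prod) (simp_all add: f)
  also have "\<dots> = (\<Prod>i\<in>UNIV. LINT x|lborel. f i x)"
    unfolding Basis by (simp add: prod.reindex[OF inj] idx)
  finally show ?thesis .
qed

section \<open>Coupling of Hermite functions by multiplication with the second velocity
  component\<close>

lemma maxwellian_prod: "maxwellian \<xi> = (\<Prod>i\<in>UNIV. std_normal_density (vec_nth \<xi> i))"
proof -
  have "(norm \<xi>)\<^sup>2 = (\<Sum>i\<in>UNIV. (vec_nth \<xi> i)\<^sup>2)"
    unfolding power2_norm_eq_inner inner_vec_def by (simp add: power2_eq_square)
  then have e: "exp (- (norm \<xi>)\<^sup>2 / 2) = (\<Prod>i\<in>UNIV. exp (- (vec_nth \<xi> i)\<^sup>2 / 2))"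
    by (simp add: exp_sum[symmetric] sum_negf sum_divide_distrib)
  have "(1 / sqrt (2 * pi)) ^ 3 = (2 * pi) powr (- 3 / 2)"
  proof -
    have "(2 * pi) powr (3 / 2) = ((2 * pi) powr (1 / 2)) powr (real 3)" unfolding powr_powr by simp
    also have "\<dots> = sqrt (2 * pi) ^ 3" by (subst powr_realpow) (simp_all add: powr_half_sqrt)
    finally have "(2 * pi) powr (3 / 2) = sqrt (2 * pi) ^ 3" .
    moreover have "(2 * pi) powr (- 3 / 2) = 1 / (2 * pi) powr (3 / 2)" by (simp add: powr_minus_divide[symmetric])
    ultimately show ?thesis by (simp only: power_one_over)
  qed
  then show ?thesis
    unfolding maxwellian_def e std_normal_density_def prod.distrib by simp
qed

lemma grad_entry:
  "(LINT \<xi>|lborel. maxwellian \<xi> * vec_nth \<xi> 2 * hermite_phi \<alpha> \<xi> * hermite_phi \<beta> \<xi>) =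
    (\<Prod>i\<in>UNIV. gauss_mean ((if i = 2 then [:0, 1:] else 1) * hermite_poly (vec_nth \<alpha> i) * hermite_poly (vec_nth \<beta> i))
       / (sqrt (fact (vec_nth \<alpha> i)) * sqrt (fact (vec_nth \<beta> i))))"
proof -
  define P :: "3 \<Rightarrow> real poly" where
    "P i = (if i = 2 then [:0, 1:] else 1) * hermite_poly (vec_nth \<alpha> i) * hermite_poly (vec_nth \<beta> i)" for i
  define c where "c i = sqrt (fact (vec_nth \<alpha> i)) * sqrt (fact (vec_nth \<beta> i))" for i :: 3
  have x2: "vec_nth \<xi> 2 = (\<Prod>i\<in>UNIV. if i = 2 then vec_nth \<xi> i else 1)" for \<xi> :: "real ^ 3"
    by (simp add: prod.delta)
  have "maxwellian \<xi> * vec_nth \<xi> 2 * hermite_phi \<alpha> \<xi> * hermite_phi \<beta> \<xi> =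
      (\<Prod>i\<in>UNIV. std_normal_density (vec_nth \<xi> i) * poly (P i) (vec_nth \<xi> i) / c i)" for \<xi>
    unfolding maxwellian_prod hermite_phi_def
    by (subst x2) (simp only: prod.distrib[symmetric], rule prod.cong, simp_all add: P_def c_def poly_hermite_poly)
  then have "(LINT \<xi>|lborel. maxwellian \<xi> * vec_nth \<xi> 2 * hermite_phi \<alpha> \<xi> * hermite_phi \<beta> \<xi>) =
      (LINT \<xi>|lborel. (\<Prod>i\<in>UNIV. std_normal_density (vec_nth \<xi> i) * poly (P i) (vec_nth \<xi> i) / c i))" by simp
  also have "\<dots> = (\<Prod>i\<in>UNIV. LINT x|lborel. std_normal_density x * poly (P i) x / c i)"
    by (rule lebesgue_integral_prod_components) (intro integrable_divide_zero integrable_gauss_poly)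
  also have "\<dots> = (\<Prod>i\<in>UNIV. gauss_mean (P i) / c i)" by (simp add: gauss_mean_def)
  finally show ?thesis unfolding P_def c_def .
qed

text \<open>Selection rules: a product is nonzero only if every factor is, and each factor is one of
  the two one-dimensional Hermite means.\<close>

lemma grad_entry_nonzeroD:
  assumes "(LINT \<xi>|lborel. maxwellian \<xi> * vec_nth \<xi> 2 * hermite_phi \<alpha> \<xi> * hermite_phi \<beta> \<xi>) \<noteq> 0"
  shows "i \<noteq> 2 \<Longrightarrow> vec_nth \<alpha> i = vec_nth \<beta> i"
    and "vec_nth \<beta> 2 = Suc (vec_nth \<alpha> 2) \<or> vec_nth \<alpha> 2 = Suc (vec_nth \<beta> 2)"
proof -
  have "(\<Prod>i\<in>UNIV. gauss_mean ((if i = 2 then [:0, 1:] else 1) * hermite_poly (vec_nth \<alpha> i) * hermite_poly (vec_nth \<beta> i))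
       / (sqrt (fact (vec_nth \<alpha> i)) * sqrt (fact (vec_nth \<beta> i)))) \<noteq> 0"
    using assms unfolding grad_entry .
  then have "gauss_mean ((if i = 2 then [:0, 1:] else 1) * hermite_poly (vec_nth \<alpha> i) * hermite_poly (vec_nth \<beta> i)) \<noteq> 0" for i
    unfolding prod_zero_iff[OF finite_class.finite_UNIV] by fastforce
  note nz = this
  show "i \<noteq> 2 \<Longrightarrow> vec_nth \<alpha> i = vec_nth \<beta> i" using nz[of i] by (simp add: gauss_mean_hermite split: if_splits)
  have "gauss_mean ([:0, 1:] * hermite_poly (vec_nth \<alpha> 2) * hermite_poly (vec_nth \<beta> 2)) \<noteq> 0"
    using nz[of 2] unfolding eqTrueI[OF refl] if_True .
  then show "vec_nth \<beta> 2 = Suc (vec_nth \<alpha> 2) \<or> vec_nth \<alpha> 2 = Suc (vec_nth \<beta> 2)"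
    unfolding gauss_mean_x_hermite by (simp split: if_splits)
qed

lemma grad_entry_nonzeroI:
  assumes "\<And>i. i \<noteq> 2 \<Longrightarrow> vec_nth \<alpha> i = vec_nth \<beta> i" "vec_nth \<beta> 2 = Suc (vec_nth \<alpha> 2)"
  shows "(LINT \<xi>|lborel. maxwellian \<xi> * vec_nth \<xi> 2 * hermite_phi \<alpha> \<xi> * hermite_phi \<beta> \<xi>) \<noteq> 0"
proof -
  have "gauss_mean ((if i = 2 then [:0, 1:] else 1) * hermite_poly (vec_nth \<alpha> i) * hermite_poly (vec_nth \<beta> i)) \<noteq> 0" for i
  proof (cases "i = 2")
    case True
    then show ?thesis using assms(2) unfolding if_P[OF True] gauss_mean_x_hermite by (simp add: True)
  next
    case False
    then show ?thesis using assms(1)[OF False] by (simp add: gauss_mean_hermite)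
  qed
  then show ?thesis unfolding grad_entry prod_zero_iff[OF finite_class.finite_UNIV] by simp
qed

text \<open>An entry of \<open>M\<close> vanishes unless its two indices differ by exactly one unit
  in the second component and agree in the others. The row just below an odd index \<beta> therefore
  involves only \<beta> and the index two units lower, and induction on the second component of
  \<beta> removes the coefficients one after another.\<close>

lemma grad_M_injective:
  assumes idx: "grad_ordering K m n idx" and x: "x \<in> carrier_vec n" and Mx: "grad_M m n idx *\<^sub>v x = 0\<^sub>v m"
  shows "x = 0\<^sub>v n"
proof (rule eq_vecI)
  have even: "bij_betw idx {0..<m} (even_indices K)" and odd: "bij_betw idx {m..<m + n} (odd_indices K)"
    using idx unfolding grad_ordering_def by auto
  have zero: "x $ j = 0" if "j < n" "vec_nth (idx (m + j)) 2 = b" for j b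
    using that
  proof (induction b arbitrary: j rule: less_induct)
    case (less b)
    define \<beta> where "\<beta> = idx (m + j)"
    have \<beta>: "\<beta> \<in> odd_indices K" using odd less.prems(1) unfolding \<beta>_def by (auto simp: bij_betw_def)
    then have b: "odd b" "(\<Sum>i\<in>UNIV. vec_nth \<beta> i) \<le> K" using less.prems(2) by (auto simp: odd_indices_def \<beta>_def)
    \<comment> \<open>An odd second component is at least 1, so \<open>b - 1\<close> is a true
      predecessor; the total degree does not grow, and \<alpha> is an admissible even index.\<close>
    define \<alpha> where "\<alpha> = vec_lambda (\<lambda>i. if i = 2 then b - 1 else vec_nth \<beta> i)"
    have \<alpha>: "vec_nth \<alpha> i = (if i = 2 then b - 1 else vec_nth \<beta> i)" for i by (simp add: \<alpha>_def)
    have "(\<Sum>i\<in>UNIV. vec_nth \<alpha> i) \<le> (\<Sum>i\<in>UNIV. vec_nth \<beta> i)"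
      using less.prems(2) by (intro sum_mono) (auto simp: \<alpha> \<beta>_def)
    then have "\<alpha> \<in> even_indices K" using b by (simp add: even_indices_def \<alpha>)
    then obtain i where i: "i < m" "idx i = \<alpha>" using even unfolding bij_betw_def by (metis atLeastLessThan_iff imageE)
    define E where "E j' = (LINT \<xi>|lborel. maxwellian \<xi> * vec_nth \<xi> 2 * hermite_phi (idx i) \<xi> * hermite_phi (idx (m + j')) \<xi>)" for j'
    have Ej: "E j \<noteq> 0"
      unfolding E_def
    proof (rule grad_entry_nonzeroI)
      show "vec_nth (idx i) l = vec_nth (idx (m + j)) l" if "l \<noteq> 2" for l using i \<alpha> that by (simp add: \<beta>_def)
      show "vec_nth (idx (m + j)) 2 = Suc (vec_nth (idx i) 2)" using i \<alpha> b less.prems(2) by (simp add: odd_pos)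
    qed
    have other: "E j' * x $ j' = 0" if j': "j' < n" "j' \<noteq> j" for j'
    proof (rule ccontr)
      assume "E j' * x $ j' \<noteq> 0"
      then have E': "E j' \<noteq> 0" and xj': "x $ j' \<noteq> 0" by auto
      note D = grad_entry_nonzeroD[OF E'[unfolded E_def]]
      have same: "vec_nth (idx (m + j')) l = vec_nth \<beta> l" if "l \<noteq> 2" for l using D(1)[OF that] i \<alpha> that by simp
      \<comment> \<open>The neighbours of \<open>b - 1\<close> are \<open>b\<close> and
        \<open>b - 2\<close>: the first identifies the column, the second is covered by the
        induction hypothesis.\<close>
      have "vec_nth (idx (m + j')) 2 = b \<or> vec_nth (idx (m + j')) 2 < b"
        using D(2) i \<alpha>[of 2] b(1) by (auto simp: odd_pos)
      then show False
      proof
        assume "vec_nth (idx (m + j')) 2 = b"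
        then have "vec_nth (idx (m + j')) l = vec_nth \<beta> l" for l using same less.prems(2) by (cases "l = 2") (simp_all add: \<beta>_def)
        then have "idx (m + j') = idx (m + j)" unfolding \<beta>_def by (simp add: Finite_Cartesian_Product.vec_eq_iff)
        then have "m + j' = m + j"
          using inj_onD[OF bij_betw_imp_inj_on[OF odd], of "m + j'" "m + j"] j'(1) less.prems(1) by simp
        then show False using j'(2) by simp
      next
        assume "vec_nth (idx (m + j')) 2 < b"
        then show False using less.IH[OF _ j'(1) refl] xj' by blast
      qed
    qed
    have "(grad_M m n idx *\<^sub>v x) $ i = (\<Sum>j'<n. E j' * x $ j')"
      using i(1) x by (simp add: grad_M_def scalar_prod_def atLeast0LessThan E_def)
    also have "\<dots> = (\<Sum>j'<n. if j' = j then E j * x $ j else 0)" using other by (intro sum.cong) auto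
    also have "\<dots> = E j * x $ j" using less.prems(1) by simp
    finally have "E j * x $ j = 0" using Mx i(1) by simp
    then show "x $ j = 0" using Ej by simp
  qed
  fix j assume "j < dim_vec (0\<^sub>v n :: real vec)"
  then show "x $ j = 0\<^sub>v n $ j" using zero by simp
qed (use x in simp)

section \<open>Linearity and uniqueness\<close>

lemma wL2_cong:
  assumes "wL2 a f" "\<And>y. y \<ge> 0 \<Longrightarrow> f y = g y"
  shows "wL2 a g"
proof -
  have "g \<in> borel_measurable (lebesgue_on {0..}) \<longleftrightarrow> f \<in> borel_measurable (lebesgue_on {0..})"
    using assms(2) by (intro measurable_cong) simp
  moreover have "integrable (lebesgue_on {0..}) (\<lambda>y. exp (2 * a * y) * (g y)\<^sup>2) \<longleftrightarrow>
      integrable (lebesgue_on {0..}) (\<lambda>y. exp (2 * a * y) * (f y)\<^sup>2)"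
    using assms(2) by (intro Bochner_Integration.integrable_cong) simp_all
  ultimately show ?thesis using assms(1) unfolding wL2_def by blast
qed

lemma primitive_of_cong_half_line:
  assumes f: "primitive_of f g" and f': "\<And>y. y \<ge> 0 \<Longrightarrow> f y = f' y" and g': "\<And>y. y \<ge> 0 \<Longrightarrow> g y = g' y"
  shows "primitive_of f' g'"
proof -
  obtain Z where Z: "negligible Z" "\<forall>y\<in>{0..} - Z. (f has_real_derivative g y) (at y within {0..})"
    and ac: "locally_abs_continuous f" using f unfolding primitive_of_def by blast
  have "abs_continuous_on_ivl 0 b f'" if "b \<ge> 0" for b
  proof -
    have fb: "abs_continuous_on_ivl 0 b f" using ac that unfolding locally_abs_continuous_def by blast
    show ?thesis
      by (rule abs_continuous_on_ivl_sum2[OF fb fb, where B = 1]) (simp add: f'[symmetric])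
  qed
  moreover have "\<forall>y\<in>{0..} - Z. (f' has_real_derivative g' y) (at y within {0..})"
  proof
    fix y assume y: "y \<in> {0..} - Z"
    then have "(f has_real_derivative g' y) (at y within {0..})" using Z(2) g' by fastforce
    then show "(f' has_real_derivative g' y) (at y within {0..})"
      by (rule has_field_derivative_transform_within[where d = 1]) (use y f' in auto)
  qed
  ultimately show ?thesis using Z(1) unfolding primitive_of_def locally_abs_continuous_def by blast
qed

text \<open>Finitely many almost everywhere conditions can be taken one component at a time, which
  brings the notion of solution into the scalar vocabulary of \<open>wL2\<close> and
  \<open>primitive_of\<close>.\<close>

lemma half_line_solution_iff:
  assumes A: "A \<in> carrier_mat N N" and Q: "Q \<in> carrier_mat N N" and h: "\<forall>y\<ge>0. h y \<in> carrier_vec N"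
  shows "half_line_solution a A Q h W \<longleftrightarrow>
     (\<forall>y\<ge>0. W y \<in> carrier_vec N) \<and> (\<forall>i<N. wL2 a (\<lambda>y. W y $ i)) \<and>
     (\<forall>i<N. primitive_of (\<lambda>y. (A *\<^sub>v W y) $ i) (\<lambda>y. (- (Q *\<^sub>v W y) + h y) $ i)) \<and>
     (\<forall>y\<ge>0. \<forall>v\<in>carrier_vec N. A *\<^sub>v v = 0\<^sub>v N \<longrightarrow> v \<bullet> (- (Q *\<^sub>v W y) + h y) = 0)"
proof -
  have dA: "dim_row A = N" using A by simp
  have ker: "mat_kernel A = {v \<in> carrier_vec N. A *\<^sub>v v = 0\<^sub>v N}" using mat_kernel[OF A] by simp
  have ae: "(AE y in lebesgue_on {0..}. \<forall>i<N. ((\<lambda>t. (A *\<^sub>v W t) $ i) has_real_derivative (- (Q *\<^sub>v W y) + h y) $ i) (at y within {0..}))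
    \<longleftrightarrow> (\<forall>i<N. AE y in lebesgue_on {0..}. ((\<lambda>t. (A *\<^sub>v W t) $ i) has_real_derivative (- (Q *\<^sub>v W y) + h y) $ i) (at y within {0..}))"
    using AE_finite_all[OF finite_lessThan[of N]] by (simp only: Ball_def lessThan_iff)
  show ?thesis
    unfolding half_line_solution_def dA weighted_L2_iff ae ker primitive_of_iff by blast
qed

lemma half_line_solution_add_smult:
  assumes A: "A \<in> carrier_mat N N" and Q: "Q \<in> carrier_mat N N"
    and h: "\<forall>y\<ge>0. h y \<in> carrier_vec N" "\<forall>y\<ge>0. h' y \<in> carrier_vec N"
    and W: "half_line_solution a A Q h W" and W': "half_line_solution a A Q h' W'"
  shows "half_line_solution a A Q (\<lambda>y. h y + c \<cdot>\<^sub>v h' y) (\<lambda>y. W y + c \<cdot>\<^sub>v W' y)"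
proof -
  have hc: "\<forall>y\<ge>0. h y + c \<cdot>\<^sub>v h' y \<in> carrier_vec N" using h by simp
  note W = W[unfolded half_line_solution_iff[OF A Q h(1)]] and W' = W'[unfolded half_line_solution_iff[OF A Q h(2)]]
  have Wc: "W y \<in> carrier_vec N" "W' y \<in> carrier_vec N" if "y \<ge> 0" for y using W W' that by blast+
  have lin: "B *\<^sub>v (W y + c \<cdot>\<^sub>v W' y) = B *\<^sub>v W y + c \<cdot>\<^sub>v (B *\<^sub>v W' y)" if "B \<in> carrier_mat N N" "y \<ge> 0" for B y
    using Wc[OF that(2)] that(1) by (simp add: mult_add_distrib_mat_vec[of _ N N] mult_mat_vec[of _ N N])
  have R: "- (Q *\<^sub>v (W y + c \<cdot>\<^sub>v W' y)) + (h y + c \<cdot>\<^sub>v h' y) = (- (Q *\<^sub>v W y) + h y) + c \<cdot>\<^sub>v (- (Q *\<^sub>v W' y) + h' y)"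
    if "y \<ge> 0" for y
  proof -
    have "- (u + c \<cdot>\<^sub>v u') + (g + c \<cdot>\<^sub>v g') = (- u + g) + c \<cdot>\<^sub>v (- u' + g')"
      if "u \<in> carrier_vec N" "u' \<in> carrier_vec N" "g \<in> carrier_vec N" "g' \<in> carrier_vec N" for u u' g g' :: "real vec"
      using that by (intro eq_vecI) (auto simp: algebra_simps)
    from this[of "Q *\<^sub>v W y" "Q *\<^sub>v W' y" "h y" "h' y"]
    show ?thesis unfolding lin[OF Q that] using Q h that Wc[OF that] by auto
  qed
  have comb: "u $ i + c * u' $ i = (u + c \<cdot>\<^sub>v u') $ i"
    if "u \<in> carrier_vec N" "u' \<in> carrier_vec N" "i < N" for u u' :: "real vec" and i
    using that by auto
  show ?thesis
    unfolding half_line_solution_iff[OF A Q hc]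
  proof (intro conjI allI impI ballI)
    fix y :: real assume y: "y \<ge> 0"
    show "W y + c \<cdot>\<^sub>v W' y \<in> carrier_vec N" using Wc[OF y] by simp
    fix v :: "real vec" assume v: "v \<in> carrier_vec N" "A *\<^sub>v v = 0\<^sub>v N"
    have z: "- (Q *\<^sub>v W y) + h y \<in> carrier_vec N" "- (Q *\<^sub>v W' y) + h' y \<in> carrier_vec N"
      using Q Wc[OF y] h y by auto
    have "v \<bullet> (- (Q *\<^sub>v W y) + h y) = 0" "v \<bullet> (- (Q *\<^sub>v W' y) + h' y) = 0" using W W' y v by blast+
    then show "v \<bullet> (- (Q *\<^sub>v (W y + c \<cdot>\<^sub>v W' y)) + (h y + c \<cdot>\<^sub>v h' y)) = 0"
      unfolding R[OF y] using z v(1) by (simp add: scalar_prod_add_distrib[of _ N])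
  next
    fix i assume i: "i < N"
    have L: "wL2 a (\<lambda>y. W y $ i)" "wL2 a (\<lambda>y. W' y $ i)" using W W' i by blast+
    have "wL2 a (\<lambda>y. W y $ i + c * W' y $ i)" by (rule wL2_add(1)[OF L(1) wL2_cmult(1)[OF L(2)]])
    then show "wL2 a (\<lambda>y. (W y + c \<cdot>\<^sub>v W' y) $ i)"
      by (rule wL2_cong) (use comb[OF Wc i] in blast)
    have "primitive_of (\<lambda>y. (A *\<^sub>v W y) $ i + c * (A *\<^sub>v W' y) $ i)
       (\<lambda>y. (- (Q *\<^sub>v W y) + h y) $ i + c * (- (Q *\<^sub>v W' y) + h' y) $ i)"
      using W W' i by (intro primitive_of_add primitive_of_cmult) blast+
    then show "primitive_of (\<lambda>y. (A *\<^sub>v (W y + c \<cdot>\<^sub>v W' y)) $ i) (\<lambda>y. (- (Q *\<^sub>v (W y + c \<cdot>\<^sub>v W' y)) + (h y + c \<cdot>\<^sub>v h' y)) $ i)"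
    proof (rule primitive_of_cong_half_line)
      fix y :: real assume y: "y \<ge> 0"
      show "(A *\<^sub>v W y) $ i + c * (A *\<^sub>v W' y) $ i = (A *\<^sub>v (W y + c \<cdot>\<^sub>v W' y)) $ i"
        unfolding lin[OF A y] by (rule comb[OF _ _ i]) (use A Wc[OF y] in auto)
      show "(- (Q *\<^sub>v W y) + h y) $ i + c * (- (Q *\<^sub>v W' y) + h' y) $ i = (- (Q *\<^sub>v (W y + c \<cdot>\<^sub>v W' y)) + (h y + c \<cdot>\<^sub>v h' y)) $ i"
        unfolding R[OF y] by (rule comb[OF _ _ i]) (use Q Wc[OF y] h y in auto)
    qed
  qed
qed

lemma half_line_solution_cong:
  assumes "A \<in> carrier_mat N N" "Q \<in> carrier_mat N N" "\<forall>y\<ge>0. h y \<in> carrier_vec N"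
    and "\<And>y. y \<ge> 0 \<Longrightarrow> h y = h' y" and W: "half_line_solution a A Q h W"
  shows "half_line_solution a A Q h' W"
proof -
  have h': "\<forall>y\<ge>0. h' y \<in> carrier_vec N" using assms(3,4) by metis
  have p: "primitive_of f (\<lambda>y. (- (Q *\<^sub>v W y) + h y) $ i) \<Longrightarrow> primitive_of f (\<lambda>y. (- (Q *\<^sub>v W y) + h' y) $ i)" for f i
    by (erule primitive_of_eqI) (simp_all add: assms(4))
  show ?thesis
    using W p assms(4) unfolding half_line_solution_iff[OF assms(1-3)] half_line_solution_iff[OF assms(1,2) h'] by auto
qed

text \<open>Past a point where \<open>f\<close> is negative it stays at or below this value, so the
  integrable majorant \<open>F\<close> would be bounded below by a positive constant on a half
  line.\<close>

lemma antimono_integrable_nonneg: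
  fixes f F :: "real \<Rightarrow> real"
  assumes anti: "\<And>x y. 0 \<le> x \<Longrightarrow> x \<le> y \<Longrightarrow> f y \<le> f x"
    and F: "F integrable_on {0..}" and le: "\<And>y. y \<ge> 0 \<Longrightarrow> \<bar>f y\<bar> \<le> F y" and x: "0 \<le> x"
  shows "f x \<ge> 0"
proof (rule ccontr)
  assume "\<not> f x \<ge> 0"
  then have neg: "f x < 0" by simp
  have Fnn: "F y \<ge> 0" if "y \<ge> 0" for y using le[OF that] abs_ge_zero order_trans by blast
  then have Fa: "F absolutely_integrable_on {0..}"
    by (intro nonnegative_absolutely_integrable_1[OF F]) simp
  \<comment> \<open>Chosen so that the constant alone already contributes
    \<open>integral {0..} F + 1\<close>.\<close>
  define b where "b = x + (integral {0..} F + 1) / - f x"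
  have I0: "integral {0..} F \<ge> 0" by (rule integral_nonneg[OF F]) (simp add: Fnn)
  have b: "b \<ge> x" using I0 neg by (simp add: b_def divide_nonneg_neg)
  have sub: "{x..b} \<subseteq> {0..}" using x by auto
  have Fi: "F integrable_on {x..b}"
    by (rule set_lebesgue_integral_eq_integral(1)[OF absolutely_integrable_on_subinterval[OF Fa sub]])
  have "(b - x) * - f x = integral {x..b} (\<lambda>_. - f x)" using b by simp
  also have "\<dots> \<le> integral {x..b} F"
  proof (rule integral_le[OF _ Fi])
    fix y assume y: "y \<in> {x..b}"
    then have "f y \<le> f x" using anti x by simp
    moreover have "\<bar>f y\<bar> \<le> F y" using le y x by simp
    ultimately show "- f x \<le> F y" by simp
  qed (rule integrable_const_ivl)
  also have "\<dots> \<le> integral {0..} F" by (rule integral_subset_le[OF sub Fi F]) (simp add: Fnn)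
  finally have "(b - x) * - f x \<le> integral {0..} F" .
  moreover have "(b - x) * - f x = integral {0..} F + 1" using neg by (simp add: b_def)
  ultimately show False by simp
qed

text \<open>The weight is at least 1 for \<open>a \<ge> 0\<close>, so a nonzero constant has
  infinite weighted norm. Conserved quantities of the homogeneous system are shown to vanish in this
  way.\<close>

lemma wL2_const_eq_0:
  assumes g: "wL2 a g" and c: "\<And>y. y \<ge> 0 \<Longrightarrow> g y = c" and a: "a \<ge> 0"
  shows "c = 0"
proof -
  have "- c\<^sup>2 \<ge> 0"
  proof (rule antimono_integrable_nonneg[where f = "\<lambda>_. - c\<^sup>2" and x = 0])
    show "(\<lambda>y. exp (2 * a * y) * (g y)\<^sup>2) integrable_on {0..}" by (rule wL2_integral(1)[OF g])
    fix y :: real assume y: "y \<ge> 0"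
    have "1 * c\<^sup>2 \<le> exp (2 * a * y) * c\<^sup>2" using a y by (intro mult_right_mono) simp_all
    then show "\<bar>- c\<^sup>2\<bar> \<le> exp (2 * a * y) * (g y)\<^sup>2" using c[OF y] by simp
  qed simp_all
  then show ?thesis by simp
qed

section \<open>Even and odd parts of vectors\<close>

lemma scalar_prod_append_split:
  assumes "v \<in> carrier_vec (m + n)" "w \<in> carrier_vec (m + n)"
  shows "(v :: real vec) \<bullet> w = vec_first v m \<bullet> vec_first w m + vec_last v n \<bullet> vec_last w n"
proof -
  have "v \<bullet> w = (vec_first v m @\<^sub>v vec_last v n) \<bullet> (vec_first w m @\<^sub>v vec_last w n)"
    using assms by simp
  also have "\<dots> = vec_first v m \<bullet> vec_first w m + vec_last v n \<bullet> vec_last w n"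
    by (rule scalar_prod_append[of _ m _ n]) simp_all
  finally show ?thesis .
qed

lemma vec_first_append: "x \<in> carrier_vec m \<Longrightarrow> vec_first (x @\<^sub>v y) m = x"
  by (auto simp: vec_first_def intro!: eq_vecI)

lemma vec_last_append: "x \<in> carrier_vec m \<Longrightarrow> y \<in> carrier_vec n \<Longrightarrow> vec_last (x @\<^sub>v y) n = y"
  by (auto simp: vec_last_def intro!: eq_vecI)

lemma zero_vec_append: "0\<^sub>v m @\<^sub>v 0\<^sub>v n = (0\<^sub>v (m + n) :: real vec)"
  by (intro eq_vecI) auto

lemma grad_A_carrier: "M \<in> carrier_mat m n \<Longrightarrow> grad_A m n M \<in> carrier_mat (m + n) (m + n)"
  by (simp add: grad_A_def)

lemma grad_A_symmetric: "M \<in> carrier_mat m n \<Longrightarrow> (grad_A m n M)\<^sup>T = grad_A m n M"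
  unfolding grad_A_def by (subst transpose_four_block_mat[of _ m m _ n _ n]) auto

lemma grad_A_mult_append:
  assumes M: "M \<in> carrier_mat m n" and x: "x \<in> carrier_vec m" "y \<in> carrier_vec n"
  shows "grad_A m n M *\<^sub>v (x @\<^sub>v y) = (M *\<^sub>v y) @\<^sub>v (M\<^sup>T *\<^sub>v x)"
proof -
  have "grad_A m n M *\<^sub>v (x @\<^sub>v y) = (0\<^sub>m m m *\<^sub>v x + M *\<^sub>v y) @\<^sub>v (M\<^sup>T *\<^sub>v x + 0\<^sub>m n n *\<^sub>v y)"
    unfolding grad_A_def using M x by (intro four_block_mat_mult_vec) auto
  moreover have "0\<^sub>m m m *\<^sub>v x = 0\<^sub>v m" "0\<^sub>m n n *\<^sub>v y = 0\<^sub>v n" using x by (auto intro!: eq_vecI)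
  moreover have "M *\<^sub>v y \<in> carrier_vec m" "M\<^sup>T *\<^sub>v x \<in> carrier_vec n" using M x by auto
  ultimately show ?thesis by simp
qed

lemma grad_A_mult:
  assumes M: "M \<in> carrier_mat m n" and v: "v \<in> carrier_vec (m + n)"
  shows "vec_first (grad_A m n M *\<^sub>v v) m = M *\<^sub>v vec_last v n" "vec_last (grad_A m n M *\<^sub>v v) n = M\<^sup>T *\<^sub>v vec_first v m"
proof -
  have "grad_A m n M *\<^sub>v v = grad_A m n M *\<^sub>v (vec_first v m @\<^sub>v vec_last v n)" using v by simp
  also have "\<dots> = (M *\<^sub>v vec_last v n) @\<^sub>v (M\<^sup>T *\<^sub>v vec_first v m)" by (rule grad_A_mult_append[OF M]) simp_all
  finally have "grad_A m n M *\<^sub>v v = (M *\<^sub>v vec_last v n) @\<^sub>v (M\<^sup>T *\<^sub>v vec_first v m)" .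
  moreover have "M *\<^sub>v vec_last v n \<in> carrier_vec m" "M\<^sup>T *\<^sub>v vec_first v m \<in> carrier_vec n" using M by auto
  ultimately show "vec_first (grad_A m n M *\<^sub>v v) m = M *\<^sub>v vec_last v n" "vec_last (grad_A m n M *\<^sub>v v) n = M\<^sup>T *\<^sub>v vec_first v m"
    by (simp_all add: vec_first_append vec_last_append)
qed

text \<open>The energy \<open>D\<^sub>o \<bullet> M\<^sup>T D\<^sub>e\<close> has derivative \<open>- D \<bullet> Q D\<close>. It decreases and is integrable, hence is nonnegative,
  whereas the boundary condition makes it nonpositive at \<open>y = 0\<close>.\<close>

lemma homogeneous_layer_solution_eq_0:
  fixes M Q H :: "real mat" and D :: "real \<Rightarrow> real vec"
  assumes M: "M \<in> carrier_mat m n" and M_inj: "\<And>x. x \<in> carrier_vec n \<Longrightarrow> M *\<^sub>v x = 0\<^sub>v m \<Longrightarrow> x = 0\<^sub>v n"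
    and A: "A = grad_A m n M" and Q: "Q \<in> carrier_mat (m + n) (m + n)" "Q\<^sup>T = Q"
    and Q_nonneg: "\<And>v. v \<in> carrier_vec (m + n) \<Longrightarrow> v \<bullet> (Q *\<^sub>v v) \<ge> 0"
    and null: "\<And>v. v \<in> carrier_vec (m + n) \<Longrightarrow> A *\<^sub>v v = 0\<^sub>v (m + n) \<Longrightarrow> Q *\<^sub>v v = 0\<^sub>v (m + n) \<Longrightarrow> v = 0\<^sub>v (m + n)"
    and H: "H \<in> carrier_mat n n" "pos_def H" and \<chi>: "\<chi> > 0" and a: "a \<ge> 0"
    and D: "half_line_solution a A Q (\<lambda>_. 0\<^sub>v (m + n)) D"
    and z: "z \<in> carrier_vec m" "Q *\<^sub>v (z @\<^sub>v 0\<^sub>v n) = 0\<^sub>v (m + n)"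
    and bc: "H *\<^sub>v vec_last (D 0) n + \<chi> \<cdot>\<^sub>v (M\<^sup>T *\<^sub>v (vec_first (D 0) m + z)) = 0\<^sub>v n"
  shows "\<And>y. y \<ge> 0 \<Longrightarrow> D y = 0\<^sub>v (m + n)" and "z = 0\<^sub>v m"
proof -
  define N where "N = m + n"
  have Ac: "A \<in> carrier_mat N N" "A\<^sup>T = A" unfolding A N_def using grad_A_carrier[OF M] grad_A_symmetric[OF M] by auto
  note Q = Q[folded N_def]
  have zero: "\<forall>y\<ge>(0::real). 0\<^sub>v N \<in> carrier_vec N" by simp
  note D' = D[folded N_def, unfolded half_line_solution_iff[OF Ac(1) Q(1) zero]]
  have Dc: "D y \<in> carrier_vec N" if "y \<ge> 0" for y using D' that by blast
  have DL: "wL2 a (\<lambda>y. D y $ i)" if "i < N" for i using D' that by blast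
  have QDc: "Q *\<^sub>v D y \<in> carrier_vec N" if "y \<ge> 0" for y using Q Dc[OF that] by simp
  have prim: "primitive_of (\<lambda>y. (A *\<^sub>v D y) $ i) (\<lambda>y. - (Q *\<^sub>v D y) $ i)" if i: "i < N" for i
  proof -
    have "primitive_of (\<lambda>y. (A *\<^sub>v D y) $ i) (\<lambda>y. (- (Q *\<^sub>v D y) + 0\<^sub>v N) $ i)" using D' i by blast
    then show ?thesis
    proof (rule primitive_of_cong_half_line)
      fix y :: real assume "y \<ge> 0"
      then show "(- (Q *\<^sub>v D y) + 0\<^sub>v N) $ i = - (Q *\<^sub>v D y) $ i" using QDc i by (metis carrier_vecD index_uminus_vec(1) right_zero_vec uminus_carrier_vec)
    qed simp
  qed
  have alg: "v \<bullet> (Q *\<^sub>v D y) = 0" if "y \<ge> 0" "v \<in> carrier_vec N" "A *\<^sub>v v = 0\<^sub>v N" for y v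
  proof -
    have "v \<bullet> (- (Q *\<^sub>v D y) + 0\<^sub>v N) = 0" using D' that by blast
    moreover have "- (Q *\<^sub>v D y) + 0\<^sub>v N = - (Q *\<^sub>v D y)" using QDc[OF that(1)] by simp
    ultimately show ?thesis by (simp add: scalar_prod_uminus_right)
  qed
  have ADL: "wL2 a (\<lambda>y. (A *\<^sub>v D y) $ i)" if i: "i < N" for i
  proof (rule wL2_cong)
    show "wL2 a (\<lambda>y. \<Sum>j<N. D y $ j * A $$ (i, j))" by (rule wL2_lincomb(1)) (rule DL)
    show "(\<Sum>j<N. D y $ j * A $$ (i, j)) = (A *\<^sub>v D y) $ i" if "y \<ge> 0" for y
      using Dc[OF that] Ac i by (simp add: scalar_prod_def atLeast0LessThan mult.commute)
  qed
  define wo where "wo y = vec_last (D y) n" for y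
  define we where "we y = vec_first (D y) m" for y
  have oe: "wo y \<in> carrier_vec n" "we y \<in> carrier_vec m" for y by (simp_all add: wo_def we_def)
  have Mo: "(A *\<^sub>v D y) $ l = (M *\<^sub>v wo y) $ l" if "y \<ge> 0" "l < m" for y l
  proof -
    have "vec_first (A *\<^sub>v D y) m $ l = (M *\<^sub>v wo y) $ l"
      unfolding A wo_def by (subst grad_A_mult(1)[OF M Dc[OF that(1), unfolded N_def]]) simp
    then show ?thesis using that(2) by (simp add: vec_first_def)
  qed
  have MTe: "(A *\<^sub>v D y) $ (m + j) = (M\<^sup>T *\<^sub>v we y) $ j" if "y \<ge> 0" "j < n" for y j
  proof -
    have "vec_last (A *\<^sub>v D y) n $ j = (M\<^sup>T *\<^sub>v we y) $ j"
      unfolding A we_def by (subst grad_A_mult(2)[OF M Dc[OF that(1), unfolded N_def]]) simp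
    moreover have "dim_vec (A *\<^sub>v D y) = m + n" using Ac(1) by (simp add: N_def)
    ultimately show ?thesis using that(2) by (simp add: vec_last_def)
  qed
  \<comment> \<open>Only \<open>A D\<close> is known to be absolutely continuous. Its even block
    \<open>M D_o\<close> determines the odd part \<open>D_o\<close> through a left inverse
    \<open>P\<close> of \<open>M\<close>, whose rows are the dual vectors
    \<open>b j\<close>.\<close>
  obtain b where b: "\<And>j. j < n \<Longrightarrow> b j \<in> carrier_vec m" and bM: "\<And>j v. j < n \<Longrightarrow> v \<in> carrier_vec n \<Longrightarrow> (M *\<^sub>v v) \<bullet> b j = v $ j"
    using dual_family_exists[OF M M_inj] by blast
  define P where "P = mat n m (\<lambda>(j, l). b j $ l)"
  have P: "P \<in> carrier_mat n m" by (simp add: P_def)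
  have Pv: "(P *\<^sub>v v) $ j = (\<Sum>l<m. b j $ l * v $ l)" if "v \<in> carrier_vec m" "j < n" for v j
    using that by (simp add: P_def scalar_prod_def atLeast0LessThan)
  have PM: "P *\<^sub>v (M *\<^sub>v v) = v" if v: "v \<in> carrier_vec n" for v
  proof (rule eq_vecI)
    fix j assume "j < dim_vec v"
    then have j: "j < n" using v by simp
    have Mv: "M *\<^sub>v v \<in> carrier_vec m" using M v by simp
    have "(P *\<^sub>v (M *\<^sub>v v)) $ j = (M *\<^sub>v v) \<bullet> b j"
      unfolding Pv[OF Mv j] using b[OF j] Mv by (simp add: scalar_prod_def atLeast0LessThan mult.commute del: index_mult_mat_vec)
    then show "(P *\<^sub>v (M *\<^sub>v v)) $ j = v $ j" using bM[OF j v] by simp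
  qed (use P v in simp)
  have o_eq: "wo y $ j = (\<Sum>l<m. b j $ l * (A *\<^sub>v D y) $ l)" if "y \<ge> 0" "j < n" for y j
  proof -
    have Moc: "M *\<^sub>v wo y \<in> carrier_vec m" using M oe(1)[of y] by simp
    have "wo y $ j = (P *\<^sub>v (M *\<^sub>v wo y)) $ j" by (simp only: PM[OF oe(1)])
    also have "\<dots> = (\<Sum>l<m. b j $ l * (M *\<^sub>v wo y) $ l)" by (rule Pv[OF Moc that(2)])
    also have "\<dots> = (\<Sum>l<m. b j $ l * (A *\<^sub>v D y) $ l)" using Mo[OF that(1)] by (intro sum.cong) simp_all
    finally show ?thesis .
  qed
  define U where "U j y = (\<Sum>l<m. b j $ l * (A *\<^sub>v D y) $ l)" for j y
  define V where "V j y = (A *\<^sub>v D y) $ (m + j)" for j y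
  \<comment> \<open>Both factors are expressed through \<open>A D\<close>, so that the energy can be
    differentiated almost everywhere.\<close>
  define \<phi> where "\<phi> y = (\<Sum>j<n. U j y * V j y)" for y
  have \<phi>_eq: "\<phi> y = wo y \<bullet> (M\<^sup>T *\<^sub>v we y)" if "y \<ge> 0" for y
  proof -
    have dim: "dim_vec (M\<^sup>T *\<^sub>v we y) = n" using M by simp
    show ?thesis unfolding \<phi>_def U_def V_def scalar_prod_def dim atLeast0LessThan
      using o_eq[OF that] MTe[OF that] by (intro sum.cong) simp_all
  qed
  define g where "g i y = - (Q *\<^sub>v D y) $ i" for i y
  have pO: "primitive_of (U j) (\<lambda>y. \<Sum>l<m. b j $ l * g l y)" for j
    unfolding U_def g_def by (intro primitive_of_sum primitive_of_cmult prim) (simp add: N_def)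
  have pV: "primitive_of (V j) (g (m + j))" if "j < n" for j
    unfolding V_def g_def using that by (intro prim) (simp add: N_def)
  have p\<phi>: "primitive_of \<phi> (\<lambda>y. - (D y \<bullet> (Q *\<^sub>v D y)))"
  proof (rule primitive_of_cong_half_line)
    show "primitive_of (\<lambda>y. \<Sum>j<n. U j y * V j y) (\<lambda>y. \<Sum>j<n. (\<Sum>l<m. b j $ l * g l y) * V j y + g (m + j) y * U j y)"
      by (intro primitive_of_sum primitive_of_mult pO pV) simp
    show "(\<Sum>j<n. U j y * V j y) = \<phi> y" for y by (simp add: \<phi>_def)
    fix y :: real assume y: "y \<ge> 0"
    define r where "r = - (Q *\<^sub>v D y)"
    have r: "r \<in> carrier_vec N" and dQ: "dim_vec (Q *\<^sub>v D y) = N" using QDc[OF y] Q(1) by (simp_all add: r_def)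
    have gr: "g i y = r $ i" if "i < N" for i using that dQ by (simp add: g_def r_def)
    define re where "re = vec_first r m"
    define ro where "ro = vec_last r n"
    have rr: "re \<in> carrier_vec m" "ro \<in> carrier_vec n" by (simp_all add: re_def ro_def)
    have MTec: "M\<^sup>T *\<^sub>v we y \<in> carrier_vec n" using M oe(2)[of y] by simp
    have Pre: "P *\<^sub>v re \<in> carrier_vec n" using P rr by simp
    have 1: "(\<Sum>l<m. b j $ l * g l y) = (P *\<^sub>v re) $ j" if "j < n" for j
      unfolding Pv[OF rr(1) that] by (intro sum.cong) (simp_all add: gr N_def re_def vec_first_def)
    have 2: "g (m + j) y = ro $ j" if "j < n" for j
      using that r by (simp add: gr N_def ro_def vec_last_def)
    have "(\<Sum>j<n. (\<Sum>l<m. b j $ l * g l y) * V j y + g (m + j) y * U j y)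
        = (\<Sum>j<n. (P *\<^sub>v re) $ j * (M\<^sup>T *\<^sub>v we y) $ j) + (\<Sum>j<n. ro $ j * wo y $ j)"
      unfolding sum.distrib
      by (intro arg_cong2[where f = "(+)"] sum.cong refl) (simp_all add: 1 2 V_def U_def MTe[OF y] o_eq[OF y] del: index_mult_mat_vec)
    also have "(\<Sum>j<n. (P *\<^sub>v re) $ j * (M\<^sup>T *\<^sub>v we y) $ j) = (P *\<^sub>v re) \<bullet> (M\<^sup>T *\<^sub>v we y)"
      using M by (simp add: scalar_prod_def atLeast0LessThan del: index_mult_mat_vec)
    also have "(\<Sum>j<n. ro $ j * wo y $ j) = ro \<bullet> wo y"
      using oe(1)[of y] by (simp add: scalar_prod_def atLeast0LessThan)
    also have "(P *\<^sub>v re) \<bullet> (M\<^sup>T *\<^sub>v we y) = re \<bullet> we y"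
    proof -
      \<comment> \<open>The component of the even part that \<open>M^T\<close> annihilates. It is
        not seen by \<open>A D\<close> and may fail to be differentiable, but \<open>(e', 0)\<close>
        lies in the kernel of \<open>A\<close>, so the algebraic part of the system makes it
        orthogonal to the right-hand side.\<close>
      define e' where "e' = we y - P\<^sup>T *\<^sub>v (M\<^sup>T *\<^sub>v we y)"
      have PT: "P\<^sup>T *\<^sub>v (M\<^sup>T *\<^sub>v we y) \<in> carrier_vec m" using P MTec by simp
      have e'c: "e' \<in> carrier_vec m" using oe(2)[of y] PT by (simp add: e'_def)
      have "M\<^sup>T *\<^sub>v (P\<^sup>T *\<^sub>v (M\<^sup>T *\<^sub>v we y)) = M\<^sup>T *\<^sub>v we y"
      proof -
        have MP: "M\<^sup>T * P\<^sup>T = 1\<^sub>m n"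
        proof -
          have "P * M = 1\<^sub>m n"
          proof (rule eq_matI)
            fix i j assume "i < dim_row (1\<^sub>m n :: real mat)" "j < dim_col (1\<^sub>m n :: real mat)"
            then have ij: "i < n" "j < n" by simp_all
            have "(P * M) $$ (i, j) = (P *\<^sub>v col M j) $ i" using P M ij by simp
            also have "col M j = M *\<^sub>v unit_vec n j" using M ij by (intro eq_vecI) simp_all
            also have "(P *\<^sub>v (M *\<^sub>v unit_vec n j)) $ i = unit_vec n j $ i" by (simp only: PM[OF unit_vec_carrier])
            finally show "(P * M) $$ (i, j) = 1\<^sub>m n $$ (i, j)" using ij by (simp add: unit_vec_def)
          qed (use P M in simp_all)
          then have "(P * M)\<^sup>T = 1\<^sub>m n" by simp
          then show ?thesis using transpose_mult[OF P M] by simp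
        qed
        have "M\<^sup>T *\<^sub>v (P\<^sup>T *\<^sub>v (M\<^sup>T *\<^sub>v we y)) = (M\<^sup>T * P\<^sup>T) *\<^sub>v (M\<^sup>T *\<^sub>v we y)"
          using M P MTec by (intro assoc_mult_mat_vec[symmetric]) auto
        then show ?thesis using MP MTec by simp
      qed
      moreover have "M\<^sup>T *\<^sub>v e' = M\<^sup>T *\<^sub>v we y - M\<^sup>T *\<^sub>v (P\<^sup>T *\<^sub>v (M\<^sup>T *\<^sub>v we y))"
        unfolding e'_def using M oe(2)[of y] PT by (intro mult_minus_distrib_mat_vec[of _ n m]) auto
      ultimately have "M\<^sup>T *\<^sub>v e' = 0\<^sub>v n" using MTec by simp
      then have "A *\<^sub>v (e' @\<^sub>v 0\<^sub>v n) = 0\<^sub>v m @\<^sub>v 0\<^sub>v n"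
        unfolding A using grad_A_mult_append[OF M e'c, of "0\<^sub>v n"] mult_mat_zero_vec[OF M] by simp
      then have "A *\<^sub>v (e' @\<^sub>v 0\<^sub>v n) = 0\<^sub>v N" unfolding N_def by (simp add: zero_vec_append)
      moreover have e'N: "e' @\<^sub>v 0\<^sub>v n \<in> carrier_vec (m + n)" using e'c by simp
      ultimately have "(e' @\<^sub>v 0\<^sub>v n) \<bullet> r = 0"
        using alg[OF y, of "e' @\<^sub>v 0\<^sub>v n"] by (simp add: r_def scalar_prod_uminus_right N_def)
      then have "e' \<bullet> re = 0"
        using scalar_prod_append_split[OF e'N r[unfolded N_def]] e'c
        by (simp add: vec_first_append vec_last_append re_def)
      then have "we y \<bullet> re = (P\<^sup>T *\<^sub>v (M\<^sup>T *\<^sub>v we y)) \<bullet> re"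
        unfolding e'_def using minus_scalar_prod_distrib[OF oe(2) PT rr(1)] by simp
      also have "\<dots> = (M\<^sup>T *\<^sub>v we y) \<bullet> (P *\<^sub>v re)" by (rule transpose_vec_mult_scalar[OF P rr(1) MTec])
      finally show ?thesis
        using comm_scalar_prod[OF oe(2) rr(1), of y] comm_scalar_prod[OF MTec Pre] by simp
    qed
    also have "re \<bullet> we y + ro \<bullet> wo y = r \<bullet> D y"
      unfolding re_def ro_def we_def wo_def using scalar_prod_append_split[OF r[unfolded N_def] Dc[OF y, unfolded N_def]] by simp
    also have "r \<bullet> D y = D y \<bullet> r" by (rule comm_scalar_prod[OF r Dc[OF y]])
    also have "\<dots> = - (D y \<bullet> (Q *\<^sub>v D y))" unfolding r_def by (rule scalar_prod_uminus_right)
    finally show "(\<Sum>j<n. (\<Sum>l<m. b j $ l * g l y) * V j y + g (m + j) y * U j y) = - (D y \<bullet> (Q *\<^sub>v D y))" .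
  qed
  have anti: "\<phi> y \<le> \<phi> x" if "0 \<le> x" "x \<le> y" for x y
    using primitive_of_nonpos_imp_antimono[OF p\<phi> negligible_empty _ that] Q_nonneg Dc by (simp add: N_def)
  have OL: "wL2 a (U j)" for j
  proof -
    have "wL2 a (\<lambda>y. \<Sum>l<m. (A *\<^sub>v D y) $ l * b j $ l)" by (rule wL2_lincomb(1)) (simp add: ADL N_def)
    then show ?thesis unfolding U_def by (simp add: mult.commute)
  qed
  have VL: "wL2 a (V j)" if "j < n" for j unfolding V_def using that by (intro ADL) (simp add: N_def)
  have \<phi>_nonneg: "\<phi> x \<ge> 0" if "x \<ge> 0" for x
  proof (rule antimono_integrable_nonneg[OF anti _ _ that])
    show "(\<lambda>y. \<Sum>j<n. exp (2 * a * y) * (U j y)\<^sup>2 + exp (2 * a * y) * (V j y)\<^sup>2) integrable_on {0..}"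
      by (intro integrable_sum integrable_add wL2_integral(1) OL VL) simp_all
    fix y :: real assume y: "y \<ge> 0"
    have "\<bar>\<phi> y\<bar> \<le> (\<Sum>j<n. \<bar>U j y * V j y\<bar>)" unfolding \<phi>_def by (rule sum_abs)
    also have "\<dots> \<le> (\<Sum>j<n. exp (2 * a * y) * (U j y)\<^sup>2 + exp (2 * a * y) * (V j y)\<^sup>2)"
    proof (rule sum_mono)
      fix j
      have "2 * \<bar>U j y\<bar> * \<bar>V j y\<bar> \<le> \<bar>U j y\<bar>\<^sup>2 + \<bar>V j y\<bar>\<^sup>2" by (rule sum_squares_bound)
      moreover have "0 \<le> \<bar>U j y\<bar> * \<bar>V j y\<bar>" by simp
      ultimately have "\<bar>U j y * V j y\<bar> \<le> 1 * ((U j y)\<^sup>2 + (V j y)\<^sup>2)"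
        unfolding abs_mult power2_abs mult_1 mult.assoc by linarith
      also have "\<dots> \<le> exp (2 * a * y) * ((U j y)\<^sup>2 + (V j y)\<^sup>2)" using a y by (intro mult_right_mono) simp_all
      finally show "\<bar>U j y * V j y\<bar> \<le> exp (2 * a * y) * (U j y)\<^sup>2 + exp (2 * a * y) * (V j y)\<^sup>2" by (simp add: distrib_left)
    qed
    finally show "\<bar>\<phi> y\<bar> \<le> (\<Sum>j<n. exp (2 * a * y) * (U j y)\<^sup>2 + exp (2 * a * y) * (V j y)\<^sup>2)" .
  qed
  \<comment> \<open>As \<open>(z, 0)\<close> lies in the kernel of \<open>Q\<close>, its product
    with \<open>A D\<close> is conserved and has finite weighted norm, so it is zero. This removes
    the boundary parameter from the energy balance at 0.\<close>
  have zMo: "z \<bullet> (M *\<^sub>v wo 0) = 0"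
  proof -
    define \<psi> where "\<psi> y = (\<Sum>l<m. z $ l * (A *\<^sub>v D y) $ l)" for y
    have p: "primitive_of \<psi> (\<lambda>y. \<Sum>l<m. z $ l * g l y)"
      unfolding \<psi>_def g_def by (intro primitive_of_sum primitive_of_cmult prim) (simp add: N_def)
    have zN: "z @\<^sub>v 0\<^sub>v n \<in> carrier_vec (m + n)" using z(1) by simp
    have "(\<Sum>l<m. z $ l * g l y) = 0" if y: "y \<ge> 0" for y
    proof -
      have "(\<Sum>l<m. z $ l * g l y) = - (z \<bullet> vec_first (Q *\<^sub>v D y) m)"
        using QDc[OF y] by (simp add: g_def scalar_prod_def atLeast0LessThan vec_first_def sum_negf del: index_mult_mat_vec)
      also have "z \<bullet> vec_first (Q *\<^sub>v D y) m = (z @\<^sub>v 0\<^sub>v n) \<bullet> (Q *\<^sub>v D y)"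
        using scalar_prod_append_split[OF zN QDc[OF y, unfolded N_def]] z(1)
        by (simp add: vec_first_append vec_last_append)
      also have "\<dots> = D y \<bullet> (Q *\<^sub>v (z @\<^sub>v 0\<^sub>v n))"
        by (rule symmetric_scalar_prod[OF Q Dc[OF y] zN[folded N_def]])
      also have "\<dots> = 0" unfolding z(2) using Dc[OF y] by (simp add: N_def)
      finally show ?thesis by simp
    qed
    then have const: "\<psi> y = \<psi> 0" if "y \<ge> 0" for y
      using that by (intro primitive_of_zero_imp_const[OF p negligible_empty]) simp_all
    have "wL2 a (\<lambda>y. \<Sum>l<m. (A *\<^sub>v D y) $ l * z $ l)" by (rule wL2_lincomb(1)) (simp add: ADL N_def)
    then have "wL2 a \<psi>" unfolding \<psi>_def by (simp add: mult.commute)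
    then have "\<psi> 0 = 0" using const a by (rule wL2_const_eq_0)
    moreover have "\<psi> 0 = z \<bullet> (M *\<^sub>v wo 0)"
    proof -
      have dim: "dim_vec (M *\<^sub>v wo 0) = m" using M by simp
      show ?thesis unfolding \<psi>_def scalar_prod_def dim atLeast0LessThan using Mo[of 0] by (intro sum.cong) simp_all
    qed
    ultimately show ?thesis by simp
  qed
  have MT: "M\<^sup>T \<in> carrier_mat n m" using M by simp
  \<comment> \<open>Test the boundary condition with \<open>wo 0\<close>: the \<open>H\<close> term
    would be positive and the energy term is nonnegative, yet their sum is 0.\<close>
  have o0: "wo 0 = 0\<^sub>v n"
  proof (rule ccontr)
    assume "wo 0 \<noteq> 0\<^sub>v n"
    then have pos: "wo 0 \<bullet> (H *\<^sub>v wo 0) > 0" using H oe(1)[of 0] unfolding pos_def_def by auto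
    have c: "H *\<^sub>v wo 0 \<in> carrier_vec n" "M\<^sup>T *\<^sub>v we 0 \<in> carrier_vec n" "M\<^sup>T *\<^sub>v z \<in> carrier_vec n" using H MT oe z by auto
    have "H *\<^sub>v wo 0 + \<chi> \<cdot>\<^sub>v (M\<^sup>T *\<^sub>v we 0 + M\<^sup>T *\<^sub>v z) = 0\<^sub>v n"
      using bc mult_add_distrib_mat_vec[OF MT oe(2)[of 0] z(1)] by (simp add: wo_def we_def)
    then have "wo 0 \<bullet> (H *\<^sub>v wo 0 + \<chi> \<cdot>\<^sub>v (M\<^sup>T *\<^sub>v we 0 + M\<^sup>T *\<^sub>v z)) = 0" using oe(1)[of 0] by simp
    then have "wo 0 \<bullet> (H *\<^sub>v wo 0) + \<chi> * (wo 0 \<bullet> (M\<^sup>T *\<^sub>v we 0) + wo 0 \<bullet> (M\<^sup>T *\<^sub>v z)) = 0"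
      using c oe(1)[of 0] by (simp add: scalar_prod_add_distrib[of _ n])
    moreover have "wo 0 \<bullet> (M\<^sup>T *\<^sub>v z) = 0"
      using scalar_prod_mult_mat_vec[OF MT z(1) oe(1)[of 0]] zMo comm_scalar_prod[of "M *\<^sub>v wo 0" m z] M oe(1)[of 0] z(1) by simp
    moreover have "wo 0 \<bullet> (M\<^sup>T *\<^sub>v we 0) \<ge> 0" using \<phi>_nonneg[of 0] \<phi>_eq[of 0] by simp
    moreover have "\<chi> * (wo 0 \<bullet> (M\<^sup>T *\<^sub>v we 0)) \<ge> 0" using calculation(3) \<chi> by simp
    ultimately show False using pos by simp
  qed
  have "\<phi> 0 = 0" using \<phi>_eq[of 0] o0 MT oe(2)[of 0] by simp
  then have \<phi>0: "\<phi> y = 0" if "y \<ge> 0" for y using anti[of 0 y] \<phi>_nonneg[OF that] that by simp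
  obtain Z where Z: "negligible Z" "\<forall>y\<in>{0..} - Z. (\<phi> has_real_derivative - (D y \<bullet> (Q *\<^sub>v D y))) (at y within {0..})"
    using p\<phi> unfolding primitive_of_def by blast
  \<comment> \<open>Zero energy gives zero dissipation. The point 0 is left out so that the
    derivative is two-sided and can be compared with that of the zero function.\<close>
  have QD0: "Q *\<^sub>v D y = 0\<^sub>v N" if y: "y \<ge> 0" "y \<notin> insert 0 Z" for y
  proof -
    have y0: "y > 0" "y \<in> {0..} - Z" using y by auto
    have "at y within {0..} = at y" using y0 by (intro at_within_interior) simp
    then have "(\<phi> has_real_derivative - (D y \<bullet> (Q *\<^sub>v D y))) (at y)" using Z(2) y0(2) by metis
    then have "((\<lambda>_. 0) has_real_derivative - (D y \<bullet> (Q *\<^sub>v D y))) (at y)"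
      by (rule has_field_derivative_transform_within_open[of _ _ _ "{0<..}"]) (use y0 \<phi>0 in auto)
    then have "D y \<bullet> (Q *\<^sub>v D y) = 0" using DERIV_unique[OF DERIV_const[of 0]] by fastforce
    then show ?thesis using Dc[OF y(1)] Q_nonneg by (intro psd_null_vector[OF Q]) (simp_all add: N_def)
  qed
  \<comment> \<open>Each component of \<open>A D\<close> has derivative 0 almost everywhere and
    finite weighted norm, so it is a constant equal to 0.\<close>
  have AD0: "A *\<^sub>v D y = 0\<^sub>v N" if y: "y \<ge> 0" for y
  proof (rule eq_vecI)
    fix i assume "i < dim_vec (0\<^sub>v N :: real vec)"
    then have i: "i < N" by simp
    have const: "(A *\<^sub>v D x) $ i = (A *\<^sub>v D 0) $ i" if "x \<ge> 0" for x
    proof (rule primitive_of_zero_imp_const[OF prim[OF i] _ _ that])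
      show "negligible (insert 0 Z)" using Z(1) by simp
      fix t :: real assume "t \<ge> 0" "t \<notin> insert 0 Z"
      then show "- (Q *\<^sub>v D t) $ i = 0" using QD0[of t] i by simp
    qed
    have "(A *\<^sub>v D 0) $ i = 0" using ADL[OF i] const a by (rule wL2_const_eq_0)
    then show "(A *\<^sub>v D y) $ i = 0\<^sub>v N $ i" using const[OF y] i by simp
  qed (use Ac in simp)
  \<comment> \<open>The algebraic condition at every point enters here: \<open>D y\<close> itself is
    a kernel vector of \<open>A\<close>, so \<open>D y \<bullet> Q (D y) = 0\<close> without an
    exceptional set.\<close>
  show D0: "D y = 0\<^sub>v (m + n)" if y: "y \<ge> 0" for y
  proof (rule null)
    have "D y \<bullet> (Q *\<^sub>v D y) = 0" by (rule alg[OF y Dc[OF y] AD0[OF y]])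
    then show "Q *\<^sub>v D y = 0\<^sub>v (m + n)"
      unfolding N_def[symmetric] using Dc[OF y] Q_nonneg by (intro psd_null_vector[OF Q]) (simp_all add: N_def)
  qed (use Dc[OF y] AD0[OF y] in \<open>simp_all add: N_def\<close>)
  \<comment> \<open>With \<open>D 0 = 0\<close> the boundary condition reduces to
    \<open>M^T z = 0\<close>, so \<open>(z, 0)\<close> lies in both kernels.\<close>
  have "z @\<^sub>v 0\<^sub>v n = 0\<^sub>v (m + n)"
  proof (rule null[OF _ _ z(2)])
    show "z @\<^sub>v 0\<^sub>v n \<in> carrier_vec (m + n)" using z(1) by simp
    have we0: "we 0 = 0\<^sub>v m" unfolding we_def D0[OF order_refl] by (auto simp: vec_first_def)
    have "H *\<^sub>v wo 0 = 0\<^sub>v n" unfolding o0 by (rule mult_mat_zero_vec[OF H(1)])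
    then have "\<chi> \<cdot>\<^sub>v (M\<^sup>T *\<^sub>v z) = 0\<^sub>v n"
      using bc we0 z(1) MT by (simp add: wo_def[symmetric] we_def[symmetric])
    then have "\<chi> * (M\<^sup>T *\<^sub>v z) $ j = 0" if "j < n" for j
      using that MT by (metis index_smult_vec(1) index_zero_vec(1) carrier_matD(1) dim_mult_mat_vec)
    then have "M\<^sup>T *\<^sub>v z = 0\<^sub>v n" using \<chi> MT by (intro eq_vecI) (simp_all del: index_mult_mat_vec)
    then show "A *\<^sub>v (z @\<^sub>v 0\<^sub>v n) = 0\<^sub>v (m + n)"
      unfolding A using grad_A_mult_append[OF M z(1), of "0\<^sub>v n"] mult_mat_zero_vec[OF M] by (simp add: zero_vec_append)
  qed
  then have "vec_first (z @\<^sub>v 0\<^sub>v n) m = vec_first (0\<^sub>v (m + n)) m" by simp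
  then show "z = 0\<^sub>v m" unfolding vec_first_append[OF z(1)] by (auto simp: vec_first_def)
qed

section \<open>Block bases\<close>

lemma diag_block_mat_two:
  assumes "X \<in> carrier_mat m a" "Y \<in> carrier_mat n b"
  shows "diag_block_mat [X, Y] = four_block_mat X (0\<^sub>m m b) (0\<^sub>m n a) (Y :: real mat)"
proof -
  have Y: "diag_block_mat [Y] = Y" by (intro eq_matI) (auto simp: Let_def)
  have "diag_block_mat [X, Y] = (let B = diag_block_mat [Y] in
      four_block_mat X (0\<^sub>m (dim_row X) (dim_col B)) (0\<^sub>m (dim_row B) (dim_col X)) B)"
    by (rule diag_block_mat.simps(2))
  then show ?thesis unfolding Y Let_def using assms by simp
qed

lemma diag_block_mat_two_carrier:
  fixes X Y :: "real mat"
  assumes "X \<in> carrier_mat m a" "Y \<in> carrier_mat n b"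
  shows "diag_block_mat [X, Y] \<in> carrier_mat (m + n) (a + b)"
  unfolding diag_block_mat_two[OF assms] using assms by simp

lemma diag_block_mat_two_mult:
  assumes X: "X \<in> carrier_mat m a" and Y: "Y \<in> carrier_mat n b" and x: "x \<in> carrier_vec a" "y \<in> carrier_vec b"
  shows "diag_block_mat [X, Y] *\<^sub>v (x @\<^sub>v y) = (X *\<^sub>v x) @\<^sub>v ((Y :: real mat) *\<^sub>v y)"
proof -
  have "diag_block_mat [X, Y] *\<^sub>v (x @\<^sub>v y) = (X *\<^sub>v x + 0\<^sub>m m b *\<^sub>v y) @\<^sub>v (0\<^sub>m n a *\<^sub>v x + Y *\<^sub>v y)"
    unfolding diag_block_mat_two[OF X Y] using X Y x by (intro four_block_mat_mult_vec) auto
  moreover have "0\<^sub>m m b *\<^sub>v y = 0\<^sub>v m" "0\<^sub>m n a *\<^sub>v x = 0\<^sub>v n" using x by (auto intro!: eq_vecI)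
  moreover have "X *\<^sub>v x \<in> carrier_vec m" "Y *\<^sub>v y \<in> carrier_vec n" using X Y x by auto
  ultimately show ?thesis by simp
qed

lemma carrier_vec_append_cases:
  assumes "v \<in> carrier_vec (m + n)"
  obtains x y where "x \<in> carrier_vec m" "y \<in> carrier_vec n" "v = (x @\<^sub>v y :: real vec)"
proof
  show "v = vec_first v m @\<^sub>v vec_last v n" using assms by simp
qed simp_all

lemma append_vec_eq_zero:
  assumes "x \<in> carrier_vec m" "y \<in> carrier_vec n" "x @\<^sub>v y = (0\<^sub>v (m + n) :: real vec)"
  shows "x = 0\<^sub>v m" "y = 0\<^sub>v n"
  using assms unfolding zero_vec_append[symmetric] by simp_all

lemma mat_range_eq_col_space:
  "(B :: real mat) \<in> carrier_mat n k \<Longrightarrow> vec_space.col_space n B = (\<lambda>x. B *\<^sub>v x) ` carrier_vec k"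
  by (subst vec_space.col_space_eq) auto

lemma orthonormal_basis_matD:
  assumes "orthonormal_basis_mat B n k S"
  shows "B \<in> carrier_mat n k" "\<And>x. x \<in> carrier_vec k \<Longrightarrow> B\<^sup>T *\<^sub>v (B *\<^sub>v x) = x" "S = (\<lambda>x. B *\<^sub>v x) ` carrier_vec k"
    "\<And>x. x \<in> carrier_vec k \<Longrightarrow> B *\<^sub>v x = 0\<^sub>v n \<Longrightarrow> x = 0\<^sub>v k"
proof -
  show B: "B \<in> carrier_mat n k" and S: "S = (\<lambda>x. B *\<^sub>v x) ` carrier_vec k"
    using assms mat_range_eq_col_space unfolding orthonormal_basis_mat_def by auto
  have BT: "B\<^sup>T \<in> carrier_mat k n" using B by simp
  show BB: "B\<^sup>T *\<^sub>v (B *\<^sub>v x) = x" if "x \<in> carrier_vec k" for x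
    using assoc_mult_mat_vec[OF BT B that] assms that unfolding orthonormal_basis_mat_def by simp
  show "x = 0\<^sub>v k" if "x \<in> carrier_vec k" "B *\<^sub>v x = 0\<^sub>v n" for x
    using BB[OF that(1)] that(2) mult_mat_zero_vec[OF BT] by simp
qed

text \<open>Orthogonality of the joined matrix, translated into statements on the ranges of its
  three blocks. The last one expands \<open>v\<close> in the orthonormal columns, where only the
  middle block survives; the dimensions follow from counting columns.\<close>

lemma orthogonal_triple:
  fixes Y1 Y2 Y3 :: "real mat"
  assumes Y: "Y1 \<in> carrier_mat n a" "Y2 \<in> carrier_mat n b" "Y3 \<in> carrier_mat n c"
    and orth: "real_orthogonal n (mat_of_cols n (cols Y1 @ cols Y2 @ cols Y3))"
  shows "a + b + c = n"
    and "\<And>u x. u \<in> carrier_vec c \<Longrightarrow> x \<in> carrier_vec a \<Longrightarrow> (Y3 *\<^sub>v u) \<bullet> (Y1 *\<^sub>v x) = 0"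
    and "\<And>u x. u \<in> carrier_vec c \<Longrightarrow> x \<in> carrier_vec b \<Longrightarrow> (Y3 *\<^sub>v u) \<bullet> (Y2 *\<^sub>v x) = 0"
    and "\<And>u. u \<in> carrier_vec c \<Longrightarrow> Y3 *\<^sub>v u = 0\<^sub>v n \<Longrightarrow> u = 0\<^sub>v c"
    and "\<And>v. v \<in> carrier_vec n \<Longrightarrow> (\<And>u. u \<in> carrier_vec c \<Longrightarrow> (Y3 *\<^sub>v u) \<bullet> v = 0) \<Longrightarrow>
      (\<And>x. x \<in> carrier_vec a \<Longrightarrow> (Y1 *\<^sub>v x) \<bullet> v = 0) \<Longrightarrow> \<exists>x\<in>carrier_vec b. v = Y2 *\<^sub>v x"
proof -
  define U where "U = mat_of_cols n (cols Y1 @ cols Y2 @ cols Y3)"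
  have U: "U \<in> carrier_mat n n" and UU: "U\<^sup>T * U = 1\<^sub>m n"
    using orth unfolding real_orthogonal_def U_def by auto
  have "dim_col U = a + b + c" unfolding U_def using Y by simp
  then show abc: "a + b + c = n" using U by simp
  have col_c: "col B i \<in> carrier_vec n" if "B \<in> carrier_mat n l" for B :: "real mat" and l i
    using that by (metis carrier_matD(1) col_dim)
  have colU: "col U i = (if i < a then col Y1 i else if i < a + b then col Y2 (i - a) else col Y3 (i - a - b))" if i: "i < n" for i
  proof -
    have len: "length (cols Y1 @ cols Y2 @ cols Y3) = n" using Y abc by simp
    have nth: "(cols Y1 @ cols Y2 @ cols Y3) ! i = (if i < a then col Y1 i else if i < a + b then col Y2 (i - a) else col Y3 (i - a - b))"
    proof -
      consider "i < a" | l where "i = a + l" "l < b" | l where "i = a + b + l" "l < c"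
      proof -
        assume c1: "i < a \<Longrightarrow> thesis" and c2: "\<And>l. i = a + l \<Longrightarrow> l < b \<Longrightarrow> thesis" and c3: "\<And>l. i = a + b + l \<Longrightarrow> l < c \<Longrightarrow> thesis"
        have "i < a \<or> (i = a + (i - a) \<and> i - a < b) \<or> (i = a + b + (i - a - b) \<and> i - a - b < c)"
          using i abc by arith
        then show thesis using c1 c2 c3 by metis
      qed
      then show ?thesis
        using Y by cases (simp_all add: nth_append)
    qed
    have "col U i = (cols Y1 @ cols Y2 @ cols Y3) ! i"
      unfolding U_def using i len col_c[OF Y(1)] col_c[OF Y(2)] col_c[OF Y(3)]
      by (intro col_mat_of_cols) (simp_all only: nth, simp)
    then show ?thesis unfolding nth .
  qed
  have dot: "col U i \<bullet> col U j = (if i = j then 1 else 0)" if "i < n" "j < n" for i j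
  proof -
    have "(U\<^sup>T * U) $$ (i, j) = col U i \<bullet> col U j" using U that by simp
    then show ?thesis unfolding UU using that by simp
  qed
  have col3: "col Y3 i = col U (a + b + i)" if "i < c" for i using colU[of "a + b + i"] that abc by simp
  have col2: "col Y2 i = col U (a + i)" if "i < b" for i using colU[of "a + i"] that abc by simp
  have col1: "col Y1 i = col U i" if "i < a" for i using colU[of i] that abc by simp
  have Y3T: "Y3\<^sup>T \<in> carrier_mat c n" using Y by simp
  have Z31: "Y3\<^sup>T * Y1 = 0\<^sub>m c a"
    using Y abc by (intro eq_matI) (simp_all add: col3 col1 dot)
  have Z32: "Y3\<^sup>T * Y2 = 0\<^sub>m c b"
    using Y abc by (intro eq_matI) (simp_all add: col3 col2 dot)
  have Z33: "Y3\<^sup>T * Y3 = 1\<^sub>m c"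
    using Y abc by (intro eq_matI) (simp_all add: col3 dot)
  have pair: "(Y3 *\<^sub>v u) \<bullet> (B *\<^sub>v x) = u \<bullet> ((Y3\<^sup>T * B) *\<^sub>v x)" if "u \<in> carrier_vec c" "B \<in> carrier_mat n l" "x \<in> carrier_vec l" for u B x l
  proof -
    have "u \<bullet> (Y3\<^sup>T *\<^sub>v (B *\<^sub>v x)) = (Y3\<^sup>T\<^sup>T *\<^sub>v u) \<bullet> (B *\<^sub>v x)"
      using that by (intro scalar_prod_mult_mat_vec[OF Y3T]) auto
    then show ?thesis using assoc_mult_mat_vec[OF Y3T that(2,3)] by simp
  qed
  have zero: "0\<^sub>m l l' *\<^sub>v x = (0\<^sub>v l :: real vec)" if "x \<in> carrier_vec l'" for l l' x
    using that by (intro eq_vecI) auto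
  show "(Y3 *\<^sub>v u) \<bullet> (Y1 *\<^sub>v x) = 0" if "u \<in> carrier_vec c" "x \<in> carrier_vec a" for u x
    unfolding pair[OF that(1) Y(1) that(2)] Z31 using that by (simp add: zero)
  show "(Y3 *\<^sub>v u) \<bullet> (Y2 *\<^sub>v x) = 0" if "u \<in> carrier_vec c" "x \<in> carrier_vec b" for u x
    unfolding pair[OF that(1) Y(2) that(2)] Z32 using that by (simp add: zero)
  show "u = 0\<^sub>v c" if u: "u \<in> carrier_vec c" "Y3 *\<^sub>v u = 0\<^sub>v n" for u
    using assoc_mult_mat_vec[OF Y3T Y(3) u(1)] u mult_mat_zero_vec[OF Y3T] unfolding Z33 by simp
  fix v :: "real vec" assume v: "v \<in> carrier_vec n" and v3: "\<And>u. u \<in> carrier_vec c \<Longrightarrow> (Y3 *\<^sub>v u) \<bullet> v = 0"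
    and v1: "\<And>x. x \<in> carrier_vec a \<Longrightarrow> (Y1 *\<^sub>v x) \<bullet> v = 0"
  have col_unit: "col B i = B *\<^sub>v unit_vec l i" if "B \<in> carrier_mat n l" "i < l" for B :: "real mat" and l i
    using that by (intro eq_vecI) auto
  have UT: "U\<^sup>T \<in> carrier_mat n n" using U by simp
  have UUT: "U * U\<^sup>T = 1\<^sub>m n" by (rule mat_mult_left_right_inverse[OF UT U UU])
  have w0: "col U j \<bullet> v = 0" if "j < n" "\<not> (a \<le> j \<and> j < a + b)" for j
  proof (cases "j < a")
    case True
    then show ?thesis using v1[of "unit_vec a j"] col1[OF True] col_unit[OF Y(1) True] by simp
  next
    case False
    define i where "i = j - a - b"
    have i: "i < c" "j = a + b + i" using False that abc by (auto simp: i_def)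
    show ?thesis using v3[of "unit_vec c i"] col3[OF i(1)] col_unit[OF Y(3) i(1)] by (simp add: i(2))
  qed
  have Y2T: "Y2\<^sup>T *\<^sub>v v \<in> carrier_vec b" using Y(2) v by simp
  have "v = Y2 *\<^sub>v (Y2\<^sup>T *\<^sub>v v)"
  proof (rule eq_vecI)
    fix i assume "i < dim_vec (Y2 *\<^sub>v (Y2\<^sup>T *\<^sub>v v))"
    then have i: "i < n" using Y by simp
    have "v = U *\<^sub>v (U\<^sup>T *\<^sub>v v)" using assoc_mult_mat_vec[OF U UT v] UUT v by simp
    then have "v $ i = (U *\<^sub>v (U\<^sup>T *\<^sub>v v)) $ i" by simp
    also have "\<dots> = (\<Sum>j<n. col U j $ i * (col U j \<bullet> v))"
      using U i v by (simp add: scalar_prod_def[of "row U i"] atLeast0LessThan)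
    also have "\<dots> = (\<Sum>j\<in>{a..<a + b}. col U j $ i * (col U j \<bullet> v))"
      using abc w0 by (intro sum.mono_neutral_right) auto
    also have "\<dots> = (\<Sum>j<b. col U (a + j) $ i * (col U (a + j) \<bullet> v))"
      by (rule sum.reindex_bij_witness[of _ "\<lambda>j. a + j" "\<lambda>j. j - a"]) auto
    also have "\<dots> = (\<Sum>j<b. Y2 $$ (i, j) * (col Y2 j \<bullet> v))"
      using i Y by (intro sum.cong) (simp_all add: col2[symmetric])
    also have "\<dots> = (Y2 *\<^sub>v (Y2\<^sup>T *\<^sub>v v)) $ i"
      using i Y by (simp add: scalar_prod_def[of "row Y2 i"] atLeast0LessThan)
    finally show "v $ i = (Y2 *\<^sub>v (Y2\<^sup>T *\<^sub>v v)) $ i" .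
  qed (use Y v in simp)
  then show "\<exists>x\<in>carrier_vec b. v = Y2 *\<^sub>v x" using Y2T by blast
qed

text \<open>One half of Sylvester's law of inertia. If \<open>q\<close> exceeded the number of
  positive \<mu>, some \<open>B z\<close> with nonzero \<open>z\<close> would be
  \<open>Q\<close>-orthogonal to all eigenvectors with positive \<mu>, and the form \<open>A\<close>
  could not be positive on it.\<close>

lemma positive_subspace_dim_le:
  fixes A Q B :: "real mat" and \<mu> :: "nat \<Rightarrow> real"
  assumes A: "A \<in> carrier_mat k k" and Q: "Q \<in> carrier_mat k k" "Q\<^sup>T = Q"
    and Q_inj: "\<And>u. u \<in> carrier_vec k \<Longrightarrow> Q *\<^sub>v u = 0\<^sub>v k \<Longrightarrow> u = 0\<^sub>v k"
    and c: "\<And>i. i < k \<Longrightarrow> c i \<in> carrier_vec k"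
    and cQ: "\<And>i j. i < k \<Longrightarrow> j < k \<Longrightarrow> c i \<bullet> (Q *\<^sub>v c j) = (if i = j then 1 else 0)"
    and cA: "\<And>i j. i < k \<Longrightarrow> j < k \<Longrightarrow> c i \<bullet> (A *\<^sub>v c j) = (if i = j then \<mu> i else 0)"
    and span: "\<And>u. u \<in> carrier_vec k \<Longrightarrow> (\<And>i. i < k \<Longrightarrow> c i \<bullet> u = 0) \<Longrightarrow> u = 0\<^sub>v k"
    and B: "B \<in> carrier_mat k q"
    and pos: "\<And>z. z \<in> carrier_vec q \<Longrightarrow> z \<noteq> 0\<^sub>v q \<Longrightarrow> (B *\<^sub>v z) \<bullet> (A *\<^sub>v (B *\<^sub>v z)) > 0"
  shows "q \<le> card {i. i < k \<and> \<mu> i > 0}"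
proof (rule ccontr)
  define F where "F = {i. i < k \<and> \<mu> i > 0}"
  assume "\<not> q \<le> card {i. i < k \<and> \<mu> i > 0}"
  then have lt: "card F < q" by (simp add: F_def)
  have "finite F" by (simp add: F_def)
  then obtain \<pi> where \<pi>: "bij_betw \<pi> {0..<card F} F" using ex_bij_betw_nat_finite by blast
  have \<pi>k: "\<pi> i < k" if "i < card F" for i using \<pi> that unfolding bij_betw_def F_def by auto
  \<comment> \<open>The kernel of \<open>R\<close> consists of the \<open>z\<close> for which
    \<open>B z\<close> is \<open>Q\<close>-orthogonal to the selected eigenvectors; it is nonzero
    because \<open>R\<close> has more columns than rows.\<close>
  define R where "R = mat_of_rows q (map (\<lambda>i. B\<^sup>T *\<^sub>v (Q *\<^sub>v c (\<pi> i))) [0..<card F])"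
  have R: "R \<in> carrier_mat (card F) q" unfolding R_def carrier_mat_def by simp
  obtain z where z: "z \<in> carrier_vec q" "z \<noteq> 0\<^sub>v q" "R *\<^sub>v z = 0\<^sub>v (card F)"
    using wide_matrix_has_kernel[OF R lt] by blast
  define u where "u = B *\<^sub>v z"
  have u: "u \<in> carrier_vec k" using B z by (simp add: u_def)
  define x where "x i = u \<bullet> (Q *\<^sub>v c i)" for i
  have xF: "x i = 0" if "i \<in> F" for i
  proof -
    have "i \<in> \<pi> ` {0..<card F}" using bij_betw_imp_surj_on[OF \<pi>] that by simp
    then obtain l where l: "l < card F" "i = \<pi> l" by (elim imageE) simp
    have Qc: "Q *\<^sub>v c i \<in> carrier_vec k" using Q c[OF \<pi>k[OF l(1)]] l(2) by simp
    have rc: "B\<^sup>T *\<^sub>v (Q *\<^sub>v c i) \<in> carrier_vec q" using B Qc by simp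
    define b where "b = B\<^sup>T *\<^sub>v (Q *\<^sub>v c i)"
    have b: "b \<in> carrier_vec q" using rc by (simp add: b_def)
    have "map (\<lambda>i. B\<^sup>T *\<^sub>v (Q *\<^sub>v c (\<pi> i))) [0..<card F] ! l = b" using l(1) unfolding b_def l(2) by simp
    then have "row R l = b" using l(1) b unfolding R_def by (subst mat_of_rows_row) simp_all
    moreover have "(R *\<^sub>v z) $ l = row R l \<bullet> z" using R l(1) by (intro index_mult_mat_vec) simp
    ultimately have "b \<bullet> z = 0" using z(3) l(1) by simp
    moreover have "b \<bullet> z = (Q *\<^sub>v c i) \<bullet> (B *\<^sub>v z)" unfolding b_def by (rule transpose_vec_mult_scalar[OF B z(1) Qc])
    moreover have "(Q *\<^sub>v c i) \<bullet> (B *\<^sub>v z) = x i" unfolding x_def u_def[symmetric] by (rule comm_scalar_prod[OF Qc u])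
    ultimately show ?thesis by simp
  qed
  \<comment> \<open>The eigenvector expansion of \<open>u\<close>; agreement with \<open>u\<close>
    follows from completeness of the family and injectivity of \<open>Q\<close>.\<close>
  define w where "w = lincomb k k c x"
  have w: "w \<in> carrier_vec k" by (simp add: w_def)
  have lin: "X *\<^sub>v w = lincomb k k (\<lambda>i. X *\<^sub>v c i) x" if "X \<in> carrier_mat k k" for X
    unfolding w_def by (rule mult_mat_lincomb[OF that]) (rule c)
  have Q0: "Q *\<^sub>v (u - w) = 0\<^sub>v k"
  proof (rule span)
    fix i assume i: "i < k"
    have "c i \<bullet> (Q *\<^sub>v w) = (\<Sum>j<k. x j * (c i \<bullet> (Q *\<^sub>v c j)))"
      unfolding lin[OF Q(1)] by (rule scalar_prod_lincomb[OF c[OF i]]) (use Q c in simp)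
    also have "\<dots> = (\<Sum>j<k. if j = i then x i else 0)" using i by (intro sum.cong) (simp_all add: cQ)
    also have "\<dots> = c i \<bullet> (Q *\<^sub>v u)" using i symmetric_scalar_prod[OF Q u c[OF i]] by (simp add: x_def)
    finally show "c i \<bullet> (Q *\<^sub>v (u - w)) = 0"
      unfolding mult_minus_distrib_mat_vec[OF Q(1) u w] using Q u w c[OF i] by (simp add: scalar_prod_minus_distrib[of _ k])
  next
    show "Q *\<^sub>v (u - w) \<in> carrier_vec k" using Q(1) u w by simp
  qed
  have "u - w \<in> carrier_vec k" using u w by simp
  then have "u - w = 0\<^sub>v k" by (rule Q_inj) (rule Q0)
  then have diff: "(u - w) $ i = 0" if "i < k" for i using that by simp
  have uw: "u = w"
  proof (rule eq_vecI)
    show "u $ i = w $ i" if "i < dim_vec w" for i using diff[of i] that w by simp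
  qed (use u w in simp)
  have "u \<bullet> (A *\<^sub>v u) = (\<Sum>j<k. x j * (u \<bullet> (A *\<^sub>v c j)))"
  proof -
    have "u \<bullet> (A *\<^sub>v w) = (\<Sum>j<k. x j * (u \<bullet> (A *\<^sub>v c j)))"
      unfolding lin[OF A] by (rule scalar_prod_lincomb[OF u]) (use A c in simp)
    then show ?thesis by (simp add: uw)
  qed
  also have "\<dots> = (\<Sum>j<k. \<mu> j * (x j)\<^sup>2)"
  proof (rule sum.cong)
    fix j assume "j \<in> {..<k}"
    then have j: "j < k" by simp
    have Ac: "A *\<^sub>v c j \<in> carrier_vec k" using A c[OF j] by simp
    have "u \<bullet> (A *\<^sub>v c j) = (A *\<^sub>v c j) \<bullet> w" using comm_scalar_prod[OF u Ac] uw by simp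
    also have "\<dots> = (\<Sum>i<k. x i * ((A *\<^sub>v c j) \<bullet> c i))" unfolding w_def by (rule scalar_prod_lincomb[OF Ac]) (rule c)
    also have "\<dots> = (\<Sum>i<k. if i = j then x j * \<mu> j else 0)"
    proof (intro sum.cong refl)
      fix i assume "i \<in> {..<k}"
      then have i: "i < k" by simp
      show "x i * ((A *\<^sub>v c j) \<bullet> c i) = (if i = j then x j * \<mu> j else 0)"
        using cA[OF i j] comm_scalar_prod[OF Ac c[OF i]] by simp
    qed
    finally show "x j * (u \<bullet> (A *\<^sub>v c j)) = \<mu> j * (x j)\<^sup>2" using j by (simp add: power2_eq_square)
  qed simp
  also have "\<dots> \<le> 0"
  proof (rule sum_nonpos)
    fix j assume "j \<in> {..<k}"
    then show "\<mu> j * (x j)\<^sup>2 \<le> 0" using xF[of j] by (cases "\<mu> j > 0") (simp_all add: F_def mult_nonpos_nonneg)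
  qed
  finally show False using pos[OF z(1,2)] by (simp add: u_def)
qed

lemma triple_product_kernel:
  fixes X B Y :: "real mat"
  assumes X: "X \<in> carrier_mat n p" and B: "B \<in> carrier_mat n m" and Y: "Y \<in> carrier_mat m q" and x: "x \<in> carrier_vec q"
  shows "x \<in> mat_kernel (X\<^sup>T * B * Y) \<longleftrightarrow> (\<forall>y\<in>carrier_vec p. (X *\<^sub>v y) \<bullet> (B *\<^sub>v (Y *\<^sub>v x)) = 0)"
proof -
  have XT: "X\<^sup>T \<in> carrier_mat p n" and XB: "X\<^sup>T * B \<in> carrier_mat p m" and XBY: "X\<^sup>T * B * Y \<in> carrier_mat p q"
    and Yx: "Y *\<^sub>v x \<in> carrier_vec m" and BYx: "B *\<^sub>v (Y *\<^sub>v x) \<in> carrier_vec n" using assms by auto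
  have eq: "(X\<^sup>T * B * Y) *\<^sub>v x = X\<^sup>T *\<^sub>v (B *\<^sub>v (Y *\<^sub>v x))"
    using assoc_mult_mat_vec[OF XB Y x] assoc_mult_mat_vec[OF XT B Yx] by simp
  have dot: "y \<bullet> (X\<^sup>T *\<^sub>v (B *\<^sub>v (Y *\<^sub>v x))) = (X *\<^sub>v y) \<bullet> (B *\<^sub>v (Y *\<^sub>v x))" if "y \<in> carrier_vec p" for y
    using scalar_prod_mult_mat_vec[OF XT BYx that] by simp
  have XTc: "X\<^sup>T *\<^sub>v (B *\<^sub>v (Y *\<^sub>v x)) \<in> carrier_vec p" using XT BYx by simp
  show ?thesis
  proof
    assume "x \<in> mat_kernel (X\<^sup>T * B * Y)"
    then have "X\<^sup>T *\<^sub>v (B *\<^sub>v (Y *\<^sub>v x)) = 0\<^sub>v p" using mat_kernelD(2)[OF XBY] eq by simp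
    then show "\<forall>y\<in>carrier_vec p. (X *\<^sub>v y) \<bullet> (B *\<^sub>v (Y *\<^sub>v x)) = 0" using dot by force
  next
    assume "\<forall>y\<in>carrier_vec p. (X *\<^sub>v y) \<bullet> (B *\<^sub>v (Y *\<^sub>v x)) = 0"
    then have "(X\<^sup>T *\<^sub>v (B *\<^sub>v (Y *\<^sub>v x))) \<bullet> (X\<^sup>T *\<^sub>v (B *\<^sub>v (Y *\<^sub>v x))) = 0" using dot XTc by simp
    then have "X\<^sup>T *\<^sub>v (B *\<^sub>v (Y *\<^sub>v x)) = 0\<^sub>v p" using scalar_prod_self_eq_0[OF XTc] by simp
    then show "x \<in> mat_kernel (X\<^sup>T * B * Y)" using mat_kernelI[OF XBY x] eq by simp
  qed
qed

section \<open>The block bases satisfy the abstract hypotheses\<close>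

lemma grad_A_form:
  assumes M: "M \<in> carrier_mat m n" and v: "x \<in> carrier_vec m" "y \<in> carrier_vec n" "x' \<in> carrier_vec m" "y' \<in> carrier_vec n"
  shows "(x @\<^sub>v y) \<bullet> (grad_A m n M *\<^sub>v (x' @\<^sub>v y')) = x \<bullet> (M *\<^sub>v y') + y \<bullet> (M\<^sup>T *\<^sub>v x')"
proof -
  have "M *\<^sub>v y' \<in> carrier_vec m" "M\<^sup>T *\<^sub>v x' \<in> carrier_vec n" using M v by auto
  then show ?thesis
    unfolding grad_A_mult_append[OF M v(3,4)] using v by (intro scalar_prod_append[of _ m _ n]) simp_all
qed

text \<open>\<open>A\<close> exchanges parities: the even part of \<open>A G c\<close> comes from
  \<open>M Go\<close> and is spanned by \<open>Y2\<close>, the odd part comes from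
  \<open>M^T Ge\<close> and is spanned by \<open>Z2\<close>. The clauses on \<open>V3\<close> thus
  reduce to the orthogonality of the two triples, and those that relate \<open>V1\<close> to
  \<open>G\<close> to the kernels spanned by \<open>Xe\<close> and \<open>Xo\<close>.\<close>

lemma block_kinetic_pencil:
  fixes M Q Qe Qo Ge Go Xe Xo Y1 Y2 Y3 Z1 Z2 Z3 :: "real mat"
  assumes M: "M \<in> carrier_mat m n"
    and Qe: "Qe \<in> carrier_mat m m" and Qo: "Qo \<in> carrier_mat n n"
    and Q_block: "Q = diag_block_mat [Qe, Qo]"
    and Q_psd: "pos_semidef Q"
    and null_AQ: "mat_kernel (grad_A m n M) \<inter> mat_kernel Q = {0\<^sub>v (m + n)}"
    and Ge: "orthonormal_basis_mat Ge m p1 (mat_kernel Qe)"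
    and Go: "orthonormal_basis_mat Go n p2 (mat_kernel Qo)"
    and Xe: "orthonormal_basis_mat Xe p1 r1 (mat_kernel (Go\<^sup>T * M\<^sup>T * Ge))"
    and Xo: "orthonormal_basis_mat Xo p2 r2 (mat_kernel (Ge\<^sup>T * M * Go))"
    and Y1: "Y1 = Ge * Xe" and Z1: "Z1 = Go * Xo"
    and Y2: "orthonormal_basis_mat Y2 m p2 (vec_space.col_space m (M * Go))"
    and Z2: "orthonormal_basis_mat Z2 n p1 (vec_space.col_space n (M\<^sup>T * Ge))"
    and Y3: "Y3 \<in> carrier_mat m k1" and Z3: "Z3 \<in> carrier_mat n k2"
    and Y_orth: "real_orthogonal m (mat_of_cols m (cols Y1 @ cols Y2 @ cols Y3))"
    and Z_orth: "real_orthogonal n (mat_of_cols n (cols Z1 @ cols Z2 @ cols Z3))"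
  shows "kinetic_pencil (m + n) (p1 + p2) (k1 + k2) (r1 + r2) (grad_A m n M) Q
    (diag_block_mat [Ge, Go]) (diag_block_mat [Y1, Z1]) (diag_block_mat [Y3, Z3])"
proof -
  note Ge = orthonormal_basis_matD[OF Ge] and Go = orthonormal_basis_matD[OF Go]
    and Xe = orthonormal_basis_matD[OF Xe] and Xo = orthonormal_basis_matD[OF Xo]
    and Y2 = orthonormal_basis_matD[OF Y2] and Z2 = orthonormal_basis_matD[OF Z2]
  have MT: "M\<^sup>T \<in> carrier_mat n m" and MGo: "M * Go \<in> carrier_mat m p2" and MGe: "M\<^sup>T * Ge \<in> carrier_mat n p1"
    using M Ge(1) Go(1) by auto
  have Y1c: "Y1 \<in> carrier_mat m r1" and Z1c: "Z1 \<in> carrier_mat n r2"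
    unfolding Y1 Z1 using Ge(1) Go(1) Xe(1) Xo(1) by auto
  have Y1v: "Y1 *\<^sub>v x = Ge *\<^sub>v (Xe *\<^sub>v x)" if "x \<in> carrier_vec r1" for x unfolding Y1 by (rule assoc_mult_mat_vec[OF Ge(1) Xe(1) that])
  have Z1v: "Z1 *\<^sub>v x = Go *\<^sub>v (Xo *\<^sub>v x)" if "x \<in> carrier_vec r2" for x unfolding Z1 by (rule assoc_mult_mat_vec[OF Go(1) Xo(1) that])
  note Y = orthogonal_triple[OF Y1c Y2(1) Y3 Y_orth] and Z = orthogonal_triple[OF Z1c Z2(1) Z3 Z_orth]
  have Y2_to: "\<exists>c\<in>carrier_vec p2. Y2 *\<^sub>v w = M *\<^sub>v (Go *\<^sub>v c)" if "w \<in> carrier_vec p2" for w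
  proof -
    have "Y2 *\<^sub>v w \<in> (\<lambda>x. (M * Go) *\<^sub>v x) ` carrier_vec p2"
      using that unfolding mat_range_eq_col_space[OF MGo, symmetric] Y2(3) by blast
    then show ?thesis using assoc_mult_mat_vec[OF M Go(1)] by auto
  qed
  have Y2_of: "\<exists>w\<in>carrier_vec p2. M *\<^sub>v (Go *\<^sub>v c) = Y2 *\<^sub>v w" if "c \<in> carrier_vec p2" for c
  proof -
    have "(M * Go) *\<^sub>v c \<in> (\<lambda>x. Y2 *\<^sub>v x) ` carrier_vec p2"
      using that unfolding Y2(3)[symmetric] mat_range_eq_col_space[OF MGo] by blast
    then show ?thesis using assoc_mult_mat_vec[OF M Go(1) that] by auto
  qed
  have Z2_to: "\<exists>c\<in>carrier_vec p1. Z2 *\<^sub>v w = M\<^sup>T *\<^sub>v (Ge *\<^sub>v c)" if "w \<in> carrier_vec p1" for w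
  proof -
    have "Z2 *\<^sub>v w \<in> (\<lambda>x. (M\<^sup>T * Ge) *\<^sub>v x) ` carrier_vec p1"
      using that unfolding mat_range_eq_col_space[OF MGe, symmetric] Z2(3) by blast
    then show ?thesis using assoc_mult_mat_vec[OF MT Ge(1)] by auto
  qed
  have Z2_of: "\<exists>w\<in>carrier_vec p1. M\<^sup>T *\<^sub>v (Ge *\<^sub>v c) = Z2 *\<^sub>v w" if "c \<in> carrier_vec p1" for c
  proof -
    have "(M\<^sup>T * Ge) *\<^sub>v c \<in> (\<lambda>x. Z2 *\<^sub>v x) ` carrier_vec p1"
      using that unfolding Z2(3)[symmetric] mat_range_eq_col_space[OF MGe] by blast
    then show ?thesis using assoc_mult_mat_vec[OF MT Ge(1) that] by auto
  qed
  have Xe_ker: "(Go *\<^sub>v y) \<bullet> (M\<^sup>T *\<^sub>v (Ge *\<^sub>v (Xe *\<^sub>v d))) = 0" if "d \<in> carrier_vec r1" "y \<in> carrier_vec p2" for d y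
  proof -
    have d: "Xe *\<^sub>v d \<in> carrier_vec p1" using Xe(1) that by simp
    have "Xe *\<^sub>v d \<in> mat_kernel (Go\<^sup>T * M\<^sup>T * Ge)" unfolding Xe(3) using that by blast
    then show ?thesis using that unfolding triple_product_kernel[OF Go(1) MT Ge(1) d] by blast
  qed
  have Xo_ker: "(Ge *\<^sub>v y) \<bullet> (M *\<^sub>v (Go *\<^sub>v (Xo *\<^sub>v d))) = 0" if "d \<in> carrier_vec r2" "y \<in> carrier_vec p1" for d y
  proof -
    have d: "Xo *\<^sub>v d \<in> carrier_vec p2" using Xo(1) that by simp
    have "Xo *\<^sub>v d \<in> mat_kernel (Ge\<^sup>T * M * Go)" unfolding Xo(3) using that by blast
    then show ?thesis using that unfolding triple_product_kernel[OF Ge(1) M Go(1) d] by blast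
  qed
  have Qc: "Q \<in> carrier_mat (m + n) (m + n)" unfolding Q_block by (rule diag_block_mat_two_carrier[OF Qe Qo])
  have Qv: "Q *\<^sub>v (x @\<^sub>v y) = (Qe *\<^sub>v x) @\<^sub>v (Qo *\<^sub>v y)" if "x \<in> carrier_vec m" "y \<in> carrier_vec n" for x y
    unfolding Q_block by (rule diag_block_mat_two_mult[OF Qe Qo that])
  have Ac: "grad_A m n M \<in> carrier_mat (m + n) (m + n)" by (rule grad_A_carrier[OF M])
  have Gv: "diag_block_mat [Ge, Go] *\<^sub>v (x @\<^sub>v y) = (Ge *\<^sub>v x) @\<^sub>v (Go *\<^sub>v y)" if "x \<in> carrier_vec p1" "y \<in> carrier_vec p2" for x y
    by (rule diag_block_mat_two_mult[OF Ge(1) Go(1) that])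
  have V1v: "diag_block_mat [Y1, Z1] *\<^sub>v (x @\<^sub>v y) = (Y1 *\<^sub>v x) @\<^sub>v (Z1 *\<^sub>v y)" if "x \<in> carrier_vec r1" "y \<in> carrier_vec r2" for x y
    by (rule diag_block_mat_two_mult[OF Y1c Z1c that])
  have V3v: "diag_block_mat [Y3, Z3] *\<^sub>v (x @\<^sub>v y) = (Y3 *\<^sub>v x) @\<^sub>v (Z3 *\<^sub>v y)" if "x \<in> carrier_vec k1" "y \<in> carrier_vec k2" for x y
    by (rule diag_block_mat_two_mult[OF Y3 Z3 that])
  have GeV: "Ge *\<^sub>v x \<in> carrier_vec m" if "x \<in> carrier_vec p1" for x using Ge(1) that by simp
  have GoV: "Go *\<^sub>v x \<in> carrier_vec n" if "x \<in> carrier_vec p2" for x using Go(1) that by simp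
  have XeV: "Xe *\<^sub>v x \<in> carrier_vec p1" if "x \<in> carrier_vec r1" for x using Xe(1) that by simp
  have XoV: "Xo *\<^sub>v x \<in> carrier_vec p2" if "x \<in> carrier_vec r2" for x using Xo(1) that by simp
  have Y1V: "Y1 *\<^sub>v x \<in> carrier_vec m" if "x \<in> carrier_vec r1" for x using Y1c that by simp
  have Z1V: "Z1 *\<^sub>v x \<in> carrier_vec n" if "x \<in> carrier_vec r2" for x using Z1c that by simp
  have Y3V: "Y3 *\<^sub>v x \<in> carrier_vec m" if "x \<in> carrier_vec k1" for x using Y3 that by simp
  have Z3V: "Z3 *\<^sub>v x \<in> carrier_vec n" if "x \<in> carrier_vec k2" for x using Z3 that by simp
  show ?thesis
  proof (unfold_locales)
    show "grad_A m n M \<in> carrier_mat (m + n) (m + n)" by (rule Ac)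
    show "(grad_A m n M)\<^sup>T = grad_A m n M" by (rule grad_A_symmetric[OF M])
    show "Q \<in> carrier_mat (m + n) (m + n)" by (rule Qc)
    show "Q\<^sup>T = Q" using Q_psd by (simp add: pos_semidef_def)
    show "diag_block_mat [Ge, Go] \<in> carrier_mat (m + n) (p1 + p2)" by (rule diag_block_mat_two_carrier[OF Ge(1) Go(1)])
    show "diag_block_mat [Y1, Z1] \<in> carrier_mat (m + n) (r1 + r2)" by (rule diag_block_mat_two_carrier[OF Y1c Z1c])
    show "diag_block_mat [Y3, Z3] \<in> carrier_mat (m + n) (k1 + k2)" by (rule diag_block_mat_two_carrier[OF Y3 Z3])
  next
    fix v :: "real vec" assume vc: "v \<in> carrier_vec (m + n)"
    then show "0 \<le> v \<bullet> (Q *\<^sub>v v)" using Q_psd Qc by (simp add: pos_semidef_def)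
  next
    fix v :: "real vec" assume vc: "v \<in> carrier_vec (m + n)" "grad_A m n M *\<^sub>v v = 0\<^sub>v (m + n)" "Q *\<^sub>v v = 0\<^sub>v (m + n)"
    then show "v = 0\<^sub>v (m + n)" using null_AQ mat_kernelI[OF Ac] mat_kernelI[OF Qc] by blast
  next
    fix c :: "real vec" assume cc: "c \<in> carrier_vec (p1 + p2)" and 0: "diag_block_mat [Ge, Go] *\<^sub>v c = 0\<^sub>v (m + n)"
    obtain x y where c: "x \<in> carrier_vec p1" "y \<in> carrier_vec p2" "c = x @\<^sub>v y" using cc by (rule carrier_vec_append_cases)
    have "Ge *\<^sub>v x = 0\<^sub>v m" "Go *\<^sub>v y = 0\<^sub>v n"
      using append_vec_eq_zero[OF GeV[OF c(1)] GoV[OF c(2)]] 0 Gv[OF c(1,2)] c(3) by simp_all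
    then have "x = 0\<^sub>v p1" "y = 0\<^sub>v p2" using Ge(4)[OF c(1)] Go(4)[OF c(2)] by simp_all
    then show "c = 0\<^sub>v (p1 + p2)" unfolding c(3) by (simp add: zero_vec_append)
  next
    fix c :: "real vec" assume cc: "c \<in> carrier_vec (p1 + p2)"
    obtain x y where c: "x \<in> carrier_vec p1" "y \<in> carrier_vec p2" "c = x @\<^sub>v y" using cc by (rule carrier_vec_append_cases)
    have "Ge *\<^sub>v x \<in> mat_kernel Qe" "Go *\<^sub>v y \<in> mat_kernel Qo" unfolding Ge(3) Go(3) using c by blast+
    then have "Qe *\<^sub>v (Ge *\<^sub>v x) = 0\<^sub>v m" "Qo *\<^sub>v (Go *\<^sub>v y) = 0\<^sub>v n" using mat_kernelD(2)[OF Qe] mat_kernelD(2)[OF Qo] by blast+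
    then show "Q *\<^sub>v (diag_block_mat [Ge, Go] *\<^sub>v c) = 0\<^sub>v (m + n)"
      unfolding c(3) Gv[OF c(1,2)] Qv[OF GeV[OF c(1)] GoV[OF c(2)]] by (simp add: zero_vec_append)
  next
    fix v :: "real vec" assume vc: "v \<in> carrier_vec (m + n)" and 0: "Q *\<^sub>v v = 0\<^sub>v (m + n)"
    obtain x y where v: "x \<in> carrier_vec m" "y \<in> carrier_vec n" "v = x @\<^sub>v y" using vc by (rule carrier_vec_append_cases)
    have q: "Qe *\<^sub>v x \<in> carrier_vec m" "Qo *\<^sub>v y \<in> carrier_vec n" using Qe Qo v by simp_all
    have "(Qe *\<^sub>v x) @\<^sub>v (Qo *\<^sub>v y) = 0\<^sub>v (m + n)" using 0 Qv[OF v(1,2)] unfolding v(3) by simp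
    note append_vec_eq_zero[OF q this]
    then have "x \<in> mat_kernel Qe" "y \<in> mat_kernel Qo" using mat_kernelI[OF Qe v(1)] mat_kernelI[OF Qo v(2)] by blast+
    then obtain c1 c2 where c: "c1 \<in> carrier_vec p1" "x = Ge *\<^sub>v c1" "c2 \<in> carrier_vec p2" "y = Go *\<^sub>v c2"
      unfolding Ge(3) Go(3) by blast
    then show "\<exists>c\<in>carrier_vec (p1 + p2). v = diag_block_mat [Ge, Go] *\<^sub>v c"
      using v(3) Gv[OF c(1,3)] by (intro bexI[of _ "c1 @\<^sub>v c2"]) simp_all
  next
    fix d :: "real vec" assume dc: "d \<in> carrier_vec (r1 + r2)" and 0: "diag_block_mat [Y1, Z1] *\<^sub>v d = 0\<^sub>v (m + n)"
    obtain x y where d: "x \<in> carrier_vec r1" "y \<in> carrier_vec r2" "d = x @\<^sub>v y" using dc by (rule carrier_vec_append_cases)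
    have "Y1 *\<^sub>v x = 0\<^sub>v m" "Z1 *\<^sub>v y = 0\<^sub>v n"
      using append_vec_eq_zero[OF Y1V[OF d(1)] Z1V[OF d(2)]] 0 V1v[OF d(1,2)] d(3) by simp_all
    then have "x = 0\<^sub>v r1" "y = 0\<^sub>v r2" using Y1v[OF d(1)] Z1v[OF d(2)] Ge(4) Go(4) Xe(4) Xo(4) XeV[OF d(1)] XoV[OF d(2)] d by simp_all
    then show "d = 0\<^sub>v (r1 + r2)" using d(3) by (simp add: zero_vec_append)
  next
    fix d :: "real vec" assume dc: "d \<in> carrier_vec (r1 + r2)"
    obtain x y where d: "x \<in> carrier_vec r1" "y \<in> carrier_vec r2" "d = x @\<^sub>v y" using dc by (rule carrier_vec_append_cases)
    then show "\<exists>c\<in>carrier_vec (p1 + p2). diag_block_mat [Y1, Z1] *\<^sub>v d = diag_block_mat [Ge, Go] *\<^sub>v c"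
      using V1v[OF d(1,2)] Gv[OF XeV[OF d(1)] XoV[OF d(2)]] Y1v[OF d(1)] Z1v[OF d(2)] XeV[OF d(1)] XoV[OF d(2)]
      by (intro bexI[of _ "(Xe *\<^sub>v x) @\<^sub>v (Xo *\<^sub>v y)"]) simp_all
  next
    fix c d :: "real vec" assume cc: "c \<in> carrier_vec (p1 + p2)" and d0: "d \<in> carrier_vec (r1 + r2)"
    obtain x y where c: "x \<in> carrier_vec p1" "y \<in> carrier_vec p2" "c = x @\<^sub>v y" using cc by (rule carrier_vec_append_cases)
    obtain x' y' where d: "x' \<in> carrier_vec r1" "y' \<in> carrier_vec r2" "d = x' @\<^sub>v y'" using d0 by (rule carrier_vec_append_cases)
    show "(diag_block_mat [Ge, Go] *\<^sub>v c) \<bullet> (grad_A m n M *\<^sub>v (diag_block_mat [Y1, Z1] *\<^sub>v d)) = 0"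
      unfolding c(3) d(3) Gv[OF c(1,2)] V1v[OF d(1,2)]
        Y1v[OF d(1)] Z1v[OF d(2)] grad_A_form[OF M GeV[OF c(1)] GoV[OF c(2)] GeV[OF XeV[OF d(1)]] GoV[OF XoV[OF d(2)]]]
      using Xe_ker[OF d(1) c(2)] Xo_ker[OF d(2) c(1)] by simp
  next
    fix c :: "real vec" assume cc: "c \<in> carrier_vec (p1 + p2)"
      and orth: "\<And>c'. c' \<in> carrier_vec (p1 + p2) \<Longrightarrow> (diag_block_mat [Ge, Go] *\<^sub>v c') \<bullet> (grad_A m n M *\<^sub>v (diag_block_mat [Ge, Go] *\<^sub>v c)) = 0"
    obtain x y where c: "x \<in> carrier_vec p1" "y \<in> carrier_vec p2" "c = x @\<^sub>v y" using cc by (rule carrier_vec_append_cases)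
    have form: "(Ge *\<^sub>v x') \<bullet> (M *\<^sub>v (Go *\<^sub>v y)) + (Go *\<^sub>v y') \<bullet> (M\<^sup>T *\<^sub>v (Ge *\<^sub>v x)) = 0"
      if "x' \<in> carrier_vec p1" "y' \<in> carrier_vec p2" for x' y'
    proof -
      have "x' @\<^sub>v y' \<in> carrier_vec (p1 + p2)" using that by simp
      from orth[OF this] show ?thesis
        unfolding c(3) Gv[OF that] Gv[OF c(1,2)] grad_A_form[OF M GeV[OF that(1)] GoV[OF that(2)] GeV[OF c(1)] GoV[OF c(2)]] .
    qed
    have MGeX: "M\<^sup>T *\<^sub>v (Ge *\<^sub>v x) \<in> carrier_vec n" "M *\<^sub>v (Go *\<^sub>v y) \<in> carrier_vec m" using M GeV[OF c(1)] GoV[OF c(2)] by simp_all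
    \<comment> \<open>Setting one block of the test vector to zero separates the two
      parities.\<close>
    have "(Ge *\<^sub>v x') \<bullet> (M *\<^sub>v (Go *\<^sub>v y)) = 0" if "x' \<in> carrier_vec p1" for x'
      using form[OF that zero_carrier_vec] mult_mat_zero_vec[OF Go(1)] MGeX by simp
    then have "y \<in> mat_kernel (Ge\<^sup>T * M * Go)" unfolding triple_product_kernel[OF Ge(1) M Go(1) c(2)] by blast
    then obtain y' where y': "y' \<in> carrier_vec r2" "y = Xo *\<^sub>v y'" unfolding Xo(3) by blast
    have "(Go *\<^sub>v y') \<bullet> (M\<^sup>T *\<^sub>v (Ge *\<^sub>v x)) = 0" if "y' \<in> carrier_vec p2" for y'
      using form[OF zero_carrier_vec that] mult_mat_zero_vec[OF Ge(1)] MGeX by simp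
    then have "x \<in> mat_kernel (Go\<^sup>T * M\<^sup>T * Ge)" unfolding triple_product_kernel[OF Go(1) MT Ge(1) c(1)] by blast
    then obtain x' where x': "x' \<in> carrier_vec r1" "x = Xe *\<^sub>v x'" unfolding Xe(3) by blast
    show "\<exists>d\<in>carrier_vec (r1 + r2). diag_block_mat [Ge, Go] *\<^sub>v c = diag_block_mat [Y1, Z1] *\<^sub>v d"
      using Gv[OF c(1,2)] V1v[OF x'(1) y'(1)] Y1v[OF x'(1)] Z1v[OF y'(1)] c(3) x' y'
      by (intro bexI[of _ "x' @\<^sub>v y'"]) simp_all
  next
    fix u :: "real vec" assume uc: "u \<in> carrier_vec (k1 + k2)" and 0: "diag_block_mat [Y3, Z3] *\<^sub>v u = 0\<^sub>v (m + n)"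
    obtain x y where u: "x \<in> carrier_vec k1" "y \<in> carrier_vec k2" "u = x @\<^sub>v y" using uc by (rule carrier_vec_append_cases)
    have "Y3 *\<^sub>v x = 0\<^sub>v m" "Z3 *\<^sub>v y = 0\<^sub>v n"
      using append_vec_eq_zero[OF Y3V[OF u(1)] Z3V[OF u(2)]] 0 V3v[OF u(1,2)] u(3) by simp_all
    then show "u = 0\<^sub>v (k1 + k2)" using Y(4)[OF u(1)] Z(4)[OF u(2)] u(3) by (simp add: zero_vec_append)
  next
    fix u c :: "real vec" assume u0: "u \<in> carrier_vec (k1 + k2)" and c0: "c \<in> carrier_vec (p1 + p2)"
    obtain x y where c: "x \<in> carrier_vec p1" "y \<in> carrier_vec p2" "c = x @\<^sub>v y" using c0 by (rule carrier_vec_append_cases)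
    obtain x' y' where u: "x' \<in> carrier_vec k1" "y' \<in> carrier_vec k2" "u = x' @\<^sub>v y'" using u0 by (rule carrier_vec_append_cases)
    obtain w where w: "w \<in> carrier_vec p2" "M *\<^sub>v (Go *\<^sub>v y) = Y2 *\<^sub>v w" using Y2_of[OF c(2)] by blast
    obtain w' where w': "w' \<in> carrier_vec p1" "M\<^sup>T *\<^sub>v (Ge *\<^sub>v x) = Z2 *\<^sub>v w'" using Z2_of[OF c(1)] by blast
    show "(diag_block_mat [Y3, Z3] *\<^sub>v u) \<bullet> (grad_A m n M *\<^sub>v (diag_block_mat [Ge, Go] *\<^sub>v c)) = 0"
      unfolding c(3) u(3) Gv[OF c(1,2)] V3v[OF u(1,2)]
        grad_A_form[OF M Y3V[OF u(1)] Z3V[OF u(2)] GeV[OF c(1)] GoV[OF c(2)]] w(2) w'(2)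
      using Y(3)[OF u(1) w(1)] Z(3)[OF u(2) w'(1)] by simp
  next
    fix u d :: "real vec" assume u0: "u \<in> carrier_vec (k1 + k2)" and d0: "d \<in> carrier_vec (r1 + r2)"
    obtain x y where d: "x \<in> carrier_vec r1" "y \<in> carrier_vec r2" "d = x @\<^sub>v y" using d0 by (rule carrier_vec_append_cases)
    obtain x' y' where u: "x' \<in> carrier_vec k1" "y' \<in> carrier_vec k2" "u = x' @\<^sub>v y'" using u0 by (rule carrier_vec_append_cases)
    show "(diag_block_mat [Y3, Z3] *\<^sub>v u) \<bullet> (diag_block_mat [Y1, Z1] *\<^sub>v d) = 0"
      unfolding d(3) u(3) V1v[OF d(1,2)] V3v[OF u(1,2)]
        scalar_prod_append[OF Y3V[OF u(1)] Z3V[OF u(2)] Y1V[OF d(1)] Z1V[OF d(2)]]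
      using Y(2)[OF u(1) d(1)] Z(2)[OF u(2) d(2)] by simp
  next
    fix v :: "real vec" assume v0: "v \<in> carrier_vec (m + n)"
      and o3: "\<And>u. u \<in> carrier_vec (k1 + k2) \<Longrightarrow> (diag_block_mat [Y3, Z3] *\<^sub>v u) \<bullet> v = 0"
      and o1: "\<And>d. d \<in> carrier_vec (r1 + r2) \<Longrightarrow> (diag_block_mat [Y1, Z1] *\<^sub>v d) \<bullet> v = 0"
    obtain x y where v: "x \<in> carrier_vec m" "y \<in> carrier_vec n" "v = x @\<^sub>v y" using v0 by (rule carrier_vec_append_cases)
    have s3: "(Y3 *\<^sub>v a) \<bullet> x + (Z3 *\<^sub>v b) \<bullet> y = 0" if "a \<in> carrier_vec k1" "b \<in> carrier_vec k2" for a b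
      using o3[of "a @\<^sub>v b"] that V3v[OF that] scalar_prod_append[OF Y3V[OF that(1)] Z3V[OF that(2)] v(1,2)] v(3) by simp
    have s1: "(Y1 *\<^sub>v a) \<bullet> x + (Z1 *\<^sub>v b) \<bullet> y = 0" if "a \<in> carrier_vec r1" "b \<in> carrier_vec r2" for a b
      using o1[of "a @\<^sub>v b"] that V1v[OF that] scalar_prod_append[OF Y1V[OF that(1)] Z1V[OF that(2)] v(1,2)] v(3) by simp
    have z: "(0\<^sub>v n :: real vec) \<bullet> y = 0" "(0\<^sub>v m :: real vec) \<bullet> x = 0" using v by simp_all
    have "\<exists>w\<in>carrier_vec p2. x = Y2 *\<^sub>v w"
    proof (rule Y(5)[OF v(1)])
      show "(Y3 *\<^sub>v a) \<bullet> x = 0" if "a \<in> carrier_vec k1" for a using s3[OF that zero_carrier_vec] mult_mat_zero_vec[OF Z3] z by simp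
      show "(Y1 *\<^sub>v a) \<bullet> x = 0" if "a \<in> carrier_vec r1" for a using s1[OF that zero_carrier_vec] mult_mat_zero_vec[OF Z1c] z by simp
    qed
    then obtain c2 where c2: "c2 \<in> carrier_vec p2" "x = M *\<^sub>v (Go *\<^sub>v c2)" using Y2_to by fastforce
    have "\<exists>w\<in>carrier_vec p1. y = Z2 *\<^sub>v w"
    proof (rule Z(5)[OF v(2)])
      show "(Z3 *\<^sub>v a) \<bullet> y = 0" if "a \<in> carrier_vec k2" for a using s3[OF zero_carrier_vec that] mult_mat_zero_vec[OF Y3] z by simp
      show "(Z1 *\<^sub>v a) \<bullet> y = 0" if "a \<in> carrier_vec r2" for a using s1[OF zero_carrier_vec that] mult_mat_zero_vec[OF Y1c] z by simp
    qed
    then obtain c1 where c1: "c1 \<in> carrier_vec p1" "y = M\<^sup>T *\<^sub>v (Ge *\<^sub>v c1)" using Z2_to by fastforce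
    show "\<exists>c\<in>carrier_vec (p1 + p2). v = grad_A m n M *\<^sub>v (diag_block_mat [Ge, Go] *\<^sub>v c)"
      using Gv[OF c1(1) c2(1)] grad_A_mult_append[OF M GeV[OF c1(1)] GoV[OF c2(1)]] c1 c2 v(3)
      by (intro bexI[of _ "c1 @\<^sub>v c2"]) simp_all
  qed
qed

text \<open>With \<open>K = Y3\<^sup>T M Z3\<close>, the form \<open>A\<close> takes the value \<open>2 \<bar>K z\<bar>\<^sup>2\<close> at \<open>V3 (K z, z)\<close>.\<close>

lemma block_positive_subspace:
  fixes M Ge Go Xe Xo Y1 Y2 Y3 Z1 Z2 Z3 :: "real mat"
  assumes M: "M \<in> carrier_mat m n" and M_inj: "\<And>x. x \<in> carrier_vec n \<Longrightarrow> M *\<^sub>v x = 0\<^sub>v m \<Longrightarrow> x = 0\<^sub>v n"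
    and Ge: "Ge \<in> carrier_mat m p1" and Go: "Go \<in> carrier_mat n p2" and Xe: "Xe \<in> carrier_mat p1 r1"
    and Xo: "orthonormal_basis_mat Xo p2 0 (mat_kernel (Ge\<^sup>T * M * Go))"
    and Y1: "Y1 = Ge * Xe" and Z1: "Z1 = Go * Xo"
    and Y2: "orthonormal_basis_mat Y2 m p2 (vec_space.col_space m (M * Go))"
    and Z2: "orthonormal_basis_mat Z2 n p1 (vec_space.col_space n (M\<^sup>T * Ge))"
    and Y3: "Y3 \<in> carrier_mat m k1" and Z3: "Z3 \<in> carrier_mat n k2"
    and Y_orth: "real_orthogonal m (mat_of_cols m (cols Y1 @ cols Y2 @ cols Y3))"
    and Z_orth: "real_orthogonal n (mat_of_cols n (cols Z1 @ cols Z2 @ cols Z3))"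
  shows "\<exists>B. B \<in> carrier_mat (k1 + k2) k2 \<and> (\<forall>z\<in>carrier_vec k2. z \<noteq> 0\<^sub>v k2 \<longrightarrow>
    (diag_block_mat [Y3, Z3] *\<^sub>v (B *\<^sub>v z)) \<bullet> (grad_A m n M *\<^sub>v (diag_block_mat [Y3, Z3] *\<^sub>v (B *\<^sub>v z))) > 0)"
proof -
  note Xo = orthonormal_basis_matD[OF Xo] and Y2 = orthonormal_basis_matD[OF Y2] and Z2 = orthonormal_basis_matD[OF Z2]
  have Y1c: "Y1 \<in> carrier_mat m r1" and Z1c: "Z1 \<in> carrier_mat n 0" unfolding Y1 Z1 using Ge Go Xe Xo(1) by auto
  note Y = orthogonal_triple[OF Y1c Y2(1) Y3 Y_orth] and Z = orthogonal_triple[OF Z1c Z2(1) Z3 Z_orth]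
  have MT: "M\<^sup>T \<in> carrier_mat n m" and MGo: "M * Go \<in> carrier_mat m p2" and MGe: "M\<^sup>T * Ge \<in> carrier_mat n p1"
    and Y3T: "Y3\<^sup>T \<in> carrier_mat k1 m" using M Ge Go Y3 by auto
  define K where "K = Y3\<^sup>T * (M * Z3)"
  have MZ: "M * Z3 \<in> carrier_mat m k2" using M Z3 by simp
  have K: "K \<in> carrier_mat k1 k2" using Y3T MZ by (simp add: K_def)
  have Kv: "K *\<^sub>v z = Y3\<^sup>T *\<^sub>v (M *\<^sub>v (Z3 *\<^sub>v z))" if "z \<in> carrier_vec k2" for z
    unfolding K_def using assoc_mult_mat_vec[OF Y3T MZ that] assoc_mult_mat_vec[OF M Z3 that] by simp
  define B where "B = K @\<^sub>r 1\<^sub>m k2"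
  have B: "B \<in> carrier_mat (k1 + k2) k2" unfolding B_def using K by (intro carrier_append_rows) simp_all
  have Bv: "B *\<^sub>v z = (K *\<^sub>v z) @\<^sub>v z" if "z \<in> carrier_vec k2" for z
    unfolding B_def using mat_mult_append[OF K one_carrier_mat that] that by simp
  have pos: "(diag_block_mat [Y3, Z3] *\<^sub>v (B *\<^sub>v z)) \<bullet> (grad_A m n M *\<^sub>v (diag_block_mat [Y3, Z3] *\<^sub>v (B *\<^sub>v z))) > 0"
    if z: "z \<in> carrier_vec k2" "z \<noteq> 0\<^sub>v k2" for z
  proof -
    have Kz: "K *\<^sub>v z \<in> carrier_vec k1" and Z3z: "Z3 *\<^sub>v z \<in> carrier_vec n" and MZ3z: "M *\<^sub>v (Z3 *\<^sub>v z) \<in> carrier_vec m"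
      and YK: "Y3 *\<^sub>v (K *\<^sub>v z) \<in> carrier_vec m" using K Z3 M Y3 z by auto
    \<comment> \<open>The columns of \<open>Z3\<close> are orthogonal to those of \<open>Z2\<close>,
      which span the range of \<open>M^T Ge\<close>.\<close>
    have MZ2: "(M\<^sup>T *\<^sub>v (Ge *\<^sub>v c)) \<bullet> (Z3 *\<^sub>v z) = 0" if c: "c \<in> carrier_vec p1" for c
    proof -
      have "(M\<^sup>T * Ge) *\<^sub>v c \<in> (\<lambda>x. Z2 *\<^sub>v x) ` carrier_vec p1"
        using c unfolding Z2(3)[symmetric] mat_range_eq_col_space[OF MGe] by blast
      then obtain w where w: "w \<in> carrier_vec p1" "M\<^sup>T *\<^sub>v (Ge *\<^sub>v c) = Z2 *\<^sub>v w"
        using assoc_mult_mat_vec[OF MT Ge c] by auto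
      have "Z2 *\<^sub>v w \<in> carrier_vec n" using Z2(1) w by simp
      then show ?thesis using Z(3)[OF z(1) w(1)] comm_scalar_prod[OF Z3z] w(2) by simp
    qed
    have GeM: "(Ge *\<^sub>v c) \<bullet> (M *\<^sub>v (Z3 *\<^sub>v z)) = 0" if c: "c \<in> carrier_vec p1" for c
      using scalar_prod_mult_mat_vec[OF M Z3z, of "Ge *\<^sub>v c"] MZ2[OF c] Ge c by simp
    \<comment> \<open>If \<open>K z = 0\<close>, then \<open>M Z3 z\<close> is orthogonal to
      \<open>Y3\<close> and to \<open>Y1\<close>, so it is some \<open>M Go c\<close>, and it is
      also orthogonal to \<open>Ge\<close>. Then \<open>c\<close> lies in the kernel of
      \<open>Ge^T M Go\<close>, which is zero, and injectivity of \<open>M\<close> and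
      \<open>Z3\<close> gives the contradiction.\<close>
    have nz: "K *\<^sub>v z \<noteq> 0\<^sub>v k1"
    proof
      assume K0: "K *\<^sub>v z = 0\<^sub>v k1"
      have "\<exists>x\<in>carrier_vec p2. M *\<^sub>v (Z3 *\<^sub>v z) = Y2 *\<^sub>v x"
      proof (rule Y(5)[OF MZ3z])
        fix u :: "real vec" assume u: "u \<in> carrier_vec k1"
        have "u \<bullet> (Y3\<^sup>T *\<^sub>v (M *\<^sub>v (Z3 *\<^sub>v z))) = (Y3\<^sup>T\<^sup>T *\<^sub>v u) \<bullet> (M *\<^sub>v (Z3 *\<^sub>v z))" by (rule scalar_prod_mult_mat_vec[OF Y3T MZ3z u])
        then show "(Y3 *\<^sub>v u) \<bullet> (M *\<^sub>v (Z3 *\<^sub>v z)) = 0" using K0 Kv[OF z(1)] u by simp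
      next
        fix d :: "real vec" assume d: "d \<in> carrier_vec r1"
        then have "Xe *\<^sub>v d \<in> carrier_vec p1" using Xe by simp
        then show "(Y1 *\<^sub>v d) \<bullet> (M *\<^sub>v (Z3 *\<^sub>v z)) = 0" unfolding Y1 assoc_mult_mat_vec[OF Ge Xe d] by (rule GeM)
      qed
      then obtain x where x: "x \<in> carrier_vec p2" "M *\<^sub>v (Z3 *\<^sub>v z) = Y2 *\<^sub>v x" by blast
      have "Y2 *\<^sub>v x \<in> (\<lambda>x. (M * Go) *\<^sub>v x) ` carrier_vec p2"
        using x unfolding mat_range_eq_col_space[OF MGo, symmetric] Y2(3) by blast
      then obtain c where c: "c \<in> carrier_vec p2" "M *\<^sub>v (Z3 *\<^sub>v z) = M *\<^sub>v (Go *\<^sub>v c)"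
        using x(2) assoc_mult_mat_vec[OF M Go] by auto
      have "c \<in> mat_kernel (Ge\<^sup>T * M * Go)"
        unfolding triple_product_kernel[OF Ge M Go c(1)] c(2)[symmetric] using GeM by blast
      \<comment> \<open>\<open>Xo\<close> has no columns here, so the kernel that it spans is
        zero.\<close>
      then have "c = 0\<^sub>v p2" unfolding Xo(3) using Xo(1) by (auto intro!: eq_vecI simp: scalar_prod_def)
      then have "M *\<^sub>v (Z3 *\<^sub>v z) = 0\<^sub>v m" using c(2) mult_mat_zero_vec[OF Go] mult_mat_zero_vec[OF M] by simp
      then have "Z3 *\<^sub>v z = 0\<^sub>v n" by (rule M_inj[OF Z3z])
      then show False using Z(4)[OF z(1)] z(2) by blast
    qed
    have "(diag_block_mat [Y3, Z3] *\<^sub>v (B *\<^sub>v z)) = (Y3 *\<^sub>v (K *\<^sub>v z)) @\<^sub>v (Z3 *\<^sub>v z)"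
      unfolding Bv[OF z(1)] by (rule diag_block_mat_two_mult[OF Y3 Z3 Kz z(1)])
    then have "(diag_block_mat [Y3, Z3] *\<^sub>v (B *\<^sub>v z)) \<bullet> (grad_A m n M *\<^sub>v (diag_block_mat [Y3, Z3] *\<^sub>v (B *\<^sub>v z)))
        = (Y3 *\<^sub>v (K *\<^sub>v z)) \<bullet> (M *\<^sub>v (Z3 *\<^sub>v z)) + (Z3 *\<^sub>v z) \<bullet> (M\<^sup>T *\<^sub>v (Y3 *\<^sub>v (K *\<^sub>v z)))"
      using grad_A_form[OF M YK Z3z YK Z3z] by simp
    also have "(Z3 *\<^sub>v z) \<bullet> (M\<^sup>T *\<^sub>v (Y3 *\<^sub>v (K *\<^sub>v z))) = (M *\<^sub>v (Z3 *\<^sub>v z)) \<bullet> (Y3 *\<^sub>v (K *\<^sub>v z))"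
      using scalar_prod_mult_mat_vec[OF MT YK Z3z] by simp
    also have "\<dots> = (Y3 *\<^sub>v (K *\<^sub>v z)) \<bullet> (M *\<^sub>v (Z3 *\<^sub>v z))" by (rule comm_scalar_prod[OF MZ3z YK])
    also have "(Y3 *\<^sub>v (K *\<^sub>v z)) \<bullet> (M *\<^sub>v (Z3 *\<^sub>v z)) = (K *\<^sub>v z) \<bullet> (K *\<^sub>v z)"
      using scalar_prod_mult_mat_vec[OF Y3T MZ3z Kz] Kv[OF z(1)] by simp
    finally have "(diag_block_mat [Y3, Z3] *\<^sub>v (B *\<^sub>v z)) \<bullet> (grad_A m n M *\<^sub>v (diag_block_mat [Y3, Z3] *\<^sub>v (B *\<^sub>v z)))
        = 2 * ((K *\<^sub>v z) \<bullet> (K *\<^sub>v z))" by simp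
    moreover have "(K *\<^sub>v z) \<bullet> (K *\<^sub>v z) > 0"
      using scalar_prod_self_nonneg[of "K *\<^sub>v z"] scalar_prod_self_eq_0[OF Kz] nz by fastforce
    ultimately show ?thesis by simp
  qed
  show ?thesis using B pos by blast
qed

section \<open>The boundary value problem\<close>

lemma scalar_prod_power2_le:
  assumes "v \<in> carrier_vec n" "w \<in> carrier_vec n"
  shows "((v :: real vec) \<bullet> w)\<^sup>2 \<le> (v \<bullet> v) * (w \<bullet> w)"
  using Cauchy_Schwarz_ineq_sum[of "\<lambda>i. v $ i" "\<lambda>i. w $ i" "{..<n}"] assms
  by (simp add: scalar_prod_def power2_eq_square atLeast0LessThan)

lemma index_power2_le_scalar_prod:
  assumes "l < dim_vec v"
  shows "((v :: real vec) $ l)\<^sup>2 \<le> v \<bullet> v"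
proof -
  have "(v $ l)\<^sup>2 \<le> (\<Sum>i<dim_vec v. (v $ i)\<^sup>2)" by (rule member_le_sum) (use assms in simp_all)
  then show ?thesis by (simp add: scalar_prod_def power2_eq_square atLeast0LessThan)
qed

lemma scalar_prod_self_add_le:
  assumes "v \<in> carrier_vec n" "w \<in> carrier_vec n"
  shows "((v + w) \<bullet> (v + w) :: real) \<le> 2 * (v \<bullet> v) + 2 * (w \<bullet> w)"
proof -
  have "(v + w) \<bullet> (v + w) = (\<Sum>i<n. (v $ i + w $ i)\<^sup>2)"
    using assms by (simp add: scalar_prod_def power2_eq_square atLeast0LessThan)
  also have "\<dots> \<le> (\<Sum>i<n. 2 * (v $ i)\<^sup>2 + 2 * (w $ i)\<^sup>2)"
  proof (rule sum_mono)
    show "(v $ i + w $ i)\<^sup>2 \<le> 2 * (v $ i)\<^sup>2 + 2 * (w $ i)\<^sup>2" for i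
      using sum_squares_bound[of "v $ i" "w $ i"] by (simp add: power2_sum)
  qed
  also have "\<dots> = 2 * (v \<bullet> v) + 2 * (w \<bullet> w)"
    using assms by (simp add: scalar_prod_def power2_eq_square atLeast0LessThan sum.distrib sum_distrib_left)
  finally show ?thesis .
qed

text \<open>Cauchy-Schwarz row by row, with the squared Frobenius norm as constant.\<close>

lemma mat_vec_bounded:
  fixes B :: "real mat"
  assumes B: "B \<in> carrier_mat nr nc"
  shows "\<exists>K\<ge>0. \<forall>v\<in>carrier_vec nc. (B *\<^sub>v v) \<bullet> (B *\<^sub>v v) \<le> K * (v \<bullet> v)"
proof (intro exI[of _ "\<Sum>i<nr. row B i \<bullet> row B i"] conjI ballI)
  show "0 \<le> (\<Sum>i<nr. row B i \<bullet> row B i)" by (intro sum_nonneg scalar_prod_self_nonneg)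
  fix v :: "real vec" assume v: "v \<in> carrier_vec nc"
  have "(B *\<^sub>v v) \<bullet> (B *\<^sub>v v) = (\<Sum>i<nr. (row B i \<bullet> v)\<^sup>2)"
    using B by (simp add: scalar_prod_def[of "B *\<^sub>v v"] power2_eq_square atLeast0LessThan)
  also have "\<dots> \<le> (\<Sum>i<nr. (row B i \<bullet> row B i) * (v \<bullet> v))"
    using B v by (intro sum_mono scalar_prod_power2_le[of _ nc]) auto
  finally show "(B *\<^sub>v v) \<bullet> (B *\<^sub>v v) \<le> (\<Sum>i<nr. row B i \<bullet> row B i) * (v \<bullet> v)"
    by (simp add: sum_distrib_right)
qed

text \<open>The two kinds of unknowns are stacked into one vector. Injectivity makes the square
  matrix invertible, and a bound for the inverse is uniform in the right-hand side.\<close>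

lemma square_system_solvable:
  fixes C :: "real mat" and T :: "nat \<Rightarrow> real vec"
  assumes T: "\<And>i. i < q \<Longrightarrow> T i \<in> carrier_vec n" and C: "C \<in> carrier_mat n p" and qp: "q + p = n"
    and inj: "\<And>c u. u \<in> carrier_vec p \<Longrightarrow> lincomb n q T c + C *\<^sub>v u = 0\<^sub>v n \<Longrightarrow> (\<forall>i<q. c i = 0) \<and> u = 0\<^sub>v p"
  shows "\<exists>K\<ge>0. \<forall>\<rho>\<in>carrier_vec n. \<exists>c u. u \<in> carrier_vec p \<and> lincomb n q T c + C *\<^sub>v u = \<rho> \<and>
    (\<forall>i<q. (c i)\<^sup>2 \<le> K * (\<rho> \<bullet> \<rho>)) \<and> u \<bullet> u \<le> K * (\<rho> \<bullet> \<rho>)"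
proof -
  define \<Phi> where "\<Phi> = mat n n (\<lambda>(i, j). if j < q then T j $ i else C $$ (i, j - q))"
  have \<Phi>: "\<Phi> \<in> carrier_mat n n" by (simp add: \<Phi>_def)
  define tail where "tail y = vec p (\<lambda>l. y $ (q + l))" for y :: "real vec"
  have tail: "tail y \<in> carrier_vec p" for y by (simp add: tail_def)
  have \<Phi>v: "\<Phi> *\<^sub>v y = lincomb n q T (\<lambda>i. y $ i) + C *\<^sub>v tail y" if y: "y \<in> carrier_vec n" for y
  proof (rule eq_vecI)
    fix i assume "i < dim_vec (lincomb n q T (\<lambda>i. y $ i) + C *\<^sub>v tail y)"
    then have i: "i < n" using C by simp
    have "(\<Phi> *\<^sub>v y) $ i = (\<Sum>j<n. \<Phi> $$ (i, j) * y $ j)"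
      using \<Phi> y i by (simp add: scalar_prod_def atLeast0LessThan)
    also have "\<dots> = (\<Sum>j<n. (if j < q then T j $ i else C $$ (i, j - q)) * y $ j)"
      using i by (intro sum.cong) (simp_all add: \<Phi>_def)
    also have "{..<n} = {..<q} \<union> {q..<q + p}" using qp by auto
    also have "(\<Sum>j\<in>{..<q} \<union> {q..<q + p}. (if j < q then T j $ i else C $$ (i, j - q)) * y $ j) =
        (\<Sum>j<q. (if j < q then T j $ i else C $$ (i, j - q)) * y $ j) +
        (\<Sum>j\<in>{q..<q + p}. (if j < q then T j $ i else C $$ (i, j - q)) * y $ j)"
      by (intro sum.union_disjoint) auto
    also have "(\<Sum>j<q. (if j < q then T j $ i else C $$ (i, j - q)) * y $ j) = (\<Sum>j<q. y $ j * T j $ i)"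
      by (intro sum.cong) simp_all
    also have "(\<Sum>j\<in>{q..<q + p}. (if j < q then T j $ i else C $$ (i, j - q)) * y $ j) = (\<Sum>l<p. C $$ (i, l) * y $ (q + l))"
      by (rule sum.reindex_bij_witness[of _ "\<lambda>l. q + l" "\<lambda>j. j - q"]) auto
    also have "\<dots> = (C *\<^sub>v tail y) $ i"
      using C i by (simp add: scalar_prod_def atLeast0LessThan tail_def)
    finally show "(\<Phi> *\<^sub>v y) $ i = (lincomb n q T (\<lambda>i. y $ i) + C *\<^sub>v tail y) $ i" using C i by simp
  qed (use \<Phi> C in simp)
  have "\<exists>B. B \<in> carrier_mat n n \<and> \<Phi> * B = 1\<^sub>m n \<and> B * \<Phi> = 1\<^sub>m n \<and> mat_inverse \<Phi> = Some B"
  proof (rule injective_imp_inverse[OF \<Phi>])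
    fix y :: "real vec" assume y: "y \<in> carrier_vec n" and "\<Phi> *\<^sub>v y = 0\<^sub>v n"
    then have z: "(\<forall>i<q. y $ i = 0) \<and> tail y = 0\<^sub>v p" unfolding \<Phi>v[OF y] by (intro inj tail)
    have tl: "y $ (q + l) = 0" if "l < p" for l
    proof -
      have "tail y $ l = 0" using z that by simp
      then show ?thesis using that by (simp add: tail_def)
    qed
    show "y = 0\<^sub>v n"
    proof (rule eq_vecI)
      fix i assume "i < dim_vec (0\<^sub>v n :: real vec)"
      then have i: "i < n" by simp
      show "y $ i = 0\<^sub>v n $ i"
      proof (cases "i < q")
        case True then show ?thesis using z i by simp
      next
        case False
        then have "i - q < p" "q + (i - q) = i" using i qp by simp_all
        then show ?thesis using tl[of "i - q"] i by simp
      qed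
    qed (use y in simp)
  qed
  then obtain \<Psi> where \<Psi>: "\<Psi> \<in> carrier_mat n n" "\<Phi> * \<Psi> = 1\<^sub>m n" by blast
  obtain K where K: "K \<ge> 0" "\<forall>v\<in>carrier_vec n. (\<Psi> *\<^sub>v v) \<bullet> (\<Psi> *\<^sub>v v) \<le> K * (v \<bullet> v)"
    using mat_vec_bounded[OF \<Psi>(1)] by blast
  show ?thesis
  proof (intro exI[of _ K] conjI ballI K(1))
    fix \<rho> :: "real vec" assume \<rho>: "\<rho> \<in> carrier_vec n"
    define y where "y = \<Psi> *\<^sub>v \<rho>"
    have y: "y \<in> carrier_vec n" using \<Psi> \<rho> by (simp add: y_def)
    have "\<Phi> *\<^sub>v y = \<rho>" unfolding y_def using assoc_mult_mat_vec[OF \<Phi> \<Psi>(1) \<rho>] \<Psi>(2) \<rho> by simp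
    then have eq: "lincomb n q T (\<lambda>i. y $ i) + C *\<^sub>v tail y = \<rho>" unfolding \<Phi>v[OF y] .
    have yy: "y \<bullet> y \<le> K * (\<rho> \<bullet> \<rho>)" unfolding y_def using K(2) \<rho> by blast
    have c: "(y $ i)\<^sup>2 \<le> K * (\<rho> \<bullet> \<rho>)" if "i < q" for i
      using index_power2_le_scalar_prod[of i y] that qp y yy by simp
    have "tail y \<bullet> tail y = (\<Sum>l<p. (y $ (q + l))\<^sup>2)"
      by (simp add: scalar_prod_def tail_def power2_eq_square atLeast0LessThan)
    also have "\<dots> = (\<Sum>j\<in>{q..<q + p}. (y $ j)\<^sup>2)"
      by (rule sum.reindex_bij_witness[of _ "\<lambda>j. j - q" "\<lambda>l. q + l"]) auto
    also have "\<dots> \<le> (\<Sum>j<n. (y $ j)\<^sup>2)" using qp by (intro sum_mono2) auto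
    also have "\<dots> = y \<bullet> y" using y by (simp add: scalar_prod_def power2_eq_square atLeast0LessThan)
    finally have "tail y \<bullet> tail y \<le> K * (\<rho> \<bullet> \<rho>)" using yy by simp
    then show "\<exists>c u. u \<in> carrier_vec p \<and> lincomb n q T c + C *\<^sub>v u = \<rho> \<and>
        (\<forall>i<q. (c i)\<^sup>2 \<le> K * (\<rho> \<bullet> \<rho>)) \<and> u \<bullet> u \<le> K * (\<rho> \<bullet> \<rho>)"
      using tail eq c by (intro exI[of _ "\<lambda>i. y $ i"] exI[of _ "tail y"]) simp
  qed
qed

section \<open>Superposition of half-line solutions\<close>

lemma lincomb_Suc:
  assumes "t d \<in> carrier_vec n"
  shows "lincomb n (Suc d) t c = lincomb n d t c + c d \<cdot>\<^sub>v t d"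
  using assms by (intro eq_vecI) (simp_all add: lincomb_def)

lemma half_line_solution_cong_half_line:
  assumes A: "A \<in> carrier_mat N N" and Q: "Q \<in> carrier_mat N N" and h: "\<forall>y\<ge>0. h y \<in> carrier_vec N"
    and W: "half_line_solution a A Q h W" and eq: "\<And>y. y \<ge> 0 \<Longrightarrow> W y = W' y"
  shows "half_line_solution a A Q h W'"
proof -
  note W = W[unfolded half_line_solution_iff[OF A Q h]]
  have 1: "W' y \<in> carrier_vec N" if "y \<ge> 0" for y
  proof -
    have "W y \<in> carrier_vec N" using W that by blast
    then show ?thesis unfolding eq[OF that] .
  qed
  have 2: "wL2 a (\<lambda>y. W' y $ i)" if "i < N" for i
  proof (rule wL2_cong)
    show "wL2 a (\<lambda>y. W y $ i)" using W that by blast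
    show "W y $ i = W' y $ i" if "y \<ge> 0" for y unfolding eq[OF that] ..
  qed
  have 3: "primitive_of (\<lambda>y. (A *\<^sub>v W' y) $ i) (\<lambda>y. (- (Q *\<^sub>v W' y) + h y) $ i)" if "i < N" for i
  proof (rule primitive_of_cong_half_line)
    show "primitive_of (\<lambda>y. (A *\<^sub>v W y) $ i) (\<lambda>y. (- (Q *\<^sub>v W y) + h y) $ i)" using W that by blast
    show "(A *\<^sub>v W y) $ i = (A *\<^sub>v W' y) $ i" "(- (Q *\<^sub>v W y) + h y) $ i = (- (Q *\<^sub>v W' y) + h y) $ i" if "y \<ge> 0" for y
      unfolding eq[OF that] by (rule refl)+
  qed
  have 4: "v \<bullet> (- (Q *\<^sub>v W' y) + h y) = 0" if "y \<ge> 0" "v \<in> carrier_vec N" "A *\<^sub>v v = 0\<^sub>v N" for y v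
  proof -
    have "v \<bullet> (- (Q *\<^sub>v W y) + h y) = 0" using W that by blast
    then show ?thesis unfolding eq[OF that(1)] .
  qed
  show ?thesis unfolding half_line_solution_iff[OF A Q h] using 1 2 3 4 by blast
qed

lemma half_line_solution_lincomb:
  assumes A: "A \<in> carrier_mat N N" and Q: "Q \<in> carrier_mat N N"
    and W: "\<And>i. i < d \<Longrightarrow> half_line_solution a A Q (\<lambda>_. 0\<^sub>v N) (W i)"
  shows "half_line_solution a A Q (\<lambda>_. 0\<^sub>v N) (\<lambda>y. lincomb N d (\<lambda>i. W i y) c)"
  using W
proof (induction d)
  case 0
  have l0: "lincomb N 0 (\<lambda>i. W i y) c = 0\<^sub>v N" for y by (intro eq_vecI) (simp_all add: lincomb_def)
  have A0: "A *\<^sub>v 0\<^sub>v N = 0\<^sub>v N" and Q0: "Q *\<^sub>v 0\<^sub>v N = 0\<^sub>v N" using mult_mat_zero_vec A Q by auto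
  have h: "\<forall>y\<ge>(0::real). 0\<^sub>v N \<in> carrier_vec N" by simp
  have p0: "primitive_of (\<lambda>_. 0) (\<lambda>_. 0)" by (rule primitive_of_const)
  show ?case
    unfolding l0 half_line_solution_iff[OF A Q h]
    using p0 wL2_zero(1) by (simp add: A0 Q0)
next
  case (Suc d)
  have h: "\<forall>y\<ge>(0::real). 0\<^sub>v N \<in> carrier_vec N" by simp
  have IH: "half_line_solution a A Q (\<lambda>_. 0\<^sub>v N) (\<lambda>y. lincomb N d (\<lambda>i. W i y) c)" by (rule Suc.IH) (rule Suc.prems, simp)
  have Wd: "half_line_solution a A Q (\<lambda>_. 0\<^sub>v N) (W d)" by (rule Suc.prems) simp
  have Wc: "\<forall>y\<ge>0. W d y \<in> carrier_vec N" using Wd unfolding half_line_solution_iff[OF A Q h] by blast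
  have "half_line_solution a A Q (\<lambda>y. 0\<^sub>v N + c d \<cdot>\<^sub>v 0\<^sub>v N) (\<lambda>y. lincomb N d (\<lambda>i. W i y) c + c d \<cdot>\<^sub>v W d y)"
    by (rule half_line_solution_add_smult[OF A Q h h IH Wd])
  moreover have "0\<^sub>v N + c d \<cdot>\<^sub>v 0\<^sub>v N = (0\<^sub>v N :: real vec)" by (intro eq_vecI) simp_all
  ultimately have S: "half_line_solution a A Q (\<lambda>y. 0\<^sub>v N) (\<lambda>y. lincomb N d (\<lambda>i. W i y) c + c d \<cdot>\<^sub>v W d y)" by simp
  have eq: "lincomb N d (\<lambda>i. W i y) c + c d \<cdot>\<^sub>v W d y = lincomb N (Suc d) (\<lambda>i. W i y) c" if "y \<ge> 0" for y
    by (rule lincomb_Suc[symmetric]) (use Wc that in simp)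
  show ?case by (rule half_line_solution_cong_half_line[OF A Q h S eq])
qed


context kinetic_pencil
begin

text \<open>Links the numbers \<mu> of the diagonalization to the eigenvalues in the restriction on
  \<open>a\<close>. Completeness of the \<open>c i\<close> turns the scalar identities into
  \<open>A' c i = \<mu> i Q' c i\<close>; finiteness of the spectrum makes its maximum a genuine
  upper bound.\<close>

lemma pencil_eigenvalue:
  assumes A': "A' = V3\<^sup>T * A * V3" and Q': "Q' = V3\<^sup>T * Q * V3"
    and c: "\<forall>i<k. c i \<in> carrier_vec k"
    and cQ: "\<forall>i<k. \<forall>j<k. (V3 *\<^sub>v c i) \<bullet> (Q *\<^sub>v (V3 *\<^sub>v c j)) = (if i = j then 1 else 0)"
    and cA: "\<forall>i<k. \<forall>j<k. (V3 *\<^sub>v c i) \<bullet> (A *\<^sub>v (V3 *\<^sub>v c j)) = (if i = j then \<mu> i else 0)"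
    and span: "\<forall>u\<in>carrier_vec k. (\<forall>i<k. c i \<bullet> u = 0) \<longrightarrow> u = 0\<^sub>v k"
    and i: "i < k"
  shows "eigenvalue (the (mat_inverse Q') * A') (\<mu> i)" "finite (spectrum (the (mat_inverse Q') * A'))"
proof -
  have V3T: "V3\<^sup>T \<in> carrier_mat k N" using V3 by simp
  have assoc: "A' = V3\<^sup>T * (A * V3)" "Q' = V3\<^sup>T * (Q * V3)"
    unfolding A' Q' by (rule assoc_mult_mat[OF V3T A(1) V3], rule assoc_mult_mat[OF V3T Q(1) V3])
  have A'c: "A' \<in> carrier_mat k k" and Q'c: "Q' \<in> carrier_mat k k"
    unfolding assoc using congruence_symmetric(1)[OF V3 A] congruence_symmetric(1)[OF V3 Q] by simp_all
  have A'v: "x \<bullet> (A' *\<^sub>v y) = (V3 *\<^sub>v x) \<bullet> (A *\<^sub>v (V3 *\<^sub>v y))" if "x \<in> carrier_vec k" "y \<in> carrier_vec k" for x y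
    unfolding assoc by (rule congruence_scalar_prod[OF V3 A(1) that])
  have Q'v: "x \<bullet> (Q' *\<^sub>v y) = (V3 *\<^sub>v x) \<bullet> (Q *\<^sub>v (V3 *\<^sub>v y))" if "x \<in> carrier_vec k" "y \<in> carrier_vec k" for x y
    unfolding assoc by (rule congruence_scalar_prod[OF V3 Q(1) that])
  have "\<exists>B. B \<in> carrier_mat k k \<and> Q' * B = 1\<^sub>m k \<and> B * Q' = 1\<^sub>m k \<and> mat_inverse Q' = Some B"
  proof (rule injective_imp_inverse[OF Q'c])
    fix v :: "real vec" assume v: "v \<in> carrier_vec k" and "Q' *\<^sub>v v = 0\<^sub>v k"
    then have "(V3 *\<^sub>v v) \<bullet> (Q *\<^sub>v (V3 *\<^sub>v v)) = 0" using Q'v[OF v v] by simp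
    then show "v = 0\<^sub>v k" using V3_Q_pos[OF v] by fastforce
  qed
  then obtain R where R: "R \<in> carrier_mat k k" "R * Q' = 1\<^sub>m k" "mat_inverse Q' = Some R" by blast
  have ci: "c i \<in> carrier_vec k" using c i by blast
  have Ac: "A' *\<^sub>v c i \<in> carrier_vec k" and Qc: "Q' *\<^sub>v c i \<in> carrier_vec k" using A'c Q'c ci by simp_all
  have "A' *\<^sub>v c i - \<mu> i \<cdot>\<^sub>v (Q' *\<^sub>v c i) = 0\<^sub>v k"
  proof (rule span[rule_format])
    show "A' *\<^sub>v c i - \<mu> i \<cdot>\<^sub>v (Q' *\<^sub>v c i) \<in> carrier_vec k" using Ac Qc by simp
    fix j assume j: "j < k"
    have cj: "c j \<in> carrier_vec k" using c j by blast
    have "c j \<bullet> (A' *\<^sub>v c i - \<mu> i \<cdot>\<^sub>v (Q' *\<^sub>v c i)) = c j \<bullet> (A' *\<^sub>v c i) - \<mu> i * (c j \<bullet> (Q' *\<^sub>v c i))"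
      using cj Ac Qc by (simp add: scalar_prod_minus_distrib[of _ k])
    also have "\<dots> = (if j = i then \<mu> j else 0) - \<mu> i * (if j = i then 1 else 0)"
      unfolding A'v[OF cj ci] Q'v[OF cj ci] cA[rule_format, OF j i] cQ[rule_format, OF j i] ..
    finally show "c j \<bullet> (A' *\<^sub>v c i - \<mu> i \<cdot>\<^sub>v (Q' *\<^sub>v c i)) = 0" by simp
  qed
  then have z: "(A' *\<^sub>v c i - \<mu> i \<cdot>\<^sub>v (Q' *\<^sub>v c i)) $ l = 0" if "l < k" for l using that by simp
  have eq: "A' *\<^sub>v c i = \<mu> i \<cdot>\<^sub>v (Q' *\<^sub>v c i)"
  proof (rule eq_vecI)
    fix l assume "l < dim_vec (\<mu> i \<cdot>\<^sub>v (Q' *\<^sub>v c i))"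
    then have l: "l < k" using Q'c by simp
    then show "(A' *\<^sub>v c i) $ l = (\<mu> i \<cdot>\<^sub>v (Q' *\<^sub>v c i)) $ l" using z[OF l] Ac Qc Q'c by (simp del: index_mult_mat_vec)
  qed (use A'c Q'c in simp)
  have RA: "R * A' \<in> carrier_mat k k" using R(1) A'c by simp
  have "(R * A') *\<^sub>v c i = R *\<^sub>v (\<mu> i \<cdot>\<^sub>v (Q' *\<^sub>v c i))" using assoc_mult_mat_vec[OF R(1) A'c ci] eq by simp
  also have "\<dots> = \<mu> i \<cdot>\<^sub>v (R *\<^sub>v (Q' *\<^sub>v c i))" by (rule mult_mat_vec[OF R(1) Qc])
  also have "R *\<^sub>v (Q' *\<^sub>v c i) = c i" using assoc_mult_mat_vec[OF R(1) Q'c ci] R(2) ci by simp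
  finally have ev: "(R * A') *\<^sub>v c i = \<mu> i \<cdot>\<^sub>v c i" .
  have "c i \<noteq> 0\<^sub>v k"
  proof
    assume 0: "c i = 0\<^sub>v k"
    have "V3 *\<^sub>v c i = 0\<^sub>v N" unfolding 0 by (rule mult_mat_zero_vec[OF V3])
    then have "(V3 *\<^sub>v c i) \<bullet> (Q *\<^sub>v (V3 *\<^sub>v c i)) = 0" using mult_mat_zero_vec[OF Q(1)] by simp
    then show False using cQ[rule_format, OF i i] by simp
  qed
  moreover have "dim_row (R * A') = k" using R(1) by simp
  ultimately show "eigenvalue (the (mat_inverse Q') * A') (\<mu> i)"
    unfolding eigenvalue_def eigenvector_def R(3) option.sel using ev ci by (intro exI[of _ "c i"]) simp
  show "finite (spectrum (the (mat_inverse Q') * A'))"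
    unfolding R(3) option.sel using card_finite_spectrum(1)[OF RA] .
qed

text \<open>Superposition of one solution with zero free data and of \<open>q\<close> homogeneous
  solutions with unit free data. The boundary equation becomes a square system for the
  \<open>q\<close> coefficients and the \<open>l\<close> parameters, and it is injective by
  \<open>unique\<close>. The operator \<open>E\<close> acts on \<open>A W 0\<close> because this is
  the quantity with an estimate.\<close>

theorem boundary_value_problem_solvable:
  fixes E C :: "real mat"
  assumes T: "triangularizing d s t e f"
    and adm: "\<And>i. i < d \<Longrightarrow> e i = 0 \<and> f i \<noteq> 0 \<or> e i \<noteq> 0 \<and> f i / e i \<noteq> a"
    and free: "q \<le> card {i. i < d \<and> e i \<noteq> 0 \<and> f i / e i > a}"
    and E: "E \<in> carrier_mat n N" and C: "C \<in> carrier_mat n l" and ql: "q + l = n"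
    and unique: "\<And>D u. half_line_solution a A Q (\<lambda>_. 0\<^sub>v N) D \<Longrightarrow> u \<in> carrier_vec l \<Longrightarrow>
      E *\<^sub>v (A *\<^sub>v D 0) + C *\<^sub>v u = 0\<^sub>v n \<Longrightarrow> D 0 = 0\<^sub>v N \<and> u = 0\<^sub>v l"
  shows "\<exists>K\<ge>0. \<forall>h \<rho>. weighted_L2 N a h \<longrightarrow> \<rho> \<in> carrier_vec n \<longrightarrow>
    (\<exists>W u. half_line_solution a A Q h W \<and> u \<in> carrier_vec l \<and> E *\<^sub>v (A *\<^sub>v W 0) + C *\<^sub>v u = \<rho> \<and>
      (weighted_norm a W)\<^sup>2 \<le> K * ((weighted_norm a h)\<^sup>2 + \<rho> \<bullet> \<rho>) \<and> u \<bullet> u \<le> K * ((weighted_norm a h)\<^sup>2 + \<rho> \<bullet> \<rho>))"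
proof -
  define F where "F = {i. i < d \<and> e i \<noteq> 0 \<and> f i / e i > a}"
  obtain C0 where C0: "C0 \<ge> 0" and ex: "\<forall>h \<theta>. weighted_L2 N a h \<longrightarrow> (\<exists>W. half_line_solution a A Q h W \<and>
     (weighted_norm a W)\<^sup>2 \<le> C0 * ((weighted_norm a h)\<^sup>2 + (\<Sum>i<d. (\<theta> i)\<^sup>2)) \<and>
     (\<forall>l<N. ((A *\<^sub>v W 0) $ l)\<^sup>2 \<le> C0 * ((weighted_norm a h)\<^sup>2 + (\<Sum>i<d. (\<theta> i)\<^sup>2))) \<and>
     (\<forall>i<d. e i \<noteq> 0 \<and> f i / e i > a \<longrightarrow> s i \<bullet> (A *\<^sub>v W 0) = e i * \<theta> i))"
    using half_line_solution_exists[OF T adm] by blast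
  have zeroL: "weighted_L2 N a (\<lambda>_. 0\<^sub>v N)" unfolding weighted_L2_iff using wL2_zero(1) by simp
  have zeroh: "\<forall>y\<ge>(0::real). 0\<^sub>v N \<in> carrier_vec N" by simp
  have "finite F" by (simp add: F_def)
  moreover have "card {0..<q} \<le> card F" using free by (simp add: F_def)
  \<comment> \<open>Any \<open>q\<close> of the free rows will do; the prescribed values in all
    other free rows are set to 0.\<close>
  ultimately obtain \<pi> where \<pi>: "\<pi> ` {0..<q} \<subseteq> F" "inj_on \<pi> {0..<q}"
    using card_le_inj[of "{0..<q}" F] by blast
  have \<pi>F: "\<pi> i < d" "e (\<pi> i) \<noteq> 0" "f (\<pi> i) / e (\<pi> i) > a" if "i < q" for i
  proof -
    have "\<pi> i \<in> F" using \<pi>(1) that by auto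
    then show "\<pi> i < d" "e (\<pi> i) \<noteq> 0" "f (\<pi> i) / e (\<pi> i) > a" by (simp_all add: F_def)
  qed
  have "\<exists>W. half_line_solution a A Q (\<lambda>_. 0\<^sub>v N) W \<and> (\<forall>j<q. s (\<pi> j) \<bullet> (A *\<^sub>v W 0) = (if j = i then e (\<pi> i) else 0))"
    if i: "i < q" for i
  proof -
    define \<theta> where "\<theta> = (\<lambda>j. if j = \<pi> i then 1 else 0 :: real)"
    obtain W where W: "half_line_solution a A Q (\<lambda>_. 0\<^sub>v N) W"
      "\<forall>i<d. e i \<noteq> 0 \<and> f i / e i > a \<longrightarrow> s i \<bullet> (A *\<^sub>v W 0) = e i * \<theta> i"
      using ex[rule_format, OF zeroL, of \<theta>] by blast
    have "s (\<pi> j) \<bullet> (A *\<^sub>v W 0) = (if j = i then e (\<pi> i) else 0)" if j: "j < q" for j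
    proof -
      have "s (\<pi> j) \<bullet> (A *\<^sub>v W 0) = e (\<pi> j) * \<theta> (\<pi> j)" using W(2)[rule_format, OF \<pi>F(1)[OF j]] \<pi>F(2,3)[OF j] by simp
      moreover have "\<pi> j = \<pi> i \<longleftrightarrow> j = i" using inj_on_eq_iff[OF \<pi>(2)] i j by simp
      ultimately show ?thesis by (simp add: \<theta>_def)
    qed
    then show ?thesis using W(1) by blast
  qed
  then have "\<exists>B. \<forall>i<q. half_line_solution a A Q (\<lambda>_. 0\<^sub>v N) (B i) \<and>
      (\<forall>j<q. s (\<pi> j) \<bullet> (A *\<^sub>v B i 0) = (if j = i then e (\<pi> i) else 0))" by (intro choice) blast
  then obtain B where B0: "\<forall>i<q. half_line_solution a A Q (\<lambda>_. 0\<^sub>v N) (B i) \<and>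
      (\<forall>j<q. s (\<pi> j) \<bullet> (A *\<^sub>v B i 0) = (if j = i then e (\<pi> i) else 0))" by (elim exE)
  have B: "half_line_solution a A Q (\<lambda>_. 0\<^sub>v N) (B i)" if "i < q" for i
    using B0[rule_format, OF that] by blast
  have sB: "s (\<pi> j) \<bullet> (A *\<^sub>v B i 0) = (if j = i then e (\<pi> i) else 0)" if "i < q" "j < q" for i j
    using B0[rule_format, OF that(1)] that(2) by blast
  have Bc: "B i y \<in> carrier_vec N" if "i < q" "y \<ge> 0" for i y
    using B[OF that(1)] that(2) unfolding half_line_solution_iff[OF A(1) Q(1) zeroh] by blast
  have BL: "wL2 a (\<lambda>y. B i y $ j)" if "i < q" "j < N" for i j
    using B[OF that(1)] that(2) unfolding half_line_solution_iff[OF A(1) Q(1) zeroh] by blast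
  define D where "D c y = lincomb N q (\<lambda>i. B i y) c" for c y
  have D: "half_line_solution a A Q (\<lambda>_. 0\<^sub>v N) (D c)" for c
    unfolding D_def by (rule half_line_solution_lincomb[OF A(1) Q(1) B])
  have Dc: "D c y \<in> carrier_vec N" for c y by (simp add: D_def)
  have AD: "A *\<^sub>v D c 0 = lincomb N q (\<lambda>i. A *\<^sub>v B i 0) c" for c
    unfolding D_def by (rule mult_mat_lincomb[OF A(1)]) (simp add: Bc)
  define T where "T i = E *\<^sub>v (A *\<^sub>v B i 0)" for i
  have ED: "E *\<^sub>v (A *\<^sub>v D c 0) = lincomb n q T c" for c
    unfolding AD T_def by (rule mult_mat_lincomb[OF E]) (simp add: Bc)
  have Tc: "T i \<in> carrier_vec n" if "i < q" for i using E Bc[OF that] by (simp add: T_def)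
  have sc: "s (\<pi> i) \<in> carrier_vec N" if "i < q" for i
    using \<open>triangularizing d s t e f\<close> \<pi>F(1)[OF that] unfolding triangularizing_def by blast
  have "\<exists>K\<ge>0. \<forall>\<rho>\<in>carrier_vec n. \<exists>c u. u \<in> carrier_vec l \<and> lincomb n q T c + C *\<^sub>v u = \<rho> \<and>
    (\<forall>i<q. (c i)\<^sup>2 \<le> K * (\<rho> \<bullet> \<rho>)) \<and> u \<bullet> u \<le> K * (\<rho> \<bullet> \<rho>)"
  proof (rule square_system_solvable[OF _ C ql])
    show "T i \<in> carrier_vec n" if "i < q" for i by (rule Tc[OF that])
    fix c u assume u: "u \<in> carrier_vec l" and "lincomb n q T c + C *\<^sub>v u = 0\<^sub>v n"
    then have z: "D c 0 = 0\<^sub>v N" "u = 0\<^sub>v l" using unique[OF D u] unfolding ED by blast+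
    \<comment> \<open>The initial value of the superposition is zero, and the test vector
      \<open>s (\<pi> i)\<close> reads the coefficient \<open>c i\<close> off \<open>A D 0\<close>,
      up to the nonzero factor \<open>e (\<pi> i)\<close>.\<close>
    have "c i = 0" if i: "i < q" for i
    proof -
      have "0 = s (\<pi> i) \<bullet> (A *\<^sub>v D c 0)" using sc[OF i] mult_mat_zero_vec[OF A(1)] unfolding z(1) by simp
      also have "\<dots> = (\<Sum>j<q. c j * (s (\<pi> i) \<bullet> (A *\<^sub>v B j 0)))"
        unfolding AD by (rule scalar_prod_lincomb[OF sc[OF i]]) (simp add: Bc)
      also have "\<dots> = (\<Sum>j<q. if j = i then c i * e (\<pi> i) else 0)" by (intro sum.cong) (simp_all add: sB i)
      finally show ?thesis using i \<pi>F(2)[OF i] by simp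
    qed
    then show "(\<forall>i<q. c i = 0) \<and> u = 0\<^sub>v l" using z(2) by blast
  qed
  then obtain K1 where K1: "K1 \<ge> 0" and solve: "\<forall>\<rho>\<in>carrier_vec n. \<exists>c u. u \<in> carrier_vec l \<and> lincomb n q T c + C *\<^sub>v u = \<rho> \<and>
    (\<forall>i<q. (c i)\<^sup>2 \<le> K1 * (\<rho> \<bullet> \<rho>)) \<and> u \<bullet> u \<le> K1 * (\<rho> \<bullet> \<rho>)" by blast
  obtain K2 where K2: "K2 \<ge> 0" "\<forall>v\<in>carrier_vec N. (E *\<^sub>v v) \<bullet> (E *\<^sub>v v) \<le> K2 * (v \<bullet> v)"
    using mat_vec_bounded[OF E] by blast
  define \<sigma> where "\<sigma> = (\<Sum>j<N. \<Sum>i<q. wsq a (\<lambda>y. B i y $ j))"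
  have \<sigma>: "\<sigma> \<ge> 0" unfolding \<sigma>_def by (intro sum_nonneg wsq_nonneg)
  \<comment> \<open>Controls the corrected right-hand side \<open>\<rho> - E w\<close> by the
    two-term bound, where \<open>w\<close> is \<open>A W 0\<close> for the particular
    solution.\<close>
  define K3 where "K3 = 2 + 2 * K2 * real N * C0"
  have K3: "K3 \<ge> 2" using K2 C0 by (simp add: K3_def)
  \<comment> \<open>The first two summands bound the particular and the homogeneous part of the
    solution, the last one bounds the parameters.\<close>
  define K where "K = 2 * C0 + 2 * (2 ^ q * (real q * (K1 * K3)) * \<sigma>) + K1 * K3"
  have K13: "K1 * K3 \<ge> 0" using K1 K3 by simp
  have P: "0 \<le> 2 ^ q * (real q * (K1 * K3)) * \<sigma>" using K13 \<sigma> by simp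
  show ?thesis
  proof (intro exI[of _ K] conjI allI impI)
    show "0 \<le> K" unfolding K_def using C0 K13 P by simp
    fix h and \<rho> :: "real vec" assume h: "weighted_L2 N a h" and \<rho>: "\<rho> \<in> carrier_vec n"
    define S where "S = (weighted_norm a h)\<^sup>2 + \<rho> \<bullet> \<rho>"
    have S: "(weighted_norm a h)\<^sup>2 \<le> S" "\<rho> \<bullet> \<rho> \<le> S" "S \<ge> 0"
      using scalar_prod_self_nonneg[of \<rho>] by (simp_all add: S_def)
    have hc: "\<forall>y\<ge>0. h y \<in> carrier_vec N" using h unfolding weighted_L2_def by blast
    obtain W where W: "half_line_solution a A Q h W"
      "(weighted_norm a W)\<^sup>2 \<le> C0 * ((weighted_norm a h)\<^sup>2 + (\<Sum>i<d. 0\<^sup>2))"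
      "\<forall>l<N. ((A *\<^sub>v W 0) $ l)\<^sup>2 \<le> C0 * ((weighted_norm a h)\<^sup>2 + (\<Sum>i<d. 0\<^sup>2))"
      using ex[rule_format, OF h, of "\<lambda>_. 0"] by blast
    have Wc: "W y \<in> carrier_vec N" if "y \<ge> 0" for y
      using W(1) that unfolding half_line_solution_iff[OF A(1) Q(1) hc] by blast
    have WL: "wL2 a (\<lambda>y. W y $ j)" if "j < N" for j
      using W(1) that unfolding half_line_solution_iff[OF A(1) Q(1) hc] by blast
    define w where "w = A *\<^sub>v W 0"
    have w: "w \<in> carrier_vec N" using Wc[of 0] by (simp add: w_def)
    have "w \<bullet> w = (\<Sum>l<N. (w $ l)\<^sup>2)" using w by (simp add: scalar_prod_def power2_eq_square atLeast0LessThan)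
    also have "\<dots> \<le> (\<Sum>l<N. C0 * S)"
    proof (rule sum_mono)
      fix l assume "l \<in> {..<N}"
      then have "(w $ l)\<^sup>2 \<le> C0 * (weighted_norm a h)\<^sup>2" using W(3) unfolding w_def by simp
      also have "\<dots> \<le> C0 * S" using S(1) C0 by (rule mult_left_mono)
      finally show "(w $ l)\<^sup>2 \<le> C0 * S" .
    qed
    finally have ww: "w \<bullet> w \<le> real N * C0 * S" by simp
    have Ew: "E *\<^sub>v w \<in> carrier_vec n" using E w by simp
    define \<rho>' where "\<rho>' = \<rho> + - (E *\<^sub>v w)"
    have \<rho>': "\<rho>' \<in> carrier_vec n" using \<rho> Ew by (simp add: \<rho>'_def)
    have mEw: "- (E *\<^sub>v w) \<in> carrier_vec n" using Ew by simp
    have "\<rho>' \<bullet> \<rho>' \<le> 2 * (\<rho> \<bullet> \<rho>) + 2 * (- (E *\<^sub>v w) \<bullet> - (E *\<^sub>v w))"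
      unfolding \<rho>'_def by (rule scalar_prod_self_add_le[OF \<rho> mEw])
    also have "- (E *\<^sub>v w) \<bullet> - (E *\<^sub>v w) = (E *\<^sub>v w) \<bullet> (E *\<^sub>v w)" by (simp add: scalar_prod_def)
    also have "(E *\<^sub>v w) \<bullet> (E *\<^sub>v w) \<le> K2 * (real N * C0 * S)"
      using K2(2)[rule_format, OF w] mult_left_mono[OF ww K2(1)] by simp
    finally have \<rho>\<rho>: "\<rho>' \<bullet> \<rho>' \<le> K3 * S" using S(2) unfolding K3_def by (simp add: algebra_simps)
    obtain c u where cu: "u \<in> carrier_vec l" "lincomb n q T c + C *\<^sub>v u = \<rho>'"
      "\<forall>i<q. (c i)\<^sup>2 \<le> K1 * (\<rho>' \<bullet> \<rho>')" "u \<bullet> u \<le> K1 * (\<rho>' \<bullet> \<rho>')"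
      using solve \<rho>' by blast
    have K1\<rho>: "K1 * (\<rho>' \<bullet> \<rho>') \<le> K1 * K3 * S" using mult_left_mono[OF \<rho>\<rho> K1] by (simp add: mult.assoc)
    define V where "V y = W y + 1 \<cdot>\<^sub>v D c y" for y
    have V0: "half_line_solution a A Q (\<lambda>y. h y + 1 \<cdot>\<^sub>v 0\<^sub>v N) V"
      unfolding V_def by (rule half_line_solution_add_smult[OF A(1) Q(1) hc zeroh W(1) D])
    have V: "half_line_solution a A Q h V"
    proof (rule half_line_solution_cong[OF A(1) Q(1) _ _ V0])
      show "\<forall>y\<ge>0. h y + 1 \<cdot>\<^sub>v 0\<^sub>v N \<in> carrier_vec N" using hc by simp
      show "h y + 1 \<cdot>\<^sub>v 0\<^sub>v N = h y" if "y \<ge> 0" for y using hc that by simp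
    qed
    have Vy: "V y = W y + D c y" for y by (simp add: V_def)
    have Vc: "V y \<in> carrier_vec N" if "y \<ge> 0" for y using Wc[OF that] Dc by (simp add: Vy)
    have VL2: "weighted_L2 N a V" using V A(1) unfolding half_line_solution_def by simp
    have cc: "(\<Sum>i<q. (c i)\<^sup>2) \<le> real q * (K1 * K3 * S)"
    proof -
      have "(\<Sum>i<q. (c i)\<^sup>2) \<le> (\<Sum>i<q. K1 * K3 * S)"
        using cu(3) K1\<rho> by (intro sum_mono) (meson lessThan_iff order_trans)
      then show ?thesis by simp
    qed
    have WL2: "weighted_L2 N a W" using W(1) A(1) unfolding half_line_solution_def by simp
    have Vj: "wsq a (\<lambda>y. V y $ j) \<le> 2 * wsq a (\<lambda>y. W y $ j) + 2 * (2 ^ q * (real q * (K1 * K3 * S)) * (\<Sum>i<q. wsq a (\<lambda>y. B i y $ j)))"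
      if j: "j < N" for j
    proof -
      have eq: "V y $ j = W y $ j + (\<Sum>i<q. B i y $ j * c i)" if "y \<ge> 0" for y
        using j Wc[OF that] by (simp add: Vy D_def lincomb_def mult.commute)
      note L = wL2_lincomb[of q a "\<lambda>i y. B i y $ j" c, OF BL[OF _ j]]
      have "wsq a (\<lambda>y. V y $ j) = wsq a (\<lambda>y. W y $ j + (\<Sum>i<q. B i y $ j * c i))"
        unfolding wsq_def by (intro Bochner_Integration.integral_cong) (simp_all add: eq)
      also have "\<dots> \<le> 2 * wsq a (\<lambda>y. W y $ j) + 2 * wsq a (\<lambda>y. \<Sum>i<q. B i y $ j * c i)"
        by (rule wL2_add(2)[OF WL[OF j] L(1)])
      also have "wsq a (\<lambda>y. \<Sum>i<q. B i y $ j * c i) \<le> 2 ^ q * (\<Sum>i<q. (c i)\<^sup>2) * (\<Sum>i<q. wsq a (\<lambda>y. B i y $ j))"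
        by (rule L(2))
      also have "\<dots> \<le> 2 ^ q * (real q * (K1 * K3 * S)) * (\<Sum>i<q. wsq a (\<lambda>y. B i y $ j))"
        using cc by (intro mult_right_mono mult_left_mono sum_nonneg wsq_nonneg) simp_all
      finally show ?thesis by simp
    qed
    have "(weighted_norm a V)\<^sup>2 = (\<Sum>j<N. wsq a (\<lambda>y. V y $ j))" by (rule weighted_norm_power2[OF VL2])
    also have "\<dots> \<le> (\<Sum>j<N. 2 * wsq a (\<lambda>y. W y $ j) + 2 * (2 ^ q * (real q * (K1 * K3 * S)) * (\<Sum>i<q. wsq a (\<lambda>y. B i y $ j))))"
      by (intro sum_mono Vj) simp
    also have "\<dots> = 2 * (weighted_norm a W)\<^sup>2 + 2 * (2 ^ q * (real q * (K1 * K3 * S)) * \<sigma>)"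
      unfolding weighted_norm_power2[OF WL2] \<sigma>_def by (simp add: sum.distrib sum_distrib_left)
    also have "(weighted_norm a W)\<^sup>2 \<le> C0 * S"
      using W(2) mult_left_mono[OF S(1) C0] by simp
    finally have nV: "(weighted_norm a V)\<^sup>2 \<le> 2 * (C0 * S) + 2 * (2 ^ q * (real q * (K1 * K3 * S)) * \<sigma>)" by simp
    have 1: "(weighted_norm a V)\<^sup>2 \<le> K * S"
    proof -
      have "0 \<le> K1 * K3 * S" using K13 S(3) by simp
      then show ?thesis using nV unfolding K_def by (simp add: algebra_simps)
    qed
    have 2: "u \<bullet> u \<le> K * S"
    proof -
      have "u \<bullet> u \<le> K1 * K3 * S" using cu(4) K1\<rho> by simp
      also have "\<dots> \<le> K * S" using S(3) C0 P unfolding K_def by (intro mult_right_mono) simp_all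
      finally show ?thesis .
    qed
    have "A *\<^sub>v V 0 = w + A *\<^sub>v D c 0" unfolding Vy w_def by (rule mult_add_distrib_mat_vec[OF A(1) Wc Dc]) simp
    moreover have "E *\<^sub>v (w + A *\<^sub>v D c 0) = E *\<^sub>v w + E *\<^sub>v (A *\<^sub>v D c 0)"
      by (rule mult_add_distrib_mat_vec[OF E w]) (simp add: Dc)
    ultimately have EV: "E *\<^sub>v (A *\<^sub>v V 0) = E *\<^sub>v w + lincomb n q T c" unfolding ED by simp
    have Cu: "C *\<^sub>v u \<in> carrier_vec n" using C cu(1) by simp
    have "E *\<^sub>v (A *\<^sub>v V 0) + C *\<^sub>v u = E *\<^sub>v w + \<rho>'"
      unfolding EV cu(2)[symmetric] by (rule assoc_add_vec[OF Ew _ Cu]) simp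
    also have "\<dots> = \<rho>" unfolding \<rho>'_def using \<rho> E w by (intro eq_vecI) simp_all
    finally show "\<exists>W u. half_line_solution a A Q h W \<and> u \<in> carrier_vec l \<and> E *\<^sub>v (A *\<^sub>v W 0) + C *\<^sub>v u = \<rho> \<and>
      (weighted_norm a W)\<^sup>2 \<le> K * ((weighted_norm a h)\<^sup>2 + \<rho> \<bullet> \<rho>) \<and> u \<bullet> u \<le> K * ((weighted_norm a h)\<^sup>2 + \<rho> \<bullet> \<rho>)"
      using V cu(1) 1 2 unfolding S_def[symmetric] by (intro exI[of _ V] exI[of _ u]) simp
  qed
qed

end

section \<open>Reduction of the boundary condition to a linear equation for
  \<open>A W 0\<close>\<close>

lemma smult_mat_mult_vec:
  "(B :: real mat) \<in> carrier_mat nr nc \<Longrightarrow> v \<in> carrier_vec nc \<Longrightarrow> (k \<cdot>\<^sub>m B) *\<^sub>v v = k \<cdot>\<^sub>v (B *\<^sub>v v)"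
  by (intro eq_vecI) (simp_all add: scalar_prod_def sum_distrib_left mult.assoc)

lemma vec_diff_eq_zero:
  assumes "v \<in> carrier_vec n" "w \<in> carrier_vec n" "v - w = (0\<^sub>v n :: real vec)"
  shows "v = w"
proof (rule eq_vecI)
  fix i assume "i < dim_vec w"
  then have i: "i < n" "i < dim_vec w" using assms by simp_all
  have "(v - w) $ i = 0" using assms(3) i by simp
  then show "v $ i = w $ i" using i by simp
qed (use assms in simp)

lemma vec_add_eq_zero_iff:
  assumes "v \<in> carrier_vec n" "w \<in> carrier_vec n"
  shows "v + w = (0\<^sub>v n :: real vec) \<longleftrightarrow> v = - w"
proof
  assume 0: "v + w = 0\<^sub>v n"
  have "v - (- w) = v + w" using assms by (intro eq_vecI) simp_all
  then have d: "v - (- w) = 0\<^sub>v n" unfolding 0 .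
  have "- w \<in> carrier_vec n" using assms(2) by simp
  then show "v = - w" using d by (rule vec_diff_eq_zero[OF assms(1)])
next
  assume "v = - w"
  then show "v + w = 0\<^sub>v n" using assms by (intro eq_vecI) simp_all
qed

text \<open>Since \<open>M\<close> has a left inverse, the boundary values of \<open>W\<close> are determined by those of \<open>A W\<close>.\<close>

lemma boundary_operator_exists:
  fixes M H :: "real mat"
  assumes M: "M \<in> carrier_mat m n" and M_inj: "\<And>x. x \<in> carrier_vec n \<Longrightarrow> M *\<^sub>v x = 0\<^sub>v m \<Longrightarrow> x = 0\<^sub>v n"
    and H: "H \<in> carrier_mat n n"
  shows "\<exists>E. E \<in> carrier_mat n (m + n) \<and> (\<forall>v\<in>carrier_vec (m + n).
    E *\<^sub>v (grad_A m n M *\<^sub>v v) = H *\<^sub>v vec_last v n + \<chi> \<cdot>\<^sub>v (M\<^sup>T *\<^sub>v vec_first v m))"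
proof -
  obtain b where b: "\<forall>j<n. b j \<in> carrier_vec m \<and> (\<forall>v\<in>carrier_vec n. (M *\<^sub>v v) \<bullet> b j = v $ j)"
    using dual_family_exists[OF M M_inj] by blast
  define P where "P = mat_of_rows m (map b [0..<n])"
  have P: "P \<in> carrier_mat n m" unfolding P_def carrier_mat_def by simp
  have rowP: "row P j = b j" if "j < n" for j using b that unfolding P_def by (subst mat_of_rows_row) simp_all
  have PM: "P *\<^sub>v (M *\<^sub>v v) = v" if v: "v \<in> carrier_vec n" for v
  proof (rule eq_vecI)
    fix j assume "j < dim_vec v"
    then have j: "j < n" using v by simp
    have Mv: "M *\<^sub>v v \<in> carrier_vec m" and bj: "b j \<in> carrier_vec m" using M v b j by simp_all
    have "(P *\<^sub>v (M *\<^sub>v v)) $ j = b j \<bullet> (M *\<^sub>v v)" using P j rowP[OF j] by (simp add: index_mult_mat_vec)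
    also have "\<dots> = v $ j" using comm_scalar_prod[OF bj Mv] b j v by simp
    finally show "(P *\<^sub>v (M *\<^sub>v v)) $ j = v $ j" .
  qed (use P v in simp)
  have HP: "H * P \<in> carrier_mat n m" using H P by simp
  define rw where "rw i = row (H * P) i @\<^sub>v (\<chi> \<cdot>\<^sub>v unit_vec n i)" for i
  have rHP: "row (H * P) i \<in> carrier_vec m" if "i < n" for i
    using row_carrier_vec[OF _ HP] that by simp
  have rw: "rw i \<in> carrier_vec (m + n)" if "i < n" for i unfolding rw_def using rHP[OF that] by simp
  define E where "E = mat_of_rows (m + n) (map rw [0..<n])"
  have E: "E \<in> carrier_mat n (m + n)" unfolding E_def carrier_mat_def by simp
  have rowE: "row E i = rw i" if "i < n" for i using rw that unfolding E_def by (subst mat_of_rows_row) simp_all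
  have "E *\<^sub>v (grad_A m n M *\<^sub>v v) = H *\<^sub>v vec_last v n + \<chi> \<cdot>\<^sub>v (M\<^sup>T *\<^sub>v vec_first v m)" if v: "v \<in> carrier_vec (m + n)" for v
  proof (rule eq_vecI)
    define x y where "x = vec_first v m" and "y = vec_last v n"
    have xy: "x \<in> carrier_vec m" "y \<in> carrier_vec n" "v = x @\<^sub>v y" using v by (simp_all add: x_def y_def)
    fix i assume "i < dim_vec (H *\<^sub>v vec_last v n + \<chi> \<cdot>\<^sub>v (M\<^sup>T *\<^sub>v vec_first v m))"
    then have i: "i < n" using M by simp
    have My: "M *\<^sub>v y \<in> carrier_vec m" and Mx: "M\<^sup>T *\<^sub>v x \<in> carrier_vec n" using M xy by simp_all
    have ui: "\<chi> \<cdot>\<^sub>v unit_vec n i \<in> carrier_vec n" by simp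
    have "(E *\<^sub>v (grad_A m n M *\<^sub>v v)) $ i = rw i \<bullet> ((M *\<^sub>v y) @\<^sub>v (M\<^sup>T *\<^sub>v x))"
      unfolding xy(3) grad_A_mult_append[OF M xy(1,2)] using E i rowE[OF i] by (simp add: index_mult_mat_vec)
    also have "\<dots> = row (H * P) i \<bullet> (M *\<^sub>v y) + (\<chi> \<cdot>\<^sub>v unit_vec n i) \<bullet> (M\<^sup>T *\<^sub>v x)"
      unfolding rw_def by (rule scalar_prod_append[OF rHP[OF i] ui My Mx])
    also have "row (H * P) i \<bullet> (M *\<^sub>v y) = ((H * P) *\<^sub>v (M *\<^sub>v y)) $ i" using HP H i by (simp add: index_mult_mat_vec)
    also have "(H * P) *\<^sub>v (M *\<^sub>v y) = H *\<^sub>v y" using assoc_mult_mat_vec[OF H P My] PM[OF xy(2)] by simp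
    also have "(\<chi> \<cdot>\<^sub>v unit_vec n i) \<bullet> (M\<^sup>T *\<^sub>v x) = \<chi> * (M\<^sup>T *\<^sub>v x) $ i"
      using Mx i by (simp add: smult_scalar_prod_distrib[OF _ Mx] scalar_prod_left_unit del: index_mult_mat_vec)
    finally show "(E *\<^sub>v (grad_A m n M *\<^sub>v v)) $ i = (H *\<^sub>v vec_last v n + \<chi> \<cdot>\<^sub>v (M\<^sup>T *\<^sub>v vec_first v m)) $ i"
      unfolding x_def y_def using M H i by (simp del: index_mult_mat_vec)
  qed (use E M in simp)
  then show ?thesis using E by blast
qed

text \<open>Only the differences \<open>Wbe - be\<close> and \<open>Wbo - bo\<close> enter, and the
  first is fixed by its two projections as \<open>g2 + Ge u\<close>. Conversely these differences
  are realized with wall data 0.\<close>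

lemma layer_solution_iff:
  fixes M Ge H :: "real mat"
  assumes M: "M \<in> carrier_mat m n" and Ge: "Ge \<in> carrier_mat m p" "\<And>x. x \<in> carrier_vec p \<Longrightarrow> Ge\<^sup>T *\<^sub>v (Ge *\<^sub>v x) = x"
    and g: "g1 \<in> carrier_vec n" "g2 \<in> carrier_vec m" "Ge\<^sup>T *\<^sub>v g2 = 0\<^sub>v p"
  shows "layer_solution a M A Q Ge H \<chi> h g1 g2 W u \<longleftrightarrow> half_line_solution a A Q h W \<and> u \<in> carrier_vec p \<and>
    H *\<^sub>v (vec_last (W 0) n + g1) + \<chi> \<cdot>\<^sub>v (M\<^sup>T *\<^sub>v (vec_first (W 0) m + (g2 + Ge *\<^sub>v u))) = 0\<^sub>v n"
proof -
  have GT: "Ge\<^sup>T \<in> carrier_mat p m" and GG: "Ge * Ge\<^sup>T \<in> carrier_mat m m" using Ge(1) by auto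
  have dims: "dim_row M = m" "dim_col M = n" using M by auto
  have proj: "(1\<^sub>m m - Ge * Ge\<^sup>T) *\<^sub>v w = w - Ge *\<^sub>v (Ge\<^sup>T *\<^sub>v w)" if w: "w \<in> carrier_vec m" for w
    using minus_mult_distrib_mat_vec[OF one_carrier_mat GG w] assoc_mult_mat_vec[OF Ge(1) GT w] w by simp
  have bc: "boundary_condition H \<chi> M (vec_first (W 0) m) (vec_last (W 0) n) Wbe Wbo be bo \<longleftrightarrow>
      H *\<^sub>v (vec_last (W 0) n + (Wbo - bo)) + \<chi> \<cdot>\<^sub>v (M\<^sup>T *\<^sub>v (vec_first (W 0) m + (Wbe - be))) = 0\<^sub>v n"
    if "Wbe \<in> carrier_vec m" "be \<in> carrier_vec m" "Wbo \<in> carrier_vec n" "bo \<in> carrier_vec n" for Wbe be Wbo bo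
  proof -
    have "vec_last (W 0) n + Wbo - bo = vec_last (W 0) n + (Wbo - bo)" using that by (intro eq_vecI) simp_all
    moreover have "vec_first (W 0) m + Wbe - be = vec_first (W 0) m + (Wbe - be)" using that by (intro eq_vecI) simp_all
    ultimately show ?thesis unfolding boundary_condition_def dims by simp
  qed
  have "(\<exists>Wbe\<in>carrier_vec m. \<exists>be\<in>carrier_vec m. \<exists>Wbo\<in>carrier_vec n. \<exists>bo\<in>carrier_vec n.
        Wbo - bo = g1 \<and> (1\<^sub>m m - Ge * Ge\<^sup>T) *\<^sub>v (Wbe - be) = g2 \<and> Ge\<^sup>T *\<^sub>v (Wbe - be) = u \<and>
        boundary_condition H \<chi> M (vec_first (W 0) m) (vec_last (W 0) n) Wbe Wbo be bo) \<longleftrightarrow>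
      u \<in> carrier_vec p \<and> H *\<^sub>v (vec_last (W 0) n + g1) + \<chi> \<cdot>\<^sub>v (M\<^sup>T *\<^sub>v (vec_first (W 0) m + (g2 + Ge *\<^sub>v u))) = 0\<^sub>v n"
    (is "?L \<longleftrightarrow> ?R")
  proof
    assume ?L
    then obtain Wbe be Wbo bo where c: "Wbe \<in> carrier_vec m" "be \<in> carrier_vec m" "Wbo \<in> carrier_vec n" "bo \<in> carrier_vec n"
      and 1: "Wbo - bo = g1" "(1\<^sub>m m - Ge * Ge\<^sup>T) *\<^sub>v (Wbe - be) = g2" "Ge\<^sup>T *\<^sub>v (Wbe - be) = u"
      and 2: "boundary_condition H \<chi> M (vec_first (W 0) m) (vec_last (W 0) n) Wbe Wbo be bo" by blast
    have w: "Wbe - be \<in> carrier_vec m" using c by simp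
    have u: "u \<in> carrier_vec p" unfolding 1(3)[symmetric] using GT w by simp
    have "g2 = (Wbe - be) - Ge *\<^sub>v u" using 1(2,3) proj[OF w] by simp
    then have "g2 + Ge *\<^sub>v u = Wbe - be" using c u Ge(1) by (intro eq_vecI) simp_all
    then show ?R using 2 u unfolding bc[OF c] 1(1) by simp
  next
    assume R: ?R
    then have u: "u \<in> carrier_vec p" by blast
    have Gu: "Ge *\<^sub>v u \<in> carrier_vec m" using Ge(1) u by simp
    define w where "w = g2 + Ge *\<^sub>v u"
    have w: "w \<in> carrier_vec m" using g Gu by (simp add: w_def)
    have Gw: "Ge\<^sup>T *\<^sub>v w = u"
      unfolding w_def using mult_add_distrib_mat_vec[OF GT g(2) Gu] g(3) Ge(2)[OF u] u by simp
    have z: "w - 0\<^sub>v m = w" "g1 - 0\<^sub>v n = g1" using w g by (auto intro!: eq_vecI)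
    have pw: "(1\<^sub>m m - Ge * Ge\<^sup>T) *\<^sub>v w = g2"
      unfolding proj[OF w] Gw unfolding w_def using g(2) Gu Ge(1) by (intro eq_vecI) simp_all
    have "boundary_condition H \<chi> M (vec_first (W 0) m) (vec_last (W 0) n) w g1 (0\<^sub>v m) (0\<^sub>v n)"
      unfolding bc[OF w zero_carrier_vec g(1) zero_carrier_vec] z using R w_def by simp
    then show ?L using w g(1) z Gw pw
      by (intro bexI[of _ w] bexI[of _ "0\<^sub>v m"] bexI[of _ g1] bexI[of _ "0\<^sub>v n"]) simp_all
  qed
  then show ?thesis unfolding layer_solution_def dims by blast
qed

theorem theorem3p1:
  fixes K m n p1 p2 r1 r2 :: nat
    and idx :: "nat \<Rightarrow> nat ^ 3"
    and L :: "(real ^ 3 \<Rightarrow> real) \<Rightarrow> real ^ 3 \<Rightarrow> real"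
    and M A Q Qe Qo Ge Go Xe Xo Y1 Y2 Y3 Z1 Z2 Z3 V3 A33 Q33 H :: "real mat"
    and \<chi> \<chi>h a :: real
  assumes K: "K \<ge> 2"
    and m: "m = card (even_indices K)" and n: "n = card (odd_indices K)"
    and idx: "grad_ordering K m n idx"
    and M: "M = grad_M m n idx"
    and A: "A = grad_A m n M"
    and Q: "Q = grad_Q L m n idx"
    and Qe: "Qe \<in> carrier_mat m m" and Qo: "Qo \<in> carrier_mat n n"
    and Q_block: "Q = diag_block_mat [Qe, Qo]"
    and Q_psd: "pos_semidef Q"
    and null_AQ: "mat_kernel A \<inter> mat_kernel Q = {0\<^sub>v (m + n)}"
    and p1: "p1 = kernel_dim Qe" and p2: "p2 = kernel_dim Qo"
    and Ge: "orthonormal_basis_mat Ge m p1 (mat_kernel Qe)"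
    and Go: "orthonormal_basis_mat Go n p2 (mat_kernel Qo)"
    and r1: "r1 = kernel_dim (Go\<^sup>T * M\<^sup>T * Ge)" and r2: "r2 = kernel_dim (Ge\<^sup>T * M * Go)"
    and Xe: "orthonormal_basis_mat Xe p1 r1 (mat_kernel (Go\<^sup>T * M\<^sup>T * Ge))"
    and Xo: "orthonormal_basis_mat Xo p2 r2 (mat_kernel (Ge\<^sup>T * M * Go))"
    and Y1: "Y1 = Ge * Xe" and Z1: "Z1 = Go * Xo"
    and Y2: "orthonormal_basis_mat Y2 m p2 (vec_space.col_space m (M * Go))"
    and Z2: "orthonormal_basis_mat Z2 n p1 (vec_space.col_space n (M\<^sup>T * Ge))"
    and Y3: "Y3 \<in> carrier_mat m (m - r1 - p2)" and Z3: "Z3 \<in> carrier_mat n (n - r2 - p1)"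
    and Y_orth: "real_orthogonal m (mat_of_cols m (cols Y1 @ cols Y2 @ cols Y3))"
    and Z_orth: "real_orthogonal n (mat_of_cols n (cols Z1 @ cols Z2 @ cols Z3))"
    and V3: "V3 = diag_block_mat [Y3, Z3]"
    and A33: "A33 = V3\<^sup>T * A * V3" and Q33: "Q33 = V3\<^sup>T * Q * V3"
    and chi: "0 \<le> \<chi>" "\<chi> \<le> 1"
    and chih: "\<chi>h = 2 * \<chi> / (2 - \<chi>) * (1 / sqrt (2 * pi))"
    and chih_pos: "\<chi>h > 0"
    and r2_zero: "r2 = 0"
    and H: "H \<in> carrier_mat n n" and H_pos: "pos_def H"
    and a_pos: "a > 0"
    and a_less: "(\<exists>ev>0. eigenvalue (the (mat_inverse Q33) * A33) ev)
                   \<longrightarrow> a < 1 / Max (spectrum (the (mat_inverse Q33) * A33))"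
  shows "\<exists>c>0. \<forall>h g1 g2.
           weighted_L2 (m + n) a h \<and> g1 \<in> carrier_vec n \<and> g2 \<in> carrier_vec m \<and> Ge\<^sup>T *\<^sub>v g2 = 0\<^sub>v p1 \<longrightarrow>
           (\<exists>W u. layer_solution a M A Q Ge H \<chi>h h g1 g2 W u \<and>
              (\<forall>W' u'. layer_solution a M A Q Ge H \<chi>h h g1 g2 W' u' \<longrightarrow>
                 (\<forall>y\<ge>0. W' y = W y) \<and> u' = u) \<and>
              weighted_norm a W \<le> c * (weighted_norm a h + vnorm g1 + vnorm g2) \<and>
              vnorm u \<le> c * (weighted_norm a h + vnorm g1 + vnorm g2))"
proof -
  define k1 k2 where "k1 = m - r1 - p2" and "k2 = n - r2 - p1"
  note Y3 = Y3[folded k1_def] and Z3 = Z3[folded k2_def]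
  have Mc: "M \<in> carrier_mat m n" unfolding M grad_M_def by simp
  have M_inj: "x = 0\<^sub>v n" if "x \<in> carrier_vec n" "M *\<^sub>v x = 0\<^sub>v m" for x
    using grad_M_injective[OF idx that(1)] that(2) unfolding M by blast
  note GeD = orthonormal_basis_matD[OF Ge] and GoD = orthonormal_basis_matD[OF Go]
    and XeD = orthonormal_basis_matD[OF Xe] and XoD = orthonormal_basis_matD[OF Xo]
  interpret kp: kinetic_pencil "m + n" "p1 + p2" "k1 + k2" "r1 + r2" A Q
      "diag_block_mat [Ge, Go]" "diag_block_mat [Y1, Z1]" "diag_block_mat [Y3, Z3]"
    unfolding A by (rule block_kinetic_pencil[OF Mc Qe Qo Q_block Q_psd null_AQ[unfolded A] Ge Go Xe Xo Y1 Z1 Y2 Z2 Y3 Z3 Y_orth Z_orth])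
  have "Z1 \<in> carrier_mat n r2" unfolding Z1 using GoD(1) XoD(1) by simp
  from orthogonal_triple(1)[OF this orthonormal_basis_matD(1)[OF Z2] Z3 Z_orth]
  \<comment> \<open>With \<open>r2 = 0\<close> the odd triple has widths 0, \<open>p1\<close> and
    \<open>k2\<close>; so \<open>k2\<close> free initial values and \<open>p1\<close> boundary
    parameters match the \<open>n\<close> boundary equations.\<close>
  have ql: "k2 + p1 = n" using r2_zero by simp
  obtain s t c \<mu> where T: "kp.triangularizing (p1 + p2 + (k1 + k2) + (r1 + r2)) s t
       (\<lambda>i. if i < p1 + p2 then 1 else if i < p1 + p2 + (k1 + k2) then \<mu> (i - (p1 + p2)) else 1)
       (\<lambda>i. if p1 + p2 \<le> i \<and> i < p1 + p2 + (k1 + k2) then 1 else 0)"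
    and c: "\<forall>i<k1 + k2. c i \<in> carrier_vec (k1 + k2)"
    and cQ: "\<forall>i<k1 + k2. \<forall>j<k1 + k2. (diag_block_mat [Y3, Z3] *\<^sub>v c i) \<bullet> (Q *\<^sub>v (diag_block_mat [Y3, Z3] *\<^sub>v c j)) = (if i = j then 1 else 0)"
    and cA: "\<forall>i<k1 + k2. \<forall>j<k1 + k2. (diag_block_mat [Y3, Z3] *\<^sub>v c i) \<bullet> (A *\<^sub>v (diag_block_mat [Y3, Z3] *\<^sub>v c j)) = (if i = j then \<mu> i else 0)"
    and span: "\<forall>u\<in>carrier_vec (k1 + k2). (\<forall>i<k1 + k2. c i \<bullet> u = 0) \<longrightarrow> u = 0\<^sub>v (k1 + k2)"
    using kp.triangularizing_exists by blast
  define p k d where "p = p1 + p2" and "k = k1 + k2" and "d = p1 + p2 + (k1 + k2) + (r1 + r2)"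
  define e f where "e = (\<lambda>i. if i < p then 1 else if i < p + k then \<mu> (i - p) else 1)"
    and "f = (\<lambda>i. if p \<le> i \<and> i < p + k then 1 else 0 :: real)"
  have T: "kp.triangularizing d s t e f" using T unfolding p_def k_def d_def e_def f_def .
  \<comment> \<open>Row \<open>p + i\<close> has rate \<open>1 / \<mu> i\<close>, which among
    positive eigenvalues is smallest at the largest one.\<close>
  have a_lt: "a < 1 / \<mu> i" if i: "i < k" and pos: "\<mu> i > 0" for i
  proof -
    note ev = kp.pencil_eigenvalue[OF A33[unfolded V3] Q33[unfolded V3] c cQ cA span, of i, folded k_def, OF i]
    have "\<mu> i \<in> spectrum (the (mat_inverse Q33) * A33)" using ev(1) unfolding spectrum_def by simp
    then have le: "\<mu> i \<le> Max (spectrum (the (mat_inverse Q33) * A33))" by (rule Max_ge[OF ev(2)])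
    have "a < 1 / Max (spectrum (the (mat_inverse Q33) * A33))" using a_less ev(1) pos by blast
    also have "\<dots> \<le> 1 / \<mu> i" using le pos by (intro divide_left_mono) simp_all
    finally show ?thesis .
  qed
  \<comment> \<open>Rows outside the \<open>V3\<close> block have rate 0 and a negative \<mu> gives
    a negative rate, both below \<open>a\<close>; the value 0 of \<mu> gives an algebraic
    row.\<close>
  have adm: "e i = 0 \<and> f i \<noteq> 0 \<or> e i \<noteq> 0 \<and> f i / e i \<noteq> a" if "i < d" for i
  proof (cases "p \<le> i \<and> i < p + k")
    case True
    then have fi: "f i = 1" and ei: "e i = \<mu> (i - p)" and ik: "i - p < k" by (auto simp: e_def f_def)
    consider "\<mu> (i - p) = 0" | "\<mu> (i - p) > 0" | "\<mu> (i - p) < 0" by linarith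
    then show ?thesis
    proof cases
      case 1 then show ?thesis using fi ei by simp
    next
      case 2 then show ?thesis using fi ei a_lt[OF ik 2] by simp
    next
      case 3
      then have "f i / e i < 0" "e i \<noteq> 0" using fi ei by simp_all
      then show ?thesis using a_pos by linarith
    qed
  next
    case False
    then have "f i = 0" "e i = 1" by (auto simp: e_def f_def)
    then show ?thesis using a_pos by simp
  qed
  have free: "k2 \<le> card {i. i < d \<and> e i \<noteq> 0 \<and> f i / e i > a}"
  proof -
    have "\<exists>B. B \<in> carrier_mat (k1 + k2) k2 \<and> (\<forall>z\<in>carrier_vec k2. z \<noteq> 0\<^sub>v k2 \<longrightarrow>
        (diag_block_mat [Y3, Z3] *\<^sub>v (B *\<^sub>v z)) \<bullet> (A *\<^sub>v (diag_block_mat [Y3, Z3] *\<^sub>v (B *\<^sub>v z))) > 0)"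
      unfolding A by (rule block_positive_subspace[OF Mc M_inj GeD(1) GoD(1) XeD(1) Xo[unfolded r2_zero] Y1 Z1 Y2 Z2 Y3 Z3 Y_orth Z_orth])
    then obtain B where B: "B \<in> carrier_mat k k2" and pos: "\<forall>z\<in>carrier_vec k2. z \<noteq> 0\<^sub>v k2 \<longrightarrow>
        (diag_block_mat [Y3, Z3] *\<^sub>v (B *\<^sub>v z)) \<bullet> (A *\<^sub>v (diag_block_mat [Y3, Z3] *\<^sub>v (B *\<^sub>v z))) > 0"
      unfolding k_def by (elim exE conjE)
    define V where "V = diag_block_mat [Y3, Z3]"
    have V: "V \<in> carrier_mat (m + n) k" unfolding V_def k_def by (rule kp.V3)
    define A' Q' where "A' = V\<^sup>T * (A * V)" and "Q' = V\<^sup>T * (Q * V)"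
    note A' = congruence_symmetric[OF V kp.A, folded A'_def]
    note Q' = congruence_symmetric[OF V kp.Q, folded Q'_def]
    have A'v: "x \<bullet> (A' *\<^sub>v y) = (V *\<^sub>v x) \<bullet> (A *\<^sub>v (V *\<^sub>v y))" if "x \<in> carrier_vec k" "y \<in> carrier_vec k" for x y
      unfolding A'_def by (rule congruence_scalar_prod[OF V kp.A(1) that])
    have Q'v: "x \<bullet> (Q' *\<^sub>v y) = (V *\<^sub>v x) \<bullet> (Q *\<^sub>v (V *\<^sub>v y))" if "x \<in> carrier_vec k" "y \<in> carrier_vec k" for x y
      unfolding Q'_def by (rule congruence_scalar_prod[OF V kp.Q(1) that])
    note cs = c[folded k_def] cQ[folded k_def V_def] cA[folded k_def V_def] span[folded k_def]
    have "k2 \<le> card {i. i < k \<and> \<mu> i > 0}"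
    proof (rule positive_subspace_dim_le[OF A'(1) Q'(1,2) _ _ _ _ _ B])
      fix u :: "real vec" assume u: "u \<in> carrier_vec k" "Q' *\<^sub>v u = 0\<^sub>v k"
      have "(V *\<^sub>v u) \<bullet> (Q *\<^sub>v (V *\<^sub>v u)) = 0" using Q'v[OF u(1) u(1)] u by simp
      then show "u = 0\<^sub>v k" using kp.V3_Q_pos[folded V_def k_def, OF u(1)] by fastforce
    next
      show "c i \<in> carrier_vec k" if "i < k" for i using cs(1) that by blast
      show "c i \<bullet> (Q' *\<^sub>v c j) = (if i = j then 1 else 0)" if "i < k" "j < k" for i j
        using Q'v[of "c i" "c j"] cs(1,2) that by simp
      show "c i \<bullet> (A' *\<^sub>v c j) = (if i = j then \<mu> i else 0)" if "i < k" "j < k" for i j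
        using A'v[of "c i" "c j"] cs(1,3) that by simp
      show "u = 0\<^sub>v k" if "u \<in> carrier_vec k" "\<And>i. i < k \<Longrightarrow> c i \<bullet> u = 0" for u using cs(4) that by blast
      fix z :: "real vec" assume z: "z \<in> carrier_vec k2" "z \<noteq> 0\<^sub>v k2"
      have Bz: "B *\<^sub>v z \<in> carrier_vec k" using B z by simp
      show "(B *\<^sub>v z) \<bullet> (A' *\<^sub>v (B *\<^sub>v z)) > 0"
        unfolding A'v[OF Bz Bz] using pos[folded V_def] z by blast
    qed
    \<comment> \<open>In the ordering of the rows the \<open>V3\<close> block starts at index
      \<open>p\<close>.\<close>
    also have "\<dots> = card ((\<lambda>i. p + i) ` {i. i < k \<and> \<mu> i > 0})" by (rule card_image[symmetric]) simp
    also have "\<dots> \<le> card {i. i < d \<and> e i \<noteq> 0 \<and> f i / e i > a}"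
    proof (rule card_mono)
      show "(\<lambda>i. p + i) ` {i. i < k \<and> \<mu> i > 0} \<subseteq> {i. i < d \<and> e i \<noteq> 0 \<and> f i / e i > a}"
      proof (rule image_subsetI)
        fix i assume "i \<in> {i. i < k \<and> \<mu> i > 0}"
        then have i: "i < k" "\<mu> i > 0" by simp_all
        have "p + i < d" using i by (simp add: d_def p_def k_def)
        moreover have "e (p + i) = \<mu> i" "f (p + i) = 1" using i by (simp_all add: e_def f_def)
        ultimately show "p + i \<in> {i. i < d \<and> e i \<noteq> 0 \<and> f i / e i > a}" using i a_lt[OF i] by simp
      qed
    qed simp
    finally show ?thesis .
  qed
  define S where "S = \<chi>h \<cdot>\<^sub>m M\<^sup>T"
  have MT: "M\<^sup>T \<in> carrier_mat n m" using Mc by simp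
  have S: "S \<in> carrier_mat n m" unfolding S_def using MT by simp
  have Sv: "S *\<^sub>v x = \<chi>h \<cdot>\<^sub>v (M\<^sup>T *\<^sub>v x)" if "x \<in> carrier_vec m" for x
    unfolding S_def by (rule smult_mat_mult_vec[OF MT that])
  obtain E where E: "E \<in> carrier_mat n (m + n)"
    and EA0: "\<forall>v\<in>carrier_vec (m + n). E *\<^sub>v (grad_A m n M *\<^sub>v v) = H *\<^sub>v vec_last v n + \<chi>h \<cdot>\<^sub>v (M\<^sup>T *\<^sub>v vec_first v m)"
    using boundary_operator_exists[OF Mc M_inj H] by blast
  have EA: "E *\<^sub>v (A *\<^sub>v v) = H *\<^sub>v vec_last v n + S *\<^sub>v vec_first v m" if "v \<in> carrier_vec (m + n)" for v
    unfolding A Sv[OF vec_first_carrier] using EA0 that by blast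
  define C where "C = S * Ge"
  have C: "C \<in> carrier_mat n p1" unfolding C_def using S GeD(1) by simp
  have Cv: "C *\<^sub>v u = S *\<^sub>v (Ge *\<^sub>v u)" if "u \<in> carrier_vec p1" for u
    unfolding C_def by (rule assoc_mult_mat_vec[OF S GeD(1) that])
  have Geu: "Ge *\<^sub>v u \<in> carrier_vec m" if "u \<in> carrier_vec p1" for u using GeD(1) that by simp
  \<comment> \<open>The boundary parameter enters the energy argument as \<open>z = Ge u\<close>,
    for which \<open>(z, 0)\<close> lies in the kernel of \<open>Q\<close>.\<close>
  have uniq: "(\<forall>y\<ge>0. D y = 0\<^sub>v (m + n)) \<and> u = 0\<^sub>v p1"
    if D: "half_line_solution a A Q (\<lambda>_. 0\<^sub>v (m + n)) D" and u: "u \<in> carrier_vec p1"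
      and bc: "E *\<^sub>v (A *\<^sub>v D 0) + C *\<^sub>v u = 0\<^sub>v n" for D u
  proof -
    have zeroh: "\<forall>y\<ge>(0::real). 0\<^sub>v (m + n) \<in> carrier_vec (m + n)" by simp
    have D0: "D 0 \<in> carrier_vec (m + n)"
      using D unfolding half_line_solution_iff[OF kp.A(1) kp.Q(1) zeroh] by simp
    have z: "Ge *\<^sub>v u \<in> carrier_vec m" by (rule Geu[OF u])
    have "Ge *\<^sub>v u \<in> mat_kernel Qe" unfolding GeD(3) using u by blast
    then have "Qe *\<^sub>v (Ge *\<^sub>v u) = 0\<^sub>v m" by (rule mat_kernelD(2)[OF Qe])
    then have Qz: "Q *\<^sub>v ((Ge *\<^sub>v u) @\<^sub>v 0\<^sub>v n) = 0\<^sub>v (m + n)"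
      unfolding Q_block diag_block_mat_two_mult[OF Qe Qo z zero_carrier_vec] mult_mat_zero_vec[OF Qo] by (simp only: zero_vec_append)
    have l: "H *\<^sub>v vec_last (D 0) n \<in> carrier_vec n" "S *\<^sub>v vec_first (D 0) m \<in> carrier_vec n" "S *\<^sub>v (Ge *\<^sub>v u) \<in> carrier_vec n"
      using H S z by simp_all
    have "H *\<^sub>v vec_last (D 0) n + \<chi>h \<cdot>\<^sub>v (M\<^sup>T *\<^sub>v (vec_first (D 0) m + Ge *\<^sub>v u)) =
        H *\<^sub>v vec_last (D 0) n + (S *\<^sub>v vec_first (D 0) m + S *\<^sub>v (Ge *\<^sub>v u))"
      using Sv[of "vec_first (D 0) m + Ge *\<^sub>v u"] mult_add_distrib_mat_vec[OF S vec_first_carrier z] z by simp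
    also have "\<dots> = E *\<^sub>v (A *\<^sub>v D 0) + C *\<^sub>v u"
      unfolding EA[OF D0] Cv[OF u] by (rule assoc_add_vec[OF l, symmetric])
    finally have bc': "H *\<^sub>v vec_last (D 0) n + \<chi>h \<cdot>\<^sub>v (M\<^sup>T *\<^sub>v (vec_first (D 0) m + Ge *\<^sub>v u)) = 0\<^sub>v n" unfolding bc .
    note hom = homogeneous_layer_solution_eq_0[OF Mc _ A kp.Q _ _ H H_pos chih_pos less_imp_le[OF a_pos] D z Qz bc']
    have 1: "D y = 0\<^sub>v (m + n)" if "y \<ge> 0" for y
      by (rule hom(1)[OF _ _ _ that]) (erule (1) M_inj | erule kp.Q_nonneg | erule (2) kp.null_AQ)+
    have 2: "Ge *\<^sub>v u = 0\<^sub>v m"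
      by (rule hom(2)) (erule (1) M_inj | erule kp.Q_nonneg | erule (2) kp.null_AQ)+
    show ?thesis using 1 GeD(4)[OF u 2] by blast
  qed
  have "\<exists>K\<ge>0. \<forall>h \<rho>. weighted_L2 (m + n) a h \<longrightarrow> \<rho> \<in> carrier_vec n \<longrightarrow>
    (\<exists>W u. half_line_solution a A Q h W \<and> u \<in> carrier_vec p1 \<and> E *\<^sub>v (A *\<^sub>v W 0) + C *\<^sub>v u = \<rho> \<and>
      (weighted_norm a W)\<^sup>2 \<le> K * ((weighted_norm a h)\<^sup>2 + \<rho> \<bullet> \<rho>) \<and> u \<bullet> u \<le> K * ((weighted_norm a h)\<^sup>2 + \<rho> \<bullet> \<rho>))"
  proof (rule kp.boundary_value_problem_solvable[OF T adm free E C ql])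
    show "D 0 = 0\<^sub>v (m + n) \<and> u = 0\<^sub>v p1"
      if "half_line_solution a A Q (\<lambda>_. 0\<^sub>v (m + n)) D" "u \<in> carrier_vec p1" "E *\<^sub>v (A *\<^sub>v D 0) + C *\<^sub>v u = 0\<^sub>v n" for D u
      using uniq[OF that] by simp
  qed
  then obtain K where K0: "K \<ge> 0" and solve: "\<forall>h \<rho>. weighted_L2 (m + n) a h \<longrightarrow> \<rho> \<in> carrier_vec n \<longrightarrow>
    (\<exists>W u. half_line_solution a A Q h W \<and> u \<in> carrier_vec p1 \<and> E *\<^sub>v (A *\<^sub>v W 0) + C *\<^sub>v u = \<rho> \<and>
      (weighted_norm a W)\<^sup>2 \<le> K * ((weighted_norm a h)\<^sup>2 + \<rho> \<bullet> \<rho>) \<and> u \<bullet> u \<le> K * ((weighted_norm a h)\<^sup>2 + \<rho> \<bullet> \<rho>))"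
    by (elim exE conjE)
  obtain KH where KH: "KH \<ge> 0" "\<forall>v\<in>carrier_vec n. (H *\<^sub>v v) \<bullet> (H *\<^sub>v v) \<le> KH * (v \<bullet> v)"
    using mat_vec_bounded[OF H] by blast
  obtain KS where KS: "KS \<ge> 0" "\<forall>v\<in>carrier_vec m. (S *\<^sub>v v) \<bullet> (S *\<^sub>v v) \<le> KS * (v \<bullet> v)"
    using mat_vec_bounded[OF S] by blast
  \<comment> \<open>Bounds the squared length of the data \<open>b = H g1 + S g2\<close> of the
    boundary equation, together with the squared norm of \<open>h\<close>.\<close>
  define Kr where "Kr = 1 + 2 * KH + 2 * KS"
  have Kr: "Kr \<ge> 1" "Kr \<ge> 2 * KH" "Kr \<ge> 2 * KS" using KH(1) KS(1) by (simp_all add: Kr_def)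
  \<comment> \<open>The square root returns from squared norms to norms; the 1 guarantees positivity
    when \<open>K = 0\<close>.\<close>
  define c where "c = sqrt (K * Kr) + 1"
  have KKr: "K * Kr \<ge> 0" using K0 Kr(1) by simp
  then have c_pos: "c > 0" by (simp add: c_def add_nonneg_pos)
  show ?thesis
  proof (rule exI[of _ c], rule conjI[OF c_pos], intro allI impI, elim conjE)
    fix h and g1 g2 :: "real vec"
    assume h: "weighted_L2 (m + n) a h" and g: "g1 \<in> carrier_vec n" "g2 \<in> carrier_vec m" "Ge\<^sup>T *\<^sub>v g2 = 0\<^sub>v p1"
    have hc: "\<forall>y\<ge>0. h y \<in> carrier_vec (m + n)" using h unfolding weighted_L2_def by blast
    define b where "b = H *\<^sub>v g1 + S *\<^sub>v g2"
    have Hg: "H *\<^sub>v g1 \<in> carrier_vec n" and Sg: "S *\<^sub>v g2 \<in> carrier_vec n" using H S g by simp_all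
    have b: "b \<in> carrier_vec n" using Hg Sg by (simp add: b_def)
    have sol_c: "W 0 \<in> carrier_vec (m + n)" if "half_line_solution a A Q h W" for W
      using that unfolding half_line_solution_iff[OF kp.A(1) kp.Q(1) hc] by simp
    have EAc: "E *\<^sub>v (A *\<^sub>v v) \<in> carrier_vec n" if "v \<in> carrier_vec (m + n)" for v using E kp.A(1) that by simp
    have Cc: "C *\<^sub>v u \<in> carrier_vec n" if "u \<in> carrier_vec p1" for u using C that by simp
    have bc: "H *\<^sub>v (vec_last v n + g1) + \<chi>h \<cdot>\<^sub>v (M\<^sup>T *\<^sub>v (vec_first v m + (g2 + Ge *\<^sub>v u))) = (E *\<^sub>v (A *\<^sub>v v) + C *\<^sub>v u) + b"
      if v: "v \<in> carrier_vec (m + n)" and u: "u \<in> carrier_vec p1" for v u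
    proof -
      note z = Geu[OF u]
      have gz: "g2 + Ge *\<^sub>v u \<in> carrier_vec m" using g z by simp
      have 1: "H *\<^sub>v (vec_last v n + g1) = H *\<^sub>v vec_last v n + H *\<^sub>v g1"
        by (rule mult_add_distrib_mat_vec[OF H vec_last_carrier g(1)])
      have "\<chi>h \<cdot>\<^sub>v (M\<^sup>T *\<^sub>v (vec_first v m + (g2 + Ge *\<^sub>v u))) = S *\<^sub>v (vec_first v m + (g2 + Ge *\<^sub>v u))"
        by (rule Sv[symmetric]) (use gz in simp)
      also have "\<dots> = S *\<^sub>v vec_first v m + S *\<^sub>v (g2 + Ge *\<^sub>v u)" by (rule mult_add_distrib_mat_vec[OF S vec_first_carrier gz])
      also have "S *\<^sub>v (g2 + Ge *\<^sub>v u) = S *\<^sub>v g2 + S *\<^sub>v (Ge *\<^sub>v u)" by (rule mult_add_distrib_mat_vec[OF S g(2) z])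
      finally have 2: "\<chi>h \<cdot>\<^sub>v (M\<^sup>T *\<^sub>v (vec_first v m + (g2 + Ge *\<^sub>v u))) = S *\<^sub>v vec_first v m + (S *\<^sub>v g2 + C *\<^sub>v u)"
        unfolding Cv[OF u] .
      define w1 w2 w3 w4 w5 where "w1 = H *\<^sub>v vec_last v n" and "w2 = H *\<^sub>v g1" and "w3 = S *\<^sub>v vec_first v m"
        and "w4 = S *\<^sub>v g2" and "w5 = C *\<^sub>v u"
      have w: "w1 \<in> carrier_vec n" "w2 \<in> carrier_vec n" "w3 \<in> carrier_vec n" "w4 \<in> carrier_vec n" "w5 \<in> carrier_vec n"
        using H S C g u by (simp_all add: w1_def w2_def w3_def w4_def w5_def)
      have "w1 + w2 + (w3 + (w4 + w5)) = (w1 + w3 + w5) + (w2 + w4)" using w by (intro eq_vecI) simp_all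
      then show ?thesis unfolding 1 2 EA[OF v] b_def w1_def w2_def w3_def w4_def w5_def .
    qed
    have lsi: "layer_solution a M A Q Ge H \<chi>h h g1 g2 W u \<longleftrightarrow> half_line_solution a A Q h W \<and> u \<in> carrier_vec p1 \<and>
        H *\<^sub>v (vec_last (W 0) n + g1) + \<chi>h \<cdot>\<^sub>v (M\<^sup>T *\<^sub>v (vec_first (W 0) m + (g2 + Ge *\<^sub>v u))) = 0\<^sub>v n" for W u
      by (rule layer_solution_iff[OF Mc GeD(1) _ g]) (rule GeD(2))
    \<comment> \<open>The boundary condition with the unknowns \<open>A W 0\<close> and
      \<open>u\<close> on the left and the given data on the right.\<close>
    have iff: "layer_solution a M A Q Ge H \<chi>h h g1 g2 W u \<longleftrightarrow>
        half_line_solution a A Q h W \<and> u \<in> carrier_vec p1 \<and> E *\<^sub>v (A *\<^sub>v W 0) + C *\<^sub>v u = - b" for W u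
    proof (cases "half_line_solution a A Q h W \<and> u \<in> carrier_vec p1")
      case True
      then have W: "half_line_solution a A Q h W" and u: "u \<in> carrier_vec p1" by blast+
      have EC: "E *\<^sub>v (A *\<^sub>v W 0) + C *\<^sub>v u \<in> carrier_vec n" using EAc[OF sol_c[OF W]] Cc[OF u] by simp
      show ?thesis
        unfolding lsi bc[OF sol_c[OF W] u] vec_add_eq_zero_iff[OF EC b] by (rule refl)
    next
      case False
      then show ?thesis unfolding lsi by blast
    qed
    have mb: "- b \<in> carrier_vec n" using b by simp
    obtain W u where W: "half_line_solution a A Q h W" and u: "u \<in> carrier_vec p1" and Wu: "E *\<^sub>v (A *\<^sub>v W 0) + C *\<^sub>v u = - b"
      and nW: "(weighted_norm a W)\<^sup>2 \<le> K * ((weighted_norm a h)\<^sup>2 + - b \<bullet> - b)"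
      and nu: "u \<bullet> u \<le> K * ((weighted_norm a h)\<^sup>2 + - b \<bullet> - b)"
      using solve[rule_format, OF h mb] by (elim exE conjE)
    define X where "X = weighted_norm a h + vnorm g1 + vnorm g2"
    have nn: "0 \<le> weighted_norm a h" "0 \<le> vnorm g1" "0 \<le> vnorm g2"
      using weighted_norm_nonneg scalar_prod_self_nonneg by (simp_all add: vnorm_def)
    have X: "X \<ge> 0" using nn by (simp add: X_def)
    have v2: "(vnorm v)\<^sup>2 = v \<bullet> v" for v :: "real vec" unfolding vnorm_def using scalar_prod_self_nonneg by simp
    have "- b \<bullet> - b = b \<bullet> b" by (simp add: scalar_prod_def)
    also have "\<dots> \<le> 2 * ((H *\<^sub>v g1) \<bullet> (H *\<^sub>v g1)) + 2 * ((S *\<^sub>v g2) \<bullet> (S *\<^sub>v g2))"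
      unfolding b_def by (rule scalar_prod_self_add_le[OF Hg Sg])
    also have "\<dots> \<le> 2 * (KH * (vnorm g1)\<^sup>2) + 2 * (KS * (vnorm g2)\<^sup>2)"
      using KH(2)[rule_format, OF g(1)] KS(2)[rule_format, OF g(2)] unfolding v2 by simp
    also have "\<dots> \<le> Kr * (vnorm g1)\<^sup>2 + Kr * (vnorm g2)\<^sup>2"
      using mult_right_mono[OF Kr(2), of "(vnorm g1)\<^sup>2"] mult_right_mono[OF Kr(3), of "(vnorm g2)\<^sup>2"] by simp
    finally have "(weighted_norm a h)\<^sup>2 + - b \<bullet> - b \<le> Kr * ((weighted_norm a h)\<^sup>2 + (vnorm g1)\<^sup>2 + (vnorm g2)\<^sup>2)"
      using mult_right_mono[OF Kr(1), of "(weighted_norm a h)\<^sup>2"] by (simp add: algebra_simps)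
    also have "\<dots> \<le> Kr * X\<^sup>2"
    proof (rule mult_left_mono)
      have "X\<^sup>2 = (weighted_norm a h)\<^sup>2 + (vnorm g1)\<^sup>2 + (vnorm g2)\<^sup>2 + 2 * (weighted_norm a h * vnorm g1)
          + 2 * (weighted_norm a h * vnorm g2) + 2 * (vnorm g1 * vnorm g2)"
        unfolding X_def power2_eq_square by (simp add: algebra_simps)
      then show "(weighted_norm a h)\<^sup>2 + (vnorm g1)\<^sup>2 + (vnorm g2)\<^sup>2 \<le> X\<^sup>2"
        using mult_nonneg_nonneg[OF nn(1,2)] mult_nonneg_nonneg[OF nn(1,3)] mult_nonneg_nonneg[OF nn(2,3)] by linarith
    qed (use Kr in simp)
    finally have total: "K * ((weighted_norm a h)\<^sup>2 + - b \<bullet> - b) \<le> K * Kr * X\<^sup>2" using mult_left_mono[OF _ K0] by (simp add: mult.assoc)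
    have bound: "x \<le> c * X" if x: "x\<^sup>2 \<le> K * ((weighted_norm a h)\<^sup>2 + - b \<bullet> - b)" for x
    proof -
      have "x\<^sup>2 \<le> (sqrt (K * Kr) * X)\<^sup>2" using x total KKr by (simp add: power_mult_distrib)
      then have "x \<le> sqrt (K * Kr) * X" by (rule power2_le_imp_le) (use KKr X in simp)
      then show ?thesis using X by (simp add: c_def distrib_right)
    qed
    have unique: "(\<forall>y\<ge>0. W' y = W y) \<and> u' = u" if "layer_solution a M A Q Ge H \<chi>h h g1 g2 W' u'" for W' u'
    proof -
      have W': "half_line_solution a A Q h W'" and u': "u' \<in> carrier_vec p1" and Wu': "E *\<^sub>v (A *\<^sub>v W' 0) + C *\<^sub>v u' = - b"
        using that unfolding iff by blast+
      have Wc: "W y \<in> carrier_vec (m + n)" "W' y \<in> carrier_vec (m + n)" if "y \<ge> 0" for y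
        using W W' that unfolding half_line_solution_iff[OF kp.A(1) kp.Q(1) hc] by blast+
      \<comment> \<open>The difference of two solutions solves the homogeneous system with
        homogeneous boundary condition, which is the situation of \<open>uniq\<close>.\<close>
      define D where "D y = W' y + (- 1) \<cdot>\<^sub>v W y" for y
      have Dy: "D y = W' y - W y" if "y \<ge> 0" for y using Wc[OF that] unfolding D_def by (intro eq_vecI) simp_all
      have D0: "half_line_solution a A Q (\<lambda>y. h y + (- 1) \<cdot>\<^sub>v h y) D"
        unfolding D_def by (rule half_line_solution_add_smult[OF kp.A(1) kp.Q(1) hc hc W' W])
      have D: "half_line_solution a A Q (\<lambda>_. 0\<^sub>v (m + n)) D"
      proof (rule half_line_solution_cong[OF kp.A(1) kp.Q(1) _ _ D0])
        show "\<forall>y\<ge>0. h y + - 1 \<cdot>\<^sub>v h y \<in> carrier_vec (m + n)" using hc by simp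
        fix y :: real assume "y \<ge> 0"
        then have "h y \<in> carrier_vec (m + n)" using hc by blast
        then show "h y + - 1 \<cdot>\<^sub>v h y = 0\<^sub>v (m + n)" by (intro eq_vecI) simp_all
      qed
      note W0 = Wc[OF order_refl]
      have AW: "A *\<^sub>v W 0 \<in> carrier_vec (m + n)" "A *\<^sub>v W' 0 \<in> carrier_vec (m + n)" using kp.A(1) W0 by simp_all
      have 1: "E *\<^sub>v (A *\<^sub>v D 0) = E *\<^sub>v (A *\<^sub>v W' 0) - E *\<^sub>v (A *\<^sub>v W 0)"
        unfolding Dy[OF order_refl] mult_minus_distrib_mat_vec[OF kp.A(1) W0(2,1)] by (rule mult_minus_distrib_mat_vec[OF E AW(2,1)])
      have 2: "C *\<^sub>v (u' - u) = C *\<^sub>v u' - C *\<^sub>v u" by (rule mult_minus_distrib_mat_vec[OF C u' u])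
      define w1 w2 w3 w4 where "w1 = E *\<^sub>v (A *\<^sub>v W' 0)" and "w2 = E *\<^sub>v (A *\<^sub>v W 0)" and "w3 = C *\<^sub>v u'" and "w4 = C *\<^sub>v u"
      have w: "w1 \<in> carrier_vec n" "w2 \<in> carrier_vec n" "w3 \<in> carrier_vec n" "w4 \<in> carrier_vec n"
        using EAc[OF W0(2)] EAc[OF W0(1)] Cc[OF u'] Cc[OF u] by (simp_all add: w1_def w2_def w3_def w4_def)
      have "(w1 - w2) + (w3 - w4) = (w1 + w3) - (w2 + w4)" using w by (intro eq_vecI) simp_all
      also have "\<dots> = - b - - b" using Wu Wu' by (simp only: w1_def w2_def w3_def w4_def)
      also have "\<dots> = 0\<^sub>v n" using b by (intro eq_vecI) simp_all
      finally have "E *\<^sub>v (A *\<^sub>v D 0) + C *\<^sub>v (u' - u) = 0\<^sub>v n" unfolding 1 2 w1_def w2_def w3_def w4_def .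
      moreover have "u' - u \<in> carrier_vec p1" using u u' by simp
      ultimately have z: "\<forall>y\<ge>0. D y = 0\<^sub>v (m + n)" "u' - u = 0\<^sub>v p1" using uniq[OF D] by blast+
      have "W' y = W y" if "y \<ge> 0" for y
        by (rule vec_diff_eq_zero[OF Wc(2,1)[OF that]]) (use z(1) Dy that in simp)
      moreover have "u' = u" by (rule vec_diff_eq_zero[OF u' u z(2)])
      ultimately show ?thesis by blast
    qed
    have sol: "layer_solution a M A Q Ge H \<chi>h h g1 g2 W u" unfolding iff using W u Wu by blast
    have b1: "weighted_norm a W \<le> c * X" by (rule bound[OF nW])
    have b2: "vnorm u \<le> c * X" by (rule bound) (use nu v2 in simp)
    show "\<exists>W u. layer_solution a M A Q Ge H \<chi>h h g1 g2 W u \<and>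
              (\<forall>W' u'. layer_solution a M A Q Ge H \<chi>h h g1 g2 W' u' \<longrightarrow>
                 (\<forall>y\<ge>0. W' y = W y) \<and> u' = u) \<and>
              weighted_norm a W \<le> c * (weighted_norm a h + vnorm g1 + vnorm g2) \<and>
              vnorm u \<le> c * (weighted_norm a h + vnorm g1 + vnorm g2)"
    proof (intro exI conjI allI impI)
      show "layer_solution a M A Q Ge H \<chi>h h g1 g2 W u" by (rule sol)
      show "W' y = W y" if "layer_solution a M A Q Ge H \<chi>h h g1 g2 W' u'" "y \<ge> 0" for W' u' y using unique[OF that(1)] that(2) by blast
      show "u' = u" if "layer_solution a M A Q Ge H \<chi>h h g1 g2 W' u'" for W' u' using unique[OF that] by blast
    qed (use b1 b2 in \<open>simp_all add: X_def\<close>)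
  qed
qed

end
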